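(* Let $a,b,\sigma,\rho$ be real constants, $q\in(0,1)$, and let $(X(t))_{t\ge 0}$ be the process uniquely defined by the stochastic pantograph equation $$dX(t)=\{aX(t)+bX(qt)\}\,dt+\{\sigma X(t)+\rho X(qt)\}\,dB(t),\quad t\ge 0,\qquad X(0)=X_0 .$$ (i) Let $\rho=0$ and $\mathbb{E}(|X_0|^2)<\infty$. If $a<0$, then $$\limsup_{t\to\infty}\frac{\log|X(t)|}{\log t}\le \alpha+1,\quad\text{a.s.},$$ where $\alpha$ is defined by $$\alpha=\frac{1}{\log q}\log\left(\frac{-a}{|b|}\right).$$ (ii) Let $\rho\neq 0$ and $\mathbb{E}(|X_0|^4)<\infty$. If $2a+\sigma^2<0$, then $$\limsup_{t\to\infty}\frac{\log|X(t)|}{\log t}\le \frac12(\alpha+1),\quad\text{a.s.},$$ where $\alpha$ is defined by $$\alpha=\frac{2}{\log q}\log\left(\frac{1}{\rho^2}\left(\sqrt{|b+\sigma\rho|^2-\rho^2(2a+\sigma^2)}-|b+\sigma\rho|\right)\right).$$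
   Context: $(B(t))_{t\ge0}$ is a standard one-dimensional Wiener process on a filtered probability space $(\Omega,\mathcal{F},\mathbb{P})$, the filtration being the natural filtration of $B$. The initial value $X_0$ is a real random variable, independent of $B$, with $\mathbb{E}(|X_0|^2)<\infty$. The process $X$ is the pathwise unique strong solution of the equation (understood in the integrated Itô sense); its existence and uniqueness are known. $\log 0$ is read as $-\infty$. *)

theory Defs
  imports "HOL-Probability.Probability"
begin

text \<open>
  Processes have type \<open>real \<Rightarrow> 'a \<Rightarrow> real\<close>; only their values at times \<open>t \<ge> 0\<close> matter.
\<close>

definition wiener_process :: "'a measure \<Rightarrow> (real \<Rightarrow> 'a \<Rightarrow> real) \<Rightarrow> bool" where
  "wiener_process M B \<longleftrightarrow>
     prob_space M \<and>
     (\<forall>t\<ge>0. B t \<in> borel_measurable M) \<and>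
     (AE \<omega> in M. B 0 \<omega> = 0) \<and>
     (AE \<omega> in M. continuous_on {0..} (\<lambda>t. B t \<omega>)) \<and>
     (\<forall>s t. 0 \<le> s \<and> s < t \<longrightarrow>
        distributed M lborel (\<lambda>\<omega>. B t \<omega> - B s \<omega>) (normal_density 0 (sqrt (t - s)))) \<and>
     (\<forall>n (p :: nat \<Rightarrow> real). 0 \<le> p 0 \<and> mono p \<longrightarrow>
        prob_space.indep_vars M (\<lambda>_. borel) (\<lambda>i \<omega>. B (p (Suc i)) \<omega> - B (p i) \<omega>) {..<n})"

definition indep_of_process ::
    "'a measure \<Rightarrow> ('a \<Rightarrow> real) \<Rightarrow> (real \<Rightarrow> 'a \<Rightarrow> real) \<Rightarrow> bool" where
  "indep_of_process M Z B \<longleftrightarrow>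
     prob_space.indep_set M
       (sets (vimage_algebra (space M) Z borel))
       (sets (vimage_algebra (space M) (\<lambda>\<omega>. \<lambda>t\<in>{0..}. B t \<omega>) (PiM {0..} (\<lambda>_. borel))))"

text \<open>
  The natural filtration of \<open>B\<close>, enlarged by the initial value \<open>Z\<close> and by the null sets of \<open>M\<close>.
  A strong solution with random initial value is adapted to this filtration, and in general not
  to that of \<open>B\<close> alone.
\<close>

definition aug_filtration ::
    "'a measure \<Rightarrow> ('a \<Rightarrow> real) \<Rightarrow> (real \<Rightarrow> 'a \<Rightarrow> real) \<Rightarrow> real \<Rightarrow> 'a measure" where
  "aug_filtration M Z B t =
     sigma (space M)
       ({Z -` A \<inter> space M | A. A \<in> sets borel} \<union>
        {B s -` A \<inter> space M | s A. s \<in> {0..t} \<and> A \<in> sets borel} \<union>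
        null_sets M)"

definition adapted :: "(real \<Rightarrow> 'a measure) \<Rightarrow> (real \<Rightarrow> 'a \<Rightarrow> real) \<Rightarrow> bool" where
  "adapted F X \<longleftrightarrow> (\<forall>t\<ge>0. X t \<in> borel_measurable (F t))"

text \<open>
  Convergence in probability. The exceptional sets are covered by events, so that nothing is
  claimed for free about sets that fail to be measurable (for which \<open>measure\<close> is 0).
\<close>

definition tendsto_in_prob ::
    "'a measure \<Rightarrow> (nat \<Rightarrow> 'a \<Rightarrow> real) \<Rightarrow> ('a \<Rightarrow> real) \<Rightarrow> bool" where
  "tendsto_in_prob M Y Z \<longleftrightarrow>
     (\<forall>\<epsilon>>0. \<forall>\<delta>>0. \<forall>\<^sub>F k in sequentially.
        \<exists>A\<in>sets M. measure M A < \<delta> \<and> {\<omega> \<in> space M. \<epsilon> < \<bar>Y k \<omega> - Z \<omega>\<bar>} \<subseteq> A)"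

text \<open>
  A simple process is given by a number \<open>n\<close> of steps, grid points \<open>p 0 \<le> \<dots> \<le> p n\<close> and values
  \<open>\<xi> i\<close> on the intervals \<open>(p i, p (i+1)]\<close>.
\<close>

definition simple_data ::
    "'a measure \<Rightarrow> (real \<Rightarrow> 'a measure) \<Rightarrow> nat \<Rightarrow> (nat \<Rightarrow> real) \<Rightarrow> (nat \<Rightarrow> 'a \<Rightarrow> real) \<Rightarrow> bool" where
  "simple_data M F n p \<xi> \<longleftrightarrow>
     0 \<le> p 0 \<and> (\<forall>i<n. p i \<le> p (Suc i)) \<and>
     (\<forall>i<n. \<xi> i \<in> borel_measurable (F (p i))) \<and>
     (\<exists>K. \<forall>i<n. \<forall>\<omega>\<in>space M. \<bar>\<xi> i \<omega>\<bar> \<le> K)"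

definition simple_process ::
    "nat \<Rightarrow> (nat \<Rightarrow> real) \<Rightarrow> (nat \<Rightarrow> 'a \<Rightarrow> real) \<Rightarrow> real \<Rightarrow> 'a \<Rightarrow> real" where
  "simple_process n p \<xi> s \<omega> = (\<Sum>i<n. \<xi> i \<omega> * indicator {p i<..p (Suc i)} s)"

definition simple_integral ::
    "(real \<Rightarrow> 'a \<Rightarrow> real) \<Rightarrow> nat \<Rightarrow> (nat \<Rightarrow> real) \<Rightarrow> (nat \<Rightarrow> 'a \<Rightarrow> real) \<Rightarrow> real \<Rightarrow> 'a \<Rightarrow> real" where
  "simple_integral B n p \<xi> t \<omega> =
     (\<Sum>i<n. \<xi> i \<omega> * (B (min t (p (Suc i))) \<omega> - B (min t (p i)) \<omega>))"

text \<open>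
  \<open>has_ito_integral M F B H t I\<close>: the random variable \<open>I\<close> is a version of the Ito integral
  \<open>\<integral>\<^sub>0\<^sup>t H dB\<close>, for adapted \<open>H\<close> with \<open>\<integral>\<^sub>0\<^sup>t H\<^sup>2 ds < \<infinity>\<close> a.s. It is the limit in probability of the
  integrals of simple processes \<open>H\<^sub>k\<close> with \<open>\<integral>\<^sub>0\<^sup>t (H\<^sub>k - H)\<^sup>2 ds \<rightarrow> 0\<close> in probability; as usual,
  it is determined only up to a null set and does not depend on the choice of the \<open>H\<^sub>k\<close>.
\<close>

definition has_ito_integral ::
    "'a measure \<Rightarrow> (real \<Rightarrow> 'a measure) \<Rightarrow> (real \<Rightarrow> 'a \<Rightarrow> real) \<Rightarrow> (real \<Rightarrow> 'a \<Rightarrow> real) \<Rightarrow>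
      real \<Rightarrow> ('a \<Rightarrow> real) \<Rightarrow> bool" where
  "has_ito_integral M F B H t I \<longleftrightarrow>
     adapted F H \<and>
     (AE \<omega> in M. set_borel_measurable lborel {0..t} (\<lambda>s. H s \<omega>) \<and>
                 set_integrable lborel {0..t} (\<lambda>s. (H s \<omega>)\<^sup>2)) \<and>
     I \<in> borel_measurable M \<and>
     (\<exists>n p \<xi>. (\<forall>k. simple_data M F (n k) (p k) (\<xi> k)) \<and>
        tendsto_in_prob M
          (\<lambda>k \<omega>. LBINT s:{0..t}. (simple_process (n k) (p k) (\<xi> k) s \<omega> - H s \<omega>)\<^sup>2) (\<lambda>_. 0) \<and>
        tendsto_in_prob M (\<lambda>k. simple_integral B (n k) (p k) (\<xi> k) t) I)"

text \<open>Strong solutions of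
  \<open>dX(t) = (a X(t) + b X(qt)) dt + (\<sigma> X(t) + \<rho> X(qt)) dB(t)\<close>, \<open>X(0) = X0\<close>.\<close>

definition pantograph_solution ::
    "'a measure \<Rightarrow> (real \<Rightarrow> 'a \<Rightarrow> real) \<Rightarrow> ('a \<Rightarrow> real) \<Rightarrow> real \<Rightarrow> real \<Rightarrow> real \<Rightarrow> real \<Rightarrow> real \<Rightarrow>
      (real \<Rightarrow> 'a \<Rightarrow> real) \<Rightarrow> bool" where
  "pantograph_solution M B X0 a b \<sigma> \<rho> q X \<longleftrightarrow>
     adapted (aug_filtration M X0 B) X \<and>
     (AE \<omega> in M. continuous_on {0..} (\<lambda>t. X t \<omega>)) \<and>
     (AE \<omega> in M. X 0 \<omega> = X0 \<omega>) \<and>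
     (\<forall>t\<ge>0. \<exists>I.
        has_ito_integral M (aug_filtration M X0 B) B (\<lambda>s \<omega>. \<sigma> * X s \<omega> + \<rho> * X (q * s) \<omega>) t I \<and>
        (AE \<omega> in M. X t \<omega> = X0 \<omega> + (LBINT s:{0..t}. a * X s \<omega> + b * X (q * s) \<omega>) + I \<omega>))"

text \<open>Natural logarithm on \<open>[0, \<infinity>]\<close> with \<open>log 0 = -\<infinity>\<close> and \<open>log \<infinity> = \<infinity>\<close>.\<close>

definition elog :: "ereal \<Rightarrow> ereal" where
  "elog x = (if x \<le> 0 then -\<infinity> else if x = \<infinity> then \<infinity> else ereal (ln (real_of_ereal x)))"

definition growth_exponent :: "(real \<Rightarrow> real) \<Rightarrow> ereal" where
  "growth_exponent x = Limsup at_top (\<lambda>t. elog (ereal \<bar>x t\<bar>) / ereal (ln t))"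

text \<open>For \<open>b = 0\<close> and \<open>a < 0\<close> the quotient is \<open>\<infinity>\<close>, so the exponent is \<open>-\<infinity>\<close> since \<open>log q < 0\<close>.\<close>

definition alpha_drift :: "real \<Rightarrow> real \<Rightarrow> real \<Rightarrow> ereal" where
  "alpha_drift a b q = ereal (1 / ln q) * elog (ereal (- a) / ereal \<bar>b\<bar>)"

definition alpha_noise :: "real \<Rightarrow> real \<Rightarrow> real \<Rightarrow> real \<Rightarrow> real \<Rightarrow> real" where
  "alpha_noise a b \<sigma> \<rho> q =
     2 / ln q *
       ln (1 / \<rho>\<^sup>2 * (sqrt (\<bar>b + \<sigma> * \<rho>\<bar>\<^sup>2 - \<rho>\<^sup>2 * (2 * a + \<sigma>\<^sup>2)) - \<bar>b + \<sigma> * \<rho>\<bar>))"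

end

theory Submission
  imports Defs "HOL-Real_Asymp.Real_Asymp"
begin

text \<open>
  Put \<open>Y = \<bar>X\<bar>\<close> in case (i) and \<open>Y = X\<^sup>2\<close> in case (ii). The solution is the limit in probability of
  its Euler sums, so that Fatou's lemma and the isometry for such sums replace Ito's formula. They
  give first \<open>sup\<^bsub>t \<le> T\<^esub> E X(t)\<^sup>2 < \<infinity>\<close> (by localization) and then the one-step inequality
  \<open>E[Y(t + h); A] \<le> (1 + c h) E[Y(t); A] + e h E[Y(q t); A] + O(h\<^bsup>3/2\<^esup>)\<close> for all events \<open>A\<close> of the past of \<open>t\<close>.
  In case (i) it comes from the Milstein expansion, whose factor
  \<open>1 + a h + \<sigma> \<Delta>B + \<sigma>\<^sup>2 ((\<Delta>B)\<^sup>2 - h) / 2\<close> is nonnegative for small \<open>h\<close>, so that taking absolute values costs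
  nothing. In case (ii) the mixed term is split by \<open>2 \<bar>X(t) X(q t)\<bar> \<le> \<kappa> X(t)\<^sup>2 + X(q t)\<^sup>2 / \<kappa>\<close> with the optimal
  \<open>\<kappa> = q powr (\<beta> / 2)\<close>.

  For every \<open>\<beta> > \<alpha>\<close> one has \<open>c + e * q powr \<beta> < 0\<close>, so \<open>t powr \<beta>\<close> is eventually a supersolution and
  \<open>E Y(t) = O(t powr \<beta>)\<close>. As \<open>c < 0\<close>, the inequality also makes \<open>Y\<close> a supermartingale on \<open>[n, n + 1]\<close> up to
  a total error \<open>O(n powr \<beta>)\<close>; the maximal inequality and the Borel-Cantelli lemma then give
  \<open>Y(t) = O(t powr \<gamma>)\<close> almost surely for every \<open>\<gamma> > \<beta> + 1\<close>.
\<close>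

section \<open>Square integrable random variables and convergence in probability\<close>

text \<open>The integral is given for each time separately and only as a limit in probability, so
  neither its martingale property nor an isometry can be quoted for it. Fatou's lemma passes upper
  bounds of nonnegative quantities to the limit; hence the estimates are one-sided, and conditional
  expectations become integrals over events of the past. Local errors must be O(h^(3/2)): 1/h steps
  then cost O(h^(1/2)), and constants depending on the horizon disappear as h tends to 0. For X^2
  the Euler expansion is good enough, because the martingale part is orthogonal to the past.
  Absolute values destroy this orthogonality and leave an Euler error of order h in mean, which
  forces the next term of the expansion. The thresholds are roots: c + e q^\<beta> = 0 at \<beta> =
  \<alpha> whenever \<alpha> is finite. In case (ii) the choice of \<kappa> turns this into \<rho>^2
  \<kappa>^2 + 2 |b + \<sigma> \<rho>| \<kappa> + 2 a + \<sigma>^2 = 0, whose positive root is the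
  argument of the logarithm in \<alpha>. The additional 1 in the exponent is the price of summing
  probabilities over the intervals [n, n + 1].\<close>

definition sq_integrable :: "'a measure \<Rightarrow> ('a \<Rightarrow> real) \<Rightarrow> bool" where
  "sq_integrable M f \<longleftrightarrow> f \<in> borel_measurable M \<and> integrable M (\<lambda>x. (f x)\<^sup>2)"

lemma sq_integrable_measurable [measurable_dest]: "sq_integrable M f \<Longrightarrow> f \<in> borel_measurable M"
  by (simp add: sq_integrable_def)

lemma sq_integrable_square: "sq_integrable M f \<Longrightarrow> integrable M (\<lambda>x. (f x)\<^sup>2)"
  by (simp add: sq_integrable_def)

lemma two_mult_le_weighted:
  fixes x y k :: real
  assumes "k > 0"
  shows "2 * x * y \<le> k * x\<^sup>2 + y\<^sup>2 / k"
proof -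
  have "0 \<le> (k * x - y)\<^sup>2 / k" using assms by simp
  also have "\<dots> = k * x\<^sup>2 + y\<^sup>2 / k - 2 * x * y"
    using assms by (simp add: power2_eq_square field_simps)
  finally show ?thesis by simp
qed

lemma two_mult_abs_le_weighted:
  fixes x y k :: real
  assumes "k > 0"
  shows "2 * \<bar>x * y\<bar> \<le> k * x\<^sup>2 + y\<^sup>2 / k"
  using two_mult_le_weighted[OF assms, of "\<bar>x\<bar>" "\<bar>y\<bar>"] by (simp add: abs_mult)

lemma sum_square_le2: "((x::real) + y)\<^sup>2 \<le> 2 * x\<^sup>2 + 2 * y\<^sup>2"
  using sum_squares_bound[of x y] by (simp add: power2_sum)

lemma sum_square_le3: "((x::real) + y + z)\<^sup>2 \<le> 3 * x\<^sup>2 + 3 * y\<^sup>2 + 3 * z\<^sup>2"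
  using sum_squares_bound[of x y] sum_squares_bound[of x z] sum_squares_bound[of y z]
  by (simp add: power2_eq_square algebra_simps)

lemma diff_square_le2: "((x::real) - y)\<^sup>2 \<le> 2 * x\<^sup>2 + 2 * y\<^sup>2"
  using sum_square_le2[of x "-y"] by simp

lemma sum_square_le_card:
  fixes f :: "nat \<Rightarrow> real"
  shows "(\<Sum>i<n. f i)\<^sup>2 \<le> real n * (\<Sum>i<n. (f i)\<^sup>2)"
  using Cauchy_Schwarz_ineq_sum[of "\<lambda>_. 1" f "{..<n}"] by simp

lemma sq_integrable_mult:
  assumes [measurable]: "sq_integrable M f" "sq_integrable M g"
  shows "integrable M (\<lambda>x. f x * g x)"
proof (rule Bochner_Integration.integrable_bound)
  show "integrable M (\<lambda>x. (f x)\<^sup>2 + (g x)\<^sup>2)"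
    using assms by (auto simp: sq_integrable_def)
  show "AE x in M. norm (f x * g x) \<le> norm ((f x)\<^sup>2 + (g x)\<^sup>2)"
  proof (rule AE_I2)
    fix x
    have "2 * \<bar>f x * g x\<bar> \<le> (f x)\<^sup>2 + (g x)\<^sup>2"
      using two_mult_abs_le_weighted[of 1 "f x" "g x"] by simp
    moreover have "0 \<le> (f x)\<^sup>2 + (g x)\<^sup>2" by simp
    ultimately show "norm (f x * g x) \<le> norm ((f x)\<^sup>2 + (g x)\<^sup>2)"
      unfolding real_norm_def by linarith
  qed
qed measurable

lemma sq_integrable_bound:
  assumes "sq_integrable M g" and [measurable]: "f \<in> borel_measurable M"
    and "AE x in M. \<bar>f x\<bar> \<le> \<bar>g x\<bar>"
  shows "sq_integrable M f"
  unfolding sq_integrable_def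
proof
  show "integrable M (\<lambda>x. (f x)\<^sup>2)"
  proof (rule Bochner_Integration.integrable_bound[OF sq_integrable_square[OF assms(1)]])
    show "AE x in M. norm ((f x)\<^sup>2) \<le> norm ((g x)\<^sup>2)"
      using assms(3) by eventually_elim (simp add: abs_le_square_iff)
  qed measurable
qed measurable

lemma sq_integrable_cmult: "sq_integrable M f \<Longrightarrow> sq_integrable M (\<lambda>x. c * f x)"
  by (auto simp: sq_integrable_def power_mult_distrib)

lemma sq_integrable_add:
  assumes [measurable]: "sq_integrable M f" "sq_integrable M g"
  shows "sq_integrable M (\<lambda>x. f x + g x)"
proof -
  have "integrable M (\<lambda>x. (f x)\<^sup>2 + (g x)\<^sup>2 + 2 * (f x * g x))"
    using assms sq_integrable_mult[OF assms] by (auto simp: sq_integrable_def)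
  then show ?thesis by (simp add: sq_integrable_def power2_sum mult.assoc)
qed

lemma sq_integrable_diff:
  assumes "sq_integrable M f" "sq_integrable M g"
  shows "sq_integrable M (\<lambda>x. f x - g x)"
  using sq_integrable_add[OF assms(1) sq_integrable_cmult[OF assms(2), of "-1"]] by simp

lemma sq_integrable_zero: "sq_integrable M (\<lambda>_. 0)"
  by (simp add: sq_integrable_def)

lemma sq_integrable_sum:
  assumes "\<And>i. i \<in> I \<Longrightarrow> sq_integrable M (f i)"
  shows "sq_integrable M (\<lambda>x. \<Sum>i\<in>I. f i x)"
  using assms
  by (induction I rule: infinite_finite_induct) (auto intro: sq_integrable_zero sq_integrable_add)

lemma sq_integrable_indicator_mult:
  assumes "sq_integrable M f" "A \<in> sets M"
  shows "sq_integrable M (\<lambda>x. indicator A x * f x)"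
  by (rule sq_integrable_bound[OF assms(1)])
    (use assms in \<open>auto simp: indicator_def intro!: borel_measurable_times sq_integrable_measurable\<close>)

lemma (in finite_measure) sq_integrable_integrable:
  assumes "sq_integrable M f"
  shows "integrable M f"
proof -
  have "sq_integrable M (\<lambda>_. 1)" by (simp add: sq_integrable_def)
  from sq_integrable_mult[OF assms this] show ?thesis by simp
qed

lemma (in finite_measure) sq_integrable_bounded:
  assumes [measurable]: "f \<in> borel_measurable M" and "\<And>x. x \<in> space M \<Longrightarrow> \<bar>f x\<bar> \<le> K"
  shows "sq_integrable M f"
proof (rule sq_integrable_bound[of M "\<lambda>_. K"])
  show "AE x in M. \<bar>f x\<bar> \<le> \<bar>K\<bar>"
    using assms(2) by (intro AE_I2) (meson abs_ge_self order_trans)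
qed (auto simp: sq_integrable_def)

lemma integral_indicator_mult_le:
  assumes "integrable M f" "\<And>x. 0 \<le> f x" "A \<in> sets M"
  shows "(LINT x|M. indicator A x * f x) \<le> (LINT x|M. f x :: real)"
  by (rule integral_mono)
    (use assms integrable_real_mult_indicator[OF assms(3,1)] in
      \<open>auto simp: mult.commute indicator_def\<close>)

text \<open>The truncated distance \<open>min 1 \<bar>Z n \<omega> - D \<omega>\<bar>\<close> is at
  most r/2 off an event of probability below r/2. Hence it tends to 0 in mean, and along a
  subsequence almost everywhere; the truncation is invisible once the values are below 1.\<close>

lemma tendsto_in_prob_AE_subseq:
  assumes "prob_space M" and lim: "tendsto_in_prob M Z D"
    and [measurable]: "\<And>n. Z n \<in> borel_measurable M" "D \<in> borel_measurable M"
  shows "\<exists>r. strict_mono (r :: nat \<Rightarrow> nat) \<and> (AE \<omega> in M. (\<lambda>k. Z (r k) \<omega>) \<longlonglongrightarrow> D \<omega>)"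
proof -
  interpret prob_space M by fact
  define u where "u n \<omega> = min 1 \<bar>Z n \<omega> - D \<omega>\<bar>" for n \<omega>
  have [measurable]: "\<And>n. u n \<in> borel_measurable M" unfolding u_def by measurable
  have u01: "0 \<le> u n \<omega>" "u n \<omega> \<le> 1" for n \<omega> by (auto simp: u_def)
  have int: "integrable M (u n)" for n
    by (rule integrable_const_bound[of _ 1]) (auto simp: u_def)
  have "(\<lambda>n. expectation (\<lambda>\<omega>. norm (u n \<omega>))) \<longlonglongrightarrow> 0"
  proof (rule LIMSEQ_I)
    fix r :: real assume "0 < r"
    then have "\<forall>\<^sub>F k in sequentially. \<exists>A\<in>sets M. measure M A < r/2 \<and>
        {\<omega> \<in> space M. r/2 < \<bar>Z k \<omega> - D \<omega>\<bar>} \<subseteq> A"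
      using lim unfolding tendsto_in_prob_def by (meson half_gt_zero)
    then obtain N where N: "\<And>k. k \<ge> N \<Longrightarrow> \<exists>A\<in>sets M. measure M A < r/2 \<and>
        {\<omega> \<in> space M. r/2 < \<bar>Z k \<omega> - D \<omega>\<bar>} \<subseteq> A"
      by (auto simp: eventually_sequentially)
    have "norm (expectation (\<lambda>\<omega>. norm (u n \<omega>)) - 0) < r" if "N \<le> n" for n
    proof -
      obtain A where A: "A \<in> sets M" "measure M A < r/2"
        "{\<omega> \<in> space M. r/2 < \<bar>Z n \<omega> - D \<omega>\<bar>} \<subseteq> A" using N[OF \<open>N \<le> n\<close>] by blast
      have "expectation (u n) \<le> expectation (\<lambda>\<omega>. indicator A \<omega> + r/2)"
      proof (rule integral_mono)
        show "integrable M (\<lambda>\<omega>. indicator A \<omega> + r/2)" using A(1)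
          by (intro Bochner_Integration.integrable_add integrable_real_indicator integrable_const)
            (simp_all add: emeasure_eq_measure)
        fix \<omega> assume "\<omega> \<in> space M"
        then show "u n \<omega> \<le> indicator A \<omega> + r/2"
        proof (cases "\<omega> \<in> A")
          case False
          with A(3) \<open>\<omega> \<in> space M\<close> have "\<bar>Z n \<omega> - D \<omega>\<bar> \<le> r/2" by (auto simp: not_less)
          moreover have "u n \<omega> \<le> \<bar>Z n \<omega> - D \<omega>\<bar>" by (simp add: u_def)
          ultimately show ?thesis using False by simp
        qed (use u01(2)[of n \<omega>] \<open>0 < r\<close> in simp)
      qed fact
      also have "\<dots> = measure M A + r/2"
      proof -
        have "integrable M (indicator A :: 'a \<Rightarrow> real)"
          using A(1) by (intro integrable_real_indicator) (simp_all add: emeasure_eq_measure)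
        then show ?thesis using A(1) by (simp add: prob_space)
      qed
      finally have "expectation (u n) < r" using A(2) by simp
      moreover have "0 \<le> expectation (u n)" by (rule Bochner_Integration.integral_nonneg) (simp add: u01)
      ultimately show ?thesis using u01(1) by (simp add: real_norm_def)
    qed
    then show "\<exists>no. \<forall>n\<ge>no. norm (expectation (\<lambda>\<omega>. norm (u n \<omega>)) - 0) < r" by blast
  qed
  from tendsto_L1_AE_subseq[OF int this]
  obtain r :: "nat \<Rightarrow> nat" where r: "strict_mono r" "AE x in M. (\<lambda>n. u (r n) x) \<longlonglongrightarrow> 0"
    by blast
  have "AE \<omega> in M. (\<lambda>k. Z (r k) \<omega>) \<longlonglongrightarrow> D \<omega>"
    using r(2)
  proof eventually_elim
    fix \<omega> assume u: "(\<lambda>n. u (r n) \<omega>) \<longlonglongrightarrow> 0"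
    then have ev: "\<forall>\<^sub>F n in sequentially. u (r n) \<omega> < 1" by (rule order_tendstoD) simp
    have "(\<lambda>n. \<bar>Z (r n) \<omega> - D \<omega>\<bar>) \<longlonglongrightarrow> 0"
      by (rule Lim_transform_eventually[OF u])
        (use ev in eventually_elim, auto simp: u_def min_def split: if_splits)
    then show "(\<lambda>k. Z (r k) \<omega>) \<longlonglongrightarrow> D \<omega>"
      by (metis LIM_zero_cancel tendsto_rabs_zero_iff)
  qed
  with r(1) show ?thesis by blast
qed

text \<open>Integrability of the limit belongs to the conclusion, because the finiteness of the
  moments of \<open>X\<close> is obtained in this way. Fatou's lemma is applied to the extended
  nonnegative integrals of a tail of the sequence.\<close>

lemma integral_Fatou_bound:
  fixes u :: "nat \<Rightarrow> 'a \<Rightarrow> real"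
  assumes lim: "AE \<omega> in M. (\<lambda>n. u n \<omega>) \<longlonglongrightarrow> v \<omega>" and [measurable]: "v \<in> borel_measurable M"
    and u: "\<forall>\<^sub>F n in sequentially. integrable M (u n) \<and> (\<forall>\<omega>\<in>space M. 0 \<le> u n \<omega>) \<and> integral\<^sup>L M (u n) \<le> c n"
    and c: "c \<longlonglongrightarrow> L"
  shows "integrable M v \<and> integral\<^sup>L M v \<le> L"
proof -
  obtain N where N: "\<And>n. n \<ge> N \<Longrightarrow> integrable M (u n)" "\<And>n \<omega>. n \<ge> N \<Longrightarrow> \<omega> \<in> space M \<Longrightarrow> 0 \<le> u n \<omega>"
    "\<And>n. n \<ge> N \<Longrightarrow> integral\<^sup>L M (u n) \<le> c n"
    using u by (auto simp: eventually_sequentially)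
  have [measurable]: "u (n + N) \<in> borel_measurable M" for n using N(1)[of "n+N"] by simp
  have lim': "AE \<omega> in M. (\<lambda>n. u (n + N) \<omega>) \<longlonglongrightarrow> v \<omega>"
    using lim by eventually_elim (rule LIMSEQ_ignore_initial_segment)
  have v0: "AE \<omega> in M. 0 \<le> v \<omega>"
    using lim' AE_space
  proof eventually_elim
    case (elim \<omega>)
    show ?case by (rule tendsto_lowerbound[OF elim(1)]) (use N(2) elim(2) in simp_all)
  qed
  have cN: "(\<lambda>n. c (n + N)) \<longlonglongrightarrow> L" using c by (rule LIMSEQ_ignore_initial_segment)
  have cpos: "0 \<le> c (n + N)" for n
  proof -
    have "0 \<le> integral\<^sup>L M (u (n + N))"
      by (rule integral_nonneg_AE, rule AE_I2, rule N(2)) simp_all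
    then show ?thesis using N(3)[of "n+N"] by simp
  qed
  then have L0: "0 \<le> L" using cN by (intro tendsto_lowerbound[OF cN]) simp_all
  have "(\<integral>\<^sup>+\<omega>. ennreal (v \<omega>) \<partial>M) = (\<integral>\<^sup>+\<omega>. liminf (\<lambda>n. ennreal (u (n + N) \<omega>)) \<partial>M)"
  proof (rule nn_integral_cong_AE)
    show "AE \<omega> in M. ennreal (v \<omega>) = liminf (\<lambda>n. ennreal (u (n + N) \<omega>))"
      using lim'
      by eventually_elim (auto intro!: lim_imp_Liminf[symmetric] tendsto_ennrealI)
  qed
  also have "\<dots> \<le> liminf (\<lambda>n. \<integral>\<^sup>+\<omega>. ennreal (u (n + N) \<omega>) \<partial>M)"
    by (rule nn_integral_liminf) measurable
  also have "\<dots> \<le> liminf (\<lambda>n. ennreal (c (n + N)))"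
  proof (rule Liminf_mono, rule always_eventually, rule allI)
    fix n
    have "(\<integral>\<^sup>+\<omega>. ennreal (u (n + N) \<omega>) \<partial>M) = ennreal (integral\<^sup>L M (u (n + N)))"
      by (rule nn_integral_eq_integral) (simp_all add: N)
    then show "(\<integral>\<^sup>+\<omega>. ennreal (u (n + N) \<omega>) \<partial>M) \<le> ennreal (c (n + N))"
      using N(3)[of "n+N"] by (simp add: ennreal_leI)
  qed
  also have "\<dots> = ennreal L"
    by (rule lim_imp_Liminf) (auto intro!: tendsto_ennrealI cN)
  finally have le: "(\<integral>\<^sup>+\<omega>. ennreal (v \<omega>) \<partial>M) \<le> ennreal L" .
  have int: "integrable M v"
    by (rule integrableI_nonneg) (use v0 le in \<open>auto simp: top_unique less_top[symmetric] intro: order_le_less_trans\<close>)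
  moreover have "integral\<^sup>L M v \<le> L"
    using le L0 nn_integral_eq_integral[OF int v0] by simp
  ultimately show ?thesis by simp
qed

text \<open>The function \<open>g\<close> depends on \<open>\<omega>\<close> so that it can carry
  the indicator of an event and a starting value: with \<open>g \<omega> z = indicator A \<omega> *
  (X t \<omega> + z)\<^sup>2\<close> a bound for Euler sums becomes a bound for the
  solution.\<close>

lemma Fatou_in_prob:
  assumes "prob_space M" and lim: "tendsto_in_prob M Z D"
    and Z[measurable]: "\<And>n. Z n \<in> borel_measurable M" and D[measurable]: "D \<in> borel_measurable M"
    and cont: "\<And>\<omega>. continuous_on UNIV (g \<omega>)" and pos: "\<And>\<omega> z. 0 \<le> (g \<omega> z :: real)"
    and gD: "(\<lambda>\<omega>. g \<omega> (D \<omega>)) \<in> borel_measurable M"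
    and bd: "\<forall>\<^sub>F n in sequentially. integrable M (\<lambda>\<omega>. g \<omega> (Z n \<omega>)) \<and> (LINT \<omega>|M. g \<omega> (Z n \<omega>)) \<le> c n"
    and c: "c \<longlonglongrightarrow> L"
  shows "integrable M (\<lambda>\<omega>. g \<omega> (D \<omega>)) \<and> (LINT \<omega>|M. g \<omega> (D \<omega>)) \<le> L"
proof -
  obtain r :: "nat \<Rightarrow> nat" where r: "strict_mono r" "AE \<omega> in M. (\<lambda>k. Z (r k) \<omega>) \<longlonglongrightarrow> D \<omega>"
    using tendsto_in_prob_AE_subseq[OF assms(1) lim Z D] by blast
  show ?thesis
  proof (rule integral_Fatou_bound[OF _ gD, of "\<lambda>k \<omega>. g \<omega> (Z (r k) \<omega>)" "c \<circ> r"])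
    show "AE \<omega> in M. (\<lambda>k. g \<omega> (Z (r k) \<omega>)) \<longlonglongrightarrow> g \<omega> (D \<omega>)"
      using r(2) by eventually_elim
        (rule continuous_on_tendsto_compose[OF cont], auto)
    show "\<forall>\<^sub>F n in sequentially. integrable M (\<lambda>\<omega>. g \<omega> (Z (r n) \<omega>)) \<and>
        (\<forall>\<omega>\<in>space M. 0 \<le> g \<omega> (Z (r n) \<omega>)) \<and> (LINT \<omega>|M. g \<omega> (Z (r n) \<omega>)) \<le> (c \<circ> r) n"
      using eventually_compose_filterlim[OF bd filterlim_subseq[OF r(1)]] pos by simp
    show "(c \<circ> r) \<longlonglongrightarrow> L" using c r(1) by (rule LIMSEQ_subseq_LIMSEQ)
  qed
qed

lemma tendsto_in_prob_add:
  assumes "prob_space M" "tendsto_in_prob M Y Y'" "tendsto_in_prob M Z Z'"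
  shows "tendsto_in_prob M (\<lambda>n \<omega>. Y n \<omega> + Z n \<omega>) (\<lambda>\<omega>. Y' \<omega> + Z' \<omega>)"
  unfolding tendsto_in_prob_def
proof (intro allI impI)
  interpret prob_space M by fact
  fix \<epsilon> \<delta> :: real assume "0 < \<epsilon>" "0 < \<delta>"
  then have "0 < \<epsilon>/2" "0 < \<delta>/2" by auto
  then have "\<forall>\<^sub>F k in sequentially. \<exists>A\<in>events. prob A < \<delta>/2 \<and> {\<omega> \<in> space M. \<epsilon>/2 < \<bar>Y k \<omega> - Y' \<omega>\<bar>} \<subseteq> A"
    "\<forall>\<^sub>F k in sequentially. \<exists>A\<in>events. prob A < \<delta>/2 \<and> {\<omega> \<in> space M. \<epsilon>/2 < \<bar>Z k \<omega> - Z' \<omega>\<bar>} \<subseteq> A"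
    using assms(2,3) unfolding tendsto_in_prob_def by blast+
  then show "\<forall>\<^sub>F k in sequentially. \<exists>A\<in>events. prob A < \<delta> \<and>
      {\<omega> \<in> space M. \<epsilon> < \<bar>Y k \<omega> + Z k \<omega> - (Y' \<omega> + Z' \<omega>)\<bar>} \<subseteq> A"
  proof eventually_elim
    case (elim k)
    then obtain A A' where A: "A \<in> events" "prob A < \<delta>/2" "{\<omega> \<in> space M. \<epsilon>/2 < \<bar>Y k \<omega> - Y' \<omega>\<bar>} \<subseteq> A"
      "A' \<in> events" "prob A' < \<delta>/2" "{\<omega> \<in> space M. \<epsilon>/2 < \<bar>Z k \<omega> - Z' \<omega>\<bar>} \<subseteq> A'" by blast
    have "prob (A \<union> A') < \<delta>" using A measure_Un_le[OF A(1,4)] by linarith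
    moreover have "{\<omega> \<in> space M. \<epsilon> < \<bar>Y k \<omega> + Z k \<omega> - (Y' \<omega> + Z' \<omega>)\<bar>} \<subseteq> A \<union> A'"
    proof
      fix \<omega> assume w: "\<omega> \<in> {\<omega> \<in> space M. \<epsilon> < \<bar>Y k \<omega> + Z k \<omega> - (Y' \<omega> + Z' \<omega>)\<bar>}"
      then have "\<epsilon> < \<bar>(Y k \<omega> - Y' \<omega>) + (Z k \<omega> - Z' \<omega>)\<bar>" by (simp add: algebra_simps)
      also have "\<dots> \<le> \<bar>Y k \<omega> - Y' \<omega>\<bar> + \<bar>Z k \<omega> - Z' \<omega>\<bar>" by (rule abs_triangle_ineq)
      finally have "\<epsilon>/2 < \<bar>Y k \<omega> - Y' \<omega>\<bar> \<or> \<epsilon>/2 < \<bar>Z k \<omega> - Z' \<omega>\<bar>" by linarith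
      with w A(3,6) show "\<omega> \<in> A \<union> A'" by blast
    qed
    ultimately show ?case using A by blast
  qed
qed

lemma tendsto_in_prob_const: "tendsto_in_prob M (\<lambda>_. Y) Y"
  unfolding tendsto_in_prob_def by (auto intro!: always_eventually bexI[of _ "{}"])

section \<open>Brownian filtrations\<close>

lemma Int_stable_vimages: "Int_stable {f -` A \<inter> S |A. A \<in> sets N}"
proof (rule Int_stableI)
  fix a b assume "a \<in> {f -` A \<inter> S |A. A \<in> sets N}" "b \<in> {f -` A \<inter> S |A. A \<in> sets N}"
  then obtain A B where "A \<in> sets N" "B \<in> sets N" "a = f -` A \<inter> S" "b = f -` B \<inter> S" by blast
  then have "a \<inter> b = f -` (A \<inter> B) \<inter> S" "A \<inter> B \<in> sets N" by auto
  then show "a \<inter> b \<in> {f -` A \<inter> S |A. A \<in> sets N}" by blast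
qed

text \<open>Independence of one increment from the whole past is the convenient form: sums of
  adapted terms are treated one step at a time, everything earlier being collected into a single
  factor measurable at the left end of the step.\<close>

locale brownian_filtration = prob_space M for M :: "'a measure" +
  fixes F :: "real \<Rightarrow> 'a measure" and B :: "real \<Rightarrow> 'a \<Rightarrow> real"
  assumes F_subalgebra: "0 \<le> t \<Longrightarrow> subalgebra M (F t)"
    and F_mono: "0 \<le> s \<Longrightarrow> s \<le> t \<Longrightarrow> sets (F s) \<subseteq> sets (F t)"
    and B_measurable: "0 \<le> t \<Longrightarrow> B t \<in> borel_measurable (F t)"
    and incr_distributed: "0 \<le> s \<Longrightarrow> s < t \<Longrightarrow>
      distributed M lborel (\<lambda>\<omega>. B t \<omega> - B s \<omega>) (normal_density 0 (sqrt (t - s)))"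
    and incr_indep: "0 \<le> s \<Longrightarrow> s < t \<Longrightarrow>
      indep_set (sets (F s)) {(\<lambda>\<omega>. B t \<omega> - B s \<omega>) -` C \<inter> space M | C. C \<in> sets borel}"
begin

lemma space_F: "0 \<le> t \<Longrightarrow> space (F t) = space M"
  using F_subalgebra by (auto simp: subalgebra_def)

lemma F_measurable_M: "0 \<le> t \<Longrightarrow> f \<in> borel_measurable (F t) \<Longrightarrow> f \<in> borel_measurable M"
  using measurable_from_subalg[OF F_subalgebra] by blast

lemma F_sets_M: "0 \<le> t \<Longrightarrow> A \<in> sets (F t) \<Longrightarrow> A \<in> events"
  using F_subalgebra by (auto simp: subalgebra_def)

lemma F_measurable_mono:
  assumes "0 \<le> s" "s \<le> t" "f \<in> borel_measurable (F s)"
  shows "f \<in> borel_measurable (F t)"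
proof (rule measurable_from_subalg[OF _ assms(3)])
  show "subalgebra (F t) (F s)"
    using assms F_mono[of s t] space_F[of s] space_F[of t] by (auto simp: subalgebra_def)
qed

lemma B_measurable_F: "0 \<le> s \<Longrightarrow> s \<le> t \<Longrightarrow> B s \<in> borel_measurable (F t)"
  using F_measurable_mono B_measurable by blast

lemma B_measurable_M [measurable]: "0 \<le> t \<Longrightarrow> B t \<in> borel_measurable M"
  using F_measurable_M B_measurable by blast

lemma incr_indep_var:
  fixes g :: "real \<Rightarrow> real"
  assumes "0 \<le> s" "s < t" "\<xi> \<in> borel_measurable (F s)" "g \<in> borel_measurable borel"
  shows "indep_var borel \<xi> borel (\<lambda>\<omega>. g (B t \<omega> - B s \<omega>))"
  unfolding indep_var_eq
proof (intro conjI)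
  have [measurable]: "\<xi> \<in> borel_measurable M" "g \<in> borel_measurable borel" "B t \<in> borel_measurable M"
    "B s \<in> borel_measurable M"
    using assms F_measurable_M by auto
  show "\<xi> \<in> borel_measurable M" "(\<lambda>\<omega>. g (B t \<omega> - B s \<omega>)) \<in> borel_measurable M" by measurable
  let ?E = "{(\<lambda>\<omega>. B t \<omega> - B s \<omega>) -` C \<inter> space M | C. C \<in> sets borel}"
  have "indep_set (sigma_sets (space M) {\<xi> -` A \<inter> space M |A. A \<in> sets borel})
      (sigma_sets (space M) {(\<lambda>\<omega>. g (B t \<omega> - B s \<omega>)) -` A \<inter> space M |A. A \<in> sets borel})"
  proof (rule indep_set_sigma_sets)
    show "Int_stable {\<xi> -` A \<inter> space M |A. A \<in> sets borel}"
      "Int_stable {(\<lambda>\<omega>. g (B t \<omega> - B s \<omega>)) -` A \<inter> space M |A. A \<in> sets borel}"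
      by (rule Int_stable_vimages)+
    have sub1: "{\<xi> -` A \<inter> space M |A. A \<in> sets borel} \<subseteq> sets (F s)"
      using measurable_sets[OF assms(3)] unfolding space_F[OF assms(1)] by blast
    have sub2: "{(\<lambda>\<omega>. g (B t \<omega> - B s \<omega>)) -` A \<inter> space M |A. A \<in> sets borel} \<subseteq> ?E"
    proof safe
      fix A :: "real set" assume "A \<in> sets borel"
      then have "g -` A \<in> sets borel" using assms(4) by (metis measurable_sets_borel)
      moreover have "(\<lambda>\<omega>. g (B t \<omega> - B s \<omega>)) -` A \<inter> space M = (\<lambda>\<omega>. B t \<omega> - B s \<omega>) -` (g -` A) \<inter> space M"
        by auto
      ultimately show "\<exists>C. (\<lambda>\<omega>. g (B t \<omega> - B s \<omega>)) -` A \<inter> space M = (\<lambda>\<omega>. B t \<omega> - B s \<omega>) -` C \<inter> space M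
          \<and> C \<in> sets borel" by blast
    qed
    show "indep_set {\<xi> -` A \<inter> space M |A. A \<in> sets borel}
       {(\<lambda>\<omega>. g (B t \<omega> - B s \<omega>)) -` A \<inter> space M |A. A \<in> sets borel}"
      using incr_indep[OF assms(1,2)] sub1 sub2 unfolding indep_sets2_eq by (meson subset_iff subset_trans)
  qed
  then show "indep_set (sigma_sets (space M) {\<xi> -` A \<inter> space M |A. A \<in> sets borel})
      (sigma_sets (space M) {(\<lambda>\<omega>. g (B t \<omega> - B s \<omega>)) -` A \<inter> space M |A. A \<in> sets borel})" .
qed

lemma indep_incr_mult:
  fixes g :: "real \<Rightarrow> real"
  assumes "0 \<le> s" "s < t" "\<xi> \<in> borel_measurable (F s)" "g \<in> borel_measurable borel"
    "integrable M \<xi>" "integrable M (\<lambda>\<omega>. g (B t \<omega> - B s \<omega>))"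
  shows "integrable M (\<lambda>\<omega>. \<xi> \<omega> * g (B t \<omega> - B s \<omega>))"
    "expectation (\<lambda>\<omega>. \<xi> \<omega> * g (B t \<omega> - B s \<omega>)) = expectation \<xi> * expectation (\<lambda>\<omega>. g (B t \<omega> - B s \<omega>))"
  using indep_var_integrable[OF incr_indep_var[OF assms(1-4)] assms(5,6)]
    indep_var_lebesgue_integral[OF incr_indep_var[OF assms(1-4)] assms(5,6)] by blast+

text \<open>The fourth moment yields the variance 2 (t - s)^2 of the squared increment, on which the
  convergence of the iterated sums rests.\<close>

lemma incr_moments:
  assumes "0 \<le> s" "s < t"
  shows incr_integrable: "integrable M (\<lambda>\<omega>. (B t \<omega> - B s \<omega>) ^ k)"
    and incr_mean: "expectation (\<lambda>\<omega>. B t \<omega> - B s \<omega>) = 0"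
    and incr_variance: "expectation (\<lambda>\<omega>. (B t \<omega> - B s \<omega>)\<^sup>2) = t - s"
    and incr_fourth: "expectation (\<lambda>\<omega>. (B t \<omega> - B s \<omega>) ^ 4) = 3 * (t - s)\<^sup>2"
proof -
  note D = incr_distributed[OF assms]
  have p: "0 < sqrt (t - s)" using assms by simp
  show "integrable M (\<lambda>\<omega>. (B t \<omega> - B s \<omega>) ^ k)"
    using distributed_integrable[OF D, of "\<lambda>x. x ^ k"] integrable_normal_moment[OF p, of 0 k] by simp
  show "expectation (\<lambda>\<omega>. B t \<omega> - B s \<omega>) = 0"
    using normal_distributed_expectation[OF p D] .
  show "expectation (\<lambda>\<omega>. (B t \<omega> - B s \<omega>)\<^sup>2) = t - s"
    using distributed_integral[OF D, of "\<lambda>x. x\<^sup>2"] integral_normal_moment_even[OF p, of 0 1] assms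
    by (simp add: fact_numeral)
  have "fact 4 / ((2 / (t - s))\<^sup>2 * 2) = 3 * (t - s)\<^sup>2"
    using assms by (simp add: fact_numeral power_divide)
  then show "expectation (\<lambda>\<omega>. (B t \<omega> - B s \<omega>) ^ 4) = 3 * (t - s)\<^sup>2"
    using distributed_integral[OF D, of "\<lambda>x. x ^ 4"] integral_normal_moment_even[OF p, of 0 2] assms
    by (simp add: fact_numeral)
qed

lemma incr_sq_integrable:
  assumes "0 \<le> s" "s < t"
  shows "sq_integrable M (\<lambda>\<omega>. B t \<omega> - B s \<omega>)"
  using incr_integrable[OF assms, of 2] assms by (auto simp: sq_integrable_def)

text \<open>A product of two square integrable variables is in general only integrable. Independence
  makes its square a product of independent integrable factors, so the terms of a noise sum stay
  square integrable.\<close>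

lemma sq_integrable_indep_mult:
  fixes g :: "real \<Rightarrow> real"
  assumes st: "0 \<le> s" "s < t" and \<xi>: "\<xi> \<in> borel_measurable (F s)" and g: "g \<in> borel_measurable borel"
    and "sq_integrable M \<xi>" "sq_integrable M (\<lambda>\<omega>. g (B t \<omega> - B s \<omega>))"
  shows "sq_integrable M (\<lambda>\<omega>. \<xi> \<omega> * g (B t \<omega> - B s \<omega>))"
    and "expectation (\<lambda>\<omega>. (\<xi> \<omega> * g (B t \<omega> - B s \<omega>))\<^sup>2) =
      expectation (\<lambda>\<omega>. (\<xi> \<omega>)\<^sup>2) * expectation (\<lambda>\<omega>. (g (B t \<omega> - B s \<omega>))\<^sup>2)"
proof -
  have [measurable]: "\<xi> \<in> borel_measurable (F s)" "g \<in> borel_measurable borel" by fact+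
  have 2: "(\<lambda>\<omega>. (\<xi> \<omega>)\<^sup>2) \<in> borel_measurable (F s)" "(\<lambda>x. (g x)\<^sup>2) \<in> borel_measurable borel"
    by measurable
  note * = indep_incr_mult[OF st 2 sq_integrable_square[OF assms(5)] sq_integrable_square[OF assms(6)]]
  show "expectation (\<lambda>\<omega>. (\<xi> \<omega> * g (B t \<omega> - B s \<omega>))\<^sup>2) =
      expectation (\<lambda>\<omega>. (\<xi> \<omega>)\<^sup>2) * expectation (\<lambda>\<omega>. (g (B t \<omega> - B s \<omega>))\<^sup>2)"
    using *(2) by (simp add: power_mult_distrib)
  have "\<xi> \<in> borel_measurable M" "(\<lambda>\<omega>. g (B t \<omega> - B s \<omega>)) \<in> borel_measurable M"
    using assms by (auto simp: sq_integrable_def)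
  then show "sq_integrable M (\<lambda>\<omega>. \<xi> \<omega> * g (B t \<omega> - B s \<omega>))"
    using *(1) by (simp add: sq_integrable_def power_mult_distrib)
qed

section \<open>Martingale transforms along a finite grid\<close>

text \<open>With \<open>g j\<close> the identity these sums are Ito sums; with the compensated
  square they are the quadratic variation error of the iterated sums. The claims share one
  induction, since the isometry at m + 1 uses square integrability and measurability of the sum up
  to m.\<close>

lemma
  fixes q :: "nat \<Rightarrow> real" and g :: "nat \<Rightarrow> real \<Rightarrow> real"
  assumes "0 \<le> q 0" "\<And>j. j < m \<Longrightarrow> q j < q (Suc j)"
    and "\<And>j. j < m \<Longrightarrow> \<eta> j \<in> borel_measurable (F (q j))" "\<And>j. j < m \<Longrightarrow> sq_integrable M (\<eta> j)"
    and "\<And>j. j < m \<Longrightarrow> g j \<in> borel_measurable borel"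
    and "\<And>j. j < m \<Longrightarrow> sq_integrable M (\<lambda>\<omega>. g j (B (q (Suc j)) \<omega> - B (q j) \<omega>))"
    and "\<And>j. j < m \<Longrightarrow> expectation (\<lambda>\<omega>. g j (B (q (Suc j)) \<omega> - B (q j) \<omega>)) = 0"
  defines "S \<equiv> \<lambda>m \<omega>. \<Sum>j<m. \<eta> j \<omega> * g j (B (q (Suc j)) \<omega> - B (q j) \<omega>)"
  shows sq_integrable_transform: "sq_integrable M (S m)"
    and transform_isometry: "expectation (\<lambda>\<omega>. (S m \<omega>)\<^sup>2) =
      (\<Sum>j<m. expectation (\<lambda>\<omega>. (\<eta> j \<omega>)\<^sup>2) * expectation (\<lambda>\<omega>. (g j (B (q (Suc j)) \<omega> - B (q j) \<omega>))\<^sup>2))"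
    and transform_orthogonal: "\<xi> \<in> borel_measurable (F (q 0)) \<Longrightarrow> sq_integrable M \<xi> \<Longrightarrow>
      expectation (\<lambda>\<omega>. \<xi> \<omega> * S m \<omega>) = 0"
proof -
  have "sq_integrable M (S m) \<and> S m \<in> borel_measurable (F (q m)) \<and> q 0 \<le> q m \<and>
     expectation (\<lambda>\<omega>. (S m \<omega>)\<^sup>2) =
      (\<Sum>j<m. expectation (\<lambda>\<omega>. (\<eta> j \<omega>)\<^sup>2) * expectation (\<lambda>\<omega>. (g j (B (q (Suc j)) \<omega> - B (q j) \<omega>))\<^sup>2)) \<and>
     (\<forall>\<xi>\<in>borel_measurable (F (q 0)). sq_integrable M \<xi> \<longrightarrow> expectation (\<lambda>\<omega>. \<xi> \<omega> * S m \<omega>) = 0)"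
    using assms(2-7)
  proof (induction m)
    case 0
    then show ?case by (simp add: S_def sq_integrable_zero)
  next
    case (Suc m)
    let ?g = "\<lambda>\<omega>. g m (B (q (Suc m)) \<omega> - B (q m) \<omega>)"
    have IH: "sq_integrable M (S m)" "S m \<in> borel_measurable (F (q m))" "q 0 \<le> q m"
     "expectation (\<lambda>\<omega>. (S m \<omega>)\<^sup>2) =
      (\<Sum>j<m. expectation (\<lambda>\<omega>. (\<eta> j \<omega>)\<^sup>2) * expectation (\<lambda>\<omega>. (g j (B (q (Suc j)) \<omega> - B (q j) \<omega>))\<^sup>2))"
      "\<And>\<xi>. \<xi> \<in> borel_measurable (F (q 0)) \<Longrightarrow> sq_integrable M \<xi> \<Longrightarrow> expectation (\<lambda>\<omega>. \<xi> \<omega> * S m \<omega>) = 0"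
      using Suc.IH[OF Suc.prems(1)[OF less_SucI] Suc.prems(2)[OF less_SucI] Suc.prems(3)[OF less_SucI]
        Suc.prems(4)[OF less_SucI] Suc.prems(5)[OF less_SucI] Suc.prems(6)[OF less_SucI]] by blast+
    have qm: "0 \<le> q m" "q m < q (Suc m)" "q 0 \<le> q m" using IH(3) assms(1) Suc.prems(1)[OF lessI] by simp_all
    have \<eta>: "\<eta> m \<in> borel_measurable (F (q m))" "sq_integrable M (\<eta> m)" and g: "g m \<in> borel_measurable borel"
      and sg: "sq_integrable M ?g" and mean: "expectation ?g = 0"
      by (fact Suc.prems(2)[OF lessI] Suc.prems(3)[OF lessI] Suc.prems(4)[OF lessI]
          Suc.prems(5)[OF lessI] Suc.prems(6)[OF lessI])+
    have S_Suc: "S (Suc m) = (\<lambda>\<omega>. S m \<omega> + \<eta> m \<omega> * ?g \<omega>)" by (auto simp: S_def)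
    note sq = sq_integrable_indep_mult[OF qm(1,2) \<eta>(1) g \<eta>(2) sg]
    \<comment> \<open>The factor from the past is a product of two square integrable variables,
      hence integrable, and independence from a centred variable makes the expectation vanish. This
      removes the cross term of the isometry (\<zeta> is the sum up to m) and gives orthogonality
      (\<zeta> is \<xi>).\<close>
    have zero: "integrable M (\<lambda>\<omega>. (\<zeta> \<omega> * \<eta> m \<omega>) * ?g \<omega>) \<and> expectation (\<lambda>\<omega>. (\<zeta> \<omega> * \<eta> m \<omega>) * ?g \<omega>) = 0"
      if "\<zeta> \<in> borel_measurable (F (q m))" "sq_integrable M \<zeta>" for \<zeta>
      using indep_incr_mult[OF qm(1,2) borel_measurable_times[OF that(1) \<eta>(1)] g
          sq_integrable_mult[OF that(2) \<eta>(2)] sq_integrable_integrable[OF sg]] mean by simp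
    have 1: "sq_integrable M (S (Suc m))"
      unfolding S_Suc by (intro sq_integrable_add IH sq)
    have "?g \<in> borel_measurable (F (q (Suc m)))"
      using B_measurable_F[of "q m" "q (Suc m)"] B_measurable[of "q (Suc m)"] qm
      by (intro measurable_compose[OF _ g] borel_measurable_diff) simp_all
    then have 2: "S (Suc m) \<in> borel_measurable (F (q (Suc m)))"
      unfolding S_Suc using F_measurable_mono[OF qm(1) less_imp_le[OF qm(2)] IH(2)]
        F_measurable_mono[OF qm(1) less_imp_le[OF qm(2)] \<eta>(1)]
      by (intro borel_measurable_add borel_measurable_times)
    have 3: "expectation (\<lambda>\<omega>. \<xi> \<omega> * S (Suc m) \<omega>) = 0"
      if "\<xi> \<in> borel_measurable (F (q 0))" "sq_integrable M \<xi>" for \<xi>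
    proof -
      have m: "\<xi> \<in> borel_measurable (F (q m))"
        using F_measurable_mono[OF assms(1) qm(3) that(1)] .
      have "expectation (\<lambda>\<omega>. \<xi> \<omega> * S (Suc m) \<omega>) = expectation (\<lambda>\<omega>. \<xi> \<omega> * S m \<omega> + (\<xi> \<omega> * \<eta> m \<omega>) * ?g \<omega>)"
        by (simp add: S_Suc algebra_simps)
      also have "\<dots> = 0"
        using zero[OF m that(2)] IH(5)[OF that] sq_integrable_mult[OF that(2) IH(1)] by simp
      finally show ?thesis .
    qed
    have "expectation (\<lambda>\<omega>. (S (Suc m) \<omega>)\<^sup>2) =
      expectation (\<lambda>\<omega>. (S m \<omega>)\<^sup>2 + (\<eta> m \<omega> * ?g \<omega>)\<^sup>2 + 2 * ((S m \<omega> * \<eta> m \<omega>) * ?g \<omega>))"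
      unfolding S_Suc by (simp add: power2_sum mult.assoc)
    also have "\<dots> = expectation (\<lambda>\<omega>. (S m \<omega>)\<^sup>2) + expectation (\<lambda>\<omega>. (\<eta> m \<omega> * ?g \<omega>)\<^sup>2)"
      using zero[OF IH(2,1)] sq_integrable_square[OF IH(1)] sq_integrable_square[OF sq(1)] by simp
    finally have 4: "expectation (\<lambda>\<omega>. (S (Suc m) \<omega>)\<^sup>2) =
       (\<Sum>j<Suc m. expectation (\<lambda>\<omega>. (\<eta> j \<omega>)\<^sup>2) * expectation (\<lambda>\<omega>. (g j (B (q (Suc j)) \<omega> - B (q j) \<omega>))\<^sup>2))"
      using IH(4) sq(2) by simp
    show ?case
      by (intro conjI ballI impI 1 2 3 4) (use qm in simp_all)
  qed
  then show "sq_integrable M (S m)"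
    "expectation (\<lambda>\<omega>. (S m \<omega>)\<^sup>2) =
      (\<Sum>j<m. expectation (\<lambda>\<omega>. (\<eta> j \<omega>)\<^sup>2) * expectation (\<lambda>\<omega>. (g j (B (q (Suc j)) \<omega> - B (q j) \<omega>))\<^sup>2))"
    "\<xi> \<in> borel_measurable (F (q 0)) \<Longrightarrow> sq_integrable M \<xi> \<Longrightarrow>
      expectation (\<lambda>\<omega>. \<xi> \<omega> * S m \<omega>) = 0" by blast+
qed

lemma
  fixes q :: "nat \<Rightarrow> real"
  assumes q: "0 \<le> q 0" "\<And>j. j < m \<Longrightarrow> q j < q (Suc j)"
    and \<eta>: "\<And>j. j < m \<Longrightarrow> \<eta> j \<in> borel_measurable (F (q j))" "\<And>j. j < m \<Longrightarrow> sq_integrable M (\<eta> j)"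
  defines "S \<equiv> \<lambda>\<omega>. \<Sum>j<m. \<eta> j \<omega> * (B (q (Suc j)) \<omega> - B (q j) \<omega>)"
  shows sq_integrable_ito_sum: "sq_integrable M S"
    and ito_sum_isometry: "expectation (\<lambda>\<omega>. (S \<omega>)\<^sup>2) =
      (\<Sum>j<m. expectation (\<lambda>\<omega>. (\<eta> j \<omega>)\<^sup>2) * (q (Suc j) - q j))"
    and ito_sum_orthogonal: "\<xi> \<in> borel_measurable (F (q 0)) \<Longrightarrow> sq_integrable M \<xi> \<Longrightarrow>
      expectation (\<lambda>\<omega>. \<xi> \<omega> * S \<omega>) = 0"
proof -
  have q0: "j \<le> m \<Longrightarrow> 0 \<le> q j" for j
  proof (induction j)
    case (Suc j) then show ?case using q(2)[of j] by simp
  qed (use q in simp)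
  have i: "j < m \<Longrightarrow> sq_integrable M (\<lambda>\<omega>. B (q (Suc j)) \<omega> - B (q j) \<omega>)"
     "j < m \<Longrightarrow> expectation (\<lambda>\<omega>. B (q (Suc j)) \<omega> - B (q j) \<omega>) = 0"
     "j < m \<Longrightarrow> expectation (\<lambda>\<omega>. (B (q (Suc j)) \<omega> - B (q j) \<omega>)\<^sup>2) = q (Suc j) - q j" for j
    using incr_sq_integrable incr_mean incr_variance q0 q(2) by auto
  note T = sq_integrable_transform[where m=m and q=q and \<eta>=\<eta> and g="\<lambda>_ x. x", OF q \<eta>]
    transform_isometry[where m=m and q=q and \<eta>=\<eta> and g="\<lambda>_ x. x", OF q \<eta>]
    transform_orthogonal[where m=m and q=q and \<eta>=\<eta> and g="\<lambda>_ x. x" and \<xi>=\<xi>, OF q \<eta>]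
  show "sq_integrable M S" unfolding S_def by (rule T(1)) (simp_all add: i)
  have "expectation (\<lambda>\<omega>. (S \<omega>)\<^sup>2) =
      (\<Sum>j<m. expectation (\<lambda>\<omega>. (\<eta> j \<omega>)\<^sup>2) * expectation (\<lambda>\<omega>. (B (q (Suc j)) \<omega> - B (q j) \<omega>)\<^sup>2))"
    unfolding S_def by (rule T(2)) (simp_all add: i)
  then show "expectation (\<lambda>\<omega>. (S \<omega>)\<^sup>2) = (\<Sum>j<m. expectation (\<lambda>\<omega>. (\<eta> j \<omega>)\<^sup>2) * (q (Suc j) - q j))"
    using i(3) by simp
  show "expectation (\<lambda>\<omega>. \<xi> \<omega> * S \<omega>) = 0"
    if "\<xi> \<in> borel_measurable (F (q 0))" "sq_integrable M \<xi>"
    unfolding S_def by (rule T(3)) (simp_all add: i that)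
qed

end

section \<open>Simple processes\<close>

lemma grid_strict_mono:
  fixes q :: "nat \<Rightarrow> real"
  assumes "\<And>j. j < m \<Longrightarrow> q j < q (Suc j)" "i < j" "j \<le> m"
  shows "q i < q j"
  using assms(2,3)
proof (induction j)
  case (Suc j)
  then have "q j < q (Suc j)" using assms(1) by simp
  then show ?case using Suc by (cases "i = j") auto
qed simp

lemma grid_mono:
  fixes q :: "nat \<Rightarrow> real"
  assumes "\<And>j. j < m \<Longrightarrow> q j < q (Suc j)" "i \<le> j" "j \<le> m"
  shows "q i \<le> q j"
  using grid_strict_mono[of m q i j] assms by (cases "i = j") (auto simp: less_le)

lemma finite_set_grid:
  fixes T :: real
  assumes "finite Q" "Q \<subseteq> {0..T}" "0 \<le> T"
  shows "\<exists>q m. 0 \<le> q 0 \<and> (\<forall>j<m. q j < q (Suc j)) \<and> q m \<le> T \<and> Q \<subseteq> q ` {..m::nat}"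
proof -
  \<comment> \<open>Adding 0 keeps the list nonempty, so that a last index exists even for empty
    Q.\<close>
  define xs where "xs = sorted_list_of_set (insert 0 Q)"
  have set: "set xs = insert 0 Q" using assms(1) unfolding xs_def by (intro set_sorted_list_of_set) simp
  then have len: "0 < length xs" by (cases xs) auto
  have str: "sorted_wrt (<) xs" unfolding xs_def by (rule strict_sorted_list_of_set)
  have "xs ! j < xs ! Suc j" if "j < length xs - 1" for j
    by (rule sorted_wrt_nth_less[OF str]) (use that in auto)
  moreover have "xs ! j \<in> {0..T}" if "j \<le> length xs - 1" for j
  proof -
    have "xs ! j \<in> set xs" using that len by (intro nth_mem) linarith
    then show ?thesis using set assms by auto
  qed
  moreover have "Q \<subseteq> (!) xs ` {..length xs - 1}"
  proof
    fix x assume "x \<in> Q"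
    then have "x \<in> set xs" using set by simp
    then obtain j where "j < length xs" "xs ! j = x" by (auto simp: in_set_conv_nth)
    then show "x \<in> (!) xs ` {..length xs - 1}" by (intro image_eqI[of _ _ j]) auto
  qed
  ultimately have "0 \<le> xs ! 0 \<and> (\<forall>j<length xs - 1. xs ! j < xs ! Suc j) \<and> xs ! (length xs - 1) \<le> T
      \<and> Q \<subseteq> (!) xs ` {..length xs - 1}" by auto
  then show ?thesis by (intro exI[of _ "(!) xs"] exI[of _ "length xs - 1"])
qed

text \<open>Cells are open on the left and closed on the right, so the right end point represents
  the value on the cell. A general \<open>f\<close> is allowed because the representation is applied
  to an integrand, to its square and to an indicator.\<close>

lemma grid_step_function:
  fixes q :: "nat \<Rightarrow> real" and f :: "real \<Rightarrow> real"
  assumes "\<And>j. j < m \<Longrightarrow> q j < q (Suc j)"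
    and "\<And>j s. j < m \<Longrightarrow> q j < s \<Longrightarrow> s \<le> q (Suc j) \<Longrightarrow> f s = f (q (Suc j))"
    and "\<And>s. s \<le> q 0 \<or> q m < s \<Longrightarrow> f s = 0"
  shows "f s = (\<Sum>j<m. f (q (Suc j)) * indicator {q j<..q (Suc j)} s)"
proof -
  have A: "(\<Sum>j<n. f (q (Suc j)) * indicator {q j<..q (Suc j)} s) = 0" if "n \<le> m" "q n < s" for n
  proof (rule sum.neutral, rule ballI)
    fix j assume "j \<in> {..<n}"
    then have "q (Suc j) \<le> q n" using grid_mono[of m q "Suc j" n] assms(1) that by auto
    then show "f (q (Suc j)) * indicator {q j<..q (Suc j)} s = 0" using that by (simp add: indicator_def)
  qed
  have B: "f s = (\<Sum>j<n. f (q (Suc j)) * indicator {q j<..q (Suc j)} s)" if "n \<le> m" "q 0 < s" "s \<le> q n" for n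
    using that
  proof (induction n)
    case (Suc n)
    show ?case
    proof (cases "s \<le> q n")
      case True
      then show ?thesis using Suc by simp
    next
      case False
      then show ?thesis using A[of n] assms(2)[of n s] Suc.prems by simp
    qed
  qed simp
  show ?thesis
  proof (cases "q 0 < s \<and> s \<le> q m")
    case True then show ?thesis using B[of m] by simp
  next
    case False
    have "(\<Sum>j<m. f (q (Suc j)) * indicator {q j<..q (Suc j)} s) = 0"
    proof (rule sum.neutral, rule ballI)
      fix j assume "j \<in> {..<m}"
      then have "q (Suc j) \<le> q m" "q 0 \<le> q j"
        using grid_mono[of m q "Suc j" m] grid_mono[of m q 0 j] assms(1) by auto
      then show "f (q (Suc j)) * indicator {q j<..q (Suc j)} s = 0" using False by (auto simp: indicator_def)
    qed
    then show ?thesis using False assms(3)[of s] by auto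
  qed
qed

lemma grid_step_integral:
  fixes q :: "nat \<Rightarrow> real" and f :: "real \<Rightarrow> real"
  assumes q: "\<And>j. j < m \<Longrightarrow> q j < q (Suc j)" "0 \<le> q 0" "q m \<le> T"
    and f: "\<And>s. f s = (\<Sum>j<m. c j * indicator {q j<..q (Suc j)} s)"
  shows "set_integrable lborel {0..T} f"
    and "(LBINT s:{0..T}. f s) = (\<Sum>j<m. c j * (q (Suc j) - q j))"
proof -
  have "has_bochner_integral lborel (\<lambda>s. \<Sum>j<m. c j * indicator {q j<..q (Suc j)} s)
      (\<Sum>j<m. c j * (q (Suc j) - q j))"
  proof (rule has_bochner_integral_sum)
    fix j assume "j \<in> {..<m}"
    then have "q j < q (Suc j)" using q by simp
    then show "has_bochner_integral lborel (\<lambda>s. c j * indicator {q j<..q (Suc j)} s) (c j * (q (Suc j) - q j))"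
      using has_bochner_integral_real_indicator[of "{q j<..q (Suc j)}" lborel]
      by (intro has_bochner_integral_mult_right) simp
  qed
  moreover have "indicator {0..T} s *\<^sub>R f s = (\<Sum>j<m. c j * indicator {q j<..q (Suc j)} s)" for s
  proof (cases "s \<in> {0..T}")
    case False
    have "(\<Sum>j<m. c j * indicator {q j<..q (Suc j)} s) = 0"
    proof (rule sum.neutral, rule ballI)
      fix j assume "j \<in> {..<m}"
      then have "q (Suc j) \<le> q m" "q 0 \<le> q j"
        using grid_mono[of m q "Suc j" m] grid_mono[of m q 0 j] q by auto
      then show "c j * indicator {q j<..q (Suc j)} s = 0" using False q by (auto simp: indicator_def)
    qed
    then show ?thesis using False by simp
  qed (simp add: f)
  ultimately have "has_bochner_integral lborel (\<lambda>s. indicator {0..T} s *\<^sub>R f s)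
      (\<Sum>j<m. c j * (q (Suc j) - q j))" by simp
  then show "set_integrable lborel {0..T} f" "(LBINT s:{0..T}. f s) = (\<Sum>j<m. c j * (q (Suc j) - q j))"
    by (simp_all add: set_integrable_def set_lebesgue_integral_def has_bochner_integral_iff)
qed

section \<open>Simple integrands paired with their integrals\<close>

context brownian_filtration
begin

text \<open>The intervals may overlap and come in any order, and the coefficients may be unbounded.
  Sums and differences of integrands living on different grids therefore stay in the relation; the
  ordered common grid that the isometry asks for is recovered by
  \<open>simple_pair_refine\<close>.\<close>

inductive simple_pair :: "real \<Rightarrow> (real \<Rightarrow> 'a \<Rightarrow> real) \<Rightarrow> ('a \<Rightarrow> real) \<Rightarrow> bool" for T where
  zero: "simple_pair T (\<lambda>_ _. 0) (\<lambda>_. 0)"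
| step: "simple_pair T K S \<Longrightarrow> 0 \<le> a \<Longrightarrow> a < b \<Longrightarrow> b \<le> T \<Longrightarrow> \<xi> \<in> borel_measurable (F a) \<Longrightarrow>
    simple_pair T (\<lambda>s \<omega>. K s \<omega> + \<xi> \<omega> * indicator {a<..b} s) (\<lambda>\<omega>. S \<omega> + \<xi> \<omega> * (B b \<omega> - B a \<omega>))"

lemma simple_pair_add:
  assumes "simple_pair T K' S'" "simple_pair T K S"
  shows "simple_pair T (\<lambda>s \<omega>. K s \<omega> + K' s \<omega>) (\<lambda>\<omega>. S \<omega> + S' \<omega>)"
  using assms(1)
proof induction
  case zero
  then show ?case using assms(2) by simp
next
  case (step K' S' a b \<xi>)
  show ?case using simple_pair.step[OF step.IH step.hyps(2-5)] by (simp add: add.assoc)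
qed

lemma simple_pair_uminus:
  assumes "simple_pair T K S"
  shows "simple_pair T (\<lambda>s \<omega>. - K s \<omega>) (\<lambda>\<omega>. - S \<omega>)"
  using assms
proof induction
  case zero
  then show ?case using simple_pair.zero by simp
next
  case (step K' S' a b \<xi>)
  show ?case using simple_pair.step[OF step.IH step.hyps(2-4), of "\<lambda>\<omega>. - \<xi> \<omega>"] step.hyps(5) by simp
qed

lemma simple_pair_diff:
  assumes "simple_pair T K S" "simple_pair T K' S'"
  shows "simple_pair T (\<lambda>s \<omega>. K s \<omega> - K' s \<omega>) (\<lambda>\<omega>. S \<omega> - S' \<omega>)"
  using simple_pair_add[OF simple_pair_uminus[OF assms(2)] assms(1)] by simp

lemma simple_pair_sum:
  fixes n :: nat
  assumes "\<And>i. i < n \<Longrightarrow> 0 \<le> a i" "\<And>i. i < n \<Longrightarrow> a i \<le> b i" "\<And>i. i < n \<Longrightarrow> b i \<le> T"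
    "\<And>i. i < n \<Longrightarrow> a i < b i \<Longrightarrow> \<xi> i \<in> borel_measurable (F (a i))"
  shows "simple_pair T (\<lambda>s \<omega>. \<Sum>i<n. \<xi> i \<omega> * indicator {a i<..b i} s)
    (\<lambda>\<omega>. \<Sum>i<n. \<xi> i \<omega> * (B (b i) \<omega> - B (a i) \<omega>))"
  using assms
proof (induction n)
  case 0
  then show ?case using simple_pair.zero by simp
next
  case (Suc n)
  have IH: "simple_pair T (\<lambda>s \<omega>. \<Sum>i<n. \<xi> i \<omega> * indicator {a i<..b i} s)
    (\<lambda>\<omega>. \<Sum>i<n. \<xi> i \<omega> * (B (b i) \<omega> - B (a i) \<omega>))"
    by (rule Suc.IH[OF Suc.prems(1)[OF less_SucI] Suc.prems(2)[OF less_SucI] Suc.prems(3)[OF less_SucI]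
        Suc.prems(4)[OF less_SucI]])
  show ?case
  proof (cases "a n < b n")
    case True
    then show ?thesis
      using simple_pair.step[OF IH Suc.prems(1)[OF lessI] True Suc.prems(3)[OF lessI] Suc.prems(4)[OF lessI True]]
      by simp
  next
    case False
    then have "a n = b n" using Suc.prems(2)[OF lessI] by simp
    then show ?thesis using IH by simp
  qed
qed

text \<open>The value on the cell (q j, q (j + 1)] is read off at its right end but is already
  measurable at its left end: the integrand is predictable.\<close>

definition grid_rep ::
    "(nat \<Rightarrow> real) \<Rightarrow> nat \<Rightarrow> (real \<Rightarrow> 'a \<Rightarrow> real) \<Rightarrow> ('a \<Rightarrow> real) \<Rightarrow> bool" where
  "grid_rep q m K S \<longleftrightarrow>
    (\<forall>j<m. K (q (Suc j)) \<in> borel_measurable (F (q j))) \<and>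
    (\<forall>j<m. \<forall>s \<omega>. q j < s \<and> s \<le> q (Suc j) \<longrightarrow> K s \<omega> = K (q (Suc j)) \<omega>) \<and>
    (\<forall>s \<omega>. s \<le> q 0 \<or> q m < s \<longrightarrow> K s \<omega> = 0) \<and>
    (\<forall>\<omega>. S \<omega> = (\<Sum>j<m. K (q (Suc j)) \<omega> * (B (q (Suc j)) \<omega> - B (q j) \<omega>)))"

text \<open>The claim is about every grid that contains Q, not about one suitable grid: the
  induction step adds the points a and b and must apply the hypothesis on the grid refined by
  them.\<close>

lemma simple_pair_refine:
  assumes "simple_pair T K S"
  shows "\<exists>Q. finite Q \<and> Q \<subseteq> {0..T} \<and> (\<forall>q m. 0 \<le> q 0 \<and> (\<forall>j<m. q j < q (Suc j)) \<and> Q \<subseteq> q ` {..m} \<longrightarrow> grid_rep q m K S)"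
  using assms
proof induction
  case zero
  show ?case by (intro exI[of _ "{}"]) (auto simp: grid_rep_def)
next
  case (step K S a b \<xi>)
  from step.IH obtain Q where Q: "finite Q" "Q \<subseteq> {0..T}" and R: "\<forall>q m. 0 \<le> q 0 \<and> (\<forall>j<m. q j < q (Suc j)) \<and> Q \<subseteq> q ` {..m} \<longrightarrow> grid_rep q m K S"
    by (elim exE conjE)
  show ?case
  proof (intro exI[of _ "insert a (insert b Q)"] conjI allI impI)
    show "finite (insert a (insert b Q))" "insert a (insert b Q) \<subseteq> {0..T}"
      using Q step.hyps by auto
    fix q :: "nat \<Rightarrow> real" and m
    assume *: "0 \<le> q 0 \<and> (\<forall>j<m. q j < q (Suc j)) \<and> insert a (insert b Q) \<subseteq> q ` {..m}"
    then have q: "0 \<le> q 0" "\<forall>j<m. q j < q (Suc j)" "Q \<subseteq> q ` {..m}" by auto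
    note R = R[rule_format, OF conjI[OF q(1) conjI[OF q(2,3)]], unfolded grid_rep_def]
    from * obtain l l' where l: "l \<le> m" "l' \<le> m" "a = q l" "b = q l'" by auto
    have mono: "i \<le> j \<Longrightarrow> j \<le> m \<Longrightarrow> q i \<le> q j" "i < j \<Longrightarrow> j \<le> m \<Longrightarrow> q i < q j" for i j
      using grid_mono[of m q i j] grid_strict_mono[of m q i j] q(2) by auto
    have "l < l'" using mono(1)[of l' l] l step.hyps(3) by (meson not_le)
    \<comment> \<open>As both end points belong to the grid, each cell lies inside {a<..b} or misses
      it.\<close>
    have ind: "indicator {a<..b} s = (if l \<le> j \<and> j < l' then 1 else (0::real))"
      if "j < m" "q j < s" "s \<le> q (Suc j)" for j s
    proof (cases "l \<le> j \<and> j < l'")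
      case True
      then have "a \<le> q j" "q (Suc j) \<le> b" using mono(1)[of l j] mono(1)[of "Suc j" l'] l that(1) by auto
      then show ?thesis using True that by (auto simp: indicator_def)
    next
      case False
      then have "q (Suc j) \<le> a \<or> b \<le> q j" using mono(1)[of "Suc j" l] mono(1)[of l' j] l that(1) by auto
      then show ?thesis using False that by (auto simp: indicator_def)
    qed
    have ind': "indicator {a<..b} (q (Suc j)) = (if l \<le> j \<and> j < l' then 1 else (0::real))" if "j < m" for j
      using ind[of j "q (Suc j)"] that q(2) by simp
    show "grid_rep q m (\<lambda>s \<omega>. K s \<omega> + \<xi> \<omega> * indicator {a<..b} s) (\<lambda>\<omega>. S \<omega> + \<xi> \<omega> * (B b \<omega> - B a \<omega>))"
      unfolding grid_rep_def
    proof (intro conjI allI impI)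
      show "(\<lambda>\<omega>. K (q (Suc j)) \<omega> + \<xi> \<omega> * indicator {a<..b} (q (Suc j))) \<in> borel_measurable (F (q j))"
        if "j < m" for j
      proof (cases "l \<le> j \<and> j < l'")
        case True
        have "a \<le> q j" using True mono(1)[of l j] l(3) that by simp
        then have "\<xi> \<in> borel_measurable (F (q j))"
          by (rule F_measurable_mono[OF step.hyps(2) _ step.hyps(5)])
        moreover have "K (q (Suc j)) \<in> borel_measurable (F (q j))" using R that by blast
        ultimately have "(\<lambda>\<omega>. K (q (Suc j)) \<omega> + \<xi> \<omega>) \<in> borel_measurable (F (q j))"
          by (intro borel_measurable_add)
        then show ?thesis unfolding ind'[OF that] if_P[OF True] by simp
      next
        case False
        have "K (q (Suc j)) \<in> borel_measurable (F (q j))" using R that by blast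
        then show ?thesis unfolding ind'[OF that] if_not_P[OF False] by simp
      qed
      show "K s \<omega> + \<xi> \<omega> * indicator {a<..b} s = K (q (Suc j)) \<omega> + \<xi> \<omega> * indicator {a<..b} (q (Suc j))"
        if "j < m" "q j < s \<and> s \<le> q (Suc j)" for j s \<omega>
      proof -
        have "K s \<omega> = K (q (Suc j)) \<omega>" using R that by blast
        then show ?thesis using that ind[of j s] ind'[of j] by simp
      qed
      show "K s \<omega> + \<xi> \<omega> * indicator {a<..b} s = 0" if "s \<le> q 0 \<or> q m < s" for s \<omega>
      proof -
        have "q 0 \<le> a" "b \<le> q m" using mono(1)[of 0 l] mono(1)[of l' m] l by auto
        then have "indicator {a<..b} s = (0::real)" using that by (auto simp: indicator_def)
        moreover have "K s \<omega> = 0" using R that by blast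
        ultimately show ?thesis by simp
      qed
      show "S \<omega> + \<xi> \<omega> * (B b \<omega> - B a \<omega>) = (\<Sum>j<m. (K (q (Suc j)) \<omega> + \<xi> \<omega> * indicator {a<..b} (q (Suc j))) *
           (B (q (Suc j)) \<omega> - B (q j) \<omega>))" for \<omega>
      proof -
        \<comment> \<open>Cutting one interval into cells does not change its contribution, because
          the increments of B telescope.\<close>
        have "(\<Sum>j<m. indicator {a<..b} (q (Suc j)) * (B (q (Suc j)) \<omega> - B (q j) \<omega>)) =
          (\<Sum>j<m. if l \<le> j \<and> j < l' then B (q (Suc j)) \<omega> - B (q j) \<omega> else 0)"
          by (rule sum.cong) (auto simp: ind')
        also have "\<dots> = (\<Sum>j\<in>{l..<l'}. B (q (Suc j)) \<omega> - B (q j) \<omega>)"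
        proof -
          have "{j \<in> {..<m}. l \<le> j \<and> j < l'} = {l..<l'}" using l(2) by auto
          then show ?thesis by (simp only: sum.inter_filter[symmetric] finite_lessThan)
        qed
        also have "\<dots> = B b \<omega> - B a \<omega>"
          using sum_Suc_diff'[of l l' "\<lambda>j. B (q j) \<omega>"] \<open>l < l'\<close> l by simp
        finally have "B b \<omega> - B a \<omega> = (\<Sum>j<m. indicator {a<..b} (q (Suc j)) * (B (q (Suc j)) \<omega> - B (q j) \<omega>))" by simp
        moreover have "S \<omega> = (\<Sum>j<m. K (q (Suc j)) \<omega> * (B (q (Suc j)) \<omega> - B (q j) \<omega>))" using R by blast
        ultimately show ?thesis by (simp only: distrib_right sum.distrib sum_distrib_left mult.assoc)
      qed
    qed
  qed
qed

lemma simple_pair_grid: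
  assumes "simple_pair T K S" "0 \<le> T"
  obtains q m where "0 \<le> q 0" "\<forall>j<m. q j < q (Suc j)" "q m \<le> T"
    "\<forall>j<m. K (q (Suc j)) \<in> borel_measurable (F (q j))"
    "\<forall>s \<omega>. K s \<omega> = (\<Sum>j<m. K (q (Suc j)) \<omega> * indicator {q j<..q (Suc j)} s)"
    "\<forall>s \<omega>. (K s \<omega>)\<^sup>2 = (\<Sum>j<m. (K (q (Suc j)) \<omega>)\<^sup>2 * indicator {q j<..q (Suc j)} s)"
    "\<forall>\<omega>. S \<omega> = (\<Sum>j<m. K (q (Suc j)) \<omega> * (B (q (Suc j)) \<omega> - B (q j) \<omega>))"
proof -
  from simple_pair_refine[OF assms(1)] obtain Q where Q: "finite Q" "Q \<subseteq> {0..T}"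
    and R: "\<forall>q m. 0 \<le> q 0 \<and> (\<forall>j<m. q j < q (Suc j)) \<and> Q \<subseteq> q ` {..m} \<longrightarrow> grid_rep q m K S"
    by (elim exE conjE)
  from finite_set_grid[OF Q assms(2)] obtain q m where q: "0 \<le> q 0" "\<forall>j<m. q j < q (Suc j)" "q m \<le> T"
    "Q \<subseteq> q ` {..m::nat}" by blast
  note R = R[rule_format, OF conjI[OF q(1) conjI[OF q(2,4)]], unfolded grid_rep_def]
  have "K s \<omega> = (\<Sum>j<m. K (q (Suc j)) \<omega> * indicator {q j<..q (Suc j)} s)" for s \<omega>
    by (rule grid_step_function[of m q "\<lambda>s. K s \<omega>"]) (use q R in \<open>blast+\<close>)
  moreover have "(K s \<omega>)\<^sup>2 = (\<Sum>j<m. (K (q (Suc j)) \<omega>)\<^sup>2 * indicator {q j<..q (Suc j)} s)" for s \<omega>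
  proof (rule grid_step_function[of m q "\<lambda>s. (K s \<omega>)\<^sup>2"])
    show "(K s \<omega>)\<^sup>2 = 0" if "s \<le> q 0 \<or> q m < s" for s using R that by (metis zero_power2)
    show "(K s \<omega>)\<^sup>2 = (K (q (Suc j)) \<omega>)\<^sup>2" if "j < m" "q j < s" "s \<le> q (Suc j)" for s j
      using R that by metis
  qed (use q in blast)
  ultimately show thesis using that[of q m] q R by blast
qed

lemma simple_pair_measurable:
  assumes "simple_pair T K S"
  shows "S \<in> borel_measurable M"
  using assms
proof induction
  case (step K S a b \<xi>)
  then have [measurable]: "\<xi> \<in> borel_measurable M" "B b \<in> borel_measurable M" "B a \<in> borel_measurable M"
    "S \<in> borel_measurable M"
    using F_measurable_M B_measurable_M by auto
  show ?case by measurable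
qed simp

lemma simple_pair_integrable:
  assumes "simple_pair T K S" "0 \<le> T"
  shows "set_integrable lborel {0..T} (\<lambda>s. (K s \<omega>)\<^sup>2)" "(\<lambda>s. K s \<omega>) \<in> borel_measurable borel"
proof -
  obtain q m where q: "0 \<le> q 0" "\<forall>j<m. q j < q (Suc j)" "q m \<le> T"
    "\<forall>j<m. K (q (Suc j)) \<in> borel_measurable (F (q j))"
    "\<forall>s \<omega>. K s \<omega> = (\<Sum>j<m. K (q (Suc j)) \<omega> * indicator {q j<..q (Suc j)} s)"
    "\<forall>s \<omega>. (K s \<omega>)\<^sup>2 = (\<Sum>j<m. (K (q (Suc j)) \<omega>)\<^sup>2 * indicator {q j<..q (Suc j)} s)"
    "\<forall>\<omega>. S \<omega> = (\<Sum>j<m. K (q (Suc j)) \<omega> * (B (q (Suc j)) \<omega> - B (q j) \<omega>))"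
    by (rule simple_pair_grid[OF assms])
  show "set_integrable lborel {0..T} (\<lambda>s. (K s \<omega>)\<^sup>2)"
    using grid_step_integral(1)[OF q(2)[rule_format] q(1,3) q(6)[rule_format]] by blast
  show "(\<lambda>s. K s \<omega>) \<in> borel_measurable borel"
    by (subst q(5)[rule_format]) measurable
qed

text \<open>Stopping the integrand once the accumulated square exceeds \<open>\<delta>\<close> costs an event of
  probability at most \<open>prob A\<close> and makes the second moment at most \<open>\<delta>\<close>.\<close>

lemma simple_pair_tail_bound:
  assumes "simple_pair T K S" "0 \<le> T" "0 < \<epsilon>" "0 < \<delta>" and A: "A \<in> events"
    and le: "\<And>\<omega>. \<omega> \<in> space M - A \<Longrightarrow> (LBINT s:{0..T}. (K s \<omega>)\<^sup>2) \<le> \<delta>"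
  shows "prob {\<omega> \<in> space M. \<epsilon> < \<bar>S \<omega>\<bar>} \<le> prob A + \<delta> / \<epsilon>\<^sup>2"
proof -
  obtain q m where G: "0 \<le> q 0" "\<forall>j<m. q j < q (Suc j)" "q m \<le> T"
    "\<forall>j<m. K (q (Suc j)) \<in> borel_measurable (F (q j))"
    "\<forall>s \<omega>. K s \<omega> = (\<Sum>j<m. K (q (Suc j)) \<omega> * indicator {q j<..q (Suc j)} s)"
    "\<forall>s \<omega>. (K s \<omega>)\<^sup>2 = (\<Sum>j<m. (K (q (Suc j)) \<omega>)\<^sup>2 * indicator {q j<..q (Suc j)} s)"
    "\<forall>\<omega>. S \<omega> = (\<Sum>j<m. K (q (Suc j)) \<omega> * (B (q (Suc j)) \<omega> - B (q j) \<omega>))"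
    by (rule simple_pair_grid[OF assms(1,2)])
  note q = G(1) G(2)[rule_format] G(3) and meas = G(4)[rule_format] and K2 = G(6)[rule_format]
    and S = G(7)[rule_format]
  define \<eta> where "\<eta> j = K (q (Suc j))" for j
  \<comment> \<open>V j includes the cell j itself. The value on that cell is known at its left end,
    so V j is still measurable there, and a surviving value satisfies (\<eta> j)^2 (q (j + 1) - q j)
    \<le> \<delta>. This makes the stopped values bounded, hence square integrable.\<close>
  define V where "V j \<omega> = (\<Sum>i<Suc j. (\<eta> i \<omega>)\<^sup>2 * (q (Suc i) - q i))" for j \<omega>
  define \<eta>' where "\<eta>' j \<omega> = (if V j \<omega> \<le> \<delta> then \<eta> j \<omega> else 0)" for j \<omega>
  define S' where "S' \<omega> = (\<Sum>j<m. \<eta>' j \<omega> * (B (q (Suc j)) \<omega> - B (q j) \<omega>))" for \<omega>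
  have mono: "i \<le> j \<Longrightarrow> j \<le> m \<Longrightarrow> q i \<le> q j" for i j using grid_mono[of m q i j] q by auto
  have q0: "j \<le> m \<Longrightarrow> 0 \<le> q j" for j using mono[of 0 j] q by auto
  have term0: "j < m \<Longrightarrow> 0 \<le> (\<eta> j \<omega>)\<^sup>2 * (q (Suc j) - q j)" for j \<omega>
    using q(2)[of j] by simp
  have \<eta>m: "\<eta> i \<in> borel_measurable (F (q j))" if "i \<le> j" "j < m" for i j
    using F_measurable_mono[of "q i" "q j" "\<eta> i"] meas[of i] q0[of i] mono[of i j] that by (simp add: \<eta>_def)
  have Vm: "V j \<in> borel_measurable (F (q j))" if "j < m" for j
    unfolding V_def by (intro borel_measurable_sum borel_measurable_times borel_measurable_power \<eta>m that) auto
  have \<eta>'m: "\<eta>' j \<in> borel_measurable (F (q j))" if "j < m" for j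
  proof -
    have [measurable]: "V j \<in> borel_measurable (F (q j))" "\<eta> j \<in> borel_measurable (F (q j))"
      using Vm \<eta>m that by auto
    show ?thesis unfolding \<eta>'_def by measurable
  qed
  have sq: "sq_integrable M (\<eta>' j)" if j: "j < m" for j
  proof (rule sq_integrable_bounded)
    show "\<eta>' j \<in> borel_measurable M" using F_measurable_M[OF q0 \<eta>'m] j by simp
    fix \<omega>
    show "\<bar>\<eta>' j \<omega>\<bar> \<le> sqrt (\<delta> / (q (Suc j) - q j))"
    proof (cases "V j \<omega> \<le> \<delta>")
      case True
      have "(\<eta> j \<omega>)\<^sup>2 * (q (Suc j) - q j) \<le> V j \<omega>"
        unfolding V_def using sum_nonneg[of "{..<j}" "\<lambda>i. (\<eta> i \<omega>)\<^sup>2 * (q (Suc i) - q i)"] term0 j by simp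
      then have "(\<eta> j \<omega>)\<^sup>2 \<le> \<delta> / (q (Suc j) - q j)" using True q(2)[OF j] by (simp add: pos_le_divide_eq)
      then show ?thesis using True by (simp add: \<eta>'_def real_le_rsqrt)
    next
      case False
      then show ?thesis using \<open>0 < \<delta>\<close> q(2)[OF j] by (simp add: \<eta>'_def)
    qed
  qed
  \<comment> \<open>If the last cell survives, the whole sum is at most V n and thus at most
    \<delta>; if it is stopped, it adds nothing to the shorter sum.\<close>
  have energy: "(\<Sum>j<n. (\<eta>' j \<omega>)\<^sup>2 * (q (Suc j) - q j)) \<le> \<delta>" if "n \<le> m" for n \<omega>
    using that
  proof (induction n)
    case (Suc n)
    show ?case
    proof (cases "V n \<omega> \<le> \<delta>")
      case True
      have "(\<Sum>j<Suc n. (\<eta>' j \<omega>)\<^sup>2 * (q (Suc j) - q j)) \<le> V n \<omega>"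
        unfolding V_def
      proof (rule sum_mono)
        fix i assume "i \<in> {..<Suc n}"
        then show "(\<eta>' i \<omega>)\<^sup>2 * (q (Suc i) - q i) \<le> (\<eta> i \<omega>)\<^sup>2 * (q (Suc i) - q i)"
          using Suc.prems term0[of i \<omega>] by (auto simp: \<eta>'_def)
      qed
      then show ?thesis using True by simp
    next
      case False
      then show ?thesis using Suc by (simp add: \<eta>'_def)
    qed
  qed (use \<open>0 < \<delta>\<close> in simp)
  have S'sq: "sq_integrable M S'"
    unfolding S'_def by (rule sq_integrable_ito_sum) (use q sq \<eta>'m in auto)
  have "expectation (\<lambda>\<omega>. (S' \<omega>)\<^sup>2) = (\<Sum>j<m. expectation (\<lambda>\<omega>. (\<eta>' j \<omega>)\<^sup>2) * (q (Suc j) - q j))"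
    unfolding S'_def by (rule ito_sum_isometry) (use q sq \<eta>'m in auto)
  also have "\<dots> = expectation (\<lambda>\<omega>. \<Sum>j<m. (\<eta>' j \<omega>)\<^sup>2 * (q (Suc j) - q j))"
    using sq by (subst Bochner_Integration.integral_sum) (auto simp: sq_integrable_def)
  also have "\<dots> \<le> expectation (\<lambda>_. \<delta>)"
    using sq energy[of m] by (intro integral_mono Bochner_Integration.integrable_sum) (auto simp: sq_integrable_def)
  finally have E: "expectation (\<lambda>\<omega>. (S' \<omega>)\<^sup>2) \<le> \<delta>" by (simp add: prob_space)
  have [measurable]: "S' \<in> borel_measurable M" using S'sq by (simp add: sq_integrable_def)
  have "prob {\<omega> \<in> space M. \<epsilon>\<^sup>2 \<le> (S' \<omega>)\<^sup>2} \<le> expectation (\<lambda>\<omega>. (S' \<omega>)\<^sup>2) / \<epsilon>\<^sup>2"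
    using integral_Markov_inequality_measure[OF sq_integrable_square[OF S'sq], of "{}" "\<epsilon>\<^sup>2"] \<open>0 < \<epsilon>\<close> by simp
  also have "\<dots> \<le> \<delta> / \<epsilon>\<^sup>2" using E by (simp add: divide_right_mono)
  finally have P: "prob {\<omega> \<in> space M. \<epsilon>\<^sup>2 \<le> (S' \<omega>)\<^sup>2} \<le> \<delta> / \<epsilon>\<^sup>2" .
  have "{\<omega> \<in> space M. \<epsilon> < \<bar>S \<omega>\<bar>} \<subseteq> A \<union> {\<omega> \<in> space M. \<epsilon>\<^sup>2 \<le> (S' \<omega>)\<^sup>2}"
  proof
    fix \<omega> assume w: "\<omega> \<in> {\<omega> \<in> space M. \<epsilon> < \<bar>S \<omega>\<bar>}"
    show "\<omega> \<in> A \<union> {\<omega> \<in> space M. \<epsilon>\<^sup>2 \<le> (S' \<omega>)\<^sup>2}"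
    proof (cases "\<omega> \<in> A")
      case False
      then have L: "(LBINT s:{0..T}. (K s \<omega>)\<^sup>2) \<le> \<delta>" using le w by auto
      have "(LBINT s:{0..T}. (K s \<omega>)\<^sup>2) = (\<Sum>j<m. (K (q (Suc j)) \<omega>)\<^sup>2 * (q (Suc j) - q j))"
        by (rule grid_step_integral(2)[OF q(2,1,3) K2])
      then have L': "(\<Sum>j<m. (\<eta> j \<omega>)\<^sup>2 * (q (Suc j) - q j)) \<le> \<delta>" using L by (simp add: \<eta>_def)
      \<comment> \<open>Off A the total energy is at most \<delta>, so no cell is stopped and both
        sums agree.\<close>
      have "\<eta>' j \<omega> = \<eta> j \<omega>" if "j < m" for j
      proof -
        have "V j \<omega> \<le> (\<Sum>j<m. (\<eta> j \<omega>)\<^sup>2 * (q (Suc j) - q j))"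
          unfolding V_def by (rule sum_mono2) (use that term0 in auto)
        then show ?thesis using L' by (simp add: \<eta>'_def)
      qed
      then have "S' \<omega> = S \<omega>" by (simp add: S'_def S \<eta>_def)
      then show ?thesis using w \<open>0 < \<epsilon>\<close> by (auto simp: abs_le_square_iff[symmetric])
    qed simp
  qed
  then have "prob {\<omega> \<in> space M. \<epsilon> < \<bar>S \<omega>\<bar>} \<le> prob (A \<union> {\<omega> \<in> space M. \<epsilon>\<^sup>2 \<le> (S' \<omega>)\<^sup>2})"
    using A by (intro finite_measure_mono) auto
  also have "\<dots> \<le> prob A + prob {\<omega> \<in> space M. \<epsilon>\<^sup>2 \<le> (S' \<omega>)\<^sup>2}"
    using A by (intro measure_Un_le) auto
  finally show ?thesis using P by simp
qed

end

section \<open>The filtration of a Wiener process\<close>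

text \<open>Since B starts in 0 almost surely, its values at finitely many times up to s are almost
  surely partial sums of increments over a grid in [0, s]. Independence of disjoint blocks of
  increments separates them from B t - B s.\<close>

lemma wiener_cylinder_indep:
  assumes W: "wiener_process M B" and st: "0 \<le> s" "s < t" and R: "finite R" "R \<subseteq> {0..s}"
    and C: "\<And>r. C r \<in> sets borel" "C' \<in> sets borel"
  shows "measure M ({\<omega> \<in> space M. \<forall>r\<in>R. B r \<omega> \<in> C r} \<inter> {\<omega> \<in> space M. B t \<omega> - B s \<omega> \<in> C'}) =
    measure M {\<omega> \<in> space M. \<forall>r\<in>R. B r \<omega> \<in> C r} * measure M {\<omega> \<in> space M. B t \<omega> - B s \<omega> \<in> C'}"
proof -
  from W have "prob_space M" by (simp add: wiener_process_def)
  interpret prob_space M by fact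
  have [measurable]: "0 \<le> r \<Longrightarrow> B r \<in> borel_measurable M" for r using W by (simp add: wiener_process_def)
  have [measurable]: "C r \<in> sets borel" "C' \<in> sets borel" for r using C by auto
  have B0: "AE \<omega> in M. B 0 \<omega> = 0" using W by (simp add: wiener_process_def)
  have "finite (insert 0 R)" "insert 0 R \<subseteq> {0..s}" using R st by auto
  from finite_set_grid[OF this st(1)] obtain q m where q: "0 \<le> q 0" "\<forall>j<m. q j < q (Suc j)" "q m \<le> s"
    "insert 0 R \<subseteq> q ` {..m::nat}" by blast
  have qm: "i \<le> j \<Longrightarrow> j \<le> m \<Longrightarrow> q i \<le> q j" for i j using grid_mono[of m q i j] q(2) by auto
  have q0: "q 0 = 0"
  proof -
    obtain j where "j \<le> m" "q j = 0" using q(4) by auto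
    then show ?thesis using qm[of 0 j] q(1) by simp
  qed
  \<comment> \<open>A Wiener process is specified along infinite nondecreasing sequences of times,
    so the grid is continued by s and then constantly by t. The increment with index m + 1 is
    exactly B t - B s; the one with index m vanishes if the grid already ends in s.\<close>
  define p where "p i = (if i \<le> m then q i else if i = Suc m then s else t)" for i
  have pmono: "mono p"
  proof (rule incseq_SucI)
    fix i show "p i \<le> p (Suc i)" using qm[of i "Suc i"] q(3) st by (auto simp: p_def le_Suc_eq not_le)
  qed
  have p0: "p 0 = 0" by (simp add: p_def q0)
  have p_nonneg: "0 \<le> p i" for i using monoD[OF pmono, of 0 i] p0 by simp
  define D where "D i \<omega> = B (p (Suc i)) \<omega> - B (p i) \<omega>" for i \<omega>
  have Dm[measurable]: "D i \<in> borel_measurable M" for i unfolding D_def using p_nonneg by measurable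
  have ind: "indep_vars (\<lambda>_. borel) D {..<Suc (Suc m)}"
    unfolding D_def using W p0 pmono by (simp add: wiener_process_def)
  let ?I = "{..<Suc m}" and ?J = "{Suc m}"
  have iv: "indep_var (PiM ?I (\<lambda>_. borel)) (\<lambda>\<omega>. restrict (\<lambda>i. D i \<omega>) ?I) (PiM ?J (\<lambda>_. borel)) (\<lambda>\<omega>. restrict (\<lambda>i. D i \<omega>) ?J)"
    by (rule indep_var_restrict[OF ind]) auto
  define idx where "idx r = (SOME j. j \<le> m \<and> q j = r)" for r
  have idx: "idx r \<le> m \<and> q (idx r) = r" if "r \<in> R" for r
    unfolding idx_def by (rule someI_ex) (use q(4) that in auto)
  define Xa where "Xa = {x \<in> space (PiM ?I (\<lambda>_. borel :: real measure)). \<forall>r\<in>R. (\<Sum>i<idx r. x i) \<in> C r}"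
  define Xb where "Xb = {x \<in> space (PiM ?J (\<lambda>_. borel :: real measure)). x (Suc m) \<in> C'}"
  have Xa: "Xa \<in> sets (PiM ?I (\<lambda>_. borel))"
  proof -
    have "(\<lambda>x. \<Sum>i<idx r. x i) \<in> borel_measurable (PiM ?I (\<lambda>_. borel :: real measure))" if "r \<in> R" for r
    proof (rule borel_measurable_sum[where f = "\<lambda>i x. x i"])
      show "(\<lambda>x. x i) \<in> borel_measurable (PiM ?I (\<lambda>_. borel :: real measure))" if "i \<in> {..<idx r}" for i
        by (rule measurable_component_singleton) (use idx[OF \<open>r \<in> R\<close>] that in auto)
    qed
    then have "{x \<in> space (PiM ?I (\<lambda>_. borel :: real measure)). (\<Sum>i<idx r. x i) \<in> C r} \<in> sets (PiM ?I (\<lambda>_. borel))"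
      if "r \<in> R" for r
      using measurable_sets_Collect[OF _ , of "\<lambda>x. \<Sum>i<idx r. x i" _ borel "\<lambda>y. y \<in> C r"] that C(1)[of r] by simp
    then show ?thesis unfolding Xa_def using R(1) by (intro sets.sets_Collect_finite_All) auto
  qed
  have Xb: "Xb \<in> sets (PiM ?J (\<lambda>_. borel))" unfolding Xb_def using C(2) by measurable
  have a: "(\<lambda>\<omega>. restrict (\<lambda>i. D i \<omega>) ?I) -` Xa \<inter> space M = {\<omega> \<in> space M. \<forall>r\<in>R. (\<Sum>i<idx r. D i \<omega>) \<in> C r}"
  proof -
    have "(\<Sum>i<idx r. restrict (\<lambda>i. D i \<omega>) ?I i) = (\<Sum>i<idx r. D i \<omega>)" if "r \<in> R" for r \<omega>
      by (rule sum.cong) (use idx[OF that] in auto)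
    then show ?thesis by (auto simp: Xa_def space_PiM)
  qed
  have b: "(\<lambda>\<omega>. restrict (\<lambda>i. D i \<omega>) ?J) -` Xb \<inter> space M = {\<omega> \<in> space M. B t \<omega> - B s \<omega> \<in> C'}"
    by (auto simp: Xb_def space_PiM D_def p_def)
  have "prob ((\<lambda>x. (restrict (\<lambda>i. D i x) ?I, restrict (\<lambda>i. D i x) ?J)) -` (Xa \<times> Xb) \<inter> space M) =
     prob {\<omega> \<in> space M. \<forall>r\<in>R. (\<Sum>i<idx r. D i \<omega>) \<in> C r} * prob {\<omega> \<in> space M. B t \<omega> - B s \<omega> \<in> C'}"
    using indep_varD[OF iv Xa Xb] unfolding a b .
  also have "(\<lambda>x. (restrict (\<lambda>i. D i x) ?I, restrict (\<lambda>i. D i x) ?J)) -` (Xa \<times> Xb) \<inter> space M =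
     {\<omega> \<in> space M. \<forall>r\<in>R. (\<Sum>i<idx r. D i \<omega>) \<in> C r} \<inter> {\<omega> \<in> space M. B t \<omega> - B s \<omega> \<in> C'}"
    unfolding a[symmetric] b[symmetric] by auto
  finally have prod: "prob ({\<omega> \<in> space M. \<forall>r\<in>R. (\<Sum>i<idx r. D i \<omega>) \<in> C r} \<inter> {\<omega> \<in> space M. B t \<omega> - B s \<omega> \<in> C'}) =
     prob {\<omega> \<in> space M. \<forall>r\<in>R. (\<Sum>i<idx r. D i \<omega>) \<in> C r} * prob {\<omega> \<in> space M. B t \<omega> - B s \<omega> \<in> C'}" .
  have tele: "(\<Sum>i<idx r. D i \<omega>) = B r \<omega>" if "r \<in> R" "B 0 \<omega> = 0" for r \<omega>
  proof -
    have "(\<Sum>i<idx r. D i \<omega>) = B (p (idx r)) \<omega> - B (p 0) \<omega>"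
      unfolding D_def by (rule sum_lessThan_telescope)
    then show ?thesis using idx[OF that(1)] that(2) p0 by (simp add: p_def)
  qed
  have AEeq: "AE \<omega> in M. (\<forall>r\<in>R. (\<Sum>i<idx r. D i \<omega>) \<in> C r) = (\<forall>r\<in>R. B r \<omega> \<in> C r)"
    using B0 by eventually_elim (simp add: tele)
  have Rm: "{\<omega> \<in> space M. \<forall>r\<in>R. B r \<omega> \<in> C r} \<in> events"
  proof (rule sets.sets_Collect_finite_All[OF _ R(1)])
    fix r assume "r \<in> R"
    then have [measurable]: "B r \<in> borel_measurable M" using R(2) by auto
    show "{\<omega> \<in> space M. B r \<omega> \<in> C r} \<in> events" by measurable
  qed
  have Dm': "{\<omega> \<in> space M. \<forall>r\<in>R. (\<Sum>i<idx r. D i \<omega>) \<in> C r} \<in> events"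
    by (rule sets.sets_Collect_finite_All[OF _ R(1)]) measurable
  have Bm: "{\<omega> \<in> space M. B t \<omega> - B s \<omega> \<in> C'} \<in> events"
    using st C(2)
    by (intro measurable_sets_Collect[of "\<lambda>\<omega>. B t \<omega> - B s \<omega>" M borel] borel_measurable_diff) auto
  have e1: "prob {\<omega> \<in> space M. \<forall>r\<in>R. (\<Sum>i<idx r. D i \<omega>) \<in> C r} = prob {\<omega> \<in> space M. \<forall>r\<in>R. B r \<omega> \<in> C r}"
    by (rule measure_eq_AE) (use AEeq Rm Dm' in \<open>auto elim: eventually_mono\<close>)
  have e2: "prob ({\<omega> \<in> space M. \<forall>r\<in>R. (\<Sum>i<idx r. D i \<omega>) \<in> C r} \<inter> {\<omega> \<in> space M. B t \<omega> - B s \<omega> \<in> C'}) =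
     prob ({\<omega> \<in> space M. \<forall>r\<in>R. B r \<omega> \<in> C r} \<inter> {\<omega> \<in> space M. B t \<omega> - B s \<omega> \<in> C'})"
    by (rule measure_eq_AE) (use AEeq Rm Dm' Bm in \<open>auto elim: eventually_mono\<close>)
  show ?thesis using prod unfolding e1 e2 .
qed

text \<open>Independence is first proved on an intersection-stable family, built from
  \<open>Z\<close> and finitely many values of B, and then extended to the sigma-algebra it
  generates. Each event of the augmented filtration agrees almost everywhere with an event of this
  sigma-algebra, and probabilities do not see the difference.\<close>

lemma wiener_brownian_filtration:
  assumes W: "wiener_process M B" and Z: "indep_of_process M Z B"
  shows "brownian_filtration M (aug_filtration M Z B) B"
proof -
  from W have "prob_space M" by (simp add: wiener_process_def)
  interpret prob_space M by fact
  have Bm[measurable]: "0 \<le> r \<Longrightarrow> B r \<in> borel_measurable M" for r using W by (simp add: wiener_process_def)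
  let ?VZ = "vimage_algebra (space M) Z borel"
  let ?VB = "vimage_algebra (space M) (\<lambda>\<omega>. \<lambda>t\<in>{0..}. B t \<omega>) (PiM {0..} (\<lambda>_. borel))"
  have setsZ: "sets ?VZ = {Z -` A \<inter> space M | A. A \<in> sets borel}"
    by (rule sets_vimage_algebra2) simp
  have setsB: "sets ?VB = {(\<lambda>\<omega>. \<lambda>t\<in>{0..}. B t \<omega>) -` A \<inter> space M | A. A \<in> sets (PiM {0..} (\<lambda>_. borel))}"
    by (rule sets_vimage_algebra2) (auto simp: space_PiM)
  have ind: "indep_set (sets ?VZ) (sets ?VB)" using Z by (simp add: indep_of_process_def)
  define G where "G t = {Z -` A \<inter> space M | A. A \<in> sets borel} \<union>
        {B s -` A \<inter> space M | s A. s \<in> {0..t} \<and> A \<in> sets borel} \<union> null_sets M" for t :: real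
  have Gev: "G t \<subseteq> events" for t
  proof -
    have "{Z -` A \<inter> space M | A. A \<in> sets borel} \<subseteq> events"
      using ind unfolding indep_sets2_eq setsZ by blast
    moreover have "{B s -` A \<inter> space M | s A. s \<in> {0..t} \<and> A \<in> sets borel} \<subseteq> events"
      using measurable_sets[OF Bm] by auto
    ultimately show ?thesis by (auto simp: G_def)
  qed
  have Gpow: "G t \<subseteq> Pow (space M)" for t using Gev sets.sets_into_space by blast
  have F: "aug_filtration M Z B t = sigma (space M) (G t)" for t by (simp add: aug_filtration_def G_def)
  have setsF: "sets (aug_filtration M Z B t) = sigma_sets (space M) (G t)" for t
    unfolding F by (rule sets_measure_of[OF Gpow])
  have spaceF: "space (aug_filtration M Z B t) = space M" for t unfolding F by (rule space_measure_of[OF Gpow])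
  have key: "prob (A \<inter> E) = prob A * prob E"
    if st: "0 \<le> s" "s < t" and A: "A \<in> sigma_sets (space M) (G s)"
      and E: "E \<in> {(\<lambda>\<omega>. B t \<omega> - B s \<omega>) -` C \<inter> space M | C. C \<in> sets borel}" for s t A E
  proof -
    define P where "P = {(Z -` A \<inter> space M) \<inter> {\<omega> \<in> space M. \<forall>r\<in>R. B r \<omega> \<in> C r} | A R C.
       A \<in> sets borel \<and> finite R \<and> R \<subseteq> {0..s} \<and> (\<forall>r. C r \<in> sets (borel :: real measure))}"
    from E obtain C' where C': "C' \<in> sets borel" "E = {\<omega> \<in> space M. B t \<omega> - B s \<omega> \<in> C'}" by auto
    have Eev: "E \<in> events" unfolding C'(2) using st C'(1)
      by (intro measurable_sets_Collect[of "\<lambda>\<omega>. B t \<omega> - B s \<omega>" M borel] borel_measurable_diff Bm) auto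
    have cyl: "{\<omega> \<in> space M. \<forall>r\<in>R. B r \<omega> \<in> C r} \<in> sets ?VB"
        "{\<omega> \<in> space M. \<forall>r\<in>R. B r \<omega> \<in> C r} \<inter> E \<in> sets ?VB"
      if "finite R" "R \<subseteq> {0..s}" "\<forall>r. C r \<in> sets (borel :: real measure)" for R C
    proof -
      let ?N = "PiM {0..} (\<lambda>_. borel) :: (real \<Rightarrow> real) measure"
      let ?X = "{x \<in> space ?N. \<forall>r\<in>R. x r \<in> C r}" and ?Y = "{x \<in> space ?N. x t - x s \<in> C'}"
      have X: "?X \<in> sets ?N"
      proof (rule sets.sets_Collect_finite_All[OF _ that(1)])
        fix r assume "r \<in> R"
        then have "r \<in> {0..}" "C r \<in> sets borel" using that by auto
        then show "{x \<in> space ?N. x r \<in> C r} \<in> sets ?N" by measurable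
      qed
      have "(\<lambda>x. x t - x s) \<in> borel_measurable ?N"
        by (intro borel_measurable_diff measurable_component_singleton) (use st in auto)
      then have Y: "?Y \<in> sets ?N" using C'(1) by measurable
      have 1: "(\<lambda>\<omega>. \<lambda>t\<in>{0..}. B t \<omega>) -` ?X \<inter> space M = {\<omega> \<in> space M. \<forall>r\<in>R. B r \<omega> \<in> C r}"
        using that(2) by (auto simp: space_PiM subset_iff)
      have 2: "(\<lambda>\<omega>. \<lambda>t\<in>{0..}. B t \<omega>) -` (?X \<inter> ?Y) \<inter> space M = {\<omega> \<in> space M. \<forall>r\<in>R. B r \<omega> \<in> C r} \<inter> E"
        using that(2) st by (auto simp: space_PiM subset_iff C'(2))
      show "{\<omega> \<in> space M. \<forall>r\<in>R. B r \<omega> \<in> C r} \<in> sets ?VB" unfolding setsB using 1[symmetric] X by blast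
      show "{\<omega> \<in> space M. \<forall>r\<in>R. B r \<omega> \<in> C r} \<inter> E \<in> sets ?VB"
        unfolding setsB using 2[symmetric] sets.Int[OF X Y] by blast
    qed
    have Pint: "Int_stable P"
    proof (rule Int_stableI)
      fix a b assume "a \<in> P" "b \<in> P"
      then obtain A R C A' R' C' where
        a: "a = (Z -` A \<inter> space M) \<inter> {\<omega> \<in> space M. \<forall>r\<in>R. B r \<omega> \<in> C r}" "A \<in> sets borel" "finite R" "R \<subseteq> {0..s}" "\<forall>r. C r \<in> sets (borel :: real measure)"
        and b: "b = (Z -` A' \<inter> space M) \<inter> {\<omega> \<in> space M. \<forall>r\<in>R'. B r \<omega> \<in> C' r}" "A' \<in> sets borel" "finite R'" "R' \<subseteq> {0..s}" "\<forall>r. C' r \<in> sets (borel :: real measure)"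
        unfolding P_def by blast
      \<comment> \<open>A time constrained by only one of the two events receives the whole line as
        its other constraint.\<close>
      let ?C = "\<lambda>r. (if r \<in> R then C r else UNIV) \<inter> (if r \<in> R' then C' r else UNIV)"
      have "a \<inter> b = (Z -` (A \<inter> A') \<inter> space M) \<inter> {\<omega> \<in> space M. \<forall>r\<in>R \<union> R'. B r \<omega> \<in> ?C r}"
        unfolding a b by auto
      moreover have "A \<inter> A' \<in> sets borel" "finite (R \<union> R')" "R \<union> R' \<subseteq> {0..s}" "\<forall>r. ?C r \<in> sets borel"
        using a b by auto
      ultimately show "a \<inter> b \<in> P" unfolding P_def
        by (intro CollectI exI[of _ "A \<inter> A'"] exI[of _ "R \<union> R'"] exI[of _ ?C]) blast
    qed
    have Pev: "P \<subseteq> events"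
    proof
      fix a assume "a \<in> P"
      then obtain A R C where
        a: "a = (Z -` A \<inter> space M) \<inter> {\<omega> \<in> space M. \<forall>r\<in>R. B r \<omega> \<in> C r}" "A \<in> sets borel" "finite R" "R \<subseteq> {0..s}" "\<forall>r. C r \<in> sets (borel :: real measure)"
        unfolding P_def by blast
      have "Z -` A \<inter> space M \<in> events" using Gev[of 0] a(2) unfolding G_def by blast
      moreover have "{\<omega> \<in> space M. \<forall>r\<in>R. B r \<omega> \<in> C r} \<in> events"
        using cyl(1)[OF a(3-5)] ind unfolding indep_sets2_eq by blast
      ultimately show "a \<in> events" unfolding a(1) by (rule sets.Int)
    qed
    have "indep_set P {E}"
    proof (rule indep_setI[OF Pev])
      show "{E} \<subseteq> events" using Eev by simp
      fix a e assume "a \<in> P" "e \<in> {E}"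
      then obtain A R C where
        a: "a = (Z -` A \<inter> space M) \<inter> {\<omega> \<in> space M. \<forall>r\<in>R. B r \<omega> \<in> C r}" "A \<in> sets borel" "finite R" "R \<subseteq> {0..s}" "\<forall>r. C r \<in> sets (borel :: real measure)"
        unfolding P_def by blast
      have ZA: "Z -` A \<inter> space M \<in> sets ?VZ" using a(2) unfolding setsZ by blast
      let ?D = "{\<omega> \<in> space M. \<forall>r\<in>R. B r \<omega> \<in> C r}"
      \<comment> \<open>Independence of Z and B is used twice, for the cylinder with the increment
        and for the cylinder alone; in between, the cylinder is separated from the
        increment.\<close>
      have "prob (a \<inter> E) = prob (Z -` A \<inter> space M) * prob (?D \<inter> E)"
        using indep_setD[OF ind ZA cyl(2)[OF a(3-5)]] unfolding a(1) by (simp add: Int_assoc)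
      also have "prob (?D \<inter> E) = prob ?D * prob E"
        unfolding C'(2) by (rule wiener_cylinder_indep[OF W st a(3,4)]) (use a(5) C'(1) in auto)
      also have "prob (Z -` A \<inter> space M) * (prob ?D * prob E) = prob a * prob E"
        using indep_setD[OF ind ZA cyl(1)[OF a(3-5)]] unfolding a(1) by simp
      finally show "prob (a \<inter> e) = prob a * prob e" using \<open>e \<in> {E}\<close> by simp
    qed
    moreover have "Int_stable {E}" by (simp add: Int_stable_def)
    ultimately have indP: "indep_set (sigma_sets (space M) P) (sigma_sets (space M) {E})"
      using Pint by (intro indep_set_sigma_sets)
    have sP: "sigma_sets (space M) P \<subseteq> events" by (rule sets.sigma_sets_subset[OF Pev])
    have Ppow: "P \<subseteq> Pow (space M)" using Pev sets.sets_into_space by blast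
    \<comment> \<open>The replacement is built along the generation of the sigma-algebra: null sets
      among the generators are replaced by the empty set, the other generators are kept.\<close>
    have "\<exists>A'\<in>sigma_sets (space M) P. AE \<omega> in M. \<omega> \<in> A \<longleftrightarrow> \<omega> \<in> A'"
      using A
    proof induction
      case (Basic a)
      then consider A where "A \<in> sets borel" "a = Z -` A \<inter> space M"
        | r A where "r \<in> {0..s}" "A \<in> sets borel" "a = B r -` A \<inter> space M" | "a \<in> null_sets M"
        unfolding G_def by blast
      then show ?case
      proof cases
        case (1 A)
        then have "a = (Z -` A \<inter> space M) \<inter> {\<omega> \<in> space M. \<forall>r\<in>{}. B r \<omega> \<in> (UNIV :: real set)}" by auto
        then have "a \<in> P" unfolding P_def using 1 by (intro CollectI exI[of _ A] exI[of _ "{}"] exI[of _ "\<lambda>_. UNIV"]) auto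
        then show ?thesis by (intro bexI[of _ a]) (auto intro: sigma_sets.Basic)
      next
        case (2 r A)
        then have "a = (Z -` UNIV \<inter> space M) \<inter> {\<omega> \<in> space M. \<forall>r\<in>{r}. B r \<omega> \<in> A}" by auto
        then have "a \<in> P" unfolding P_def using 2 by (intro CollectI exI[of _ UNIV] exI[of _ "{r}"] exI[of _ "\<lambda>_. A"]) auto
        then show ?thesis by (intro bexI[of _ a]) (auto intro: sigma_sets.Basic)
      next
        case 3
        then have "AE \<omega> in M. \<omega> \<notin> a" by (rule AE_not_in)
        then show ?thesis by (intro bexI[of _ "{}"]) (auto intro: sigma_sets.Empty)
      qed
    next
      case Empty
      show ?case by (intro bexI[of _ "{}"]) (auto intro: sigma_sets.Empty)
    next
      case (Compl a)
      then obtain A' where A': "A' \<in> sigma_sets (space M) P" "AE \<omega> in M. \<omega> \<in> a \<longleftrightarrow> \<omega> \<in> A'" by blast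
      have "AE \<omega> in M. \<omega> \<in> space M - a \<longleftrightarrow> \<omega> \<in> space M - A'" using A'(2) by eventually_elim auto
      then show ?case using sigma_sets.Compl[OF A'(1)] by blast
    next
      case (Union a)
      then have "\<forall>i. \<exists>A'. A' \<in> sigma_sets (space M) P \<and> (AE \<omega> in M. \<omega> \<in> a i \<longleftrightarrow> \<omega> \<in> A')" by blast
      then obtain A' where A': "\<And>i. A' i \<in> sigma_sets (space M) P" "\<And>i. AE \<omega> in M. \<omega> \<in> a i \<longleftrightarrow> \<omega> \<in> A' i"
        by metis
      have "AE \<omega> in M. \<forall>i::nat. \<omega> \<in> a i \<longleftrightarrow> \<omega> \<in> A' i" unfolding AE_all_countable using A'(2) by blast
      then have "AE \<omega> in M. \<omega> \<in> \<Union> (range a) \<longleftrightarrow> \<omega> \<in> \<Union> (range A')" by eventually_elim auto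
      then show ?case using sigma_sets.Union[of A', OF A'(1)] by blast
    qed
    then obtain A' where A': "A' \<in> sigma_sets (space M) P" "AE \<omega> in M. \<omega> \<in> A \<longleftrightarrow> \<omega> \<in> A'" by blast
    have Aev: "A \<in> events" using A sets.sigma_sets_subset[OF Gev] by blast
    have A'ev: "A' \<in> events" using A'(1) sP by blast
    have "prob (A \<inter> E) = prob (A' \<inter> E)"
      by (rule measure_eq_AE) (use A'(2) Aev A'ev Eev in \<open>auto elim: eventually_mono\<close>)
    also have "\<dots> = prob A' * prob E"
      by (rule indep_setD[OF indP A'(1)]) (auto intro: sigma_sets.Basic)
    also have "prob A' = prob A"
      by (rule measure_eq_AE) (use A'(2) Aev A'ev in \<open>auto elim: eventually_mono\<close>)
    finally show ?thesis .
  qed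
  show ?thesis
  proof
    show "subalgebra M (aug_filtration M Z B t)" for t
      unfolding subalgebra_def spaceF setsF using sets.sigma_sets_subset[OF Gev] by simp
    show "sets (aug_filtration M Z B s) \<subseteq> sets (aug_filtration M Z B t)" if "s \<le> t" for s t
    proof -
      have "{B r -` A \<inter> space M | r A. r \<in> {0..s} \<and> A \<in> sets borel} \<subseteq>
        {B r -` A \<inter> space M | r A. r \<in> {0..t} \<and> A \<in> sets borel}"
        using that by fastforce
      then have "G s \<subseteq> G t" unfolding G_def by blast
      then show ?thesis unfolding setsF by (rule sigma_sets_mono')
    qed
    show "B t \<in> borel_measurable (aug_filtration M Z B t)" if "0 \<le> t" for t
    proof (rule measurableI)
      fix A :: "real set" assume "A \<in> sets borel"
      then have "B t -` A \<inter> space M \<in> G t" using that by (auto simp: G_def)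
      then show "B t -` A \<inter> space (aug_filtration M Z B t) \<in> sets (aug_filtration M Z B t)"
        unfolding setsF spaceF by (rule sigma_sets.Basic)
    qed simp
    show "distributed M lborel (\<lambda>\<omega>. B t \<omega> - B s \<omega>) (normal_density 0 (sqrt (t - s)))"
      if "0 \<le> s" "s < t" for s t
      using W that by (simp add: wiener_process_def)
    show "indep_set (sets (aug_filtration M Z B s)) {(\<lambda>\<omega>. B t \<omega> - B s \<omega>) -` C \<inter> space M | C. C \<in> sets borel}"
      if st: "0 \<le> s" "s < t" for s t
    proof (rule indep_setI)
      show "sets (aug_filtration M Z B s) \<subseteq> events"
        unfolding setsF by (rule sets.sigma_sets_subset[OF Gev])
      have "(\<lambda>\<omega>. B t \<omega> - B s \<omega>) \<in> borel_measurable M"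
        using st by (intro borel_measurable_diff Bm) auto
      then show "{(\<lambda>\<omega>. B t \<omega> - B s \<omega>) -` C \<inter> space M | C. C \<in> sets borel} \<subseteq> events"
        using measurable_sets by blast
    qed (use key[OF st] setsF in blast)
  qed
qed

section \<open>Euler sums\<close>

lemma tendsto_in_prob_AE_cong:
  assumes "prob_space M" "tendsto_in_prob M Z D" "AE \<omega> in M. D \<omega> = D' \<omega>"
  shows "tendsto_in_prob M Z D'"
  unfolding tendsto_in_prob_def
proof (intro allI impI)
  interpret prob_space M by fact
  fix \<epsilon> \<delta> :: real assume "0 < \<epsilon>" "0 < \<delta>"
  obtain N where N: "{\<omega> \<in> space M. D \<omega> \<noteq> D' \<omega>} \<subseteq> N" "emeasure M N = 0" "N \<in> events"
    using assms(3) by (rule AE_E)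
  have "\<forall>\<^sub>F k in sequentially. \<exists>A\<in>events. prob A < \<delta> \<and> {\<omega> \<in> space M. \<epsilon> < \<bar>Z k \<omega> - D \<omega>\<bar>} \<subseteq> A"
    using assms(2) \<open>0 < \<epsilon>\<close> \<open>0 < \<delta>\<close> unfolding tendsto_in_prob_def by blast
  then show "\<forall>\<^sub>F k in sequentially. \<exists>A\<in>events. prob A < \<delta> \<and> {\<omega> \<in> space M. \<epsilon> < \<bar>Z k \<omega> - D' \<omega>\<bar>} \<subseteq> A"
  proof eventually_elim
    case (elim k)
    then obtain A where A: "A \<in> events" "prob A < \<delta>" "{\<omega> \<in> space M. \<epsilon> < \<bar>Z k \<omega> - D \<omega>\<bar>} \<subseteq> A" by blast
    have "prob (A \<union> N) \<le> prob A + prob N" by (rule measure_Un_le[OF A(1) N(3)])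
    then have "prob (A \<union> N) < \<delta>" using A(2) N(2) by (simp add: measure_def)
    moreover have "{\<omega> \<in> space M. \<epsilon> < \<bar>Z k \<omega> - D' \<omega>\<bar>} \<subseteq> A \<union> N"
    proof
      fix \<omega> assume w: "\<omega> \<in> {\<omega> \<in> space M. \<epsilon> < \<bar>Z k \<omega> - D' \<omega>\<bar>}"
      show "\<omega> \<in> A \<union> N"
      proof (cases "D \<omega> = D' \<omega>")
        case True
        then have "\<omega> \<in> {\<omega> \<in> space M. \<epsilon> < \<bar>Z k \<omega> - D \<omega>\<bar>}" using w by simp
        then show ?thesis using A(3) by blast
      next
        case False
        then have "\<omega> \<in> {\<omega> \<in> space M. D \<omega> \<noteq> D' \<omega>}" using w by simp
        then show ?thesis using N(1) by blast
      qed
    qed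
    ultimately show ?case using A(1) N(3) by (intro bexI[of _ "A \<union> N"]) auto
  qed
qed

section \<open>Uniform grids and step functions on them\<close>

definition grid_pt :: "real \<Rightarrow> real \<Rightarrow> nat \<Rightarrow> nat \<Rightarrow> real" where
  "grid_pt s t n i = s + (t - s) * real i / real n"

lemma grid_pt_0 [simp]: "grid_pt s t n 0 = s"
  by (simp add: grid_pt_def)

lemma grid_pt_n [simp]: "0 < n \<Longrightarrow> grid_pt s t n n = t"
  by (simp add: grid_pt_def)

lemma grid_pt_step: "grid_pt s t n (Suc i) - grid_pt s t n i = (t - s) / real n"
  by (simp add: grid_pt_def field_simps add_divide_distrib[symmetric] diff_divide_distrib[symmetric])

lemma grid_pt_less: "s < t \<Longrightarrow> i < n \<Longrightarrow> grid_pt s t n i < grid_pt s t n (Suc i)"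
proof -
  assume "s < t" "i < n"
  then have "0 < (t - s) / real n" by simp
  then show ?thesis using grid_pt_step[of s t n i] by simp
qed

lemma grid_pt_bounds:
  assumes "s < t" "i \<le> n"
  shows "s \<le> grid_pt s t n i" "grid_pt s t n i \<le> t"
proof -
  have "real i / real n \<le> 1" using assms by (simp add: divide_le_eq)
  then have "(t - s) * (real i / real n) \<le> (t - s) * 1" using assms by (intro mult_left_mono) auto
  then show "grid_pt s t n i \<le> t" by (simp add: grid_pt_def)
  show "s \<le> grid_pt s t n i" using assms by (simp add: grid_pt_def)
qed

text \<open>Evaluation at the left end of each cell makes the step function nonanticipating, so that
  its integral against B is an Ito sum.\<close>

definition grid_step :: "(real \<Rightarrow> real) \<Rightarrow> real \<Rightarrow> real \<Rightarrow> nat \<Rightarrow> real \<Rightarrow> real" where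
  "grid_step \<phi> s t n r = (\<Sum>i<n. \<phi> (grid_pt s t n i) * indicator {grid_pt s t n i<..grid_pt s t n (Suc i)} r)"

lemma grid_step_approx:
  assumes st: "0 \<le> s" "s < t" "0 < n" and e: "0 \<le> e"
    and \<phi>: "\<And>r r'. r \<in> {0..t} \<Longrightarrow> r' \<in> {0..t} \<Longrightarrow> \<bar>r - r'\<bar> \<le> (t - s) / real n \<Longrightarrow> \<bar>\<phi> r - \<phi> r'\<bar> \<le> e"
  shows "\<bar>grid_step \<phi> s t n r - \<phi> r * indicator {s<..t} r\<bar> \<le> e"
proof -
  let ?q = "grid_pt s t n"
  let ?i = "\<lambda>j. indicator {?q j<..?q (Suc j)} r :: real"
  have q: "\<And>j. j < n \<Longrightarrow> ?q j < ?q (Suc j)" using grid_pt_less[OF st(2)] .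
  \<comment> \<open>The cells partition (s, t]. Both sides of the comparison thus become sums over
    the same cells, of which only the one containing r contributes.\<close>
  have ind: "indicator {s<..t} r = (\<Sum>j<n. ?i j)"
  proof -
    have "indicator {s<..t} r = (\<Sum>j<n. indicator {s<..t} (?q (Suc j)) * ?i j)"
    proof (rule grid_step_function[where f = "indicator {s<..t}"])
      show "?q j < ?q (Suc j)" if "j < n" for j by (rule q[OF that])
      show "indicator {s<..t} u = indicator {s<..t} (?q (Suc j))" if "j < n" "?q j < u" "u \<le> ?q (Suc j)" for j u
        using that grid_pt_bounds[OF st(2), of j n] grid_pt_bounds[OF st(2), of "Suc j" n]
        by (simp add: indicator_def)
      show "indicator {s<..t} u = 0" if "u \<le> ?q 0 \<or> ?q n < u" for u
        using that st by (auto simp: indicator_def)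
    qed
    also have "\<dots> = (\<Sum>j<n. ?i j)"
    proof (rule sum.cong[OF refl])
      fix j assume "j \<in> {..<n}"
      then have "s < ?q (Suc j) \<and> ?q (Suc j) \<le> t"
        using grid_pt_bounds[OF st(2), of j n] grid_pt_bounds[OF st(2), of "Suc j" n] q[of j] by auto
      then show "indicator {s<..t} (?q (Suc j)) * ?i j = ?i j" by simp
    qed
    finally show ?thesis .
  qed
  have "\<bar>grid_step \<phi> s t n r - \<phi> r * indicator {s<..t} r\<bar> = \<bar>\<Sum>j<n. (\<phi> (?q j) - \<phi> r) * ?i j\<bar>"
    unfolding ind grid_step_def by (simp only: left_diff_distrib sum_subtractf sum_distrib_left)
  also have "\<dots> \<le> (\<Sum>j<n. \<bar>(\<phi> (?q j) - \<phi> r) * ?i j\<bar>)" by (rule sum_abs)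
  also have "\<dots> \<le> (\<Sum>j<n. e * ?i j)"
  proof (rule sum_mono)
    fix j assume j: "j \<in> {..<n}"
    show "\<bar>(\<phi> (?q j) - \<phi> r) * ?i j\<bar> \<le> e * ?i j"
    proof (cases "?q j < r \<and> r \<le> ?q (Suc j)")
      case True
      then have "\<bar>?q j - r\<bar> \<le> (t - s) / real n" using grid_pt_step[of s t n j] by linarith
      moreover have "?q j \<in> {0..t}" "r \<in> {0..t}"
        using True grid_pt_bounds[OF st(2), of j n] grid_pt_bounds[OF st(2), of "Suc j" n] j st(1) by auto
      ultimately show ?thesis using \<phi> True by simp
    qed (auto simp: indicator_def)
  qed
  also have "\<dots> = e * indicator {s<..t} r" unfolding ind by (simp only: sum_distrib_left)
  also have "\<dots> \<le> e" using e by (simp add: indicator_def)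
  finally show ?thesis .
qed

lemma grid_step_LBINT:
  assumes "0 \<le> s" "s < t" "0 < n"
  shows "set_integrable lborel {0..t} (grid_step \<phi> s t n)"
    and "(LBINT r:{0..t}. grid_step \<phi> s t n r) = (\<Sum>i<n. \<phi> (grid_pt s t n i) * ((t - s) / real n))"
  using grid_step_integral[of n "grid_pt s t n" t "grid_step \<phi> s t n" "\<lambda>i. \<phi> (grid_pt s t n i)"]
    grid_pt_less[OF assms(2)] assms grid_pt_step[of s t n]
  by (simp_all add: grid_step_def)

abbreviation (in brownian_filtration) grid_incr :: "real \<Rightarrow> real \<Rightarrow> nat \<Rightarrow> nat \<Rightarrow> 'a \<Rightarrow> real" where
  "grid_incr s t n i \<omega> \<equiv> B (grid_pt s t n (Suc i)) \<omega> - B (grid_pt s t n i) \<omega>"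

text \<open>For each t the integral is a random variable of its own, not part of a process;
  continuity of the paths of X is what connects different times. The initial value is written as
  \<open>X 0\<close>, which is adapted.\<close>

locale pantograph = brownian_filtration M F B for M :: "'a measure" and F B +
  fixes X :: "real \<Rightarrow> 'a \<Rightarrow> real" and a b \<sigma> \<rho> q :: real
  assumes q: "0 < q" "q < 1"
    and X_adapted: "adapted F X"
    and X_cont: "AE \<omega> in M. continuous_on {0..} (\<lambda>t. X t \<omega>)"
    and X_eq: "\<And>t. 0 \<le> t \<Longrightarrow> \<exists>I. has_ito_integral M F B (\<lambda>s \<omega>. \<sigma> * X s \<omega> + \<rho> * X (q * s) \<omega>) t I \<and>
      (AE \<omega> in M. X t \<omega> = X 0 \<omega> + (LBINT s:{0..t}. a * X s \<omega> + b * X (q * s) \<omega>) + I \<omega>)"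
    and X0_sq: "integrable M (\<lambda>\<omega>. (X 0 \<omega>)\<^sup>2)"
begin

abbreviation drift :: "real \<Rightarrow> 'a \<Rightarrow> real" where
  "drift s \<omega> \<equiv> a * X s \<omega> + b * X (q * s) \<omega>"

abbreviation noise :: "real \<Rightarrow> 'a \<Rightarrow> real" where
  "noise s \<omega> \<equiv> \<sigma> * X s \<omega> + \<rho> * X (q * s) \<omega>"

definition euler_sum :: "real \<Rightarrow> real \<Rightarrow> nat \<Rightarrow> 'a \<Rightarrow> real" where
  "euler_sum s t n \<omega> = (\<Sum>i<n. drift (grid_pt s t n i) \<omega> * ((t - s) / real n)) +
     (\<Sum>i<n. noise (grid_pt s t n i) \<omega> * grid_incr s t n i \<omega>)"

lemma X_measurable_F: "0 \<le> s \<Longrightarrow> s \<le> t \<Longrightarrow> X s \<in> borel_measurable (F t)"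
  using X_adapted F_measurable_mono[of s t "X s"] by (simp add: adapted_def)

lemma X_measurable [measurable]: "0 \<le> t \<Longrightarrow> X t \<in> borel_measurable M"
  using X_measurable_F[of t t] F_measurable_M by simp

lemma qs: "0 \<le> s \<Longrightarrow> 0 \<le> q * s" "0 \<le> s \<Longrightarrow> q * s \<le> s"
  using q by (simp_all add: mult_left_le_one_le)

lemma X_q_measurable [measurable]: "0 \<le> t \<Longrightarrow> X (q * t) \<in> borel_measurable M"
  using X_measurable[of "q * t"] q by simp

lemma X_q_measurable_F: "0 \<le> s \<Longrightarrow> s \<le> t \<Longrightarrow> X (q * s) \<in> borel_measurable (F t)"
  using X_measurable_F[of "q * s" t] qs[of s] by simp

lemma noise_measurable_F: "0 \<le> s \<Longrightarrow> s \<le> t \<Longrightarrow> noise s \<in> borel_measurable (F t)"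
  by (intro borel_measurable_add borel_measurable_times borel_measurable_const X_measurable_F X_q_measurable_F)

lemma euler_sum_measurable:
  assumes "0 \<le> s" "s < t"
  shows "euler_sum s t n \<in> borel_measurable M"
proof -
  have *: "0 \<le> grid_pt s t n i" for i
    using assms by (simp add: grid_pt_def)
  show ?thesis unfolding euler_sum_def
    by (intro borel_measurable_add borel_measurable_sum borel_measurable_times borel_measurable_diff
        borel_measurable_const X_measurable X_q_measurable B_measurable_M *)
qed

text \<open>Every continuous path is uniformly continuous on compact intervals, but with a modulus
  of its own. The events that the modulus 1/(n + 1) fails at rational times decrease to a null set,
  so off an event of small probability one modulus serves all paths. Rational times keep these
  events measurable, and continuity restores the other times.\<close>

lemma modulus_of_continuity:
  assumes "0 < \<epsilon>" "0 < \<delta>"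
  shows "\<exists>d>0. \<exists>A\<in>events. prob A < \<delta> \<and> (\<forall>\<omega>\<in>space M - A. continuous_on {0..} (\<lambda>t. X t \<omega>) \<and>
    (\<forall>r\<in>{0..T}. \<forall>r'\<in>{0..T}. \<bar>r - r'\<bar> \<le> d \<longrightarrow> \<bar>X r \<omega> - X r' \<omega>\<bar> \<le> \<epsilon>))"
proof -
  obtain N where N: "{\<omega> \<in> space M. \<not> continuous_on {0..} (\<lambda>t. X t \<omega>)} \<subseteq> N" "emeasure M N = 0" "N \<in> events"
    using X_cont by (rule AE_E)
  \<comment> \<open>The range is extended to T + 1 because points of [0, T] are approximated by
    rationals from the right.\<close>
  define D where "D = {0..T+1} \<inter> \<rat>"
  have cD: "countable D" unfolding D_def by (intro countable_Int2 countable_rat)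
  define E where "E n = (\<Union>r\<in>D. \<Union>r'\<in>D. {\<omega> \<in> space M. \<bar>r - r'\<bar> < 1 / real (Suc n) \<and> \<epsilon> < \<bar>X r \<omega> - X r' \<omega>\<bar>})" for n
  have Eev: "E n \<in> events" for n
    unfolding E_def
  proof (intro sets.countable_UN'' cD)
    fix r r' assume "r \<in> D" "r' \<in> D"
    then have [measurable]: "X r \<in> borel_measurable M" "X r' \<in> borel_measurable M" by (auto simp: D_def)
    show "{\<omega> \<in> space M. \<bar>r - r'\<bar> < 1 / real (Suc n) \<and> \<epsilon> < \<bar>X r \<omega> - X r' \<omega>\<bar>} \<in> events" by measurable
  qed
  have dec: "decseq E"
  proof (rule decseq_SucI)
    fix n
    have "1 / real (Suc (Suc n)) \<le> 1 / real (Suc n)" by (simp add: field_simps)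
    then show "E (Suc n) \<subseteq> E n" unfolding E_def by (intro UN_mono order_refl) auto
  qed
  have int: "(\<Inter>n. E n) \<subseteq> N"
  proof
    fix \<omega> assume w: "\<omega> \<in> (\<Inter>n. E n)"
    then have sp: "\<omega> \<in> space M" unfolding E_def by auto
    show "\<omega> \<in> N"
    proof (rule ccontr)
      assume "\<omega> \<notin> N"
      then have "continuous_on {0..} (\<lambda>t. X t \<omega>)" using N(1) sp by blast
      then have "continuous_on {0..T+1} (\<lambda>t. X t \<omega>)" by (rule continuous_on_subset) auto
      then have "uniformly_continuous_on {0..T+1} (\<lambda>t. X t \<omega>)"
        by (rule compact_uniformly_continuous) simp
      from uniformly_continuous_onE[OF this \<open>0 < \<epsilon>\<close>]
      obtain d where d: "d > 0" "\<And>x x'. x \<in> {0..T+1} \<Longrightarrow> x' \<in> {0..T+1} \<Longrightarrow> dist x' x < d \<Longrightarrow> dist (X x' \<omega>) (X x \<omega>) < \<epsilon>"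
        by blast
      obtain n where n: "1 / real (Suc n) < d" using d(1) by (metis nat_approx_posE)
      have "\<omega> \<in> E n" using w by blast
      then obtain r r' where "r \<in> D" "r' \<in> D" "\<bar>r - r'\<bar> < 1 / real (Suc n)" "\<epsilon> < \<bar>X r \<omega> - X r' \<omega>\<bar>"
        unfolding E_def by blast
      then show False using d(2)[of r' r] n by (simp add: D_def dist_real_def)
    qed
  qed
  have "(\<lambda>n. prob (E n)) \<longlonglongrightarrow> prob (\<Inter>n. E n)"
    by (rule finite_Lim_measure_decseq) (use Eev dec in auto)
  moreover have "prob (\<Inter>n. E n) \<le> prob N" by (rule finite_measure_mono[OF int N(3)])
  moreover have N0: "prob N = 0" using N(2) by (simp add: measure_def)
  ultimately have "(\<lambda>n. prob (E n)) \<longlonglongrightarrow> 0" by (simp add: measure_le_0_iff)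
  then have "\<forall>\<^sub>F n in sequentially. prob (E n) < \<delta>" using \<open>0 < \<delta>\<close> by (rule order_tendstoD)
  then obtain n where n: "prob (E n) < \<delta>" by (auto simp: eventually_sequentially)
  have "prob (E n \<union> N) < \<delta>" using measure_Un_le[OF Eev N(3), of n] n N0 by simp
  \<comment> \<open>Half of the distance that E n controls leaves room for rational neighbours of r
    and r', which are eventually closer than 1/(n + 1) to each other.\<close>
  moreover have "\<bar>X r \<omega> - X r' \<omega>\<bar> \<le> \<epsilon>"
    if w: "\<omega> \<in> space M" "\<omega> \<notin> E n" and cont: "continuous_on {0..} (\<lambda>t. X t \<omega>)"
      and r: "r \<in> {0..T}" "r' \<in> {0..T}" "\<bar>r - r'\<bar> \<le> 1 / (2 * real (Suc n))" for \<omega> r r'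
  proof -
    have ex: "\<exists>u. (\<forall>k. u k \<in> D \<and> \<bar>u k - x\<bar> \<le> 1 / real (Suc k)) \<and> u \<longlonglongrightarrow> x" if "x \<in> {0..T}" for x
    proof -
      have "\<exists>y\<in>\<rat>. x < y \<and> y < x + 1 / real (Suc k)" for k by (rule Rats_dense_in_real) simp
      then obtain u where u: "\<And>k. u k \<in> \<rat>" "\<And>k. x < u k" "\<And>k. u k < x + 1 / real (Suc k)" by metis
      have le1: "1 / real (Suc k) \<le> 1" for k by simp
      have u2: "u k < x + 1" for k using u(3)[of k] le1[of k] by linarith
      have "u k \<in> D" for k using u(1,2)[of k] u2[of k] that unfolding D_def by auto
      moreover have "\<bar>u k - x\<bar> \<le> 1 / real (Suc k)" for k using u(2,3)[of k] by linarith
      moreover have "u \<longlonglongrightarrow> x"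
      proof (rule tendsto_sandwich[of "\<lambda>_. x" u _ "\<lambda>k. x + 1 / real (Suc k)"])
        show "(\<lambda>k. x + 1 / real (Suc k)) \<longlonglongrightarrow> x"
          using tendsto_add[OF tendsto_const[of x] LIMSEQ_inverse_real_of_nat] by (simp add: inverse_eq_divide)
        show "\<forall>\<^sub>F k in sequentially. x \<le> u k" by (intro always_eventually allI less_imp_le u(2))
        show "\<forall>\<^sub>F k in sequentially. u k \<le> x + 1 / real (Suc k)" by (intro always_eventually allI less_imp_le u(3))
      qed simp
      ultimately show ?thesis by blast
    qed
    obtain u where u: "\<forall>k. u k \<in> D \<and> \<bar>u k - r\<bar> \<le> 1 / real (Suc k)" "u \<longlonglongrightarrow> r" using ex[OF r(1)] by blast
    obtain u' where u': "\<forall>k. u' k \<in> D \<and> \<bar>u' k - r'\<bar> \<le> 1 / real (Suc k)" "u' \<longlonglongrightarrow> r'" using ex[OF r(2)] by blast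
    have lim: "(\<lambda>k. X (v k) \<omega>) \<longlonglongrightarrow> X x \<omega>" if "\<forall>k. v k \<in> D \<and> P k" "v \<longlonglongrightarrow> x" "x \<in> {0..T}" for v x P
      by (rule continuous_on_tendsto_compose[OF cont that(2)]) (use that in \<open>auto simp: D_def\<close>)
    have L: "(\<lambda>k. \<bar>X (u k) \<omega> - X (u' k) \<omega>\<bar>) \<longlonglongrightarrow> \<bar>X r \<omega> - X r' \<omega>\<bar>"
      by (intro tendsto_rabs tendsto_diff lim[OF u r(1)] lim[OF u' r(2)])
    have "(\<lambda>k. \<bar>u k - u' k\<bar>) \<longlonglongrightarrow> \<bar>r - r'\<bar>" by (intro tendsto_rabs tendsto_diff u(2) u'(2))
    moreover have "\<bar>r - r'\<bar> < 1 / real (Suc n)"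
      using r(3) by (rule order_le_less_trans) (simp add: divide_strict_left_mono)
    ultimately have ev: "\<forall>\<^sub>F k in sequentially. \<bar>u k - u' k\<bar> < 1 / real (Suc n)" by (rule order_tendstoD)
    show ?thesis
    proof (rule tendsto_upperbound[OF L])
      show "\<forall>\<^sub>F k in sequentially. \<bar>X (u k) \<omega> - X (u' k) \<omega>\<bar> \<le> \<epsilon>"
        using ev
      proof eventually_elim
        case (elim k)
        have "u k \<in> D" "u' k \<in> D" using u(1) u'(1) by blast+
        show ?case
        proof (rule ccontr)
          assume "\<not> ?case"
          then have "\<omega> \<in> E n" unfolding E_def using w(1) elim \<open>u k \<in> D\<close> \<open>u' k \<in> D\<close> by force
          then show False using w(2) by blast
        qed
      qed
    qed simp
  qed
  moreover have "continuous_on {0..} (\<lambda>t. X t \<omega>)" if "\<omega> \<in> space M" "\<omega> \<notin> N" for \<omega>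
    using N(1) that by blast
  ultimately have "(E n \<union> N) \<in> events \<and> prob (E n \<union> N) < \<delta> \<and>
     (\<forall>\<omega>\<in>space M - (E n \<union> N). continuous_on {0..} (\<lambda>t. X t \<omega>) \<and>
    (\<forall>r\<in>{0..T}. \<forall>r'\<in>{0..T}. \<bar>r - r'\<bar> \<le> 1 / (2 * real (Suc n)) \<longrightarrow> \<bar>X r \<omega> - X r' \<omega>\<bar> \<le> \<epsilon>))"
    using Eev[of n] N(3) by auto
  moreover have "0 < 1 / (2 * real (Suc n))" by simp
  ultimately show ?thesis by blast
qed

text \<open>Multiplication by q maps [0, t] into itself and shortens distances, so one modulus of X
  controls the present and the delayed value alike.\<close>

lemma linear_modulus:
  assumes "\<forall>r\<in>{0..t}. \<forall>r'\<in>{0..t}. \<bar>r - r'\<bar> \<le> d \<longrightarrow> \<bar>X r \<omega> - X r' \<omega>\<bar> \<le> e"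
    and r: "r \<in> {0..t}" "r' \<in> {0..t}" "\<bar>r - r'\<bar> \<le> d"
  shows "\<bar>(u * X r \<omega> + v * X (q * r) \<omega>) - (u * X r' \<omega> + v * X (q * r') \<omega>)\<bar> \<le> (\<bar>u\<bar> + \<bar>v\<bar>) * e"
proof -
  have 1: "\<bar>X r \<omega> - X r' \<omega>\<bar> \<le> e" using assms by blast
  have "\<bar>q * r - q * r'\<bar> = q * \<bar>r - r'\<bar>" using q by (simp add: right_diff_distrib[symmetric] abs_mult)
  also have "\<dots> \<le> \<bar>r - r'\<bar>" using q by (simp add: mult_left_le_one_le)
  finally have "\<bar>q * r - q * r'\<bar> \<le> d" using r(3) by simp
  moreover have "q * r \<in> {0..t}" "q * r' \<in> {0..t}" using r qs[of r] qs[of r'] by auto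
  ultimately have 2: "\<bar>X (q * r) \<omega> - X (q * r') \<omega>\<bar> \<le> e" using assms(1) by blast
  have "\<bar>(u * X r \<omega> + v * X (q * r) \<omega>) - (u * X r' \<omega> + v * X (q * r') \<omega>)\<bar> =
    \<bar>u * (X r \<omega> - X r' \<omega>) + v * (X (q * r) \<omega> - X (q * r') \<omega>)\<bar>" by (simp add: algebra_simps)
  also have "\<dots> \<le> \<bar>u\<bar> * \<bar>X r \<omega> - X r' \<omega>\<bar> + \<bar>v\<bar> * \<bar>X (q * r) \<omega> - X (q * r') \<omega>\<bar>"
    by (rule order_trans[OF abs_triangle_ineq]) (simp add: abs_mult)
  also have "\<dots> \<le> \<bar>u\<bar> * e + \<bar>v\<bar> * e" by (intro add_mono mult_left_mono 1 2) auto
  finally show ?thesis by (simp add: algebra_simps)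
qed

lemma linear_continuous:
  assumes "continuous_on {0..} (\<lambda>t. X t \<omega>)"
  shows "continuous_on {0..t} (\<lambda>r. u * X r \<omega> + v * X (q * r) \<omega>)"
proof -
  have "continuous_on {0..t} (\<lambda>t. X t \<omega>)" by (rule continuous_on_subset[OF assms]) auto
  moreover have "continuous_on {0..t} (\<lambda>r. X (q * r) \<omega>)"
    by (rule continuous_on_compose2[OF assms]) (use q in \<open>auto intro!: continuous_intros\<close>)
  ultimately show ?thesis by (intro continuous_intros)
qed

lemma drift_sum_tendsto:
  assumes st: "0 \<le> s" "s < t"
  shows "tendsto_in_prob M (\<lambda>n \<omega>. \<Sum>i<n. drift (grid_pt s t n i) \<omega> * ((t - s) / real n))
    (\<lambda>\<omega>. (LBINT r:{0..t}. drift r \<omega>) - (LBINT r:{0..s}. drift r \<omega>))"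
  unfolding tendsto_in_prob_def
proof (intro allI impI)
  fix \<epsilon> \<delta> :: real assume ed: "0 < \<epsilon>" "0 < \<delta>"
  have t: "0 < t" using st by simp
  let ?c = "\<bar>a\<bar> + \<bar>b\<bar>"
  \<comment> \<open>The summand 1 keeps the denominator positive when a = b = 0.\<close>
  define e where "e = \<epsilon> / (t * (?c + 1))"
  have cpos: "0 < ?c + 1" by (simp add: add_nonneg_pos)
  have e: "0 < e" unfolding e_def using ed t cpos by (intro divide_pos_pos mult_pos_pos)
  have ce: "t * (?c * e) \<le> \<epsilon>"
  proof -
    have "t * (?c * e) \<le> t * ((?c + 1) * e)" using t e by (intro mult_left_mono mult_right_mono) auto
    also have "\<dots> = \<epsilon>"
    proof -
      have "t * (k * (\<epsilon> / (t * k))) = \<epsilon>" if "0 < k" for k using t that by (simp add: field_simps)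
      from this[OF cpos] show ?thesis unfolding e_def .
    qed
    finally show ?thesis .
  qed
  from modulus_of_continuity[OF e ed(2), of t] obtain d A where d: "0 < d" and A: "A \<in> events" "prob A < \<delta>"
    and mod: "\<forall>\<omega>\<in>space M - A. continuous_on {0..} (\<lambda>t. X t \<omega>) \<and>
    (\<forall>r\<in>{0..t}. \<forall>r'\<in>{0..t}. \<bar>r - r'\<bar> \<le> d \<longrightarrow> \<bar>X r \<omega> - X r' \<omega>\<bar> \<le> e)" by blast
  have "(\<lambda>n. (t - s) / real n) \<longlonglongrightarrow> 0" by real_asymp
  then have "\<forall>\<^sub>F n in sequentially. (t - s) / real n < d" using d by (rule order_tendstoD)
  then show "\<forall>\<^sub>F n in sequentially. \<exists>A\<in>events. prob A < \<delta> \<and>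
     {\<omega> \<in> space M. \<epsilon> < \<bar>(\<Sum>i<n. drift (grid_pt s t n i) \<omega> * ((t - s) / real n)) -
       ((LBINT r:{0..t}. drift r \<omega>) - (LBINT r:{0..s}. drift r \<omega>))\<bar>} \<subseteq> A"
    using eventually_gt_at_top[of 0]
  proof eventually_elim
    case (elim n)
    have "\<bar>(\<Sum>i<n. drift (grid_pt s t n i) \<omega> * ((t - s) / real n)) -
       ((LBINT r:{0..t}. drift r \<omega>) - (LBINT r:{0..s}. drift r \<omega>))\<bar> \<le> \<epsilon>" if w: "\<omega> \<in> space M - A" for \<omega>
    proof -
      let ?f = "\<lambda>r. drift r \<omega>"
      have cont: "continuous_on {0..} (\<lambda>t. X t \<omega>)" using mod w by blast
      have int: "set_integrable lborel {0..u} ?f" for u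
        by (rule borel_integrable_atLeastAtMost'[OF linear_continuous[OF cont]])
      have int2: "set_integrable lborel {0..t} (\<lambda>r. ?f r * indicator {s<..t} r)"
      proof -
        have "integrable lborel (\<lambda>r. indicator {s<..t} r *\<^sub>R (indicator {0..t} r *\<^sub>R ?f r))"
          by (rule integrable_mult_indicator[OF _ int[of t, unfolded set_integrable_def]]) simp
        then show ?thesis by (simp add: set_integrable_def mult_ac)
      qed
      \<comment> \<open>The equation provides integrals starting at 0. Their difference is written
        as one integral over [0, t], where it can be compared pointwise with the step
        function.\<close>
      have split: "(LBINT r:{0..t}. ?f r * indicator {s<..t} r) = (LBINT r:{0..t}. ?f r) - (LBINT r:{0..s}. ?f r)"
      proof -
        have "(LBINT r:{0..t}. ?f r) - (LBINT r:{0..s}. ?f r) =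
          (LINT r|lborel. indicator {0..t} r *\<^sub>R ?f r - indicator {0..s} r *\<^sub>R ?f r)"
          using int[of t] int[of s] unfolding set_integrable_def set_lebesgue_integral_def
          by (intro Bochner_Integration.integral_diff[symmetric])
        also have "\<dots> = (LBINT r:{0..t}. ?f r * indicator {s<..t} r)"
          unfolding set_lebesgue_integral_def
          by (rule Bochner_Integration.integral_cong) (use st in \<open>auto simp: indicator_def\<close>)
        finally show ?thesis by simp
      qed
      have appr: "\<bar>grid_step ?f s t n r - ?f r * indicator {s<..t} r\<bar> \<le> ?c * e" for r
      proof (rule grid_step_approx[OF st elim(2)])
        show "0 \<le> ?c * e" using e by simp
        fix r r' assume "r \<in> {0..t}" "r' \<in> {0..t}" "\<bar>r - r'\<bar> \<le> (t - s) / real n"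
        then show "\<bar>?f r - ?f r'\<bar> \<le> ?c * e"
          using linear_modulus[of t d \<omega> e r r'] mod w elim(1) by (auto intro: order_trans)
      qed
      have eq: "(\<Sum>i<n. drift (grid_pt s t n i) \<omega> * ((t - s) / real n)) -
       ((LBINT r:{0..t}. drift r \<omega>) - (LBINT r:{0..s}. drift r \<omega>)) =
       (LBINT r:{0..t}. grid_step ?f s t n r - ?f r * indicator {s<..t} r)"
        using set_integral_diff[OF grid_step_LBINT(1)[OF st elim(2), of ?f] int2]
        unfolding split grid_step_LBINT(2)[OF st elim(2)] by simp
      have "\<bar>LBINT r:{0..t}. grid_step ?f s t n r - ?f r * indicator {s<..t} r\<bar> \<le> (LBINT r:{0..t}. \<bar>grid_step ?f s t n r - ?f r * indicator {s<..t} r\<bar>)"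
        using set_integral_norm_bound[OF set_integral_diff(1)[OF grid_step_LBINT(1)[OF st elim(2), of ?f] int2]]
        by simp
      also have "\<dots> \<le> (LBINT r:{0..t}. ?c * e)"
      proof (rule set_integral_mono)
        show "set_integrable lborel {0..t} (\<lambda>r. \<bar>grid_step ?f s t n r - ?f r * indicator {s<..t} r\<bar>)"
          using set_integral_diff(1)[OF grid_step_LBINT(1)[OF st elim(2), of ?f] int2] by (rule set_integrable_abs)
        show "set_integrable lborel {0..t} (\<lambda>r. ?c * e)"
          by (rule borel_integrable_atLeastAtMost') (intro continuous_intros)
      qed (rule appr)
      also have "\<dots> = t * (?c * e)" using t by (simp add: set_lebesgue_integral_def)
      finally show ?thesis using ce unfolding eq by simp
    qed
    then show ?case using A by (intro bexI[of _ A]) (auto simp: not_less[symmetric])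
  qed
qed

text \<open>The horizon T may exceed t: an integral up to s is later compared on [0, t] with an
  integral up to t, and the cutoff in the integrand accounts for the earlier end.\<close>

lemma simple_data_pair:
  assumes sd: "simple_data M F n p \<xi>" and t: "0 \<le> t" "t \<le> T"
  shows "simple_pair T (\<lambda>s \<omega>. simple_process n p \<xi> s \<omega> * indicator {..t} s) (simple_integral B n p \<xi> t)"
proof -
  have p0: "0 \<le> p i" if "i \<le> n" for i
    using that
  proof (induction i)
    case (Suc i)
    then have "0 \<le> p i" "p i \<le> p (Suc i)" using sd by (auto simp: simple_data_def)
    then show ?case by simp
  qed (use sd in \<open>simp add: simple_data_def\<close>)
  have "simple_pair T (\<lambda>s \<omega>. \<Sum>i<n. \<xi> i \<omega> * indicator {min t (p i)<..min t (p (Suc i))} s)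
    (\<lambda>\<omega>. \<Sum>i<n. \<xi> i \<omega> * (B (min t (p (Suc i))) \<omega> - B (min t (p i)) \<omega>))"
  proof (rule simple_pair_sum)
    fix i assume i: "i < n"
    show "0 \<le> min t (p i)" using p0[of i] i t by simp
    show "min t (p i) \<le> min t (p (Suc i))" using sd i by (auto simp: simple_data_def intro: min.mono)
    show "min t (p (Suc i)) \<le> T" using t by simp
    show "\<xi> i \<in> borel_measurable (F (min t (p i)))" if "min t (p i) < min t (p (Suc i))"
    proof -
      have "min t (p i) = p i" using that by (auto simp: min_def split: if_splits)
      then show ?thesis using sd i by (simp add: simple_data_def)
    qed
  qed
  moreover have "(\<lambda>s \<omega>. \<Sum>i<n. \<xi> i \<omega> * indicator {min t (p i)<..min t (p (Suc i))} s) =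
    (\<lambda>s \<omega>. simple_process n p \<xi> s \<omega> * indicator {..t} s)"
    unfolding simple_process_def sum_distrib_right
    by (intro ext sum.cong) (auto simp: indicator_def)
  moreover have "(\<lambda>\<omega>. \<Sum>i<n. \<xi> i \<omega> * (B (min t (p (Suc i))) \<omega> - B (min t (p i)) \<omega>)) = simple_integral B n p \<xi> t"
    by (auto simp: simple_integral_def)
  ultimately show ?thesis by simp
qed

lemma noise_sum_pair:
  assumes "0 \<le> s" "s < t"
  shows "simple_pair t (\<lambda>r \<omega>. grid_step (\<lambda>r. noise r \<omega>) s t n r)
    (\<lambda>\<omega>. \<Sum>i<n. noise (grid_pt s t n i) \<omega> * grid_incr s t n i \<omega>)"
  unfolding grid_step_def
proof (rule simple_pair_sum)
  fix i assume i: "i < n"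
  show g: "0 \<le> grid_pt s t n i" using grid_pt_bounds[of s t i n] assms i by simp
  show "grid_pt s t n i \<le> grid_pt s t n (Suc i)" using grid_pt_less[OF assms(2) i] by simp
  show "grid_pt s t n (Suc i) \<le> t" using grid_pt_bounds[of s t "Suc i" n] assms i by simp
  show "noise (grid_pt s t n i) \<in> borel_measurable (F (grid_pt s t n i))"
    by (rule noise_measurable_F[OF g]) simp
qed

lemma simple_minus_continuous_integrable:
  assumes "simple_pair T K S" "0 \<le> T" "continuous_on {0..T} h"
  shows "set_integrable lborel {0..T} (\<lambda>r. (K r \<omega> - h r)\<^sup>2)"
proof -
  note K = simple_pair_integrable[OF assms(1,2), of \<omega>]
  have h2: "set_integrable lborel {0..T} (\<lambda>r. (h r)\<^sup>2)"
    by (rule borel_integrable_atLeastAtMost') (intro continuous_intros assms(3))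
  have hm: "set_borel_measurable lborel {0..T} h"
    using borel_integrable_atLeastAtMost'[OF assms(3)] by (auto simp: set_integrable_def set_borel_measurable_def)
  have [measurable]: "(\<lambda>r. K r \<omega>) \<in> borel_measurable lborel" using K(2) by simp
  have "integrable lborel (\<lambda>r. indicator {0..T} r *\<^sub>R (2 * (K r \<omega>)\<^sup>2 + 2 * (h r)\<^sup>2))"
    using set_integral_add(1)[OF set_integrable_mult_right[of 2, OF K(1)] set_integrable_mult_right[of 2, OF h2]]
    by (simp add: set_integrable_def)
  then show ?thesis unfolding set_integrable_def
  proof (rule Bochner_Integration.integrable_bound)
    have "(\<lambda>r. indicator {0..T} r * (indicator {0..T} r * K r \<omega> - indicator {0..T} r * h r)\<^sup>2) \<in> borel_measurable lborel"
      using hm unfolding set_borel_measurable_def by simp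
    moreover have "(\<lambda>r. indicator {0..T} r * (indicator {0..T} r * K r \<omega> - indicator {0..T} r * h r)\<^sup>2) =
      (\<lambda>r. indicator {0..T} r *\<^sub>R (K r \<omega> - h r)\<^sup>2)" by (auto simp: indicator_def)
    ultimately show "(\<lambda>r. indicator {0..T} r *\<^sub>R (K r \<omega> - h r)\<^sup>2) \<in> borel_measurable lborel" by simp
    show "AE r in lborel. norm (indicator {0..T} r *\<^sub>R (K r \<omega> - h r)\<^sup>2)
       \<le> norm (indicator {0..T} r *\<^sub>R (2 * (K r \<omega>)\<^sup>2 + 2 * (h r)\<^sup>2))"
      using diff_square_le2 by (intro AE_I2) (auto simp: indicator_def)
  qed
qed

text \<open>The integrals at t and at s come with unrelated simple approximations. The first
  approximation minus the second minus the Euler step function is again a simple integrand, with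
  small energy off a small event, so \<open>simple_pair_tail_bound\<close> makes its integral small
  in probability.\<close>

lemma noise_sum_tendsto:
  assumes st: "0 \<le> s" "s < t"
    and It: "has_ito_integral M F B noise t It" and Is: "has_ito_integral M F B noise s Is"
  shows "tendsto_in_prob M
    (\<lambda>n \<omega>. \<Sum>i<n. noise (grid_pt s t n i) \<omega> * grid_incr s t n i \<omega>)
    (\<lambda>\<omega>. It \<omega> - Is \<omega>)"
  unfolding tendsto_in_prob_def
proof (intro allI impI)
  fix \<epsilon> \<delta> :: real assume ed: "0 < \<epsilon>" "0 < \<delta>"
  have t: "0 < t" using st by simp
  let ?N = "\<lambda>n \<omega>. \<Sum>i<n. noise (grid_pt s t n i) \<omega> * grid_incr s t n i \<omega>"
  define \<eta> where "\<eta> = (\<epsilon>/3)\<^sup>2 * (\<delta>/8)"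
  have \<eta>: "0 < \<eta>" using ed by (simp add: \<eta>_def)
  have pos: "0 < \<epsilon>/3" "0 < \<delta>/8" "0 < \<eta>/9" using ed \<eta> by auto
  let ?c = "\<bar>\<sigma>\<bar> + \<bar>\<rho>\<bar>"
  define e where "e = sqrt (\<eta> / (9 * t)) / (?c + 1)"
  have cpos: "0 < ?c + 1" by (simp add: add_nonneg_pos)
  have e: "0 < e" unfolding e_def using \<eta> t cpos by (intro divide_pos_pos real_sqrt_gt_zero) auto
  have ce: "t * (?c * e)\<^sup>2 \<le> \<eta> / 9"
  proof -
    have "?c * e \<le> (?c + 1) * e" using e by (intro mult_right_mono) auto
    also have "\<dots> = sqrt (\<eta> / (9 * t))" unfolding e_def using cpos by simp
    finally have "(?c * e)\<^sup>2 \<le> \<eta> / (9 * t)"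
      using power_mono[of "?c * e" "sqrt (\<eta> / (9 * t))" 2] e \<eta> t by simp
    then have "t * (?c * e)\<^sup>2 \<le> t * (\<eta> / (9 * t))" using t by (intro mult_left_mono) auto
    then show ?thesis using t by simp
  qed
  obtain n1 p1 \<xi>1 where s1: "\<forall>k. simple_data M F (n1 k) (p1 k) (\<xi>1 k)"
    "tendsto_in_prob M (\<lambda>k \<omega>. LBINT r:{0..t}. (simple_process (n1 k) (p1 k) (\<xi>1 k) r \<omega> - noise r \<omega>)\<^sup>2) (\<lambda>_. 0)"
    "tendsto_in_prob M (\<lambda>k. simple_integral B (n1 k) (p1 k) (\<xi>1 k) t) It"
    using It unfolding has_ito_integral_def by (elim conjE exE)
  obtain n2 p2 \<xi>2 where s2: "\<forall>k. simple_data M F (n2 k) (p2 k) (\<xi>2 k)"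
    "tendsto_in_prob M (\<lambda>k \<omega>. LBINT r:{0..s}. (simple_process (n2 k) (p2 k) (\<xi>2 k) r \<omega> - noise r \<omega>)\<^sup>2) (\<lambda>_. 0)"
    "tendsto_in_prob M (\<lambda>k. simple_integral B (n2 k) (p2 k) (\<xi>2 k) s) Is"
    using Is unfolding has_ito_integral_def by (elim conjE exE)
  note ev = s1(2,3)[unfolded tendsto_in_prob_def, rule_format] s2(2,3)[unfolded tendsto_in_prob_def, rule_format]
  \<comment> \<open>One index k is fixed for all four approximations; afterwards only the uniform
    grid is refined.\<close>
  have "\<exists>k. (\<exists>A\<in>events. prob A < \<delta>/8 \<and> {\<omega> \<in> space M. \<eta>/9 < \<bar>(LBINT r:{0..t}. (simple_process (n1 k) (p1 k) (\<xi>1 k) r \<omega> - noise r \<omega>)\<^sup>2) - 0\<bar>} \<subseteq> A) \<and>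
    (\<exists>A\<in>events. prob A < \<delta>/8 \<and> {\<omega> \<in> space M. \<epsilon>/3 < \<bar>simple_integral B (n1 k) (p1 k) (\<xi>1 k) t \<omega> - It \<omega>\<bar>} \<subseteq> A) \<and>
    (\<exists>A\<in>events. prob A < \<delta>/8 \<and> {\<omega> \<in> space M. \<eta>/9 < \<bar>(LBINT r:{0..s}. (simple_process (n2 k) (p2 k) (\<xi>2 k) r \<omega> - noise r \<omega>)\<^sup>2) - 0\<bar>} \<subseteq> A) \<and>
    (\<exists>A\<in>events. prob A < \<delta>/8 \<and> {\<omega> \<in> space M. \<epsilon>/3 < \<bar>simple_integral B (n2 k) (p2 k) (\<xi>2 k) s \<omega> - Is \<omega>\<bar>} \<subseteq> A)"
    by (rule eventually_happens'[OF sequentially_bot], intro eventually_conj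
      ev(1)[OF pos(3,2)] ev(2)[OF pos(1,2)] ev(3)[OF pos(3,2)] ev(4)[OF pos(1,2)])
  then obtain k A1 A2 A3 A4 where
    A1: "A1 \<in> events" "prob A1 < \<delta>/8" "{\<omega> \<in> space M. \<eta>/9 < \<bar>(LBINT r:{0..t}. (simple_process (n1 k) (p1 k) (\<xi>1 k) r \<omega> - noise r \<omega>)\<^sup>2) - 0\<bar>} \<subseteq> A1"
    and A2: "A2 \<in> events" "prob A2 < \<delta>/8" "{\<omega> \<in> space M. \<epsilon>/3 < \<bar>simple_integral B (n1 k) (p1 k) (\<xi>1 k) t \<omega> - It \<omega>\<bar>} \<subseteq> A2"
    and A3: "A3 \<in> events" "prob A3 < \<delta>/8" "{\<omega> \<in> space M. \<eta>/9 < \<bar>(LBINT r:{0..s}. (simple_process (n2 k) (p2 k) (\<xi>2 k) r \<omega> - noise r \<omega>)\<^sup>2) - 0\<bar>} \<subseteq> A3"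
    and A4: "A4 \<in> events" "prob A4 < \<delta>/8" "{\<omega> \<in> space M. \<epsilon>/3 < \<bar>simple_integral B (n2 k) (p2 k) (\<xi>2 k) s \<omega> - Is \<omega>\<bar>} \<subseteq> A4"
    by (elim exE conjE bexE)
  let ?P1 = "simple_process (n1 k) (p1 k) (\<xi>1 k)" and ?P2 = "simple_process (n2 k) (p2 k) (\<xi>2 k)"
  let ?S1 = "simple_integral B (n1 k) (p1 k) (\<xi>1 k) t" and ?S2 = "simple_integral B (n2 k) (p2 k) (\<xi>2 k) s"
  from modulus_of_continuity[OF e pos(2), of t] obtain d A where d: "0 < d" and A: "A \<in> events" "prob A < \<delta>/8"
    and mod: "\<forall>\<omega>\<in>space M - A. continuous_on {0..} (\<lambda>t. X t \<omega>) \<and>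
    (\<forall>r\<in>{0..t}. \<forall>r'\<in>{0..t}. \<bar>r - r'\<bar> \<le> d \<longrightarrow> \<bar>X r \<omega> - X r' \<omega>\<bar> \<le> e)" by blast
  have "(\<lambda>n. (t - s) / real n) \<longlonglongrightarrow> 0" by real_asymp
  then have "\<forall>\<^sub>F n in sequentially. (t - s) / real n < d" using d by (rule order_tendstoD)
  then show "\<forall>\<^sub>F n in sequentially. \<exists>A\<in>events. prob A < \<delta> \<and>
     {\<omega> \<in> space M. \<epsilon> < \<bar>?N n \<omega> - (It \<omega> - Is \<omega>)\<bar>} \<subseteq> A"
    using eventually_gt_at_top[of 0]
  proof eventually_elim
    case (elim n)
    let ?R = "\<lambda>r \<omega>. grid_step (\<lambda>r. noise r \<omega>) s t n r"
    let ?K1 = "\<lambda>r \<omega>. ?P1 r \<omega> * indicator {..t} r" and ?K2 = "\<lambda>r \<omega>. ?P2 r \<omega> * indicator {..s} r"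
    let ?K = "\<lambda>r \<omega>. ?K1 r \<omega> - ?K2 r \<omega> - ?R r \<omega>"
    let ?S = "\<lambda>\<omega>. ?S1 \<omega> - ?S2 \<omega> - ?N n \<omega>"
    have pr1: "simple_pair t ?K1 ?S1" by (rule simple_data_pair[OF s1(1)[rule_format]]) (use t in auto)
    have pr2: "simple_pair t ?K2 ?S2" by (rule simple_data_pair[OF s2(1)[rule_format]]) (use st in auto)
    have pr3: "simple_pair t ?R (?N n)" by (rule noise_sum_pair[OF st])
    have pr: "simple_pair t ?K ?S" by (intro simple_pair_diff pr1 pr2 pr3)
    define C where "C = A \<union> (A1 \<union> A3)"
    have Cev: "C \<in> events" using A A1 A3 by (auto simp: C_def)
    have "prob C \<le> prob A + (prob A1 + prob A3)"
      unfolding C_def using A A1 A3 by (intro order_trans[OF measure_Un_le] add_left_mono measure_Un_le) auto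
    then have pC: "prob C \<le> 3 * \<delta> / 8" using A(2) A1(2) A3(2) by simp
    have le: "(LBINT r:{0..t}. (?K r \<omega>)\<^sup>2) \<le> \<eta>" if w: "\<omega> \<in> space M - C" for \<omega>
    proof -
      let ?H = "\<lambda>r. noise r \<omega>"
      have w': "\<omega> \<in> space M - A" "\<omega> \<in> space M" "\<omega> \<notin> A1" "\<omega> \<notin> A3" using w by (auto simp: C_def)
      have cont0: "continuous_on {0..} (\<lambda>t. X t \<omega>)" using mod w'(1) by blast
      have cont: "continuous_on {0..u} ?H" for u by (rule linear_continuous[OF cont0])
      let ?U1 = "\<lambda>r. (?K1 r \<omega> - ?H r)\<^sup>2" and ?U2 = "\<lambda>r. indicator {..s} r * (?K2 r \<omega> - ?H r)\<^sup>2"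
      let ?U3 = "\<lambda>r. (?R r \<omega> - ?H r * indicator {s<..t} r)\<^sup>2"
      have i1: "set_integrable lborel {0..t} ?U1"
        by (rule simple_minus_continuous_integrable[OF pr1 _ cont]) (use t in simp)
      have i2: "set_integrable lborel {0..t} ?U2"
      proof -
        have "set_integrable lborel {0..t} (\<lambda>r. (?K2 r \<omega> - ?H r)\<^sup>2)"
          by (rule simple_minus_continuous_integrable[OF pr2 _ cont]) (use t in simp)
        then have "integrable lborel (\<lambda>r. indicator {..s} r *\<^sub>R (indicator {0..t} r *\<^sub>R (?K2 r \<omega> - ?H r)\<^sup>2))"
          unfolding set_integrable_def by (rule integrable_mult_indicator[rotated]) simp
        then show ?thesis unfolding set_integrable_def by (simp add: mult_ac)
      qed
      have "(LBINT r:{0..t}. ?U1 r) = (LBINT r:{0..t}. (?P1 r \<omega> - ?H r)\<^sup>2)"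
        by (rule set_lebesgue_integral_cong) auto
      then have b1: "(LBINT r:{0..t}. ?U1 r) \<le> \<eta> / 9" using A1(3) w' by (auto simp: not_less subset_iff)
      have "(LBINT r:{0..t}. ?U2 r) = (LBINT r:{0..s}. (?P2 r \<omega> - ?H r)\<^sup>2)"
        unfolding set_lebesgue_integral_def
        by (rule Bochner_Integration.integral_cong) (use st in \<open>auto simp: indicator_def\<close>)
      then have b2: "(LBINT r:{0..t}. ?U2 r) \<le> \<eta> / 9" using A3(3) w' by (auto simp: not_less subset_iff)
      have U3: "?U3 r \<le> (?c * e)\<^sup>2" for r
      proof -
        have "\<bar>?R r \<omega> - ?H r * indicator {s<..t} r\<bar> \<le> ?c * e"
        proof (rule grid_step_approx[OF st elim(2)])
          show "0 \<le> ?c * e" using e by simp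
          fix r r' assume "r \<in> {0..t}" "r' \<in> {0..t}" "\<bar>r - r'\<bar> \<le> (t - s) / real n"
          then show "\<bar>?H r - ?H r'\<bar> \<le> ?c * e"
            using linear_modulus[of t d \<omega> e r r'] mod w'(1) elim(1) by (auto intro: order_trans)
        qed
        then have "\<bar>?R r \<omega> - ?H r * indicator {s<..t} r\<bar>\<^sup>2 \<le> (?c * e)\<^sup>2" by (rule power_mono) simp
        then show ?thesis by simp
      qed
      \<comment> \<open>On [0, s] both approximations follow the noise, which cancels between them;
        on (s, t] the first approximation and the step function do. What remains are the three
        errors.\<close>
      have bound: "(?K r \<omega>)\<^sup>2 \<le> 3 * ?U1 r + 3 * ?U2 r + 3 * (?c * e)\<^sup>2" if r: "r \<in> {0..t}" for r
      proof -
        let ?u1 = "?K1 r \<omega> - ?H r" and ?u2 = "indicator {..s} r * (?K2 r \<omega> - ?H r)"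
        let ?u3 = "?R r \<omega> - ?H r * indicator {s<..t} r"
        have "?K r \<omega> = ?u1 + (- ?u2) + (- ?u3)" using r by (cases "r \<le> s") (auto simp: indicator_def)
        then have "(?K r \<omega>)\<^sup>2 = (?u1 + (- ?u2) + (- ?u3))\<^sup>2" by (rule arg_cong)
        also have "\<dots> \<le> 3 * ?u1\<^sup>2 + 3 * (- ?u2)\<^sup>2 + 3 * (- ?u3)\<^sup>2" by (rule sum_square_le3)
        finally have "(?K r \<omega>)\<^sup>2 \<le> 3 * ?u1\<^sup>2 + 3 * (- ?u2)\<^sup>2 + 3 * (- ?u3)\<^sup>2" .
        moreover have "(- ?u2)\<^sup>2 = ?U2 r" by (simp add: power_mult_distrib indicator_def)
        ultimately show ?thesis using U3[of r] unfolding power2_minus by linarith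
      qed
      have const: "set_integrable lborel {0..t} (\<lambda>r. 3 * (?c * e)\<^sup>2)"
        by (rule borel_integrable_atLeastAtMost') (intro continuous_intros)
      note I = set_integral_add(1)[OF set_integral_add(1)[OF set_integrable_mult_right[of 3, OF i1]
          set_integrable_mult_right[of 3, OF i2]] const]
      have "(LBINT r:{0..t}. (?K r \<omega>)\<^sup>2) \<le> (LBINT r:{0..t}. 3 * ?U1 r + 3 * ?U2 r + 3 * (?c * e)\<^sup>2)"
        by (rule set_integral_mono[OF simple_pair_integrable(1)[OF pr] I bound]) (use t in auto)
      also have "\<dots> = 3 * (LBINT r:{0..t}. ?U1 r) + 3 * (LBINT r:{0..t}. ?U2 r) + 3 * (t * (?c * e)\<^sup>2)"
      proof -
        have "(LBINT r:{0..t}. 3 * ?U1 r + 3 * ?U2 r + 3 * (?c * e)\<^sup>2) =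
          (LBINT r:{0..t}. 3 * ?U1 r) + (LBINT r:{0..t}. 3 * ?U2 r) + (LBINT r:{0..t}. 3 * (?c * e)\<^sup>2)"
          using set_integral_add(2)[OF set_integral_add(1)[OF set_integrable_mult_right[of 3, OF i1]
          set_integrable_mult_right[of 3, OF i2]] const]
           set_integral_add(2)[OF set_integrable_mult_right[of 3, OF i1] set_integrable_mult_right[of 3, OF i2]] by simp
        moreover have "(LBINT r:{0..t}. 3 * (?c * e)\<^sup>2) = 3 * (t * (?c * e)\<^sup>2)"
          using t by (simp add: set_lebesgue_integral_def)
        ultimately show ?thesis by simp
      qed
      also have "\<dots> \<le> \<eta>" using b1 b2 ce by linarith
      finally show ?thesis .
    qed
    have "prob {\<omega> \<in> space M. \<epsilon>/3 < \<bar>?S \<omega>\<bar>} \<le> prob C + \<eta> / (\<epsilon>/3)\<^sup>2"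
      by (rule simple_pair_tail_bound[OF pr _ pos(1) \<eta> Cev le]) (use t in auto)
    also have "\<eta> / (\<epsilon>/3)\<^sup>2 = \<delta>/8" using ed by (simp add: \<eta>_def)
    finally have P5: "prob {\<omega> \<in> space M. \<epsilon>/3 < \<bar>?S \<omega>\<bar>} \<le> \<delta> / 2" using pC by simp
    have [measurable]: "?S \<in> borel_measurable M" by (rule simple_pair_measurable[OF pr])
    have A5: "{\<omega> \<in> space M. \<epsilon>/3 < \<bar>?S \<omega>\<bar>} \<in> events" by measurable
    let ?D = "{\<omega> \<in> space M. \<epsilon>/3 < \<bar>?S \<omega>\<bar>} \<union> (A2 \<union> A4)"
    have "prob ?D \<le> prob {\<omega> \<in> space M. \<epsilon>/3 < \<bar>?S \<omega>\<bar>} + (prob A2 + prob A4)"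
      using A5 A2 A4 by (intro order_trans[OF measure_Un_le] add_left_mono measure_Un_le) auto
    then have "prob ?D < \<delta>" using P5 A2(2) A4(2) ed by linarith
    moreover have "?D \<in> events" using A5 A2 A4 by auto
    moreover have "{\<omega> \<in> space M. \<epsilon> < \<bar>?N n \<omega> - (It \<omega> - Is \<omega>)\<bar>} \<subseteq> ?D"
    proof
      fix \<omega> assume "\<omega> \<in> {\<omega> \<in> space M. \<epsilon> < \<bar>?N n \<omega> - (It \<omega> - Is \<omega>)\<bar>}"
      then have w: "\<omega> \<in> space M" "\<epsilon> < \<bar>?N n \<omega> - (It \<omega> - Is \<omega>)\<bar>" by auto
      have "?N n \<omega> - (It \<omega> - Is \<omega>) = - ?S \<omega> + (?S1 \<omega> - It \<omega>) - (?S2 \<omega> - Is \<omega>)" by simp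
      then have "\<epsilon>/3 < \<bar>?S \<omega>\<bar> \<or> \<epsilon>/3 < \<bar>?S1 \<omega> - It \<omega>\<bar> \<or> \<epsilon>/3 < \<bar>?S2 \<omega> - Is \<omega>\<bar>"
        using w(2) by linarith
      then show "\<omega> \<in> ?D" using w(1) A2(3) A4(3) by blast
    qed
    ultimately show ?case by blast
  qed
qed

text \<open>Subtracting the equation at s from the equation at t cancels the initial value. This is
  the form in which the equation enters all later estimates.\<close>

lemma euler_sum_tendsto:
  assumes st: "0 \<le> s" "s < t"
  shows "tendsto_in_prob M (euler_sum s t) (\<lambda>\<omega>. X t \<omega> - X s \<omega>)"
proof -
  have t: "0 \<le> t" using st by simp
  from X_eq[OF t] obtain It where It: "has_ito_integral M F B noise t It"
    "AE \<omega> in M. X t \<omega> = X 0 \<omega> + (LBINT r:{0..t}. drift r \<omega>) + It \<omega>" by blast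
  from X_eq[OF st(1)] obtain Is where Is: "has_ito_integral M F B noise s Is"
    "AE \<omega> in M. X s \<omega> = X 0 \<omega> + (LBINT r:{0..s}. drift r \<omega>) + Is \<omega>" by blast
  have "tendsto_in_prob M (euler_sum s t)
    (\<lambda>\<omega>. ((LBINT r:{0..t}. drift r \<omega>) - (LBINT r:{0..s}. drift r \<omega>)) + (It \<omega> - Is \<omega>))"
    using tendsto_in_prob_add[OF prob_space_axioms drift_sum_tendsto[OF st] noise_sum_tendsto[OF st It(1) Is(1)]]
    unfolding euler_sum_def[abs_def] .
  then show ?thesis
  proof (rule tendsto_in_prob_AE_cong[OF prob_space_axioms])
    show "AE \<omega> in M. ((LBINT r:{0..t}. drift r \<omega>) - (LBINT r:{0..s}. drift r \<omega>)) + (It \<omega> - Is \<omega>) = X t \<omega> - X s \<omega>"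
      using It(2) Is(2) by eventually_elim simp
  qed
qed

end

section \<open>Second moments\<close>

lemma tendsto_in_prob_eventually_cong:
  assumes "tendsto_in_prob M Z D" "\<forall>\<^sub>F n in sequentially. Z n = Z' n"
  shows "tendsto_in_prob M Z' D"
  unfolding tendsto_in_prob_def
proof (intro allI impI)
  fix \<epsilon> \<delta> :: real assume "0 < \<epsilon>" "0 < \<delta>"
  then have "\<forall>\<^sub>F k in sequentially. \<exists>A\<in>sets M. measure M A < \<delta> \<and> {\<omega> \<in> space M. \<epsilon> < \<bar>Z k \<omega> - D \<omega>\<bar>} \<subseteq> A"
    using assms(1) unfolding tendsto_in_prob_def by blast
  then show "\<forall>\<^sub>F k in sequentially. \<exists>A\<in>sets M. measure M A < \<delta> \<and> {\<omega> \<in> space M. \<epsilon> < \<bar>Z' k \<omega> - D \<omega>\<bar>} \<subseteq> A"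
    using assms(2) by eventually_elim simp
qed

lemma tendsto_in_prob_L2:
  assumes "prob_space M" and sq: "\<forall>\<^sub>F n in sequentially. sq_integrable M (\<lambda>\<omega>. Z n \<omega> - D \<omega>) \<and>
      (LINT \<omega>|M. (Z n \<omega> - D \<omega>)\<^sup>2) \<le> c n"
    and c: "c \<longlonglongrightarrow> 0"
  shows "tendsto_in_prob M Z D"
  unfolding tendsto_in_prob_def
proof (intro allI impI)
  interpret prob_space M by fact
  fix \<epsilon> \<delta> :: real assume ed: "0 < \<epsilon>" "0 < \<delta>"
  have "\<forall>\<^sub>F n in sequentially. c n < \<delta> * \<epsilon>\<^sup>2" using c by (rule order_tendstoD) (use ed in simp)
  with sq show "\<forall>\<^sub>F k in sequentially. \<exists>A\<in>events. prob A < \<delta> \<and> {\<omega> \<in> space M. \<epsilon> < \<bar>Z k \<omega> - D \<omega>\<bar>} \<subseteq> A"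
  proof eventually_elim
    case (elim n)
    then have int: "integrable M (\<lambda>\<omega>. (Z n \<omega> - D \<omega>)\<^sup>2)" and m: "(\<lambda>\<omega>. Z n \<omega> - D \<omega>) \<in> borel_measurable M"
      by (auto simp: sq_integrable_def)
    have "prob {\<omega> \<in> space M. \<epsilon>\<^sup>2 \<le> (Z n \<omega> - D \<omega>)\<^sup>2} \<le> expectation (\<lambda>\<omega>. (Z n \<omega> - D \<omega>)\<^sup>2) / \<epsilon>\<^sup>2"
      using integral_Markov_inequality_measure[OF int, of "{}" "\<epsilon>\<^sup>2"] ed by simp
    also have "\<dots> < \<delta>" using elim ed by (simp add: divide_less_eq)
    finally have "prob {\<omega> \<in> space M. \<epsilon>\<^sup>2 \<le> (Z n \<omega> - D \<omega>)\<^sup>2} < \<delta>" .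
    moreover have "{\<omega> \<in> space M. \<epsilon>\<^sup>2 \<le> (Z n \<omega> - D \<omega>)\<^sup>2} \<in> events" using m by measurable
    moreover have "{\<omega> \<in> space M. \<epsilon> < \<bar>Z n \<omega> - D \<omega>\<bar>} \<subseteq> {\<omega> \<in> space M. \<epsilon>\<^sup>2 \<le> (Z n \<omega> - D \<omega>)\<^sup>2}"
    proof
      fix \<omega> assume "\<omega> \<in> {\<omega> \<in> space M. \<epsilon> < \<bar>Z n \<omega> - D \<omega>\<bar>}"
      then have w: "\<omega> \<in> space M" "\<epsilon> \<le> \<bar>Z n \<omega> - D \<omega>\<bar>" by auto
      have "\<epsilon>\<^sup>2 \<le> \<bar>Z n \<omega> - D \<omega>\<bar>\<^sup>2" by (rule power_mono[OF w(2)]) (use ed in simp)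
      with w(1) show "\<omega> \<in> {\<omega> \<in> space M. \<epsilon>\<^sup>2 \<le> (Z n \<omega> - D \<omega>)\<^sup>2}" by simp
    qed
    ultimately show ?case by blast
  qed
qed

text \<open>A left Riemann sum of an increasing function stays below its integral. The factor 1/L
  gained by integration produces the contraction in \<open>stopped_moment_bound\<close>.\<close>

lemma grid_exp_sum_le:
  assumes "0 < L" "0 < t" "0 < n"
  shows "(\<Sum>i<n. exp (L * grid_pt 0 t n i) * (t / real n)) \<le> exp (L * t) / L"
proof -
  let ?d = "t / real n"
  have d: "0 < ?d" using assms by simp
  have step: "exp (L * grid_pt 0 t n i) * ?d \<le> (exp (L * grid_pt 0 t n (Suc i)) - exp (L * grid_pt 0 t n i)) / L" for i
  proof -
    have "1 + L * ?d \<le> exp (L * ?d)" by (rule exp_ge_add_one_self)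
    then have "exp (L * grid_pt 0 t n i) * (L * ?d) \<le> exp (L * grid_pt 0 t n i) * (exp (L * ?d) - 1)"
      by (intro mult_left_mono) (linarith, simp)
    also have "\<dots> = exp (L * grid_pt 0 t n i + L * ?d) - exp (L * grid_pt 0 t n i)"
      by (simp add: exp_add algebra_simps)
    also have "L * grid_pt 0 t n i + L * ?d = L * grid_pt 0 t n (Suc i)"
    proof -
      have "grid_pt 0 t n (Suc i) = grid_pt 0 t n i + ?d" using grid_pt_step[of 0 t n i] by simp
      then show ?thesis by (simp only: distrib_left)
    qed
    finally show ?thesis using assms(1) by (simp add: pos_le_divide_eq mult_ac)
  qed
  have "(\<Sum>i<n. exp (L * grid_pt 0 t n i) * ?d) \<le>
    (\<Sum>i<n. (exp (L * grid_pt 0 t n (Suc i)) - exp (L * grid_pt 0 t n i)) / L)"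
    by (intro sum_mono step)
  also have "\<dots> = (exp (L * t) - 1) / L"
    using sum_lessThan_telescope[of "\<lambda>i. exp (L * grid_pt 0 t n i)" n] assms(3)
    by (simp add: sum_divide_distrib[symmetric])
  also have "\<dots> \<le> exp (L * t) / L" using assms(1) by (simp add: divide_right_mono)
  finally show ?thesis .
qed

section \<open>Mean square bounds for drift and noise sums\<close>

context brownian_filtration
begin

lemma
  assumes st: "0 \<le> s" "s < t" "0 < n"
    and V: "\<And>i. i < n \<Longrightarrow> V i \<in> borel_measurable (F (grid_pt s t n i))" "\<And>i. i < n \<Longrightarrow> sq_integrable M (V i)"
  defines "S \<equiv> \<lambda>\<omega>. \<Sum>i<n. V i \<omega> * grid_incr s t n i \<omega>"
  shows grid_noise_sum_sq: "sq_integrable M S"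
    and grid_noise_sum_var: "expectation (\<lambda>\<omega>. (S \<omega>)\<^sup>2) = (\<Sum>i<n. expectation (\<lambda>\<omega>. (V i \<omega>)\<^sup>2) * ((t - s) / real n))"
    and grid_noise_sum_orth: "\<xi> \<in> borel_measurable (F s) \<Longrightarrow> sq_integrable M \<xi> \<Longrightarrow> expectation (\<lambda>\<omega>. \<xi> \<omega> * S \<omega>) = 0"
proof -
  have q: "0 \<le> grid_pt s t n 0" "\<And>j. j < n \<Longrightarrow> grid_pt s t n j < grid_pt s t n (Suc j)"
    using st grid_pt_less[OF st(2)] by auto
  show "sq_integrable M S" unfolding S_def by (rule sq_integrable_ito_sum[OF q V])
  show "expectation (\<lambda>\<omega>. (S \<omega>)\<^sup>2) = (\<Sum>i<n. expectation (\<lambda>\<omega>. (V i \<omega>)\<^sup>2) * ((t - s) / real n))"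
    unfolding S_def using ito_sum_isometry[OF q V] by (simp add: grid_pt_step)
  show "expectation (\<lambda>\<omega>. \<xi> \<omega> * S \<omega>) = 0" if "\<xi> \<in> borel_measurable (F s)" "sq_integrable M \<xi>"
    unfolding S_def by (rule ito_sum_orthogonal[OF q V]) (use that in auto)
qed

lemma grid_noise_sum_var_le:
  assumes st: "0 \<le> s" "s < t" "0 < n"
    and V: "\<And>i. i < n \<Longrightarrow> V i \<in> borel_measurable (F (grid_pt s t n i))" "\<And>i. i < n \<Longrightarrow> sq_integrable M (V i)"
    and le: "\<And>i. i < n \<Longrightarrow> expectation (\<lambda>\<omega>. (V i \<omega>)\<^sup>2) \<le> c"
  shows "expectation (\<lambda>\<omega>. (\<Sum>i<n. V i \<omega> * grid_incr s t n i \<omega>)\<^sup>2) \<le> (t - s) * c"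
proof -
  have "(\<Sum>i<n. expectation (\<lambda>\<omega>. (V i \<omega>)\<^sup>2) * ((t - s) / real n)) \<le> (\<Sum>i<n. c * ((t - s) / real n))"
    using le st by (intro sum_mono mult_right_mono) auto
  also have "\<dots> = (t - s) * c" using st by simp
  finally show ?thesis using grid_noise_sum_var[OF st V] by simp
qed

lemma grid_drift_sum_sq:
  assumes "\<And>i. i < n \<Longrightarrow> sq_integrable M (U i)"
  shows "sq_integrable M (\<lambda>\<omega>. \<Sum>i<n. U i \<omega> * d)"
  using sq_integrable_cmult[OF assms, of _ d] by (intro sq_integrable_sum) (simp add: mult.commute)

lemma grid_drift_sum_le:
  fixes n :: nat
  assumes U: "\<And>i. i < n \<Longrightarrow> sq_integrable M (U i)" and d: "0 \<le> d"
  shows "expectation (\<lambda>\<omega>. (\<Sum>i<n. U i \<omega> * d)\<^sup>2) \<le> real n * d * (\<Sum>i<n. expectation (\<lambda>\<omega>. (U i \<omega>)\<^sup>2) * d)"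
proof -
  have sq: "integrable M (\<lambda>\<omega>. (U i \<omega>)\<^sup>2)" if "i < n" for i using U[OF that] by (simp add: sq_integrable_def)
  have "expectation (\<lambda>\<omega>. (\<Sum>i<n. U i \<omega> * d)\<^sup>2) \<le> expectation (\<lambda>\<omega>. real n * (\<Sum>i<n. (U i \<omega>)\<^sup>2 * d\<^sup>2))"
  proof (rule integral_mono)
    show "integrable M (\<lambda>\<omega>. (\<Sum>i<n. U i \<omega> * d)\<^sup>2)"
      by (rule sq_integrable_square[OF grid_drift_sum_sq[OF U]])
    show "integrable M (\<lambda>\<omega>. real n * (\<Sum>i<n. (U i \<omega>)\<^sup>2 * d\<^sup>2))"
      using sq by (intro integrable_mult_right Bochner_Integration.integrable_sum integrable_mult_left) auto
    show "(\<Sum>i<n. U i \<omega> * d)\<^sup>2 \<le> real n * (\<Sum>i<n. (U i \<omega>)\<^sup>2 * d\<^sup>2)" for \<omega>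
      using sum_square_le_card[of "\<lambda>i. U i \<omega> * d" n] by (simp add: power_mult_distrib)
  qed
  also have "\<dots> = real n * (\<Sum>i<n. expectation (\<lambda>\<omega>. (U i \<omega>)\<^sup>2) * d\<^sup>2)"
    using sq by (subst integral_mult_right_zero, subst Bochner_Integration.integral_sum) auto
  also have "\<dots> = real n * d * (\<Sum>i<n. expectation (\<lambda>\<omega>. (U i \<omega>)\<^sup>2) * d)"
    by (simp add: sum_distrib_left power2_eq_square mult_ac)
  finally show ?thesis .
qed

lemma grid_drift_sum_le_const:
  assumes st: "s < t" "0 < n"
    and U: "\<And>i. i < n \<Longrightarrow> sq_integrable M (U i)" "\<And>i. i < n \<Longrightarrow> expectation (\<lambda>\<omega>. (U i \<omega>)\<^sup>2) \<le> c"
  shows "expectation (\<lambda>\<omega>. (\<Sum>i<n. U i \<omega> * ((t - s) / real n))\<^sup>2) \<le> (t - s)\<^sup>2 * c"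
proof -
  let ?d = "(t - s) / real n"
  have d: "0 \<le> ?d" using st by simp
  have "expectation (\<lambda>\<omega>. (\<Sum>i<n. U i \<omega> * ?d)\<^sup>2) \<le> real n * ?d * (\<Sum>i<n. expectation (\<lambda>\<omega>. (U i \<omega>)\<^sup>2) * ?d)"
    by (rule grid_drift_sum_le[OF U(1) d])
  also have "\<dots> \<le> real n * ?d * (\<Sum>i<n. c * ?d)"
    by (intro mult_left_mono sum_mono mult_right_mono U(2) d mult_nonneg_nonneg) auto
  also have "\<dots> = (t - s)\<^sup>2 * c" using st by (simp add: power2_eq_square)
  finally show ?thesis .
qed

text \<open>Cauchy-Schwarz gives (t - s)^2 for the drift sum, the isometry gives t - s for the noise
  sum, and Fatou's lemma carries the bound to the limit. General coefficients U and V make it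
  applicable to increments and to the remainders of the Euler and Milstein expansions.\<close>

lemma grid_sum_limit_bound:
  assumes st: "0 \<le> s" "s < t"
    and U: "\<And>r. s \<le> r \<Longrightarrow> r \<le> t \<Longrightarrow> sq_integrable M (U r)" "\<And>r. s \<le> r \<Longrightarrow> r \<le> t \<Longrightarrow> expectation (\<lambda>\<omega>. (U r \<omega>)\<^sup>2) \<le> c"
    and V: "\<And>r. s \<le> r \<Longrightarrow> r \<le> t \<Longrightarrow> V r \<in> borel_measurable (F r)"
     "\<And>r. s \<le> r \<Longrightarrow> r \<le> t \<Longrightarrow> sq_integrable M (V r)" "\<And>r. s \<le> r \<Longrightarrow> r \<le> t \<Longrightarrow> expectation (\<lambda>\<omega>. (V r \<omega>)\<^sup>2) \<le> c'"
    and lim: "tendsto_in_prob M (\<lambda>n \<omega>. (\<Sum>i<n. U (grid_pt s t n i) \<omega> * ((t - s) / real n)) +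
      (\<Sum>i<n. V (grid_pt s t n i) \<omega> * grid_incr s t n i \<omega>)) D"
    and D: "D \<in> borel_measurable M"
  shows "sq_integrable M D \<and> expectation (\<lambda>\<omega>. (D \<omega>)\<^sup>2) \<le> 2 * (t - s)\<^sup>2 * c + 2 * (t - s) * c'"
proof -
  let ?P = "\<lambda>n \<omega>. \<Sum>i<n. U (grid_pt s t n i) \<omega> * ((t - s) / real n)"
  let ?N = "\<lambda>n \<omega>. \<Sum>i<n. V (grid_pt s t n i) \<omega> * grid_incr s t n i \<omega>"
  have g: "s \<le> grid_pt s t n i" "grid_pt s t n i \<le> t" if "i < n" for i n
    using grid_pt_bounds[OF st(2), of i n] that by auto
  have P: "sq_integrable M (?P n)" "0 < n \<Longrightarrow> expectation (\<lambda>\<omega>. (?P n \<omega>)\<^sup>2) \<le> (t - s)\<^sup>2 * c" for n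
  proof -
    show "sq_integrable M (?P n)" by (rule grid_drift_sum_sq) (rule U(1)[OF g])
    show "expectation (\<lambda>\<omega>. (?P n \<omega>)\<^sup>2) \<le> (t - s)\<^sup>2 * c" if "0 < n"
      by (rule grid_drift_sum_le_const[OF st(2) that]) (rule U[OF g]; assumption)+
  qed
  have N: "sq_integrable M (?N n)" "0 < n \<Longrightarrow> expectation (\<lambda>\<omega>. (?N n \<omega>)\<^sup>2) \<le> (t - s) * c'" for n
  proof -
    have "sq_integrable M (?N n)" if "0 < n"
      by (rule grid_noise_sum_sq[OF st that]) (rule V(1,2)[OF g]; assumption)+
    then show "sq_integrable M (?N n)" by (cases "n = 0") (auto simp: sq_integrable_zero)
    show "expectation (\<lambda>\<omega>. (?N n \<omega>)\<^sup>2) \<le> (t - s) * c'" if "0 < n"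
      by (rule grid_noise_sum_var_le[OF st that]) (rule V[OF g]; assumption)+
  qed
  have PN: "sq_integrable M (\<lambda>\<omega>. ?P n \<omega> + ?N n \<omega>)" for n by (rule sq_integrable_add[OF P(1) N(1)])
  have "integrable M (\<lambda>\<omega>. (D \<omega>)\<^sup>2) \<and> (LINT \<omega>|M. (D \<omega>)\<^sup>2) \<le> 2 * (t - s)\<^sup>2 * c + 2 * (t - s) * c'"
  proof (rule Fatou_in_prob[OF prob_space_axioms lim _ D, where g = "\<lambda>_ z. z\<^sup>2"])
    show "\<forall>\<^sub>F n in sequentially. integrable M (\<lambda>\<omega>. (?P n \<omega> + ?N n \<omega>)\<^sup>2) \<and>
      (LINT \<omega>|M. (?P n \<omega> + ?N n \<omega>)\<^sup>2) \<le> 2 * (t - s)\<^sup>2 * c + 2 * (t - s) * c'"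
      using eventually_gt_at_top[of 0]
    proof eventually_elim
      case (elim n)
      have "(LINT \<omega>|M. (?P n \<omega> + ?N n \<omega>)\<^sup>2) \<le> (LINT \<omega>|M. 2 * (?P n \<omega>)\<^sup>2 + 2 * (?N n \<omega>)\<^sup>2)"
        using sq_integrable_square[OF PN[of n]] sq_integrable_square[OF P(1)[of n]] sq_integrable_square[OF N(1)[of n]]
        by (intro integral_mono sum_square_le2) auto
      also have "\<dots> = 2 * (LINT \<omega>|M. (?P n \<omega>)\<^sup>2) + 2 * (LINT \<omega>|M. (?N n \<omega>)\<^sup>2)"
        using sq_integrable_square[OF P(1)[of n]] sq_integrable_square[OF N(1)[of n]] by simp
      also have "\<dots> \<le> 2 * ((t - s)\<^sup>2 * c) + 2 * ((t - s) * c')"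
        using P(2)[OF elim] N(2)[OF elim] by (intro add_mono mult_left_mono) auto
      finally show ?case using sq_integrable_square[OF PN[of n]] by (intro conjI) (simp_all only: mult.assoc)
    qed
    show "(\<lambda>\<omega>. ?P n \<omega> + ?N n \<omega>) \<in> borel_measurable M" for n using PN[of n] by (simp add: sq_integrable_def)
  qed (use D in \<open>auto intro!: continuous_intros\<close>)
  then show ?thesis using D by (simp add: sq_integrable_def)
qed

end

section \<open>Localization and finiteness of the second moment\<close>

context pantograph
begin

definition dil :: "real set" where
  "dil = (\<lambda>(k, u). q ^ k * u) ` (UNIV \<times> ({0..1} \<inter> \<rat>))"

text \<open>The event that \<open>X\<close> stays in \<open>[-N, N]\<close> up to time \<open>s\<close>. Testing it only on \<open>dil\<close>, which is
  closed under multiplication by \<open>q\<close> and by rationals in \<open>[0, 1]\<close>, makes it measurable and gives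
  the inclusions below without using continuity.\<close>

definition bdd_upto :: "real \<Rightarrow> real \<Rightarrow> 'a set" where
  "bdd_upto N s = {\<omega> \<in> space M. \<forall>r\<in>dil. \<bar>X (r * s) \<omega>\<bar> \<le> N}"

lemma dil_bounds: "r \<in> dil \<Longrightarrow> 0 \<le> r \<and> r \<le> 1"
  using q by (auto simp: dil_def intro!: mult_le_one power_le_one)

lemma countable_dil: "countable dil"
  unfolding dil_def by (intro countable_image countable_SIGMA countable_Int2 countable_rat) auto

lemma dil_mult_rat: "r \<in> dil \<Longrightarrow> u \<in> {0..1} \<inter> \<rat> \<Longrightarrow> r * u \<in> dil"
proof -
  assume "r \<in> dil" and u: "u \<in> {0..1} \<inter> \<rat>"
  then obtain k w where "r = q ^ k * w" "w \<in> {0..1} \<inter> \<rat>" by (auto simp: dil_def)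
  moreover then have "w * u \<in> {0..1} \<inter> \<rat>" using u by (auto intro: mult_le_one)
  ultimately show "r * u \<in> dil" unfolding dil_def by (intro image_eqI[of _ _ "(k, w * u)"]) auto
qed

lemma dil_mult_q: "r \<in> dil \<Longrightarrow> r * q \<in> dil"
proof -
  assume "r \<in> dil"
  then obtain k w where "r = q ^ k * w" "w \<in> {0..1} \<inter> \<rat>" by (auto simp: dil_def)
  then show "r * q \<in> dil" unfolding dil_def by (intro image_eqI[of _ _ "(Suc k, w)"]) auto
qed

lemma one_dil: "1 \<in> dil"
  unfolding dil_def by (intro image_eqI[of _ _ "(0, 1)"]) auto

lemma bdd_upto_F: "0 \<le> s \<Longrightarrow> bdd_upto N s \<in> sets (F s)"
proof -
  assume s: "0 \<le> s"
  have "(\<Union>r\<in>dil. {\<omega> \<in> space (F s). N < \<bar>X (r * s) \<omega>\<bar>}) \<in> sets (F s)"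
  proof (rule sets.countable_UN''[OF countable_dil])
    fix r assume "r \<in> dil"
    then have "0 \<le> r * s" "r * s \<le> s" using dil_bounds[of r] s by (auto simp: mult_left_le_one_le)
    then have [measurable]: "X (r * s) \<in> borel_measurable (F s)" by (rule X_measurable_F)
    show "{\<omega> \<in> space (F s). N < \<bar>X (r * s) \<omega>\<bar>} \<in> sets (F s)" by measurable
  qed
  then have "space (F s) - (\<Union>r\<in>dil. {\<omega> \<in> space (F s). N < \<bar>X (r * s) \<omega>\<bar>}) \<in> sets (F s)" by blast
  moreover have "bdd_upto N s = space (F s) - (\<Union>r\<in>dil. {\<omega> \<in> space (F s). N < \<bar>X (r * s) \<omega>\<bar>})"
    by (auto simp: bdd_upto_def space_F[OF s] not_less)
  ultimately show ?thesis by simp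
qed

lemma bdd_upto_events: "0 \<le> s \<Longrightarrow> bdd_upto N s \<in> events"
  using bdd_upto_F F_sets_M by blast

lemma bdd_upto_X: "\<omega> \<in> bdd_upto N s \<Longrightarrow> \<bar>X s \<omega>\<bar> \<le> N"
  unfolding bdd_upto_def using one_dil by force

lemma bdd_upto_mult: "\<omega> \<in> bdd_upto N s \<Longrightarrow> (\<And>r. r \<in> dil \<Longrightarrow> r * u \<in> dil) \<Longrightarrow> \<omega> \<in> bdd_upto N (u * s)"
  unfolding bdd_upto_def by (auto simp: mult.assoc[symmetric])

lemma bdd_upto_q: "\<omega> \<in> bdd_upto N s \<Longrightarrow> \<omega> \<in> bdd_upto N (q * s)"
  by (rule bdd_upto_mult[OF _ dil_mult_q])

lemma bdd_upto_grid: "\<omega> \<in> bdd_upto N t \<Longrightarrow> i \<le> n \<Longrightarrow> \<omega> \<in> bdd_upto N (grid_pt 0 t n i)"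
proof -
  assume w: "\<omega> \<in> bdd_upto N t" and i: "i \<le> n"
  have "real i / real n \<in> {0..1} \<inter> \<rat>" using i by (auto simp: divide_le_eq)
  then have "\<omega> \<in> bdd_upto N (real i / real n * t)"
    by (intro bdd_upto_mult[OF w] dil_mult_rat)
  then show ?thesis by (simp add: grid_pt_def mult.commute)
qed

lemma stopped_sq_integrable:
  assumes "0 \<le> s"
  shows "sq_integrable M (\<lambda>\<omega>. indicator (bdd_upto N s) \<omega> * X s \<omega>)"
    "sq_integrable M (\<lambda>\<omega>. indicator (bdd_upto N s) \<omega> * X (q * s) \<omega>)"
proof -
  have [measurable]: "X s \<in> borel_measurable M" "X (q * s) \<in> borel_measurable M" "bdd_upto N s \<in> events"
    using assms bdd_upto_events by auto
  show "sq_integrable M (\<lambda>\<omega>. indicator (bdd_upto N s) \<omega> * X s \<omega>)"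
    by (rule sq_integrable_bounded[of _ "\<bar>N\<bar>"])
      (auto simp: indicator_def intro: order_trans[OF bdd_upto_X abs_ge_self])
  show "sq_integrable M (\<lambda>\<omega>. indicator (bdd_upto N s) \<omega> * X (q * s) \<omega>)"
    by (rule sq_integrable_bounded[of _ "\<bar>N\<bar>"])
      (auto simp: indicator_def intro: order_trans[OF bdd_upto_X[OF bdd_upto_q] abs_ge_self])
qed

text \<open>At most N^2, hence finite before anything is known about the moments of X.\<close>

definition stopped_moment :: "real \<Rightarrow> real \<Rightarrow> real" where
  "stopped_moment N s = expectation (\<lambda>\<omega>. (indicator (bdd_upto N s) \<omega> * X s \<omega>)\<^sup>2)"

lemma stopped_moment_nonneg: "0 \<le> stopped_moment N s"
  unfolding stopped_moment_def by (rule Bochner_Integration.integral_nonneg) simp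

lemma stopped_moment_le: "0 \<le> s \<Longrightarrow> stopped_moment N s \<le> N\<^sup>2"
proof -
  assume s: "0 \<le> s"
  have "stopped_moment N s \<le> expectation (\<lambda>_. N\<^sup>2)"
    unfolding stopped_moment_def
  proof (rule integral_mono)
    show "integrable M (\<lambda>\<omega>. (indicator (bdd_upto N s) \<omega> * X s \<omega>)\<^sup>2)"
      by (rule sq_integrable_square[OF stopped_sq_integrable(1)[OF s]])
    show "(indicator (bdd_upto N s) \<omega> * X s \<omega>)\<^sup>2 \<le> N\<^sup>2" for \<omega>
      using power_mono[OF bdd_upto_X[of \<omega> N s], of 2] by (auto simp: indicator_def)
  qed simp
  then show ?thesis by (simp add: prob_space)
qed

text \<open>A path bounded by N up to s in the sense of \<open>bdd_upto\<close> is so up to q s as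
  well. The delayed value on the event for s is therefore controlled by the stopped moment at q
  s.\<close>

lemma stopped_linear:
  assumes s: "0 \<le> s"
  shows "sq_integrable M (\<lambda>\<omega>. indicator (bdd_upto N s) \<omega> * (u * X s \<omega> + v * X (q * s) \<omega>))"
    "expectation (\<lambda>\<omega>. (indicator (bdd_upto N s) \<omega> * (u * X s \<omega> + v * X (q * s) \<omega>))\<^sup>2) \<le>
      2 * u\<^sup>2 * stopped_moment N s + 2 * v\<^sup>2 * stopped_moment N (q * s)"
proof -
  let ?i = "indicator (bdd_upto N s) :: 'a \<Rightarrow> real"
  note S = stopped_sq_integrable[OF s, of N]
  have eq: "?i \<omega> * (u * X s \<omega> + v * X (q * s) \<omega>) = u * (?i \<omega> * X s \<omega>) + v * (?i \<omega> * X (q * s) \<omega>)" for \<omega>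
    by (simp add: algebra_simps)
  show sq: "sq_integrable M (\<lambda>\<omega>. ?i \<omega> * (u * X s \<omega> + v * X (q * s) \<omega>))"
    unfolding eq by (intro sq_integrable_add sq_integrable_cmult S)
  have "expectation (\<lambda>\<omega>. (?i \<omega> * X (q * s) \<omega>)\<^sup>2) \<le> stopped_moment N (q * s)"
    unfolding stopped_moment_def
  proof (rule integral_mono)
    show "integrable M (\<lambda>\<omega>. (?i \<omega> * X (q * s) \<omega>)\<^sup>2)" by (rule sq_integrable_square[OF S(2)])
    show "integrable M (\<lambda>\<omega>. (indicator (bdd_upto N (q * s)) \<omega> * X (q * s) \<omega>)\<^sup>2)"
      by (rule sq_integrable_square[OF stopped_sq_integrable(1)]) (use qs s in auto)
    show "(?i \<omega> * X (q * s) \<omega>)\<^sup>2 \<le> (indicator (bdd_upto N (q * s)) \<omega> * X (q * s) \<omega>)\<^sup>2" for \<omega>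
      using bdd_upto_q[of \<omega> N s] by (auto simp: indicator_def)
  qed
  then have q_le: "2 * v\<^sup>2 * expectation (\<lambda>\<omega>. (?i \<omega> * X (q * s) \<omega>)\<^sup>2) \<le> 2 * v\<^sup>2 * stopped_moment N (q * s)"
    by (intro mult_left_mono) auto
  have "expectation (\<lambda>\<omega>. (?i \<omega> * (u * X s \<omega> + v * X (q * s) \<omega>))\<^sup>2) \<le>
    expectation (\<lambda>\<omega>. 2 * u\<^sup>2 * (?i \<omega> * X s \<omega>)\<^sup>2 + 2 * v\<^sup>2 * (?i \<omega> * X (q * s) \<omega>)\<^sup>2)"
  proof (rule integral_mono[OF sq_integrable_square[OF sq]])
    show "integrable M (\<lambda>\<omega>. 2 * u\<^sup>2 * (?i \<omega> * X s \<omega>)\<^sup>2 + 2 * v\<^sup>2 * (?i \<omega> * X (q * s) \<omega>)\<^sup>2)"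
      using S by (intro Bochner_Integration.integrable_add integrable_mult_right sq_integrable_square)
    show "(?i \<omega> * (u * X s \<omega> + v * X (q * s) \<omega>))\<^sup>2 \<le> 2 * u\<^sup>2 * (?i \<omega> * X s \<omega>)\<^sup>2 + 2 * v\<^sup>2 * (?i \<omega> * X (q * s) \<omega>)\<^sup>2" for \<omega>
      unfolding eq using sum_square_le2[of "u * (?i \<omega> * X s \<omega>)" "v * (?i \<omega> * X (q * s) \<omega>)"]
      by (simp add: power_mult_distrib mult_ac)
  qed
  also have "\<dots> = 2 * u\<^sup>2 * expectation (\<lambda>\<omega>. (?i \<omega> * X s \<omega>)\<^sup>2) + 2 * v\<^sup>2 * expectation (\<lambda>\<omega>. (?i \<omega> * X (q * s) \<omega>)\<^sup>2)"
    using sq_integrable_square[OF S(1)] sq_integrable_square[OF S(2)]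
    by (subst Bochner_Integration.integral_add) (auto intro!: integrable_mult_right)
  also have "\<dots> \<le> 2 * u\<^sup>2 * stopped_moment N s + 2 * v\<^sup>2 * stopped_moment N (q * s)"
    using q_le by (simp add: stopped_moment_def)
  finally show "expectation (\<lambda>\<omega>. (?i \<omega> * (u * X s \<omega> + v * X (q * s) \<omega>))\<^sup>2) \<le>
      2 * u\<^sup>2 * stopped_moment N s + 2 * v\<^sup>2 * stopped_moment N (q * s)" .
qed

text \<open>On the event for t the events for all grid points hold too. There the Euler sum
  coincides with the sum whose coefficients are cut off at each grid point by an event of its own
  past, and to that sum the isometry applies. The factor 3 in c splits the initial value, the drift
  sum and the noise sum.\<close>

lemma stopped_moment_step:
  assumes t: "0 < t" "t \<le> T" and L: "0 < L" and K: "0 \<le> K"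
    and le: "\<And>s. 0 \<le> s \<Longrightarrow> s \<le> T \<Longrightarrow> stopped_moment N s \<le> K * exp (L * s)"
  defines "c \<equiv> 3 * (T * (2 * a\<^sup>2 + 2 * b\<^sup>2) + (2 * \<sigma>\<^sup>2 + 2 * \<rho>\<^sup>2))"
  shows "stopped_moment N t \<le> 3 * expectation (\<lambda>\<omega>. (X 0 \<omega>)\<^sup>2) + c * K * (exp (L * t) / L)"
proof -
  let ?i = "\<lambda>s. indicator (bdd_upto N s) :: 'a \<Rightarrow> real"
  let ?g = "\<lambda>n i. grid_pt 0 t n i"
  let ?m0 = "expectation (\<lambda>\<omega>. (X 0 \<omega>)\<^sup>2)"
  let ?bd = "3 * ?m0 + c * K * (exp (L * t) / L)"
  have g: "0 \<le> ?g n i" "?g n i \<le> t" if "i < n" for i n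
    using grid_pt_bounds[OF t(1), of i n] that by auto
  have lin: "expectation (\<lambda>\<omega>. (?i s \<omega> * (u * X s \<omega> + v * X (q * s) \<omega>))\<^sup>2) \<le> (2 * u\<^sup>2 + 2 * v\<^sup>2) * (K * exp (L * s))"
    if s: "0 \<le> s" "s \<le> t" for s u v
  proof -
    have 1: "stopped_moment N s \<le> K * exp (L * s)" using le s t by auto
    have "stopped_moment N (q * s) \<le> K * exp (L * (q * s))" using le[of "q * s"] qs[OF s(1)] s t by auto
    also have "\<dots> \<le> K * exp (L * s)" using K L qs(2)[OF s(1)] by (intro mult_left_mono) auto
    finally have 2: "stopped_moment N (q * s) \<le> K * exp (L * s)" .
    have "expectation (\<lambda>\<omega>. (?i s \<omega> * (u * X s \<omega> + v * X (q * s) \<omega>))\<^sup>2) \<le>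
      2 * u\<^sup>2 * stopped_moment N s + 2 * v\<^sup>2 * stopped_moment N (q * s)" by (rule stopped_linear(2)[OF s(1)])
    also have "\<dots> \<le> 2 * u\<^sup>2 * (K * exp (L * s)) + 2 * v\<^sup>2 * (K * exp (L * s))"
      by (intro add_mono mult_left_mono 1 2) auto
    finally show ?thesis by (simp add: algebra_simps)
  qed
  have X0: "sq_integrable M (X 0)" using X0_sq by (simp add: sq_integrable_def)
  have Xt: "(\<lambda>\<omega>. X t \<omega> - X 0 \<omega>) \<in> borel_measurable M" using t by (intro borel_measurable_diff X_measurable) auto
  have "integrable M (\<lambda>\<omega>. ?i t \<omega> * (X 0 \<omega> + (X t \<omega> - X 0 \<omega>))\<^sup>2) \<and>
    (LINT \<omega>|M. ?i t \<omega> * (X 0 \<omega> + (X t \<omega> - X 0 \<omega>))\<^sup>2) \<le> ?bd"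
  proof (rule Fatou_in_prob[OF prob_space_axioms euler_sum_tendsto[OF order_refl t(1)] _ Xt,
      where g = "\<lambda>\<omega> z. ?i t \<omega> * (X 0 \<omega> + z)\<^sup>2" and c = "\<lambda>_. ?bd"])
    show "euler_sum 0 t n \<in> borel_measurable M" for n by (rule euler_sum_measurable[OF order_refl t(1)])
    show "(\<lambda>\<omega>. ?i t \<omega> * (X 0 \<omega> + (X t \<omega> - X 0 \<omega>))\<^sup>2) \<in> borel_measurable M"
      using t bdd_upto_events[of t N] by (auto intro!: borel_measurable_times)
    show "\<forall>\<^sub>F n in sequentially. integrable M (\<lambda>\<omega>. ?i t \<omega> * (X 0 \<omega> + euler_sum 0 t n \<omega>)\<^sup>2) \<and>
      (LINT \<omega>|M. ?i t \<omega> * (X 0 \<omega> + euler_sum 0 t n \<omega>)\<^sup>2) \<le> ?bd"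
      using eventually_gt_at_top[of 0]
    proof eventually_elim
      case (elim n)
      let ?d = "t / real n"
      let ?U = "\<lambda>i \<omega>. ?i (?g n i) \<omega> * drift (?g n i) \<omega>" and ?V = "\<lambda>i \<omega>. ?i (?g n i) \<omega> * noise (?g n i) \<omega>"
      let ?P = "\<lambda>\<omega>. \<Sum>i<n. ?U i \<omega> * ?d"
      let ?N = "\<lambda>\<omega>. \<Sum>i<n. ?V i \<omega> * (B (?g n (Suc i)) \<omega> - B (?g n i) \<omega>)"
      have d: "0 \<le> ?d" using t by simp
      have U: "sq_integrable M (?U i)" if "i < n" for i by (rule stopped_linear(1)[OF g(1)[OF that]])
      have V: "sq_integrable M (?V i)" if "i < n" for i by (rule stopped_linear(1)[OF g(1)[OF that]])
      have Vm: "?V i \<in> borel_measurable (F (?g n i))" if "i < n" for i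
        using noise_measurable_F[OF g(1)[OF that] order_refl] bdd_upto_F[OF g(1)[OF that], of N]
        by (intro borel_measurable_times borel_measurable_indicator) auto
      have P: "sq_integrable M ?P" by (rule grid_drift_sum_sq[OF U])
      have N: "sq_integrable M ?N" by (rule grid_noise_sum_sq[OF order_refl t(1) elim Vm V])
      let ?e = "exp (L * t) / L"
      have es: "(\<Sum>i<n. K * exp (L * ?g n i) * ?d) \<le> K * ?e"
        using mult_left_mono[OF grid_exp_sum_le[OF L t(1) elim] K] by (simp add: sum_distrib_left mult_ac)
      have "expectation (\<lambda>\<omega>. (?P \<omega>)\<^sup>2) \<le> real n * ?d * (\<Sum>i<n. expectation (\<lambda>\<omega>. (?U i \<omega>)\<^sup>2) * ?d)"
        by (rule grid_drift_sum_le[OF U d])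
      also have "\<dots> \<le> real n * ?d * (\<Sum>i<n. (2 * a\<^sup>2 + 2 * b\<^sup>2) * (K * exp (L * ?g n i)) * ?d)"
        by (intro mult_left_mono sum_mono mult_right_mono lin g d mult_nonneg_nonneg) auto
      also have "\<dots> = t * (2 * a\<^sup>2 + 2 * b\<^sup>2) * (\<Sum>i<n. K * exp (L * ?g n i) * ?d)"
        using elim by (simp add: sum_distrib_left mult_ac)
      also have "\<dots> \<le> T * (2 * a\<^sup>2 + 2 * b\<^sup>2) * (K * ?e)"
        using t K d by (intro mult_mono es sum_nonneg) auto
      finally have EP: "expectation (\<lambda>\<omega>. (?P \<omega>)\<^sup>2) \<le> T * (2 * a\<^sup>2 + 2 * b\<^sup>2) * (K * ?e)" .
      have "expectation (\<lambda>\<omega>. (?N \<omega>)\<^sup>2) = (\<Sum>i<n. expectation (\<lambda>\<omega>. (?V i \<omega>)\<^sup>2) * ?d)"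
        using grid_noise_sum_var[OF order_refl t(1) elim Vm V] by simp
      also have "\<dots> \<le> (\<Sum>i<n. (2 * \<sigma>\<^sup>2 + 2 * \<rho>\<^sup>2) * (K * exp (L * ?g n i)) * ?d)"
        by (intro sum_mono mult_right_mono lin g d) auto
      also have "\<dots> = (2 * \<sigma>\<^sup>2 + 2 * \<rho>\<^sup>2) * (\<Sum>i<n. K * exp (L * ?g n i) * ?d)"
        by (simp add: sum_distrib_left mult_ac)
      also have "\<dots> \<le> (2 * \<sigma>\<^sup>2 + 2 * \<rho>\<^sup>2) * (K * ?e)" by (intro mult_left_mono es) auto
      finally have EN: "expectation (\<lambda>\<omega>. (?N \<omega>)\<^sup>2) \<le> (2 * \<sigma>\<^sup>2 + 2 * \<rho>\<^sup>2) * (K * ?e)" .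
      \<comment> \<open>The grid points are rational multiples of t, so \<open>bdd_upto_grid\<close>
        makes every cutoff equal to 1.\<close>
      have eu: "euler_sum 0 t n \<omega> = ?P \<omega> + ?N \<omega>" if "\<omega> \<in> bdd_upto N t" for \<omega>
      proof -
        have "?i (?g n i) \<omega> = 1" if "i < n" for i using bdd_upto_grid[OF \<open>\<omega> \<in> _\<close>, of i n] that by simp
        then show ?thesis unfolding euler_sum_def by simp
      qed
      have pw: "?i t \<omega> * (X 0 \<omega> + euler_sum 0 t n \<omega>)\<^sup>2 \<le> 3 * (X 0 \<omega>)\<^sup>2 + 3 * (?P \<omega>)\<^sup>2 + 3 * (?N \<omega>)\<^sup>2" for \<omega>
        using sum_square_le3[of "X 0 \<omega>" "?P \<omega>" "?N \<omega>"] eu[of \<omega>] by (cases "\<omega> \<in> bdd_upto N t") (auto simp: add.assoc)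
      have int: "integrable M (\<lambda>\<omega>. 3 * (X 0 \<omega>)\<^sup>2 + 3 * (?P \<omega>)\<^sup>2 + 3 * (?N \<omega>)\<^sup>2)"
        using X0 P N by (intro Bochner_Integration.integrable_add integrable_mult_right sq_integrable_square)
      have int2: "integrable M (\<lambda>\<omega>. ?i t \<omega> * (X 0 \<omega> + euler_sum 0 t n \<omega>)\<^sup>2)"
      proof (rule Bochner_Integration.integrable_bound[OF int])
        show "(\<lambda>\<omega>. ?i t \<omega> * (X 0 \<omega> + euler_sum 0 t n \<omega>)\<^sup>2) \<in> borel_measurable M"
          using bdd_upto_events[of t N] t
          by (intro borel_measurable_times borel_measurable_indicator borel_measurable_power borel_measurable_add
              X_measurable euler_sum_measurable) auto
        show "AE \<omega> in M. norm (?i t \<omega> * (X 0 \<omega> + euler_sum 0 t n \<omega>)\<^sup>2) \<le> norm (3 * (X 0 \<omega>)\<^sup>2 + 3 * (?P \<omega>)\<^sup>2 + 3 * (?N \<omega>)\<^sup>2)"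
        proof (rule AE_I2)
          fix \<omega>
          have "0 \<le> ?i t \<omega> * (X 0 \<omega> + euler_sum 0 t n \<omega>)\<^sup>2" by simp
          then show "norm (?i t \<omega> * (X 0 \<omega> + euler_sum 0 t n \<omega>)\<^sup>2) \<le> norm (3 * (X 0 \<omega>)\<^sup>2 + 3 * (?P \<omega>)\<^sup>2 + 3 * (?N \<omega>)\<^sup>2)"
            using pw[of \<omega>] unfolding real_norm_def by linarith
        qed
      qed
      have "(LINT \<omega>|M. ?i t \<omega> * (X 0 \<omega> + euler_sum 0 t n \<omega>)\<^sup>2) \<le> (LINT \<omega>|M. 3 * (X 0 \<omega>)\<^sup>2 + 3 * (?P \<omega>)\<^sup>2 + 3 * (?N \<omega>)\<^sup>2)"
        by (rule integral_mono[OF int2 int pw])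
      also have "\<dots> = 3 * ?m0 + 3 * expectation (\<lambda>\<omega>. (?P \<omega>)\<^sup>2) + 3 * expectation (\<lambda>\<omega>. (?N \<omega>)\<^sup>2)"
        using sq_integrable_square[OF X0] sq_integrable_square[OF P] sq_integrable_square[OF N] by simp
      also have "\<dots> \<le> 3 * ?m0 + 3 * (T * (2 * a\<^sup>2 + 2 * b\<^sup>2) * (K * ?e)) + 3 * ((2 * \<sigma>\<^sup>2 + 2 * \<rho>\<^sup>2) * (K * ?e))"
        using EP EN by linarith
      also have "\<dots> = ?bd" unfolding c_def by (simp only: algebra_simps)
      finally show ?case using int2 by blast
    qed
  qed (auto intro!: continuous_intros)
  then have "(LINT \<omega>|M. ?i t \<omega> * (X t \<omega>)\<^sup>2) \<le> ?bd" by simp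
  moreover have "stopped_moment N t = (LINT \<omega>|M. ?i t \<omega> * (X t \<omega>)\<^sup>2)"
    unfolding stopped_moment_def by (rule Bochner_Integration.integral_cong) (auto simp: indicator_def)
  ultimately show ?thesis by simp
qed

text \<open>A supremum weighted by exp (- L s) takes the place of Gronwall's lemma, so that no
  regularity of the stopped moment in time is involved. The resulting bound does not depend on
  N.\<close>

lemma stopped_moment_bound:
  assumes T: "0 \<le> T"
  shows "\<exists>C. \<forall>N t. 0 \<le> t \<and> t \<le> T \<longrightarrow> stopped_moment N t \<le> C"
proof -
  let ?m0 = "expectation (\<lambda>\<omega>. (X 0 \<omega>)\<^sup>2)"
  define c where "c = 3 * (T * (2 * a\<^sup>2 + 2 * b\<^sup>2) + (2 * \<sigma>\<^sup>2 + 2 * \<rho>\<^sup>2))"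
  \<comment> \<open>Makes c / L at most 1/2, so that the estimate is a contraction; the summand 1
    keeps L positive if c = 0.\<close>
  define L where "L = 2 * c + 1"
  have c0: "0 \<le> c" unfolding c_def using T by simp
  have L: "0 < L" "c / L \<le> 1 / 2" using c0 by (auto simp: L_def divide_le_eq)
  have m0: "0 \<le> ?m0" by (rule Bochner_Integration.integral_nonneg) simp
  have "stopped_moment N t \<le> 6 * ?m0 * exp (L * T)" if t: "0 \<le> t" "t \<le> T" for N t
  proof -
    \<comment> \<open>The supremum is finite thanks to the localization. Only then does K \<le> 3 m0
      + K / 2, with m0 the initial second moment, give a bound for K.\<close>
    define K where "K = Sup ((\<lambda>s. exp (- L * s) * stopped_moment N s) ` {0..T})"
    have bdd: "bdd_above ((\<lambda>s. exp (- L * s) * stopped_moment N s) ` {0..T})"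
    proof (rule bdd_aboveI2)
      fix s assume s: "s \<in> {0..T}"
      have "exp (- L * s) \<le> 1" using s L by simp
      then show "exp (- L * s) * stopped_moment N s \<le> N\<^sup>2"
        using mult_mono[of "exp (- L * s)" 1 "stopped_moment N s" "N\<^sup>2"] stopped_moment_le[of s N] stopped_moment_nonneg[of N s] s
        by simp
    qed
    have up: "exp (- L * s) * stopped_moment N s \<le> K" if "0 \<le> s" "s \<le> T" for s
      unfolding K_def by (rule cSup_upper[OF _ bdd]) (use that in auto)
    have K0: "0 \<le> K" using up[of 0] T stopped_moment_nonneg[of N 0] by simp
    have le: "stopped_moment N s \<le> K * exp (L * s)" if "0 \<le> s" "s \<le> T" for s
      using up[OF that] by (simp add: exp_minus field_simps)
    have "exp (- L * s) * stopped_moment N s \<le> 3 * ?m0 + K / 2" if s: "0 \<le> s" "s \<le> T" for s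
    proof (cases "s = 0")
      case True
      have "stopped_moment N 0 \<le> ?m0" unfolding stopped_moment_def
        by (rule integral_mono[OF sq_integrable_square[OF stopped_sq_integrable(1)[OF order_refl]] X0_sq])
          (auto simp: indicator_def)
      then have "stopped_moment N 0 \<le> 3 * ?m0 + K / 2" using m0 K0 by linarith
      then show ?thesis unfolding True by simp
    next
      case False
      then have s0: "0 < s" using s by simp
      have "stopped_moment N s \<le> 3 * ?m0 + c * K * (exp (L * s) / L)"
        unfolding c_def by (rule stopped_moment_step[OF s0 s(2) L(1) K0 le])
      also have "c * K * (exp (L * s) / L) = (c / L) * (K * exp (L * s))" by simp
      also have "\<dots> \<le> 1 / 2 * (K * exp (L * s))" using L K0 by (intro mult_right_mono) auto
      finally have "stopped_moment N s \<le> 3 * ?m0 + 1 / 2 * (K * exp (L * s))" by simp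
      then have "exp (- L * s) * stopped_moment N s \<le> exp (- L * s) * (3 * ?m0 + 1 / 2 * (K * exp (L * s)))"
        by (intro mult_left_mono) auto
      also have "\<dots> = exp (- L * s) * (3 * ?m0) + K / 2" by (simp add: algebra_simps exp_minus)
      also have "exp (- L * s) * (3 * ?m0) \<le> 1 * (3 * ?m0)" using s L m0 by (intro mult_right_mono) auto
      finally show ?thesis by simp
    qed
    then have "K \<le> 3 * ?m0 + K / 2" unfolding K_def using T by (intro cSup_least) auto
    then have "K \<le> 6 * ?m0" by simp
    then have "K * exp (L * t) \<le> 6 * ?m0 * exp (L * T)" using t L K0 m0 by (intro mult_mono) auto
    then show ?thesis using le[OF t] by simp
  qed
  then show ?thesis by blast
qed

text \<open>A continuous path is bounded on [0, t], so it lies in \<open>bdd_upto\<close> for all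
  large N. Fatou's lemma removes the cutoff from a bound that is uniform in N.\<close>

lemma second_moment_bound:
  assumes T: "0 \<le> T"
  shows "\<exists>C\<ge>0. \<forall>t. 0 \<le> t \<and> t \<le> T \<longrightarrow> sq_integrable M (X t) \<and> expectation (\<lambda>\<omega>. (X t \<omega>)\<^sup>2) \<le> C"
proof -
  obtain C where C: "\<And>N t. 0 \<le> t \<Longrightarrow> t \<le> T \<Longrightarrow> stopped_moment N t \<le> C"
    using stopped_moment_bound[OF T] by blast
  have "sq_integrable M (X t) \<and> expectation (\<lambda>\<omega>. (X t \<omega>)\<^sup>2) \<le> C" if t: "0 \<le> t" "t \<le> T" for t
  proof -
    have "integrable M (\<lambda>\<omega>. (X t \<omega>)\<^sup>2) \<and> integral\<^sup>L M (\<lambda>\<omega>. (X t \<omega>)\<^sup>2) \<le> C"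
    proof (rule integral_Fatou_bound[where u = "\<lambda>n \<omega>. (indicator (bdd_upto (real n) t) \<omega> * X t \<omega>)\<^sup>2" and c = "\<lambda>_. C"])
      show "AE \<omega> in M. (\<lambda>n. (indicator (bdd_upto (real n) t) \<omega> * X t \<omega>)\<^sup>2) \<longlonglongrightarrow> (X t \<omega>)\<^sup>2"
        using X_cont AE_space
      proof eventually_elim
        case (elim \<omega>)
        have "continuous_on {0..t} (\<lambda>s. X s \<omega>)" by (rule continuous_on_subset[OF elim(1)]) auto
        then have "compact ((\<lambda>s. X s \<omega>) ` {0..t})" by (rule compact_continuous_image) simp
        then obtain m where "\<forall>x\<in>(\<lambda>s. X s \<omega>) ` {0..t}. norm x \<le> m"
          using compact_imp_bounded bounded_iff by meson
        then have m: "\<bar>X s \<omega>\<bar> \<le> m" if "s \<in> {0..t}" for s using that by simp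
        have in': "\<omega> \<in> bdd_upto (real n) t" if "m \<le> real n" for n
        proof -
          have "\<bar>X (r * t) \<omega>\<bar> \<le> real n" if "r \<in> dil" for r
            using m[of "r * t"] dil_bounds[OF that] t \<open>m \<le> real n\<close> by (auto simp: mult_left_le_one_le)
          then show ?thesis using elim(2) by (simp add: bdd_upto_def)
        qed
        obtain n0 where n0: "m \<le> real n0" using real_arch_simple by blast
        have "\<forall>\<^sub>F n in sequentially. (X t \<omega>)\<^sup>2 = (indicator (bdd_upto (real n) t) \<omega> * X t \<omega>)\<^sup>2"
          using eventually_ge_at_top[of n0]
        proof eventually_elim
          case (elim n)
          then have "real n0 \<le> real n" by simp
          then show ?case using in'[of n] n0 by simp
        qed
        then show ?case by (rule tendsto_eventually[OF eventually_mono]) simp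
      qed
      show "(\<lambda>\<omega>. (X t \<omega>)\<^sup>2) \<in> borel_measurable M" using t by simp
      show "\<forall>\<^sub>F n in sequentially. integrable M (\<lambda>\<omega>. (indicator (bdd_upto (real n) t) \<omega> * X t \<omega>)\<^sup>2) \<and>
        (\<forall>\<omega>\<in>space M. 0 \<le> (indicator (bdd_upto (real n) t) \<omega> * X t \<omega>)\<^sup>2) \<and>
        integral\<^sup>L M (\<lambda>\<omega>. (indicator (bdd_upto (real n) t) \<omega> * X t \<omega>)\<^sup>2) \<le> C"
        using C[OF t] sq_integrable_square[OF stopped_sq_integrable(1)[OF t(1)]]
        by (intro always_eventually allI) (simp add: stopped_moment_def)
    qed simp
    then show ?thesis using t by (simp add: sq_integrable_def)
  qed
  then show ?thesis by (intro exI[of _ "max C 0"]) (auto intro: order_trans[OF _ max.cobounded1])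
qed

end

section \<open>Local expansions\<close>

lemma expectation_linear_sq_le:
  assumes f: "sq_integrable M f" and g: "sq_integrable M g"
  shows "(LINT \<omega>|M. (u * f \<omega> + v * g \<omega>)\<^sup>2) \<le> 2 * u\<^sup>2 * (LINT \<omega>|M. (f \<omega>)\<^sup>2) + 2 * v\<^sup>2 * (LINT \<omega>|M. (g \<omega>)\<^sup>2)"
proof -
  have "(LINT \<omega>|M. (u * f \<omega> + v * g \<omega>)\<^sup>2) \<le> (LINT \<omega>|M. 2 * u\<^sup>2 * (f \<omega>)\<^sup>2 + 2 * v\<^sup>2 * (g \<omega>)\<^sup>2)"
  proof (rule integral_mono)
    show "integrable M (\<lambda>\<omega>. (u * f \<omega> + v * g \<omega>)\<^sup>2)"
      by (intro sq_integrable_square sq_integrable_add sq_integrable_cmult f g)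
    show "integrable M (\<lambda>\<omega>. 2 * u\<^sup>2 * (f \<omega>)\<^sup>2 + 2 * v\<^sup>2 * (g \<omega>)\<^sup>2)"
      by (intro Bochner_Integration.integrable_add integrable_mult_right sq_integrable_square f g)
    show "(u * f \<omega> + v * g \<omega>)\<^sup>2 \<le> 2 * u\<^sup>2 * (f \<omega>)\<^sup>2 + 2 * v\<^sup>2 * (g \<omega>)\<^sup>2" for \<omega>
      using sum_square_le2[of "u * f \<omega>" "v * g \<omega>"] by (simp add: power_mult_distrib mult.assoc)
  qed
  also have "\<dots> = 2 * u\<^sup>2 * (LINT \<omega>|M. (f \<omega>)\<^sup>2) + 2 * v\<^sup>2 * (LINT \<omega>|M. (g \<omega>)\<^sup>2)"
    using sq_integrable_square[OF f] sq_integrable_square[OF g]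
    by (subst Bochner_Integration.integral_add) (auto intro!: integrable_mult_right)
  finally show ?thesis .
qed

text \<open>Summation by parts expresses twice the iterated sum as (B t - B s)^2 minus the sum of
  the squared increments. The difference from the limit is a martingale transform of the compensated
  squares, so its second moment can be computed exactly.\<close>

lemma (in brownian_filtration) iterated_ito_sum_tendsto:
  assumes st: "0 \<le> s" "s < t" and \<eta>: "\<eta> \<in> borel_measurable (F s)" "sq_integrable M \<eta>"
  shows "tendsto_in_prob M
    (\<lambda>n \<omega>. \<Sum>i<n. \<eta> \<omega> * (B (grid_pt s t n i) \<omega> - B s \<omega>) * grid_incr s t n i \<omega>)
    (\<lambda>\<omega>. \<eta> \<omega> * ((B t \<omega> - B s \<omega>)\<^sup>2 - (t - s)) / 2)"
proof (rule tendsto_in_prob_L2[OF prob_space_axioms])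
  \<comment> \<open>n cells, each contributing the variance 2 ((t - s) / n)^2 of a squared
    increment.\<close>
  let ?c = "\<lambda>n. expectation (\<lambda>\<omega>. (1/2 * \<eta> \<omega>)\<^sup>2) * (2 * (t - s)\<^sup>2) / real n"
  show "?c \<longlonglongrightarrow> 0" by (rule lim_const_over_n)
  show "\<forall>\<^sub>F n in sequentially.
    sq_integrable M (\<lambda>\<omega>. (\<Sum>i<n. \<eta> \<omega> * (B (grid_pt s t n i) \<omega> - B s \<omega>) * grid_incr s t n i \<omega>) -
      \<eta> \<omega> * ((B t \<omega> - B s \<omega>)\<^sup>2 - (t - s)) / 2) \<and>
    expectation (\<lambda>\<omega>. ((\<Sum>i<n. \<eta> \<omega> * (B (grid_pt s t n i) \<omega> - B s \<omega>) * grid_incr s t n i \<omega>) -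
      \<eta> \<omega> * ((B t \<omega> - B s \<omega>)\<^sup>2 - (t - s)) / 2)\<^sup>2) \<le> ?c n"
    using eventually_gt_at_top[of 0]
  proof eventually_elim
    case (elim n)
    let ?g = "grid_pt s t n" and ?d = "(t - s) / real n"
    let ?D = "\<lambda>i \<omega>. B (?g (Suc i)) \<omega> - B (?g i) \<omega>"
    let ?S = "\<lambda>\<omega>. \<Sum>i<n. (1/2 * \<eta> \<omega>) * (?d - (?D i \<omega>)\<^sup>2)"
    have tele: "2 * (\<Sum>i<m. (B (?g i) \<omega> - B s \<omega>) * ?D i \<omega>) = (B (?g m) \<omega> - B s \<omega>)\<^sup>2 - (\<Sum>i<m. (?D i \<omega>)\<^sup>2)" for m \<omega>
    proof (induction m)
      case (Suc m)
      have "2 * (\<Sum>i<Suc m. (B (?g i) \<omega> - B s \<omega>) * ?D i \<omega>) =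
        (B (?g m) \<omega> - B s \<omega>)\<^sup>2 - (\<Sum>i<m. (?D i \<omega>)\<^sup>2) + 2 * ((B (?g m) \<omega> - B s \<omega>) * ?D m \<omega>)"
        using Suc by (simp add: distrib_left)
      also have "\<dots> = (B (?g (Suc m)) \<omega> - B s \<omega>)\<^sup>2 - (\<Sum>i<Suc m. (?D i \<omega>)\<^sup>2)"
        by (simp add: power2_eq_square algebra_simps)
      finally show ?case .
    qed simp
    have eq: "(\<Sum>i<n. \<eta> \<omega> * (B (?g i) \<omega> - B s \<omega>) * ?D i \<omega>) - \<eta> \<omega> * ((B t \<omega> - B s \<omega>)\<^sup>2 - (t - s)) / 2 = ?S \<omega>" for \<omega>
    proof -
      have S: "?S \<omega> = 1/2 * \<eta> \<omega> * ((t - s) - (\<Sum>i<n. (?D i \<omega>)\<^sup>2))"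
        unfolding sum_distrib_left[symmetric] sum_subtractf using elim by simp
      have "(\<Sum>i<n. \<eta> \<omega> * (B (?g i) \<omega> - B s \<omega>) * ?D i \<omega>) = \<eta> \<omega> / 2 * (2 * (\<Sum>i<n. (B (?g i) \<omega> - B s \<omega>) * ?D i \<omega>))"
        by (simp add: sum_distrib_left mult.assoc)
      also have "\<dots> = \<eta> \<omega> / 2 * ((B t \<omega> - B s \<omega>)\<^sup>2 - (\<Sum>i<n. (?D i \<omega>)\<^sup>2))"
        unfolding tele using elim by simp
      finally show ?thesis unfolding S by (simp add: field_simps)
    qed
    have gp: "0 \<le> ?g 0" "\<And>j. j < n \<Longrightarrow> ?g j < ?g (Suc j)" using st grid_pt_less[OF st(2)] by auto
    have g0: "0 \<le> ?g j" "s \<le> ?g j" if "j < n" for j using grid_pt_bounds[OF st(2), of j n] st that by auto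
    have \<eta>': "(\<lambda>\<omega>. 1/2 * \<eta> \<omega>) \<in> borel_measurable (F (?g j))" if "j < n" for j
      using F_measurable_mono[OF st(1) g0(2)[OF that] \<eta>(1)] by simp
    have \<eta>2: "sq_integrable M (\<lambda>\<omega>. 1/2 * \<eta> \<omega>)" by (rule sq_integrable_cmult[OF \<eta>(2)])
    have mom: "sq_integrable M (\<lambda>\<omega>. ?d - (?D j \<omega>)\<^sup>2)" "expectation (\<lambda>\<omega>. ?d - (?D j \<omega>)\<^sup>2) = 0"
        "expectation (\<lambda>\<omega>. (?d - (?D j \<omega>)\<^sup>2)\<^sup>2) = 2 * ?d\<^sup>2" if j: "j < n" for j
    proof -
      note m = incr_moments[OF g0(1)[OF j] gp(2)[OF j]]
      note i2 = m(1)[of 2] and i4 = m(1)[of 4]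
      have sq: "(?d - (?D j \<omega>)\<^sup>2)\<^sup>2 = ?d\<^sup>2 - 2 * ?d * (?D j \<omega>)\<^sup>2 + (?D j \<omega>) ^ 4" for \<omega>
      proof -
        have "(?d - x\<^sup>2)\<^sup>2 = ?d\<^sup>2 - 2 * ?d * x\<^sup>2 + x ^ 4" for x
          by (simp add: power2_eq_square power4_eq_xxxx algebra_simps)
        then show ?thesis .
      qed
      have int: "integrable M (\<lambda>\<omega>. ?d\<^sup>2 - 2 * ?d * (?D j \<omega>)\<^sup>2 + (?D j \<omega>) ^ 4)"
        by (intro Bochner_Integration.integrable_add Bochner_Integration.integrable_diff integrable_mult_right i2 i4 integrable_const)
      have Dm: "?D j \<in> borel_measurable M"
        using g0[OF j] gp(2)[OF j] by (intro borel_measurable_diff B_measurable_M) auto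
      then show "sq_integrable M (\<lambda>\<omega>. ?d - (?D j \<omega>)\<^sup>2)" unfolding sq_integrable_def sq using int by simp
      show "expectation (\<lambda>\<omega>. ?d - (?D j \<omega>)\<^sup>2) = 0" using i2 m(3) by (simp add: prob_space grid_pt_step)
      have "expectation (\<lambda>\<omega>. (?d - (?D j \<omega>)\<^sup>2)\<^sup>2) = ?d\<^sup>2 - 2 * ?d * ?d + 3 * ?d\<^sup>2"
        unfolding sq using i2 i4 m(3,4) by (simp add: prob_space grid_pt_step)
      moreover have "y\<^sup>2 - 2 * y * y + 3 * y\<^sup>2 = 2 * y\<^sup>2" for y :: real by (simp add: power2_eq_square)
      ultimately show "expectation (\<lambda>\<omega>. (?d - (?D j \<omega>)\<^sup>2)\<^sup>2) = 2 * ?d\<^sup>2" by (simp only:)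
    qed
    have Ssq: "sq_integrable M ?S"
      by (rule sq_integrable_transform[where q = ?g and m = n and \<eta> = "\<lambda>_ \<omega>. 1/2 * \<eta> \<omega>" and g = "\<lambda>_ x. ?d - x\<^sup>2", OF gp \<eta>' \<eta>2 _ mom(1,2)]) simp_all
    have "expectation (\<lambda>\<omega>. (?S \<omega>)\<^sup>2) = (\<Sum>j<n. expectation (\<lambda>\<omega>. (1/2 * \<eta> \<omega>)\<^sup>2) * expectation (\<lambda>\<omega>. (?d - (?D j \<omega>)\<^sup>2)\<^sup>2))"
      by (rule transform_isometry[where q = ?g and m = n and \<eta> = "\<lambda>_ \<omega>. 1/2 * \<eta> \<omega>" and g = "\<lambda>_ x. ?d - x\<^sup>2", OF gp \<eta>' \<eta>2 _ mom(1,2)]) simp_all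
    also have "\<dots> = (\<Sum>j<n. expectation (\<lambda>\<omega>. (1/2 * \<eta> \<omega>)\<^sup>2) * (2 * ?d\<^sup>2))"
      using mom(3) by (intro sum.cong) auto
    also have "\<dots> = ?c n" using elim by (simp add: power2_eq_square)
    finally have "expectation (\<lambda>\<omega>. (?S \<omega>)\<^sup>2) = ?c n" .
    then show ?case unfolding eq using Ssq by simp
  qed
qed

section \<open>Local errors of the Euler and Milstein expansions\<close>

context pantograph
begin

lemma X_sq_integrable: "0 \<le> t \<Longrightarrow> sq_integrable M (X t)"
  using second_moment_bound[of t] by auto

lemma linear_sq_integrable: "0 \<le> t \<Longrightarrow> sq_integrable M (\<lambda>\<omega>. u * X t \<omega> + v * X (q * t) \<omega>)"
  using qs by (intro sq_integrable_add sq_integrable_cmult X_sq_integrable) auto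

lemma B_incr_grid_sum: "0 < n \<Longrightarrow> (\<Sum>i<n. grid_incr s t n i \<omega>) = B t \<omega> - B s \<omega>"
  using sum_lessThan_telescope[of "\<lambda>i. B (grid_pt s t n i) \<omega>" n] by simp

lemma linear_moment_bound:
  assumes C: "\<forall>t. 0 \<le> t \<and> t \<le> T \<longrightarrow> sq_integrable M (X t) \<and> expectation (\<lambda>\<omega>. (X t \<omega>)\<^sup>2) \<le> C"
    and t: "0 \<le> t" "t \<le> T"
  shows "expectation (\<lambda>\<omega>. (u * X t \<omega> + v * X (q * t) \<omega>)\<^sup>2) \<le> (2 * u\<^sup>2 + 2 * v\<^sup>2) * C"
proof -
  have qt: "0 \<le> q * t" "q * t \<le> T" using qs[of t] t by auto
  have "expectation (\<lambda>\<omega>. (u * X t \<omega> + v * X (q * t) \<omega>)\<^sup>2) \<le>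
    2 * u\<^sup>2 * expectation (\<lambda>\<omega>. (X t \<omega>)\<^sup>2) + 2 * v\<^sup>2 * expectation (\<lambda>\<omega>. (X (q * t) \<omega>)\<^sup>2)"
    by (rule expectation_linear_sq_le) (use C t qt in auto)
  also have "\<dots> \<le> 2 * u\<^sup>2 * C + 2 * v\<^sup>2 * C" using C t qt by (intro add_mono mult_left_mono) auto
  finally show ?thesis by (simp add: algebra_simps)
qed

text \<open>The drift contributes order (t - s)^2 and the noise order t - s; on a bounded horizon
  the second order dominates.\<close>

lemma increment_bound:
  assumes T: "0 \<le> T"
  shows "\<exists>C\<ge>0. \<forall>s t. 0 \<le> s \<and> s < t \<and> t \<le> T \<longrightarrow> expectation (\<lambda>\<omega>. (X t \<omega> - X s \<omega>)\<^sup>2) \<le> C * (t - s)"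
proof -
  obtain C where C: "C \<ge> 0" "\<forall>t. 0 \<le> t \<and> t \<le> T \<longrightarrow> sq_integrable M (X t) \<and> expectation (\<lambda>\<omega>. (X t \<omega>)\<^sup>2) \<le> C"
    using second_moment_bound[OF T] by blast
  let ?c = "(2 * a\<^sup>2 + 2 * b\<^sup>2) * C" and ?c' = "(2 * \<sigma>\<^sup>2 + 2 * \<rho>\<^sup>2) * C"
  have c0: "0 \<le> ?c" using C by simp
  have "expectation (\<lambda>\<omega>. (X t \<omega> - X s \<omega>)\<^sup>2) \<le> (2 * T * ?c + 2 * ?c') * (t - s)"
    if st: "0 \<le> s" "s < t" "t \<le> T" for s t
  proof -
    have "sq_integrable M (\<lambda>\<omega>. X t \<omega> - X s \<omega>) \<and> expectation (\<lambda>\<omega>. (X t \<omega> - X s \<omega>)\<^sup>2) \<le> 2 * (t - s)\<^sup>2 * ?c + 2 * (t - s) * ?c'"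
    proof (rule grid_sum_limit_bound[where U = drift and V = noise, OF st(1,2)])
      fix r assume r: "s \<le> r" "r \<le> t"
      then have r': "0 \<le> r" "r \<le> T" using st by auto
      show "sq_integrable M (drift r)" "sq_integrable M (noise r)" by (rule linear_sq_integrable[OF r'(1)])+
      show "expectation (\<lambda>\<omega>. (drift r \<omega>)\<^sup>2) \<le> ?c" "expectation (\<lambda>\<omega>. (noise r \<omega>)\<^sup>2) \<le> ?c'"
        by (rule linear_moment_bound[OF C(2) r'])+
      show "noise r \<in> borel_measurable (F r)" by (rule noise_measurable_F[OF r'(1) order_refl])
    next
      show "tendsto_in_prob M (\<lambda>n \<omega>. (\<Sum>i<n. drift (grid_pt s t n i) \<omega> * ((t - s) / real n)) +
        (\<Sum>i<n. noise (grid_pt s t n i) \<omega> * grid_incr s t n i \<omega>)) (\<lambda>\<omega>. X t \<omega> - X s \<omega>)"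
        using euler_sum_tendsto[OF st(1,2)] unfolding euler_sum_def[abs_def] .
      show "(\<lambda>\<omega>. X t \<omega> - X s \<omega>) \<in> borel_measurable M" using st by (intro borel_measurable_diff X_measurable) auto
    qed
    moreover have "2 * (t - s)\<^sup>2 * ?c \<le> 2 * T * ?c * (t - s)"
    proof -
      have "(t - s) * (2 * (t - s) * ?c) \<le> T * (2 * (t - s) * ?c)"
        by (rule mult_right_mono[OF _ mult_nonneg_nonneg[OF _ c0]]) (use st in auto)
      then show ?thesis by (simp only: power2_eq_square mult_ac)
    qed
    moreover have "(2 * T * ?c + 2 * ?c') * (t - s) = 2 * T * ?c * (t - s) + 2 * (t - s) * ?c'"
      by (simp only: distrib_right distrib_left mult_ac)
    ultimately show ?thesis by linarith
  qed
  moreover have "0 \<le> 2 * T * ?c + 2 * ?c'" using C T by simp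
  ultimately show ?thesis by blast
qed

lemma linear_increment_bound:
  assumes C: "\<forall>s t. 0 \<le> s \<and> s < t \<and> t \<le> T \<longrightarrow> expectation (\<lambda>\<omega>. (X t \<omega> - X s \<omega>)\<^sup>2) \<le> C * (t - s)" "0 \<le> C"
    and st: "0 \<le> s" "s \<le> t" "t \<le> T"
  shows "sq_integrable M (\<lambda>\<omega>. (u * X t \<omega> + v * X (q * t) \<omega>) - (u * X s \<omega> + v * X (q * s) \<omega>))"
   "expectation (\<lambda>\<omega>. ((u * X t \<omega> + v * X (q * t) \<omega>) - (u * X s \<omega> + v * X (q * s) \<omega>))\<^sup>2) \<le> (2 * u\<^sup>2 + 2 * v\<^sup>2) * C * (t - s)"
proof -
  show "sq_integrable M (\<lambda>\<omega>. (u * X t \<omega> + v * X (q * t) \<omega>) - (u * X s \<omega> + v * X (q * s) \<omega>))"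
    using st by (intro sq_integrable_diff linear_sq_integrable) auto
  have 1: "expectation (\<lambda>\<omega>. (X t \<omega> - X s \<omega>)\<^sup>2) \<le> C * (t - s)"
    using C st by (cases "s = t") auto
  have 2: "expectation (\<lambda>\<omega>. (X (q * t) \<omega> - X (q * s) \<omega>)\<^sup>2) \<le> C * (t - s)"
  proof (cases "s = t")
    case False
    then have "q * s < q * t" "0 \<le> q * s" using q st qs(1)[OF st(1)] by auto
    moreover have "q * t \<le> T" by (rule order_trans[OF qs(2) st(3)]) (use st in simp)
    ultimately have "q * s < q * t" "0 \<le> q * s" "q * t \<le> T" by auto
    then have "expectation (\<lambda>\<omega>. (X (q * t) \<omega> - X (q * s) \<omega>)\<^sup>2) \<le> C * (q * t - q * s)" using C by blast
    also have "\<dots> = C * (q * (t - s))" by (simp add: algebra_simps)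
    also have "\<dots> \<le> C * (t - s)" using C(2) q st by (intro mult_left_mono mult_left_le_one_le) auto
    finally show ?thesis .
  qed simp
  have eq: "(u * X t \<omega> + v * X (q * t) \<omega>) - (u * X s \<omega> + v * X (q * s) \<omega>) =
    u * (X t \<omega> - X s \<omega>) + v * (X (q * t) \<omega> - X (q * s) \<omega>)" for \<omega> by (simp add: algebra_simps)
  have "expectation (\<lambda>\<omega>. (u * (X t \<omega> - X s \<omega>) + v * (X (q * t) \<omega> - X (q * s) \<omega>))\<^sup>2) \<le>
    2 * u\<^sup>2 * expectation (\<lambda>\<omega>. (X t \<omega> - X s \<omega>)\<^sup>2) + 2 * v\<^sup>2 * expectation (\<lambda>\<omega>. (X (q * t) \<omega> - X (q * s) \<omega>)\<^sup>2)"
    using st qs by (intro expectation_linear_sq_le sq_integrable_diff X_sq_integrable) auto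
  also have "\<dots> \<le> 2 * u\<^sup>2 * (C * (t - s)) + 2 * v\<^sup>2 * (C * (t - s))" by (intro add_mono mult_left_mono 1 2) auto
  finally show "expectation (\<lambda>\<omega>. ((u * X t \<omega> + v * X (q * t) \<omega>) - (u * X s \<omega> + v * X (q * s) \<omega>))\<^sup>2) \<le> (2 * u\<^sup>2 + 2 * v\<^sup>2) * C * (t - s)"
    unfolding eq by (simp add: algebra_simps)
qed

definition euler_rest :: "real \<Rightarrow> real \<Rightarrow> 'a \<Rightarrow> real" where
  "euler_rest s t \<omega> = X t \<omega> - X s \<omega> - drift s \<omega> * (t - s) - noise s \<omega> * (B t \<omega> - B s \<omega>)"

lemma noise_incr_sq:
  assumes "0 \<le> s" "s \<le> r"
  shows "sq_integrable M (\<lambda>\<omega>. noise s \<omega> * (B r \<omega> - B s \<omega>))"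
proof (cases "s = r")
  case False
  then show ?thesis
    using sq_integrable_indep_mult(1)[of s r "noise s" "\<lambda>x. x"] assms noise_measurable_F[of s s]
      linear_sq_integrable[of s \<sigma> \<rho>] incr_sq_integrable[of s r] by simp
qed (simp add: sq_integrable_zero)

lemma euler_rest_sq:
  assumes "0 \<le> s" "s \<le> t"
  shows "sq_integrable M (euler_rest s t)"
proof -
  have "sq_integrable M (\<lambda>\<omega>. X t \<omega> - X s \<omega> - (t - s) * drift s \<omega> - noise s \<omega> * (B t \<omega> - B s \<omega>))"
    using assms by (intro sq_integrable_diff sq_integrable_cmult linear_sq_integrable X_sq_integrable noise_incr_sq) auto
  then show ?thesis by (simp add: euler_rest_def[abs_def] mult.commute)
qed

text \<open>Coefficients frozen at s sum up exactly, because the steps add up to t - s and the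
  increments to B t - B s. Subtracting them from the Euler sum leaves the sum of the coefficient
  changes. The identity starts at n = 1, the sums for n = 0 being empty.\<close>

lemma euler_rest_sum_tendsto:
  assumes st: "0 \<le> s" "s < t"
  shows "tendsto_in_prob M (\<lambda>n \<omega>. (\<Sum>i<n. (drift (grid_pt s t n i) \<omega> - drift s \<omega>) * ((t - s) / real n)) +
    (\<Sum>i<n. (noise (grid_pt s t n i) \<omega> - noise s \<omega>) * grid_incr s t n i \<omega>))
    (euler_rest s t)"
proof (rule tendsto_in_prob_eventually_cong)
  let ?R = "\<lambda>\<omega>. - (drift s \<omega> * (t - s)) - noise s \<omega> * (B t \<omega> - B s \<omega>)"
  have "tendsto_in_prob M (\<lambda>n \<omega>. euler_sum s t n \<omega> + ?R \<omega>) (\<lambda>\<omega>. X t \<omega> - X s \<omega> + ?R \<omega>)"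
    by (intro tendsto_in_prob_add prob_space_axioms euler_sum_tendsto st tendsto_in_prob_const)
  then show "tendsto_in_prob M (\<lambda>n \<omega>. euler_sum s t n \<omega> + ?R \<omega>) (euler_rest s t)"
    by (simp add: euler_rest_def[abs_def] algebra_simps)
  show "\<forall>\<^sub>F n in sequentially. (\<lambda>\<omega>. euler_sum s t n \<omega> + ?R \<omega>) =
    (\<lambda>\<omega>. (\<Sum>i<n. (drift (grid_pt s t n i) \<omega> - drift s \<omega>) * ((t - s) / real n)) +
    (\<Sum>i<n. (noise (grid_pt s t n i) \<omega> - noise s \<omega>) * grid_incr s t n i \<omega>))"
    using eventually_gt_at_top[of 0]
  proof eventually_elim
    case (elim n)
    show ?case
    proof
      fix \<omega>
      have 1: "(\<Sum>i<n. (drift (grid_pt s t n i) \<omega> - drift s \<omega>) * ((t - s) / real n)) =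
        (\<Sum>i<n. drift (grid_pt s t n i) \<omega> * ((t - s) / real n)) - drift s \<omega> * (t - s)"
        unfolding left_diff_distrib[of "drift _ _" "drift _ _"] sum_subtractf using elim by simp
      have 2: "(\<Sum>i<n. (noise (grid_pt s t n i) \<omega> - noise s \<omega>) * grid_incr s t n i \<omega>) =
        (\<Sum>i<n. noise (grid_pt s t n i) \<omega> * grid_incr s t n i \<omega>) -
        noise s \<omega> * (B t \<omega> - B s \<omega>)"
      proof -
        have "(\<Sum>i<n. noise s \<omega> * grid_incr s t n i \<omega>) = noise s \<omega> * (B t \<omega> - B s \<omega>)"
          unfolding sum_distrib_left[symmetric] B_incr_grid_sum[OF elim] ..
        moreover have "(\<Sum>i<n. (noise (grid_pt s t n i) \<omega> - noise s \<omega>) * grid_incr s t n i \<omega>) =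
          (\<Sum>i<n. noise (grid_pt s t n i) \<omega> * grid_incr s t n i \<omega> -
            noise s \<omega> * grid_incr s t n i \<omega>)"
          by (intro sum.cong refl left_diff_distrib)
        ultimately show ?thesis by (simp only: sum_subtractf[where g = "\<lambda>i. noise s \<omega> * _ i"] sum_subtractf)
      qed
      show "euler_sum s t n \<omega> + ?R \<omega> = (\<Sum>i<n. (drift (grid_pt s t n i) \<omega> - drift s \<omega>) * ((t - s) / real n)) +
        (\<Sum>i<n. (noise (grid_pt s t n i) \<omega> - noise s \<omega>) * grid_incr s t n i \<omega>)"
        unfolding 1 2 euler_sum_def by simp
    qed
  qed
qed

text \<open>The changes of the coefficients have mean square O(t - s); summing them against the
  noise gains another factor t - s.\<close>

lemma euler_rest_bound:
  assumes T: "0 \<le> T"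
  shows "\<exists>C\<ge>0. \<forall>s t. 0 \<le> s \<and> s < t \<and> t \<le> T \<longrightarrow> expectation (\<lambda>\<omega>. (euler_rest s t \<omega>)\<^sup>2) \<le> C * (t - s)\<^sup>2"
proof -
  obtain C where C: "C \<ge> 0" "\<forall>s t. 0 \<le> s \<and> s < t \<and> t \<le> T \<longrightarrow> expectation (\<lambda>\<omega>. (X t \<omega> - X s \<omega>)\<^sup>2) \<le> C * (t - s)"
    using increment_bound[OF T] by blast
  let ?c = "(2 * a\<^sup>2 + 2 * b\<^sup>2) * C" and ?c' = "(2 * \<sigma>\<^sup>2 + 2 * \<rho>\<^sup>2) * C"
  have c0: "0 \<le> ?c" "0 \<le> ?c'" using C by auto
  have "expectation (\<lambda>\<omega>. (euler_rest s t \<omega>)\<^sup>2) \<le> (2 * T * ?c + 2 * ?c') * (t - s)\<^sup>2"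
    if st: "0 \<le> s" "s < t" "t \<le> T" for s t
  proof -
    have "sq_integrable M (euler_rest s t) \<and> expectation (\<lambda>\<omega>. (euler_rest s t \<omega>)\<^sup>2) \<le>
      2 * (t - s)\<^sup>2 * (?c * (t - s)) + 2 * (t - s) * (?c' * (t - s))"
    proof (rule grid_sum_limit_bound[where U = "\<lambda>r \<omega>. drift r \<omega> - drift s \<omega>" and V = "\<lambda>r \<omega>. noise r \<omega> - noise s \<omega>",
        OF st(1,2)])
      fix r assume r: "s \<le> r" "r \<le> t"
      then have r': "r \<le> T" "0 \<le> r" using st by auto
      note L = linear_increment_bound[OF C(2,1) st(1) r(1) r'(1)]
      show "sq_integrable M (\<lambda>\<omega>. drift r \<omega> - drift s \<omega>)" "sq_integrable M (\<lambda>\<omega>. noise r \<omega> - noise s \<omega>)"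
        by (rule L(1))+
      have "expectation (\<lambda>\<omega>. (drift r \<omega> - drift s \<omega>)\<^sup>2) \<le> ?c * (r - s)" by (rule L(2))
      also have "\<dots> \<le> ?c * (t - s)" using r c0 by (intro mult_left_mono) auto
      finally show "expectation (\<lambda>\<omega>. (drift r \<omega> - drift s \<omega>)\<^sup>2) \<le> ?c * (t - s)" .
      have "expectation (\<lambda>\<omega>. (noise r \<omega> - noise s \<omega>)\<^sup>2) \<le> ?c' * (r - s)" by (rule L(2))
      also have "\<dots> \<le> ?c' * (t - s)" using r c0 by (intro mult_left_mono) auto
      finally show "expectation (\<lambda>\<omega>. (noise r \<omega> - noise s \<omega>)\<^sup>2) \<le> ?c' * (t - s)" .
      show "(\<lambda>\<omega>. noise r \<omega> - noise s \<omega>) \<in> borel_measurable (F r)"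
        by (rule borel_measurable_diff[OF noise_measurable_F[OF r'(2) order_refl] noise_measurable_F[OF st(1) r(1)]])
    next
      show "euler_rest s t \<in> borel_measurable M"
        using euler_rest_sq[of s t] st by (simp add: sq_integrable_def)
    qed (rule euler_rest_sum_tendsto[OF st(1,2)])
    moreover have "2 * (t - s)\<^sup>2 * (?c * (t - s)) \<le> 2 * T * ?c * (t - s)\<^sup>2"
    proof -
      have "(t - s) * (2 * (t - s)\<^sup>2 * ?c) \<le> T * (2 * (t - s)\<^sup>2 * ?c)"
        by (rule mult_right_mono[OF _ mult_nonneg_nonneg[OF _ c0(1)]]) (use st in auto)
      then show ?thesis by (simp only: mult_ac)
    qed
    moreover have "2 * (t - s) * (?c' * (t - s)) = 2 * ?c' * (t - s)\<^sup>2" by (simp only: power2_eq_square mult_ac)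
    moreover have "(2 * T * ?c + 2 * ?c') * (t - s)\<^sup>2 = 2 * T * ?c * (t - s)\<^sup>2 + 2 * ?c' * (t - s)\<^sup>2"
      by (simp only: distrib_right)
    ultimately show ?thesis by linarith
  qed
  moreover have "0 \<le> 2 * T * ?c + 2 * ?c'" using c0 T by simp
  ultimately show ?thesis by blast
qed

lemma milstein_rest_bound:
  assumes T: "0 \<le> T" and \<rho>: "\<rho> = 0"
  shows "\<exists>C\<ge>0. \<forall>s t. 0 \<le> s \<and> s < t \<and> t \<le> T \<longrightarrow>
    sq_integrable M (\<lambda>\<omega>. euler_rest s t \<omega> - \<sigma> * noise s \<omega> * ((B t \<omega> - B s \<omega>)\<^sup>2 - (t - s)) / 2) \<and>
    expectation (\<lambda>\<omega>. (euler_rest s t \<omega> - \<sigma> * noise s \<omega> * ((B t \<omega> - B s \<omega>)\<^sup>2 - (t - s)) / 2)\<^sup>2) \<le> C * (t - s) ^ 3"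
proof -
  obtain C where C: "C \<ge> 0" "\<forall>s t. 0 \<le> s \<and> s < t \<and> t \<le> T \<longrightarrow> expectation (\<lambda>\<omega>. (X t \<omega> - X s \<omega>)\<^sup>2) \<le> C * (t - s)"
    using increment_bound[OF T] by blast
  obtain C2 where C2: "C2 \<ge> 0" "\<forall>s t. 0 \<le> s \<and> s < t \<and> t \<le> T \<longrightarrow> expectation (\<lambda>\<omega>. (euler_rest s t \<omega>)\<^sup>2) \<le> C2 * (t - s)\<^sup>2"
    using euler_rest_bound[OF T] by blast
  obtain C0 where C0: "C0 \<ge> 0" "\<forall>t. 0 \<le> t \<and> t \<le> T \<longrightarrow> sq_integrable M (X t) \<and> expectation (\<lambda>\<omega>. (X t \<omega>)\<^sup>2) \<le> C0"
    using second_moment_bound[OF T] by blast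
  let ?c = "(2 * a\<^sup>2 + 2 * b\<^sup>2) * C" and ?d = "(2 * a\<^sup>2 + 2 * b\<^sup>2) * C0"
  let ?c' = "2 * \<sigma>\<^sup>2 * C2 + 2 * \<sigma>\<^sup>2 * ?d"
  have c0: "0 \<le> ?c" "0 \<le> ?c'" "0 \<le> ?d" using C C2 C0 by auto
  let ?R = "\<lambda>s t \<omega>. euler_rest s t \<omega> - \<sigma> * noise s \<omega> * ((B t \<omega> - B s \<omega>)\<^sup>2 - (t - s)) / 2"
  have "sq_integrable M (?R s t) \<and> expectation (\<lambda>\<omega>. (?R s t \<omega>)\<^sup>2) \<le> (2 * ?c + 2 * ?c') * (t - s) ^ 3"
    if st: "0 \<le> s" "s < t" "t \<le> T" for s t
  proof -
    let ?V = "\<lambda>r \<omega>. noise r \<omega> - noise s \<omega> - \<sigma> * noise s \<omega> * (B r \<omega> - B s \<omega>)"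
    have ns: "sq_integrable M (noise s)" by (rule linear_sq_integrable[OF st(1)])
    have "sq_integrable M (?R s t) \<and> expectation (\<lambda>\<omega>. (?R s t \<omega>)\<^sup>2) \<le>
      2 * (t - s)\<^sup>2 * (?c * (t - s)) + 2 * (t - s) * (?c' * (t - s)\<^sup>2)"
    proof (rule grid_sum_limit_bound[where U = "\<lambda>r \<omega>. drift r \<omega> - drift s \<omega>" and V = ?V, OF st(1,2)])
      fix r assume r: "s \<le> r" "r \<le> t"
      then have r': "r \<le> T" "0 \<le> r" using st by auto
      note L = linear_increment_bound[OF C(2,1) st(1) r(1) r'(1)]
      show "sq_integrable M (\<lambda>\<omega>. drift r \<omega> - drift s \<omega>)" by (rule L(1))
      have "expectation (\<lambda>\<omega>. (drift r \<omega> - drift s \<omega>)\<^sup>2) \<le> ?c * (r - s)" by (rule L(2))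
      also have "\<dots> \<le> ?c * (t - s)" using r c0 by (intro mult_left_mono) auto
      finally show "expectation (\<lambda>\<omega>. (drift r \<omega> - drift s \<omega>)\<^sup>2) \<le> ?c * (t - s)" .
      have Veq: "?V r \<omega> = \<sigma> * euler_rest s r \<omega> + (\<sigma> * (r - s)) * drift s \<omega>" for \<omega>
        unfolding euler_rest_def using \<rho> by (simp add: algebra_simps)
      have er: "sq_integrable M (euler_rest s r)" and ds: "sq_integrable M (drift s)"
        using euler_rest_sq[OF st(1) r(1)] linear_sq_integrable[OF st(1)] by auto
      show "sq_integrable M (?V r)" unfolding Veq by (intro sq_integrable_add sq_integrable_cmult er ds)
      have "expectation (\<lambda>\<omega>. (?V r \<omega>)\<^sup>2) \<le> 2 * \<sigma>\<^sup>2 * expectation (\<lambda>\<omega>. (euler_rest s r \<omega>)\<^sup>2) +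
        2 * (\<sigma> * (r - s))\<^sup>2 * expectation (\<lambda>\<omega>. (drift s \<omega>)\<^sup>2)"
        unfolding Veq by (rule expectation_linear_sq_le[OF er ds])
      also have "\<dots> \<le> 2 * \<sigma>\<^sup>2 * (C2 * (t - s)\<^sup>2) + 2 * (\<sigma> * (t - s))\<^sup>2 * ?d"
      proof (rule add_mono)
        have "expectation (\<lambda>\<omega>. (euler_rest s r \<omega>)\<^sup>2) \<le> C2 * (r - s)\<^sup>2"
        proof (cases "s = r")
          case True
          then show ?thesis by (simp add: euler_rest_def)
        next
          case False
          then show ?thesis using C2(2) st(1) r r'(1) by auto
        qed
        also have "\<dots> \<le> C2 * (t - s)\<^sup>2" using C2(1) r by (intro mult_left_mono power_mono) auto
        finally show "2 * \<sigma>\<^sup>2 * expectation (\<lambda>\<omega>. (euler_rest s r \<omega>)\<^sup>2) \<le> 2 * \<sigma>\<^sup>2 * (C2 * (t - s)\<^sup>2)"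
          by (intro mult_left_mono) auto
        have "expectation (\<lambda>\<omega>. (drift s \<omega>)\<^sup>2) \<le> ?d" by (rule linear_moment_bound[OF C0(2) st(1)]) (use st in simp)
        then show "2 * (\<sigma> * (r - s))\<^sup>2 * expectation (\<lambda>\<omega>. (drift s \<omega>)\<^sup>2) \<le> 2 * (\<sigma> * (t - s))\<^sup>2 * ?d"
          unfolding power_mult_distrib using r
          by (intro mult_mono power_mono mult_left_mono Bochner_Integration.integral_nonneg mult_nonneg_nonneg) auto
      qed
      also have "\<dots> = ?c' * (t - s)\<^sup>2" by (simp only: power_mult_distrib distrib_right distrib_left mult_ac)
      finally show "expectation (\<lambda>\<omega>. (?V r \<omega>)\<^sup>2) \<le> ?c' * (t - s)\<^sup>2" .
      show "?V r \<in> borel_measurable (F r)"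
        using noise_measurable_F[OF r'(2) order_refl] noise_measurable_F[OF st(1) r(1)]
          B_measurable_F[OF st(1) r(1)] B_measurable[OF r'(2)]
        by (intro borel_measurable_diff borel_measurable_times borel_measurable_const)
    next
      have "tendsto_in_prob M (\<lambda>n \<omega>. ((\<Sum>i<n. (drift (grid_pt s t n i) \<omega> - drift s \<omega>) * ((t - s) / real n)) +
        (\<Sum>i<n. (noise (grid_pt s t n i) \<omega> - noise s \<omega>) * grid_incr s t n i \<omega>)) +
        (\<Sum>i<n. ((- \<sigma>) * noise s \<omega>) * (B (grid_pt s t n i) \<omega> - B s \<omega>) * grid_incr s t n i \<omega>))
        (\<lambda>\<omega>. euler_rest s t \<omega> + ((- \<sigma>) * noise s \<omega>) * ((B t \<omega> - B s \<omega>)\<^sup>2 - (t - s)) / 2)"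
      proof (intro tendsto_in_prob_add prob_space_axioms euler_rest_sum_tendsto st iterated_ito_sum_tendsto)
        show "(\<lambda>\<omega>. (- \<sigma>) * noise s \<omega>) \<in> borel_measurable (F s)"
          by (rule borel_measurable_times[OF borel_measurable_const noise_measurable_F[OF st(1) order_refl]])
        show "sq_integrable M (\<lambda>\<omega>. (- \<sigma>) * noise s \<omega>)" by (rule sq_integrable_cmult[OF ns])
      qed
      moreover have "((\<Sum>i<n. (drift (grid_pt s t n i) \<omega> - drift s \<omega>) * ((t - s) / real n)) +
        (\<Sum>i<n. (noise (grid_pt s t n i) \<omega> - noise s \<omega>) * grid_incr s t n i \<omega>)) +
        (\<Sum>i<n. ((- \<sigma>) * noise s \<omega>) * (B (grid_pt s t n i) \<omega> - B s \<omega>) * grid_incr s t n i \<omega>)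
        = (\<Sum>i<n. (drift (grid_pt s t n i) \<omega> - drift s \<omega>) * ((t - s) / real n)) +
        (\<Sum>i<n. ?V (grid_pt s t n i) \<omega> * grid_incr s t n i \<omega>)" for n \<omega>
        unfolding add.assoc sum.distrib[symmetric] distrib_right[symmetric] by simp
      moreover have "(\<lambda>\<omega>. euler_rest s t \<omega> + ((- \<sigma>) * noise s \<omega>) * ((B t \<omega> - B s \<omega>)\<^sup>2 - (t - s)) / 2) = ?R s t"
        by (intro ext) simp
      ultimately show "tendsto_in_prob M (\<lambda>n \<omega>. (\<Sum>i<n. (drift (grid_pt s t n i) \<omega> - drift s \<omega>) * ((t - s) / real n)) +
        (\<Sum>i<n. ?V (grid_pt s t n i) \<omega> * grid_incr s t n i \<omega>)) (?R s t)"
        by (simp only:)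
      have m: "euler_rest s t \<in> borel_measurable M" "noise s \<in> borel_measurable M" "B t \<in> borel_measurable M" "B s \<in> borel_measurable M"
        using euler_rest_sq[of s t] ns st by (auto simp: sq_integrable_def)
      show "?R s t \<in> borel_measurable M"
        using m by (intro borel_measurable_diff borel_measurable_times borel_measurable_const borel_measurable_divide borel_measurable_power)
    qed
    moreover have "2 * (t - s)\<^sup>2 * (?c * (t - s)) + 2 * (t - s) * (?c' * (t - s)\<^sup>2) = (2 * ?c + 2 * ?c') * (t - s) ^ 3"
      by (simp only: power2_eq_square power3_eq_cube distrib_right distrib_left mult_ac)
    ultimately show ?thesis by simp
  qed
  moreover have "0 \<le> 2 * ?c + 2 * ?c'" using c0 by simp
  ultimately show ?thesis by blast
qed

end

section \<open>One-step inequalities\<close>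

text \<open>The mixed term of P and N is split, while 2 x N is kept: its expectation vanishes by
  orthogonality. With w = sqrt h, P^2 = O(h^2) and N^2 = O(h) in mean, the weights cost only
  O(h^(3/2)).\<close>

lemma young_square_sum:
  fixes x P N w :: real
  assumes "0 < w"
  shows "(x + P + N)\<^sup>2 \<le> x\<^sup>2 + 2 * x * P + 2 * x * N + (1 + 1 / w) * P\<^sup>2 + (1 + w) * N\<^sup>2"
proof -
  have "2 * P * N \<le> P\<^sup>2 / w + w * N\<^sup>2" using two_mult_le_weighted[OF assms, of N P] by (simp add: mult_ac)
  moreover have "(x + P + N)\<^sup>2 = x\<^sup>2 + 2 * x * P + 2 * x * N + P\<^sup>2 + N\<^sup>2 + 2 * P * N"
    by (simp add: power2_eq_square algebra_simps)
  ultimately show ?thesis by (simp add: distrib_right)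
qed

lemma young_square_shift:
  fixes x d w :: real
  assumes "0 < w"
  shows "(x + d)\<^sup>2 \<le> (1 + w) * x\<^sup>2 + (1 + 1 / w) * d\<^sup>2"
proof -
  have "2 * x * d \<le> w * x\<^sup>2 + d\<^sup>2 / w" by (rule two_mult_le_weighted[OF assms])
  moreover have "(x + d)\<^sup>2 = x\<^sup>2 + d\<^sup>2 + 2 * x * d" by (simp add: power2_sum)
  ultimately show ?thesis by (simp add: distrib_right)
qed

section \<open>One-step inequalities for the absolute value and the square of the solution\<close>

context pantograph
begin

text \<open>The Milstein factor depends only on the increment after t, so independence replaces it
  on A by its mean 1 + a h; its quadratic correction has mean zero. The present value is thus
  treated without loss, and the triangle inequality is spent on the delayed term and the remainder
  only.\<close>

lemma abs_one_step:
  assumes T: "0 \<le> T" and \<rho>: "\<rho> = 0"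
  shows "\<exists>C\<ge>0. \<exists>h0>0. \<forall>t h A. 0 \<le> t \<and> 0 < h \<and> h \<le> h0 \<and> t + h \<le> T \<and> A \<in> sets (F t) \<longrightarrow>
    expectation (\<lambda>\<omega>. indicator A \<omega> * \<bar>X (t + h) \<omega>\<bar>) \<le>
      (1 + a * h) * expectation (\<lambda>\<omega>. indicator A \<omega> * \<bar>X t \<omega>\<bar>) +
      \<bar>b\<bar> * h * expectation (\<lambda>\<omega>. indicator A \<omega> * \<bar>X (q * t) \<omega>\<bar>) + C * (h * sqrt h)"
proof -
  let ?R = "\<lambda>s t \<omega>. euler_rest s t \<omega> - \<sigma> * noise s \<omega> * ((B t \<omega> - B s \<omega>)\<^sup>2 - (t - s)) / 2"
  obtain C where C: "C \<ge> 0" "\<forall>s t. 0 \<le> s \<and> s < t \<and> t \<le> T \<longrightarrow> sq_integrable M (?R s t) \<and>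
      expectation (\<lambda>\<omega>. (?R s t \<omega>)\<^sup>2) \<le> C * (t - s) ^ 3"
    using milstein_rest_bound[OF T \<rho>] by blast
  define k where "k = \<bar>a - \<sigma>\<^sup>2 / 2\<bar>"
  \<comment> \<open>Chosen so that k h \<le> 1/2, which is what nonnegativity of G requires.\<close>
  define h0 where "h0 = 1 / (2 * (k + 1))"
  have k: "0 \<le> k" by (simp add: k_def)
  have h0: "0 < h0" using k by (simp add: h0_def)
  have "expectation (\<lambda>\<omega>. indicator A \<omega> * \<bar>X (t + h) \<omega>\<bar>) \<le>
      (1 + a * h) * expectation (\<lambda>\<omega>. indicator A \<omega> * \<bar>X t \<omega>\<bar>) +
      \<bar>b\<bar> * h * expectation (\<lambda>\<omega>. indicator A \<omega> * \<bar>X (q * t) \<omega>\<bar>) + (1 + C) * (h * sqrt h)"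
    if H: "0 \<le> t" "0 < h" "h \<le> h0" "t + h \<le> T" "A \<in> sets (F t)" for t h A
  proof -
    let ?D = "\<lambda>\<omega>. B (t + h) \<omega> - B t \<omega>"
    define G where "G x = (1 + a * h + \<sigma> * x + \<sigma>\<^sup>2 / 2 * (x\<^sup>2 - h))" for x :: real
    let ?W = "?R t (t + h)"
    have tt: "t < t + h" using H by simp
    have A: "A \<in> events" using F_sets_M H by blast
    have W: "sq_integrable M ?W" "expectation (\<lambda>\<omega>. (?W \<omega>)\<^sup>2) \<le> C * h ^ 3"
      using C(2)[rule_format, of t "t + h"] H by auto
    have G0: "0 \<le> G x" for x
    proof -
      have "k * h \<le> k * h0" using k H by (intro mult_left_mono) auto
      also have "\<dots> \<le> 1 / 2" using k by (simp add: h0_def divide_le_eq)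
      finally have kh: "k * h \<le> 1 / 2" .
      have "\<bar>(a - \<sigma>\<^sup>2 / 2) * h\<bar> = k * h" using H by (simp add: k_def abs_mult)
      then have "-1/2 \<le> (a - \<sigma>\<^sup>2 / 2) * h" using kh by linarith
      \<comment> \<open>Completing the square: the correction term supplies half of a square, and
        the rest stays near 1/2 for small h whatever the size of the increment.\<close>
      moreover have "G x = 1/2 * (1 + \<sigma> * x)\<^sup>2 + 1/2 + (a - \<sigma>\<^sup>2 / 2) * h"
        by (simp add: G_def power2_eq_square field_simps)
      moreover have "0 \<le> 1/2 * (1 + \<sigma> * x)\<^sup>2" by simp
      ultimately show ?thesis by linarith
    qed
    have Xdec: "X (t + h) \<omega> = X t \<omega> * G (?D \<omega>) + b * h * X (q * t) \<omega> + ?W \<omega>" for \<omega>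
      unfolding euler_rest_def G_def using \<rho> by (simp add: power2_eq_square field_simps)
    have pw: "indicator A \<omega> * \<bar>X (t + h) \<omega>\<bar> \<le> (indicator A \<omega> * \<bar>X t \<omega>\<bar>) * G (?D \<omega>) +
      \<bar>b\<bar> * h * (indicator A \<omega> * \<bar>X (q * t) \<omega>\<bar>) + (h * sqrt h + (?W \<omega>)\<^sup>2 / (h * sqrt h))" for \<omega>
    proof -
      have "\<bar>X (t + h) \<omega>\<bar> \<le> \<bar>X t \<omega> * G (?D \<omega>)\<bar> + \<bar>b * h * X (q * t) \<omega>\<bar> + \<bar>?W \<omega>\<bar>"
        unfolding Xdec by linarith
      also have "\<dots> = \<bar>X t \<omega>\<bar> * G (?D \<omega>) + \<bar>b\<bar> * h * \<bar>X (q * t) \<omega>\<bar> + \<bar>?W \<omega>\<bar>"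
        using G0 H by (simp only: abs_mult abs_of_nonneg[OF G0] abs_of_pos[OF H(2)])
      finally have 1: "\<bar>X (t + h) \<omega>\<bar> \<le> \<bar>X t \<omega>\<bar> * G (?D \<omega>) + \<bar>b\<bar> * h * \<bar>X (q * t) \<omega>\<bar> + \<bar>?W \<omega>\<bar>" .
      have hs: "0 < h * sqrt h" using H by simp
      \<comment> \<open>The remainder has mean square O(h^3); the weight h sqrt h turns this into a
        mean of order h^(3/2).\<close>
      have 2: "2 * \<bar>?W \<omega>\<bar> \<le> h * sqrt h + (?W \<omega>)\<^sup>2 / (h * sqrt h)"
        using two_mult_abs_le_weighted[OF hs, of 1 "?W \<omega>"] by simp
      have 3: "0 \<le> h * sqrt h + (?W \<omega>)\<^sup>2 / (h * sqrt h)" using hs by (intro add_nonneg_nonneg divide_nonneg_nonneg) auto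
      have 4: "\<bar>X (t + h) \<omega>\<bar> \<le> \<bar>X t \<omega>\<bar> * G (?D \<omega>) + \<bar>b\<bar> * h * \<bar>X (q * t) \<omega>\<bar> + (h * sqrt h + (?W \<omega>)\<^sup>2 / (h * sqrt h))"
        using 1 2 abs_ge_zero[of "?W \<omega>"] by linarith
      show ?thesis
      proof (cases "\<omega> \<in> A")
        case True
        then show ?thesis using 4 by (simp only: indicator_simps mult_1)
      next
        case False
        then show ?thesis using 3 by simp
      qed
    qed
    have iX: "integrable M (\<lambda>\<omega>. indicator A \<omega> * \<bar>X s \<omega>\<bar>)" if "0 \<le> s" for s
      using integrable_mult_indicator[OF A integrable_abs[OF sq_integrable_integrable[OF X_sq_integrable[OF that]]]] by simp
    have m: "(\<lambda>\<omega>. indicator A \<omega> * \<bar>X t \<omega>\<bar>) \<in> borel_measurable (F t)"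
      using H X_measurable_F[of t t] by (intro borel_measurable_times borel_measurable_indicator borel_measurable_abs) auto
    have Gm: "G \<in> borel_measurable borel" unfolding G_def[abs_def] by measurable
    note mom = incr_moments[OF H(1) tt]
    have i1: "integrable M ?D" and i2: "integrable M (\<lambda>\<omega>. (?D \<omega>)\<^sup>2)" using mom(1)[of 1] mom(1)[of 2] by simp_all
    have iG: "integrable M (\<lambda>\<omega>. G (?D \<omega>))"
      unfolding G_def by (intro Bochner_Integration.integrable_add Bochner_Integration.integrable_diff integrable_mult_right i1 i2 integrable_const)
    have EG: "expectation (\<lambda>\<omega>. G (?D \<omega>)) = 1 + a * h"
      unfolding G_def using i1 i2 mom(2,3) by (simp add: prob_space)
    note ind = indep_incr_mult[OF H(1) tt m Gm iX[OF H(1)] iG]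
    have iW: "integrable M (\<lambda>\<omega>. (?W \<omega>)\<^sup>2 / (h * sqrt h))"
      using sq_integrable_square[OF W(1)] by (intro integrable_divide)
    have iq: "integrable M (\<lambda>\<omega>. \<bar>b\<bar> * h * (indicator A \<omega> * \<bar>X (q * t) \<omega>\<bar>))"
      using iX[of "q * t"] qs(1)[OF H(1)] by (intro integrable_mult_right)
    have c: "integrable M (\<lambda>\<omega>. h * sqrt h)" by simp
    have "expectation (\<lambda>\<omega>. indicator A \<omega> * \<bar>X (t + h) \<omega>\<bar>) \<le> expectation (\<lambda>\<omega>. (indicator A \<omega> * \<bar>X t \<omega>\<bar>) * G (?D \<omega>) +
      \<bar>b\<bar> * h * (indicator A \<omega> * \<bar>X (q * t) \<omega>\<bar>) + (h * sqrt h + (?W \<omega>)\<^sup>2 / (h * sqrt h)))"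
      using H by (intro integral_mono iX pw Bochner_Integration.integrable_add ind(1) iq iW c) auto
    also have "\<dots> = expectation (\<lambda>\<omega>. (indicator A \<omega> * \<bar>X t \<omega>\<bar>) * G (?D \<omega>)) +
      expectation (\<lambda>\<omega>. \<bar>b\<bar> * h * (indicator A \<omega> * \<bar>X (q * t) \<omega>\<bar>)) + (expectation (\<lambda>\<omega>. h * sqrt h) + expectation (\<lambda>\<omega>. (?W \<omega>)\<^sup>2 / (h * sqrt h)))"
      by (simp only: Bochner_Integration.integral_add ind(1) iq iW c Bochner_Integration.integrable_add)
    also have "\<dots> = (1 + a * h) * expectation (\<lambda>\<omega>. indicator A \<omega> * \<bar>X t \<omega>\<bar>) +
      \<bar>b\<bar> * h * expectation (\<lambda>\<omega>. indicator A \<omega> * \<bar>X (q * t) \<omega>\<bar>) + (h * sqrt h + expectation (\<lambda>\<omega>. (?W \<omega>)\<^sup>2) / (h * sqrt h))"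
      unfolding ind(2) EG by (simp add: prob_space mult.commute)
    also have "expectation (\<lambda>\<omega>. (?W \<omega>)\<^sup>2) / (h * sqrt h) \<le> C * (h * sqrt h)"
    proof -
      have "h ^ 3 = (h * sqrt h) * (h * sqrt h)"
        using H real_sqrt_mult_self[of h] by (simp add: power3_eq_cube mult_ac)
      then have "expectation (\<lambda>\<omega>. (?W \<omega>)\<^sup>2) \<le> C * (h * sqrt h) * (h * sqrt h)" using W(2) by (simp only: mult.assoc)
      then show ?thesis using H by (simp only: pos_divide_le_eq mult_pos_pos real_sqrt_gt_zero)
    qed
    finally show ?thesis by (simp add: distrib_right)
  qed
  moreover have "0 \<le> 1 + C" using C by simp
  ultimately show ?thesis using h0 by blast
qed

text \<open>Ito's formula for X^2 over one step, as an inequality tested on A. In the expanded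
  square the noise sum is orthogonal to the value at t, and replacing coefficients at grid points by
  those at t costs O(h^(3/2)).\<close>

lemma square_one_step:
  assumes T: "0 \<le> T"
  shows "\<exists>C\<ge>0. \<forall>t h A. 0 \<le> t \<and> 0 < h \<and> h \<le> 1 \<and> t + h \<le> T \<and> A \<in> sets (F t) \<longrightarrow>
    expectation (\<lambda>\<omega>. indicator A \<omega> * (X (t + h) \<omega>)\<^sup>2) \<le>
      expectation (\<lambda>\<omega>. indicator A \<omega> * (X t \<omega>)\<^sup>2) +
      h * expectation (\<lambda>\<omega>. indicator A \<omega> * (2 * X t \<omega> * drift t \<omega> + (noise t \<omega>)\<^sup>2)) + C * (h * sqrt h)"
proof -
  obtain C0 where C0: "C0 \<ge> 0" "\<forall>t. 0 \<le> t \<and> t \<le> T \<longrightarrow> sq_integrable M (X t) \<and> expectation (\<lambda>\<omega>. (X t \<omega>)\<^sup>2) \<le> C0"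
    using second_moment_bound[OF T] by blast
  obtain C1 where C1: "C1 \<ge> 0" "\<forall>s t. 0 \<le> s \<and> s < t \<and> t \<le> T \<longrightarrow> expectation (\<lambda>\<omega>. (X t \<omega> - X s \<omega>)\<^sup>2) \<le> C1 * (t - s)"
    using increment_bound[OF T] by blast
  define fa where "fa = (2 * a\<^sup>2 + 2 * b\<^sup>2) * C0"
  define fb where "fb = (2 * \<sigma>\<^sup>2 + 2 * \<rho>\<^sup>2) * C0"
  define ga where "ga = (2 * a\<^sup>2 + 2 * b\<^sup>2) * C1"
  define gb where "gb = (2 * \<sigma>\<^sup>2 + 2 * \<rho>\<^sup>2) * C1"
  have nn: "0 \<le> fa" "0 \<le> fb" "0 \<le> ga" "0 \<le> gb" using C0 C1 by (auto simp: fa_def fb_def ga_def gb_def)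
  define C where "C = (C0 + ga) + 2 * fa + (fb + 2 * (fb + 2 * gb))"
  have "expectation (\<lambda>\<omega>. indicator A \<omega> * (X (t + h) \<omega>)\<^sup>2) \<le>
      expectation (\<lambda>\<omega>. indicator A \<omega> * (X t \<omega>)\<^sup>2) +
      h * expectation (\<lambda>\<omega>. indicator A \<omega> * (2 * X t \<omega> * drift t \<omega> + (noise t \<omega>)\<^sup>2)) + C * (h * sqrt h)"
    if H: "0 \<le> t" "0 < h" "h \<le> 1" "t + h \<le> T" "A \<in> sets (F t)" for t h A
  proof -
    let ?i = "indicator A :: 'a \<Rightarrow> real"
    \<comment> \<open>Changes of coefficients over the step have mean square O(h). With the weight
      sqrt h in Young's inequality both w and h / w are of order sqrt h.\<close>
    define w where "w = sqrt h"
    have w: "0 < w" "w \<le> 1" "w * w = h" using H by (auto simp: w_def)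
    have tt: "t < t + h" using H by simp
    have A: "A \<in> events" using F_sets_M H by blast
    have Xt: "sq_integrable M (X t)" by (rule X_sq_integrable[OF H(1)])
    have nt: "sq_integrable M (noise t)" and dt: "sq_integrable M (drift t)"
      by (rule linear_sq_integrable[OF H(1)])+
    let ?x = "\<lambda>\<omega>. ?i \<omega> * X t \<omega>"
    have xs: "sq_integrable M ?x" by (rule sq_integrable_indicator_mult[OF Xt A])
    have xm: "?x \<in> borel_measurable (F t)"
      using H X_measurable_F[of t t] by (intro borel_measurable_times borel_measurable_indicator) auto
    let ?E1 = "expectation (\<lambda>\<omega>. ?i \<omega> * (X t \<omega>)\<^sup>2)" and ?E2 = "expectation (\<lambda>\<omega>. ?x \<omega> * drift t \<omega>)"
      and ?E3 = "expectation (\<lambda>\<omega>. (?i \<omega> * noise t \<omega>)\<^sup>2)"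
    let ?bd = "?E1 + h * (2 * ?E2 + w * (C0 + ga)) + (1 + 1 / w) * (h\<^sup>2 * fa) + (1 + w) * (h * (?E3 + w * (fb + 2 * gb)))"
    have D: "(\<lambda>\<omega>. X (t + h) \<omega> - X t \<omega>) \<in> borel_measurable M" using H by (intro borel_measurable_diff X_measurable) auto
    have "integrable M (\<lambda>\<omega>. ?i \<omega> * (X t \<omega> + (X (t + h) \<omega> - X t \<omega>))\<^sup>2) \<and>
      (LINT \<omega>|M. ?i \<omega> * (X t \<omega> + (X (t + h) \<omega> - X t \<omega>))\<^sup>2) \<le> ?bd"
    proof (rule Fatou_in_prob[OF prob_space_axioms euler_sum_tendsto[OF H(1) tt] _ D,
        where g = "\<lambda>\<omega> z. ?i \<omega> * (X t \<omega> + z)\<^sup>2" and c = "\<lambda>_. ?bd"])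
      show "euler_sum t (t + h) n \<in> borel_measurable M" for n by (rule euler_sum_measurable[OF H(1) tt])
      show "(\<lambda>\<omega>. ?i \<omega> * (X t \<omega> + (X (t + h) \<omega> - X t \<omega>))\<^sup>2) \<in> borel_measurable M"
        using H A by (auto intro!: borel_measurable_times)
      show "\<forall>\<^sub>F n in sequentially. integrable M (\<lambda>\<omega>. ?i \<omega> * (X t \<omega> + euler_sum t (t + h) n \<omega>)\<^sup>2) \<and>
        (LINT \<omega>|M. ?i \<omega> * (X t \<omega> + euler_sum t (t + h) n \<omega>)\<^sup>2) \<le> ?bd"
        using eventually_gt_at_top[of 0]
      proof eventually_elim
        case (elim n)
        let ?g = "grid_pt t (t + h) n" and ?d = "(t + h - t) / real n"
        let ?P = "\<lambda>\<omega>. \<Sum>i<n. drift (?g i) \<omega> * ?d"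
        \<comment> \<open>The indicator of A is put into the coefficients. As A belongs to the past
          of t, they remain adapted: the product with \<open>X t\<close> has mean zero, and the
          isometry sees the noise on A only.\<close>
        let ?N = "\<lambda>\<omega>. \<Sum>i<n. (?i \<omega> * noise (?g i) \<omega>) * (B (?g (Suc i)) \<omega> - B (?g i) \<omega>)"
        let ?N' = "\<lambda>\<omega>. \<Sum>i<n. noise (?g i) \<omega> * (B (?g (Suc i)) \<omega> - B (?g i) \<omega>)"
        have d: "0 \<le> ?d" using H by simp
        have g: "t \<le> ?g i" "?g i \<le> T" "0 \<le> ?g i" "?g i - t \<le> h" if "i < n" for i
          using grid_pt_bounds[OF tt, of i n] that H by auto
        have ds: "sq_integrable M (drift (?g i))" and ns: "sq_integrable M (noise (?g i))" if "i < n" for i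
          by (rule linear_sq_integrable[OF g(3)[OF that]])+
        have dm: "expectation (\<lambda>\<omega>. (drift (?g i) \<omega>)\<^sup>2) \<le> fa" if "i < n" for i
          unfolding fa_def by (rule linear_moment_bound[OF C0(2) g(3)[OF that] g(2)[OF that]])
        have dinc: "sq_integrable M (\<lambda>\<omega>. drift (?g i) \<omega> - drift t \<omega>)"
           "expectation (\<lambda>\<omega>. (drift (?g i) \<omega> - drift t \<omega>)\<^sup>2) \<le> ga * h"
          and ninc: "sq_integrable M (\<lambda>\<omega>. noise (?g i) \<omega> - noise t \<omega>)"
           "expectation (\<lambda>\<omega>. (noise (?g i) \<omega> - noise t \<omega>)\<^sup>2) \<le> gb * h" if i: "i < n" for i
        proof -
          note L = linear_increment_bound[OF C1(2,1) H(1) g(1)[OF i] g(2)[OF i]]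
          show "sq_integrable M (\<lambda>\<omega>. drift (?g i) \<omega> - drift t \<omega>)" "sq_integrable M (\<lambda>\<omega>. noise (?g i) \<omega> - noise t \<omega>)"
            by (rule L(1))+
          show "expectation (\<lambda>\<omega>. (drift (?g i) \<omega> - drift t \<omega>)\<^sup>2) \<le> ga * h"
            unfolding ga_def by (rule order_trans[OF L(2) mult_left_mono[OF g(4)[OF i]]]) (use C1 in auto)
          show "expectation (\<lambda>\<omega>. (noise (?g i) \<omega> - noise t \<omega>)\<^sup>2) \<le> gb * h"
            unfolding gb_def by (rule order_trans[OF L(2) mult_left_mono[OF g(4)[OF i]]]) (use C1 in auto)
        qed
        have Ps: "sq_integrable M ?P" by (rule grid_drift_sum_sq[OF ds])
        have EP: "expectation (\<lambda>\<omega>. (?P \<omega>)\<^sup>2) \<le> h\<^sup>2 * fa"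
          using grid_drift_sum_le_const[OF tt elim ds dm] by simp
        have Vm: "(\<lambda>\<omega>. ?i \<omega> * noise (?g i) \<omega>) \<in> borel_measurable (F (?g i))" if "i < n" for i
          using noise_measurable_F[OF g(3)[OF that] order_refl] F_mono[OF H(1) g(1)[OF that]] H(5)
          by (intro borel_measurable_times borel_measurable_indicator) auto
        have Vs: "sq_integrable M (\<lambda>\<omega>. ?i \<omega> * noise (?g i) \<omega>)" if "i < n" for i
          by (rule sq_integrable_indicator_mult[OF ns[OF that] A])
        have Ns: "sq_integrable M ?N" by (rule grid_noise_sum_sq[OF H(1) tt elim Vm Vs])
        have orth: "expectation (\<lambda>\<omega>. X t \<omega> * ?N \<omega>) = 0"
        proof (rule grid_noise_sum_orth[OF H(1) tt elim Vm Vs _ Xt])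
          show "X t \<in> borel_measurable (F t)" by (rule X_measurable_F[OF H(1) order_refl])
        qed
        have EV: "expectation (\<lambda>\<omega>. (?i \<omega> * noise (?g i) \<omega>)\<^sup>2) \<le> ?E3 + w * (fb + 2 * gb)" if i: "i < n" for i
        proof -
          have nts: "sq_integrable M (\<lambda>\<omega>. ?i \<omega> * noise t \<omega>)" by (rule sq_integrable_indicator_mult[OF nt A])
          have "expectation (\<lambda>\<omega>. (?i \<omega> * noise (?g i) \<omega>)\<^sup>2) \<le>
            expectation (\<lambda>\<omega>. (1 + w) * (?i \<omega> * noise t \<omega>)\<^sup>2 + (1 + 1 / w) * (noise (?g i) \<omega> - noise t \<omega>)\<^sup>2)"
          proof (rule integral_mono)
            show "integrable M (\<lambda>\<omega>. (?i \<omega> * noise (?g i) \<omega>)\<^sup>2)" by (rule sq_integrable_square[OF Vs[OF i]])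
            show "integrable M (\<lambda>\<omega>. (1 + w) * (?i \<omega> * noise t \<omega>)\<^sup>2 + (1 + 1 / w) * (noise (?g i) \<omega> - noise t \<omega>)\<^sup>2)"
              by (intro Bochner_Integration.integrable_add integrable_mult_right sq_integrable_square nts ninc(1)[OF i])
            show "(?i \<omega> * noise (?g i) \<omega>)\<^sup>2 \<le> (1 + w) * (?i \<omega> * noise t \<omega>)\<^sup>2 + (1 + 1 / w) * (noise (?g i) \<omega> - noise t \<omega>)\<^sup>2" for \<omega>
              using young_square_shift[OF w(1), of "noise t \<omega>" "noise (?g i) \<omega> - noise t \<omega>"] w(1)
              by (cases "\<omega> \<in> A") simp_all
          qed
          also have "\<dots> = (1 + w) * ?E3 + (1 + 1 / w) * expectation (\<lambda>\<omega>. (noise (?g i) \<omega> - noise t \<omega>)\<^sup>2)"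
            using sq_integrable_square[OF nts] sq_integrable_square[OF ninc(1)[OF i]] by simp
          also have "\<dots> \<le> (1 + w) * ?E3 + (1 + 1 / w) * (gb * h)"
            using ninc(2)[OF i] w by (intro add_left_mono mult_left_mono) auto
          also have "(1 + 1 / w) * (gb * h) = gb * (h + w)" using w by (simp add: field_simps flip: w(3))
          also have "gb * (h + w) \<le> gb * (2 * w)"
            using w nn mult_left_le_one_le[of w w] by (intro mult_left_mono) auto
          also have "?E3 \<le> fb"
          proof -
            have "?E3 \<le> expectation (\<lambda>\<omega>. (noise t \<omega>)\<^sup>2)"
              by (rule integral_mono[OF sq_integrable_square[OF nts] sq_integrable_square[OF nt]]) (auto simp: indicator_def)
            also have "\<dots> \<le> fb" unfolding fb_def by (rule linear_moment_bound[OF C0(2) H(1)]) (use H in simp)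
            finally show ?thesis .
          qed
          then have "(1 + w) * ?E3 + gb * (2 * w) \<le> ?E3 + w * (fb + 2 * gb)"
            using mult_left_mono[of ?E3 fb w] w by (simp add: algebra_simps)
          finally show ?thesis by simp
        qed
        have EN: "expectation (\<lambda>\<omega>. (?N \<omega>)\<^sup>2) \<le> h * (?E3 + w * (fb + 2 * gb))"
          using grid_noise_sum_var_le[OF H(1) tt elim Vm Vs EV] by simp
        have xd: "integrable M (\<lambda>\<omega>. ?x \<omega> * drift t \<omega>)" by (rule sq_integrable_mult[OF xs dt])
        have EXP: "2 * expectation (\<lambda>\<omega>. ?x \<omega> * ?P \<omega>) \<le> h * (2 * ?E2 + w * (C0 + ga))"
        proof -
          have each: "2 * expectation (\<lambda>\<omega>. ?x \<omega> * drift (?g i) \<omega>) \<le> 2 * ?E2 + w * (C0 + ga)" if i: "i < n" for i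
          proof -
            have "2 * expectation (\<lambda>\<omega>. ?x \<omega> * drift (?g i) \<omega>) = expectation (\<lambda>\<omega>. 2 * (?x \<omega> * drift (?g i) \<omega>))" by simp
            also have "\<dots> \<le> expectation (\<lambda>\<omega>. 2 * (?x \<omega> * drift t \<omega>) + (w * (X t \<omega>)\<^sup>2 + (drift (?g i) \<omega> - drift t \<omega>)\<^sup>2 / w))"
            proof (rule integral_mono)
              show "integrable M (\<lambda>\<omega>. 2 * (?x \<omega> * drift (?g i) \<omega>))"
                by (rule integrable_mult_right[OF sq_integrable_mult[OF xs ds[OF i]]])
              show "integrable M (\<lambda>\<omega>. 2 * (?x \<omega> * drift t \<omega>) + (w * (X t \<omega>)\<^sup>2 + (drift (?g i) \<omega> - drift t \<omega>)\<^sup>2 / w))"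
                by (intro Bochner_Integration.integrable_add integrable_mult_right xd integrable_divide sq_integrable_square Xt dinc(1)[OF i])
              fix \<omega>
              have "2 * (?x \<omega> * (drift (?g i) \<omega> - drift t \<omega>)) \<le> w * (?x \<omega>)\<^sup>2 + (drift (?g i) \<omega> - drift t \<omega>)\<^sup>2 / w"
                using two_mult_le_weighted[OF w(1), of "?x \<omega>" "drift (?g i) \<omega> - drift t \<omega>"] by (simp only: mult.assoc)
              also have "w * (?x \<omega>)\<^sup>2 \<le> w * (X t \<omega>)\<^sup>2" using w by (intro mult_left_mono) (auto simp: indicator_def)
              finally show "2 * (?x \<omega> * drift (?g i) \<omega>) \<le> 2 * (?x \<omega> * drift t \<omega>) + (w * (X t \<omega>)\<^sup>2 + (drift (?g i) \<omega> - drift t \<omega>)\<^sup>2 / w)"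
                by (simp add: right_diff_distrib)
            qed
            also have "\<dots> = 2 * ?E2 + (w * expectation (\<lambda>\<omega>. (X t \<omega>)\<^sup>2) + expectation (\<lambda>\<omega>. (drift (?g i) \<omega> - drift t \<omega>)\<^sup>2) / w)"
              using xd sq_integrable_square[OF Xt] sq_integrable_square[OF dinc(1)[OF i]] by simp
            also have "\<dots> \<le> 2 * ?E2 + (w * C0 + (ga * h) / w)"
              using C0(2) H dinc(2)[OF i] w by (intro add_left_mono add_mono mult_left_mono divide_right_mono) auto
            also have "(ga * h) / w = w * ga" using w by (simp add: field_simps flip: w(3))
            finally show ?thesis by (simp add: algebra_simps)
          qed
          have "2 * expectation (\<lambda>\<omega>. ?x \<omega> * ?P \<omega>) = 2 * expectation (\<lambda>\<omega>. \<Sum>i<n. (?x \<omega> * drift (?g i) \<omega>) * ?d)"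
            by (simp only: sum_distrib_left mult.assoc)
          also have "\<dots> = 2 * (\<Sum>i<n. expectation (\<lambda>\<omega>. (?x \<omega> * drift (?g i) \<omega>) * ?d))"
            by (subst Bochner_Integration.integral_sum) (auto intro!: integrable_mult_left sq_integrable_mult[OF xs ds])
          also have "\<dots> = (\<Sum>i<n. (2 * expectation (\<lambda>\<omega>. ?x \<omega> * drift (?g i) \<omega>)) * ?d)"
            unfolding integral_mult_left_zero by (simp only: sum_distrib_left mult.assoc)
          also have "\<dots> \<le> (\<Sum>i<n. (2 * ?E2 + w * (C0 + ga)) * ?d)"
            by (intro sum_mono mult_right_mono each d) auto
          also have "\<dots> = h * (2 * ?E2 + w * (C0 + ga))" using elim by simp
          finally show ?thesis .
        qed
        let ?r = "\<lambda>\<omega>. ?i \<omega> * (X t \<omega>)\<^sup>2 + 2 * (?x \<omega> * ?P \<omega>) + 2 * (X t \<omega> * ?N \<omega>) + (1 + 1 / w) * (?P \<omega>)\<^sup>2 + (1 + w) * (?N \<omega>)\<^sup>2"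
        have i1: "integrable M (\<lambda>\<omega>. ?i \<omega> * (X t \<omega>)\<^sup>2)"
          using integrable_mult_indicator[OF A sq_integrable_square[OF Xt]] by simp
        note ii = i1 integrable_mult_right[of 2, OF sq_integrable_mult[OF xs Ps]]
          integrable_mult_right[of 2, OF sq_integrable_mult[OF Xt Ns]]
          integrable_mult_right[of "1 + 1 / w", OF sq_integrable_square[OF Ps]] integrable_mult_right[of "1 + w", OF sq_integrable_square[OF Ns]]
        have ir: "integrable M ?r" by (intro Bochner_Integration.integrable_add ii)
        have pw: "?i \<omega> * (X t \<omega> + euler_sum t (t + h) n \<omega>)\<^sup>2 \<le> ?r \<omega>" for \<omega>
        proof (cases "\<omega> \<in> A")
          case True
          have "euler_sum t (t + h) n \<omega> = ?P \<omega> + ?N' \<omega>" unfolding euler_sum_def ..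
          moreover have "?N \<omega> = ?N' \<omega>" using True by simp
          ultimately have "X t \<omega> + euler_sum t (t + h) n \<omega> = X t \<omega> + ?P \<omega> + ?N \<omega>" by simp
          then have "(X t \<omega> + euler_sum t (t + h) n \<omega>)\<^sup>2 = (X t \<omega> + ?P \<omega> + ?N \<omega>)\<^sup>2" by (rule arg_cong)
          also note young_square_sum[OF w(1), of "X t \<omega>" "?P \<omega>" "?N \<omega>"]
          finally show ?thesis using True by (simp only: indicator_simps mult_1 mult.assoc)
        next
          case False
          have "0 \<le> (1 + 1 / w) * (?P \<omega>)\<^sup>2" using w by simp
          then show ?thesis using False w by simp
        qed
        have il: "integrable M (\<lambda>\<omega>. ?i \<omega> * (X t \<omega> + euler_sum t (t + h) n \<omega>)\<^sup>2)"
        proof (rule Bochner_Integration.integrable_bound[OF ir])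
          show "(\<lambda>\<omega>. ?i \<omega> * (X t \<omega> + euler_sum t (t + h) n \<omega>)\<^sup>2) \<in> borel_measurable M"
            using A H tt
            by (intro borel_measurable_times borel_measurable_indicator borel_measurable_power borel_measurable_add
                X_measurable euler_sum_measurable) auto
          show "AE \<omega> in M. norm (?i \<omega> * (X t \<omega> + euler_sum t (t + h) n \<omega>)\<^sup>2) \<le> norm (?r \<omega>)"
          proof (rule AE_I2)
            fix \<omega>
            have "0 \<le> ?i \<omega> * (X t \<omega> + euler_sum t (t + h) n \<omega>)\<^sup>2" by simp
            then show "norm (?i \<omega> * (X t \<omega> + euler_sum t (t + h) n \<omega>)\<^sup>2) \<le> norm (?r \<omega>)"
              using pw[of \<omega>] unfolding real_norm_def by linarith
          qed
        qed
        have "(LINT \<omega>|M. ?i \<omega> * (X t \<omega> + euler_sum t (t + h) n \<omega>)\<^sup>2) \<le> (LINT \<omega>|M. ?r \<omega>)"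
          by (rule integral_mono[OF il ir pw])
        also have "\<dots> = ?E1 + 2 * expectation (\<lambda>\<omega>. ?x \<omega> * ?P \<omega>) + 2 * expectation (\<lambda>\<omega>. X t \<omega> * ?N \<omega>) +
          (1 + 1 / w) * expectation (\<lambda>\<omega>. (?P \<omega>)\<^sup>2) + (1 + w) * expectation (\<lambda>\<omega>. (?N \<omega>)\<^sup>2)"
          by (simp only: Bochner_Integration.integral_add Bochner_Integration.integrable_add ii integral_mult_right_zero)
        also have "\<dots> \<le> ?bd"
        proof -
          have "(1 + 1 / w) * expectation (\<lambda>\<omega>. (?P \<omega>)\<^sup>2) \<le> (1 + 1 / w) * (h\<^sup>2 * fa)"
            by (rule mult_left_mono[OF EP]) (use w in simp)
          moreover have "(1 + w) * expectation (\<lambda>\<omega>. (?N \<omega>)\<^sup>2) \<le> (1 + w) * (h * (?E3 + w * (fb + 2 * gb)))"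
            by (rule mult_left_mono[OF EN]) (use w in simp)
          ultimately show ?thesis unfolding orth using EXP by linarith
        qed
        finally show ?case using il by blast
      qed
    qed (auto intro!: continuous_intros)
    then have le: "expectation (\<lambda>\<omega>. ?i \<omega> * (X (t + h) \<omega>)\<^sup>2) \<le> ?bd" by simp
    have E3: "?E3 \<le> fb"
    proof -
      have "?E3 \<le> expectation (\<lambda>\<omega>. (noise t \<omega>)\<^sup>2)"
        by (rule integral_mono[OF sq_integrable_square[OF sq_integrable_indicator_mult[OF nt A]] sq_integrable_square[OF nt]])
          (auto simp: indicator_def)
      also have "\<dots> \<le> fb" unfolding fb_def by (rule linear_moment_bound[OF C0(2) H(1)]) (use H in simp)
      finally show ?thesis .
    qed
    have s1: "(1 + 1 / w) * (h\<^sup>2 * fa) \<le> 2 * fa * (h * w)"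
    proof -
      have "(1 + 1 / w) * (h\<^sup>2 * fa) = (w + 1) * (fa * (h * w))"
        using w by (simp add: field_simps power2_eq_square flip: w(3))
      also have "\<dots> \<le> 2 * (fa * (h * w))" using w nn H by (intro mult_right_mono mult_nonneg_nonneg) auto
      finally show ?thesis by simp
    qed
    have s2: "(1 + w) * (h * (?E3 + w * (fb + 2 * gb))) \<le> h * ?E3 + (fb + 2 * (fb + 2 * gb)) * (h * w)"
    proof -
      have "(1 + w) * (h * (?E3 + w * (fb + 2 * gb))) = h * ?E3 + (h * w) * (?E3 + (1 + w) * (fb + 2 * gb))"
        by (simp add: algebra_simps)
      also have "(h * w) * (?E3 + (1 + w) * (fb + 2 * gb)) \<le> (h * w) * (fb + 2 * (fb + 2 * gb))"
        using E3 w nn H by (intro mult_left_mono add_mono mult_right_mono) auto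
      finally show ?thesis by (simp add: mult.commute)
    qed
    have split: "expectation (\<lambda>\<omega>. ?i \<omega> * (2 * X t \<omega> * drift t \<omega> + (noise t \<omega>)\<^sup>2)) = 2 * ?E2 + ?E3"
    proof -
      have "?i \<omega> * (2 * X t \<omega> * drift t \<omega> + (noise t \<omega>)\<^sup>2) = 2 * (?x \<omega> * drift t \<omega>) + (?i \<omega> * noise t \<omega>)\<^sup>2" for \<omega>
        by (cases "\<omega> \<in> A") simp_all
      then show ?thesis
        using sq_integrable_mult[OF xs dt] sq_integrable_square[OF sq_integrable_indicator_mult[OF nt A]] by simp
    qed
    have "h * (2 * ?E2 + w * (C0 + ga)) = h * (2 * ?E2) + (C0 + ga) * (h * w)" by (simp only: distrib_left mult_ac)
    moreover have "C * (h * w) = (C0 + ga) * (h * w) + 2 * fa * (h * w) + (fb + 2 * (fb + 2 * gb)) * (h * w)"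
      unfolding C_def by (simp only: distrib_right)
    moreover have "h * (2 * ?E2 + ?E3) = h * (2 * ?E2) + h * ?E3" by (rule distrib_left)
    ultimately have "?bd \<le> ?E1 + h * (2 * ?E2 + ?E3) + C * (h * w)" using s1 s2 by linarith
    then show ?thesis unfolding split using le unfolding w_def by linarith
  qed
  moreover have "0 \<le> C" using nn C0 unfolding C_def by simp
  ultimately show ?thesis by blast
qed

end

section \<open>Growth of nonnegative almost supermartingales with delay\<close>

lemma sqrt_modulus_continuous:
  fixes m :: "real \<Rightarrow> real"
  assumes "0 \<le> C" and C: "\<forall>s t. 0 \<le> s \<and> s < t \<and> t \<le> T \<longrightarrow> \<bar>m t - m s\<bar> \<le> C * sqrt (t - s)"
  shows "continuous_on {0..T} m"
proof -
  have le: "\<bar>m t - m s\<bar> \<le> C * sqrt \<bar>t - s\<bar>" if "s \<in> {0..T}" "t \<in> {0..T}" for s t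
  proof (cases s t rule: linorder_cases)
    case less then show ?thesis using C that by auto
  next
    case greater
    then have "\<bar>m s - m t\<bar> \<le> C * sqrt (s - t)" using C that by auto
    then show ?thesis using greater by (simp add: abs_minus_commute)
  qed simp
  show ?thesis unfolding continuous_on_def
  proof
    fix x assume x: "x \<in> {0..T}"
    have "((\<lambda>y. m y - m x) \<longlongrightarrow> 0) (at x within {0..T})"
    proof (rule Lim_null_comparison[where g = "\<lambda>y. C * sqrt \<bar>y - x\<bar>"])
      show "\<forall>\<^sub>F y in at x within {0..T}. norm (m y - m x) \<le> C * sqrt \<bar>y - x\<bar>"
        unfolding eventually_at_topological using le[OF x] by auto
      have "((\<lambda>y. C * sqrt \<bar>y - x\<bar>) \<longlongrightarrow> C * sqrt \<bar>x - x\<bar>) (at x within {0..T})" by (intro tendsto_intros)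
      then show "((\<lambda>y. C * sqrt \<bar>y - x\<bar>) \<longlongrightarrow> 0) (at x within {0..T})" by simp
    qed
    then show "(m \<longlongrightarrow> m x) (at x within {0..T})" by (rule LIM_zero_cancel)
  qed
qed

text \<open>At the first time where \<open>m\<close> exceeds the supersolution \<open>K * t powr \<beta>\<close>, the one-step
  inequality contradicts the sign of \<open>c + e * q powr \<beta>\<close>.\<close>

lemma pantograph_comparison:
  fixes m :: "real \<Rightarrow> real"
  assumes q: "0 < q" "q < 1" and ce: "0 \<le> e" "c + e * q powr \<beta> < 0"
    and cont: "\<And>T. 0 \<le> T \<Longrightarrow> \<exists>C\<ge>0. \<forall>s t. 0 \<le> s \<and> s < t \<and> t \<le> T \<longrightarrow> \<bar>m t - m s\<bar> \<le> C * sqrt (t - s)"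
    and step: "\<And>T. 0 \<le> T \<Longrightarrow> \<exists>C\<ge>0. \<exists>h0>0. \<forall>t h. 0 \<le> t \<and> 0 < h \<and> h \<le> h0 \<and> t + h \<le> T \<longrightarrow>
      m (t + h) \<le> (1 + c * h) * m t + e * h * m (q * t) + C * (h * sqrt h)"
  shows "\<exists>K>0. \<exists>T0>0. \<forall>t\<ge>T0. m t \<le> K * t powr \<beta>"
proof -
  define \<eta> where "\<eta> = - (c + e * q powr \<beta>)"
  have \<eta>: "0 < \<eta>" using ce by (simp add: \<eta>_def)
  \<comment> \<open>Beyond T1 the relative growth rate \<beta> / t of t^\<beta> exceeds c + e
    q^\<beta>, which makes t^\<beta> a strict supersolution.\<close>
  define T1 where "T1 = (\<bar>\<beta>\<bar> + 1) / \<eta>"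
  have T1: "0 < T1" unfolding T1_def using \<eta> by (intro divide_pos_pos add_nonneg_pos) auto
  have big: "- \<eta> < \<beta> / t" if "T1 \<le> t" for t
  proof -
    have t: "0 < t" using that T1 by simp
    have "\<bar>\<beta>\<bar> + 1 \<le> t * \<eta>" using that \<eta> by (simp add: T1_def divide_le_eq)
    then have "- \<eta> * t < \<beta>" by (simp add: mult.commute)
    then show ?thesis using t by (simp add: less_divide_eq)
  qed
  have mcont: "continuous_on {0..T} m" if T: "0 \<le> T" for T
  proof -
    obtain C where "C \<ge> 0" "\<forall>s t. 0 \<le> s \<and> s < t \<and> t \<le> T \<longrightarrow> \<bar>m t - m s\<bar> \<le> C * sqrt (t - s)"
      using cont[OF T] by blast
    then show ?thesis by (rule sqrt_modulus_continuous)
  qed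
  have pcont: "continuous_on {s..t} (\<lambda>x. x powr \<beta>)" if "0 < s" for s t
    using that by (intro continuous_intros) auto
  have "continuous_on {q * T1..T1} (\<lambda>t. m t / t powr \<beta>)"
  proof (rule continuous_on_divide)
    show "continuous_on {q * T1..T1} m" by (rule continuous_on_subset[OF mcont[of T1]]) (use T1 q in auto)
    show "continuous_on {q * T1..T1} (\<lambda>x. x powr \<beta>)" using T1 q by (intro pcont) simp
    have "0 < q * T1" using T1 q by simp
    then show "\<forall>x\<in>{q * T1..T1}. x powr \<beta> \<noteq> 0" by auto
  qed
  then have "compact ((\<lambda>t. m t / t powr \<beta>) ` {q * T1..T1})" by (rule compact_continuous_image) simp
  then have "bounded ((\<lambda>t. m t / t powr \<beta>) ` {q * T1..T1})" by (rule compact_imp_bounded)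
  then obtain K0 where K0: "\<forall>x\<in>(\<lambda>t. m t / t powr \<beta>) ` {q * T1..T1}. norm x \<le> K0" unfolding bounded_iff by blast
  \<comment> \<open>The delay equation needs a whole history interval [q T1, T1] as initial data.
    The summand 1 makes the comparison strict there.\<close>
  define K where "K = \<bar>K0\<bar> + 1"
  have K: "0 < K" by (simp add: K_def)
  define w where "w t = K * t powr \<beta>" for t
  have init: "m t < w t" if "t \<in> {q * T1..T1}" for t
  proof -
    have "0 < q * T1" using T1 q by simp
    then have t: "0 < t powr \<beta>" using that by simp
    have "\<bar>m t / t powr \<beta>\<bar> \<le> K0" using K0 that by simp
    then have "m t / t powr \<beta> < K" unfolding K_def by linarith
    then show ?thesis using t by (simp add: w_def divide_less_eq)
  qed
  have "m t \<le> w t" if "T1 \<le> t" for t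
  proof (rule ccontr)
    assume "\<not> m t \<le> w t"
    define Bad where "Bad = {s \<in> {T1..t}. w s < m s}"
    have tB: "t \<in> Bad" using that \<open>\<not> m t \<le> w t\<close> by (simp add: Bad_def)
    have bdd: "bdd_below Bad" unfolding Bad_def by (rule bdd_belowI[of _ T1]) auto
    define u where "u = Inf Bad"
    have u: "T1 \<le> u" "u \<le> t"
      unfolding u_def using tB cInf_lower[OF tB bdd] by (auto intro!: cInf_greatest simp: Bad_def)
    have upos: "0 < u" using u T1 by simp
    have before: "m s \<le> w s" if "q * T1 \<le> s" "s < u" for s
    proof (cases "s \<le> T1")
      case True then show ?thesis using init[of s] that by auto
    next
      case False
      have "s \<notin> Bad" using that cInf_lower[OF _ bdd, of s] unfolding u_def by auto
      then show ?thesis using False that u by (auto simp: Bad_def)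
    qed
    have mu: "m u \<le> w u"
    proof (cases "u = T1")
      case True then show ?thesis using init[of T1] T1 q by auto
    next
      case False
      then have "T1 < u" using u by simp
      have cw: "continuous_on {T1..u} w" unfolding w_def by (intro continuous_intros pcont T1)
      have cm: "continuous_on {T1..u} m" by (rule continuous_on_subset[OF mcont[of u]]) (use T1 upos in auto)
      have "((\<lambda>s. w s - m s) \<longlongrightarrow> w u - m u) (at u within {T1..u})"
        using continuous_on_diff[OF cw cm] u unfolding continuous_on_def by auto
      then have lim: "((\<lambda>s. w s - m s) \<longlongrightarrow> w u - m u) (at_left u)"
        using at_within_Icc_at_left[OF \<open>T1 < u\<close>] by simp
      have "0 \<le> w u - m u"
      proof (rule tendsto_lowerbound[OF lim])
        show "\<forall>\<^sub>F s in at_left u. 0 \<le> w s - m s"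
          using eventually_at_left_real[OF \<open>T1 < u\<close>]
        proof eventually_elim
          case (elim s)
          have "q * T1 \<le> T1" using q T1 by (simp add: mult_left_le_one_le)
          then show ?case using before[of s] elim by auto
        qed
      qed simp
      then show ?thesis by simp
    qed
    have "0 \<le> t + 1" using upos u by simp
    from step[OF this] obtain C h0 where C: "C \<ge> 0" "h0 > 0" and st: "\<forall>t' h. 0 \<le> t' \<and> 0 < h \<and> h \<le> h0 \<and> t' + h \<le> t + 1 \<longrightarrow>
      m (t' + h) \<le> (1 + c * h) * m t' + e * h * m (q * t') + C * (h * sqrt h)" by blast
    \<comment> \<open>Near u, right difference quotients of w exceed -\<eta> w u + C sqrt (x - u),
      because w' / w = \<beta> / u > -\<eta> there. A bad time x close to u will force the opposite
      inequality.\<close>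
    have deriv: "((\<lambda>x. (w x - w u) / (x - u)) \<longlongrightarrow> K * (\<beta> * u powr (\<beta> - 1))) (at u within {u<..})"
    proof -
      have "(w has_real_derivative K * (\<beta> * u powr (\<beta> - 1))) (at u)"
        unfolding w_def using upos by (auto intro!: derivative_eq_intros)
      then have "(w has_real_derivative K * (\<beta> * u powr (\<beta> - 1))) (at u within {u<..})"
        by (rule has_field_derivative_at_within)
      then show ?thesis by (simp add: has_field_derivative_iff)
    qed
    have sq0: "((\<lambda>x. C * sqrt (x - u)) \<longlongrightarrow> C * sqrt (u - u)) (at u within {u<..})" by (intro tendsto_intros)
    have "((\<lambda>x. (w x - w u) / (x - u) - C * sqrt (x - u)) \<longlongrightarrow> K * (\<beta> * u powr (\<beta> - 1)) - C * sqrt (u - u)) (at u within {u<..})"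
      by (rule tendsto_diff[OF deriv sq0])
    moreover have "- \<eta> * w u < K * (\<beta> * u powr (\<beta> - 1)) - C * sqrt (u - u)"
    proof -
      have "K * (\<beta> * u powr (\<beta> - 1)) = (\<beta> / u) * w u"
        using upos by (simp add: w_def powr_diff)
      moreover have "- \<eta> * w u < (\<beta> / u) * w u"
        using big[OF u(1)] K upos by (intro mult_strict_right_mono) (auto simp: w_def)
      ultimately show ?thesis by simp
    qed
    ultimately have ev: "\<forall>\<^sub>F x in at_right u. - \<eta> * w u < (w x - w u) / (x - u) - C * sqrt (x - u)"
      by (rule order_tendstoD)
    \<comment> \<open>The second bound makes 1 + c h nonnegative, so that m u may be replaced by the
      larger w u.\<close>
    define h1 where "h1 = min h0 (1 / (\<bar>c\<bar> + 1))"
    have h1: "0 < h1" using C by (simp add: h1_def add_nonneg_pos)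
    from ev obtain b where b: "u < b" "\<And>x. u < x \<Longrightarrow> x < b \<Longrightarrow> - \<eta> * w u < (w x - w u) / (x - u) - C * sqrt (x - u)"
      unfolding eventually_at_right_field by blast
    \<comment> \<open>By \<open>mu\<close> the infimum u is not itself bad, so bad times occur
      arbitrarily close to its right; no derivative of m is involved.\<close>
    have "Inf Bad < min b (u + h1)" using b(1) h1 unfolding u_def[symmetric] by simp
    then obtain x where x: "x \<in> Bad" "x < min b (u + h1)" using cInf_lessD[of Bad] tB by blast
    have "u \<le> x" unfolding u_def by (rule cInf_lower[OF x(1) bdd])
    moreover have "x \<noteq> u" using x(1) mu by (auto simp: Bad_def)
    ultimately have ux: "u < x" by simp
    define h where "h = x - u"
    have "x < u + h1" using x(2) by simp
    then have "h < h1" by (simp add: h_def)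
    moreover have "h1 \<le> h0" "h1 \<le> 1 / (\<bar>c\<bar> + 1)" by (simp_all add: h1_def)
    moreover have "0 < h" using ux by (simp add: h_def)
    ultimately have h: "0 < h" "h \<le> h0" "h \<le> 1 / (\<bar>c\<bar> + 1)" by linarith+
    have xt: "u + h \<le> t + 1" using x(1) by (simp add: h_def Bad_def)
    have ch: "0 \<le> 1 + c * h"
    proof -
      have "h * (\<bar>c\<bar> + 1) \<le> 1" using h(3) by (simp add: le_divide_eq)
      moreover have "h * \<bar>c\<bar> \<ge> - (c * h)" using h(1) abs_ge_minus_self[of "c * h"] by (simp add: abs_mult mult.commute)
      moreover have "h * (\<bar>c\<bar> + 1) = h * \<bar>c\<bar> + h" by (simp add: distrib_left)
      ultimately show ?thesis using h(1) by linarith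
    qed
    have qu: "m (q * u) \<le> q powr \<beta> * w u"
    proof -
      have "q * T1 \<le> q * u" "q * u < u" using q u upos by auto
      then have "m (q * u) \<le> w (q * u)" by (rule before)
      then show ?thesis using q upos by (simp add: w_def powr_mult mult.left_commute)
    qed
    have "w x < m (u + h)" using x(1) by (simp add: Bad_def h_def)
    also have "\<dots> \<le> (1 + c * h) * m u + e * h * m (q * u) + C * (h * sqrt h)"
      using st[rule_format, of u h] h upos xt by auto
    also have "\<dots> \<le> (1 + c * h) * w u + e * h * (q powr \<beta> * w u) + C * (h * sqrt h)"
      using mu qu ch ce h by (intro add_mono mult_left_mono order_refl) auto
    also have "\<dots> = w u + h * (- \<eta> * w u + C * sqrt h)" by (simp add: \<eta>_def algebra_simps)
    finally have "(w x - w u) < h * (- \<eta> * w u + C * sqrt h)" by simp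
    then have "(w x - w u) / h < - \<eta> * w u + C * sqrt h" using h by (simp add: divide_less_eq mult.commute)
    moreover have "- \<eta> * w u < (w x - w u) / h - C * sqrt h" using b(2)[OF ux] x(2) by (simp add: h_def)
    ultimately show False by simp
  qed
  then show ?thesis using K T1 unfolding w_def by blast
qed

section \<open>From one-step inequalities to almost sure bounds\<close>

context brownian_filtration
begin

text \<open>Stopping at the first exceedance: the mean of Z k on the event of no exceedance before
  k, plus l times the probability of an earlier exceedance, grows by at most d per step. Testing the
  step inequality on events replaces conditional expectations.\<close>

lemma supermartingale_maximal_inequality:
  fixes \<tau> :: "nat \<Rightarrow> real" and Z :: "nat \<Rightarrow> 'a \<Rightarrow> real"
  assumes \<tau>: "\<And>k. 0 \<le> \<tau> k" "\<And>j k. j \<le> k \<Longrightarrow> \<tau> j \<le> \<tau> k"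
    and Z: "\<And>k. Z k \<in> borel_measurable (F (\<tau> k))" "\<And>k. integrable M (Z k)" "\<And>k \<omega>. 0 \<le> Z k \<omega>"
    and step: "\<And>k A. k < n \<Longrightarrow> A \<in> sets (F (\<tau> k)) \<Longrightarrow>
      expectation (\<lambda>\<omega>. indicator A \<omega> * Z (Suc k) \<omega>) \<le> expectation (\<lambda>\<omega>. indicator A \<omega> * Z k \<omega>) + d"
    and d: "0 \<le> d" and l: "0 < l"
  shows "l * prob {\<omega> \<in> space M. \<exists>k\<le>n. l < Z k \<omega>} \<le> expectation (Z 0) + real n * d"
proof -
  \<comment> \<open>U k looks at indices strictly below k, so U (k + 1) is an event of the past of
    \<tau> k and may be used as the test event of the step from k to k + 1.\<close>
  define U where "U k = {\<omega> \<in> space M. \<forall>j<k. Z j \<omega> \<le> l}" for k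
  have UF: "U (Suc k) \<in> sets (F (\<tau> k))" for k
  proof -
    have "{\<omega> \<in> space (F (\<tau> k)). \<forall>j\<in>{..k}. Z j \<omega> \<le> l} \<in> sets (F (\<tau> k))"
    proof (rule sets.sets_Collect_finite_All)
      fix j assume "j \<in> {..k}"
      then have [measurable]: "Z j \<in> borel_measurable (F (\<tau> k))"
        using F_measurable_mono[OF \<tau>(1) \<tau>(2)[of j k] Z(1)] by simp
      show "{\<omega> \<in> space (F (\<tau> k)). Z j \<omega> \<le> l} \<in> sets (F (\<tau> k))" by measurable
    qed simp
    moreover have "U (Suc k) = {\<omega> \<in> space (F (\<tau> k)). \<forall>j\<in>{..k}. Z j \<omega> \<le> l}"
      unfolding U_def space_F[OF \<tau>(1)[of k]] by (simp add: less_Suc_eq_le Ball_def)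
    ultimately show ?thesis by (simp only:)
  qed
  have Uev: "U k \<in> events" for k
  proof (cases k)
    case 0 then show ?thesis by (simp add: U_def)
  next
    case (Suc j) then show ?thesis using F_sets_M[OF \<tau>(1) UF] by simp
  qed
  have iZ: "integrable M (\<lambda>\<omega>. indicator A \<omega> * Z k \<omega>)" if "A \<in> events" for A k
    using integrable_mult_indicator[OF that Z(2)] by simp
  \<comment> \<open>The paths leaving U at index k have Z k above l; their share of the mean pays
    for l times their probability.\<close>
  have split: "expectation (\<lambda>\<omega>. indicator (U (Suc k)) \<omega> * Z k \<omega>) + l * prob (space M - U (Suc k)) \<le>
     expectation (\<lambda>\<omega>. indicator (U k) \<omega> * Z k \<omega>) + l * prob (space M - U k)" for k
  proof -
    define A where "A = U k - U (Suc k)"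
    have Aev: "A \<in> events" using Uev by (simp add: A_def)
    have sub: "U (Suc k) \<subseteq> U k" by (auto simp: U_def)
    have iA: "integrable M (\<lambda>\<omega>. l * indicator A \<omega>)" using Aev by (intro integrable_mult_right integrable_real_indicator) (simp_all add: emeasure_eq_measure)
    have "expectation (\<lambda>\<omega>. indicator (U (Suc k)) \<omega> * Z k \<omega> + l * indicator A \<omega>) \<le> expectation (\<lambda>\<omega>. indicator (U k) \<omega> * Z k \<omega>)"
    proof (rule integral_mono)
      show "integrable M (\<lambda>\<omega>. indicator (U (Suc k)) \<omega> * Z k \<omega> + l * indicator A \<omega>)"
        by (intro Bochner_Integration.integrable_add iZ Uev iA)
      show "integrable M (\<lambda>\<omega>. indicator (U k) \<omega> * Z k \<omega>)" by (rule iZ[OF Uev])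
      fix \<omega>
      have "l \<le> Z k \<omega>" if "\<omega> \<in> A"
        using that by (auto simp: A_def U_def less_Suc_eq)
      moreover have "\<omega> \<in> A \<Longrightarrow> \<omega> \<in> U k \<and> \<omega> \<notin> U (Suc k)" "\<omega> \<notin> A \<Longrightarrow> \<omega> \<in> U k \<Longrightarrow> \<omega> \<in> U (Suc k)"
        by (simp_all add: A_def)
      ultimately show "indicator (U (Suc k)) \<omega> * Z k \<omega> + l * indicator A \<omega> \<le> indicator (U k) \<omega> * Z k \<omega>"
        using subsetD[OF sub, of \<omega>] by (cases "\<omega> \<in> A"; cases "\<omega> \<in> U k"; cases "\<omega> \<in> U (Suc k)") simp_all
    qed
    moreover have "expectation (\<lambda>\<omega>. indicator (U (Suc k)) \<omega> * Z k \<omega> + l * indicator A \<omega>) =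
      expectation (\<lambda>\<omega>. indicator (U (Suc k)) \<omega> * Z k \<omega>) + l * prob A"
      using iZ[OF Uev, of "Suc k" k] iA Aev by simp
    moreover have "prob (space M - U (Suc k)) = prob (space M - U k) + prob A"
    proof -
      have "space M - U (Suc k) = (space M - U k) \<union> A" using sub by (auto simp: A_def U_def)
      moreover have "(space M - U k) \<inter> A = {}" by (auto simp: A_def)
      ultimately show ?thesis using finite_measure_Union[of "space M - U k" A] Uev Aev by auto
    qed
    ultimately show ?thesis by (simp add: distrib_left)
  qed
  have inv: "expectation (\<lambda>\<omega>. indicator (U k) \<omega> * Z k \<omega>) + l * prob (space M - U k) \<le> expectation (Z 0) + real k * d"
    if "k \<le> n" for k
    using that
  proof (induction k)
    case 0
    have "expectation (\<lambda>\<omega>. indicator (U 0) \<omega> * Z 0 \<omega>) = expectation (Z 0)"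
      by (rule Bochner_Integration.integral_cong) (auto simp: U_def)
    then show ?case by (simp add: U_def)
  next
    case (Suc k)
    have "expectation (\<lambda>\<omega>. indicator (U (Suc k)) \<omega> * Z (Suc k) \<omega>) \<le> expectation (\<lambda>\<omega>. indicator (U (Suc k)) \<omega> * Z k \<omega>) + d"
      using step[of k "U (Suc k)"] UF[of k] Suc.prems by simp
    moreover have "expectation (\<lambda>\<omega>. indicator (U k) \<omega> * Z k \<omega>) + l * prob (space M - U k) \<le> expectation (Z 0) + real k * d"
      using Suc by simp
    moreover have "real (Suc k) * d = real k * d + d" by (simp add: distrib_right)
    ultimately show ?case using split[of k] by linarith
  qed
  have "0 \<le> expectation (\<lambda>\<omega>. indicator (U (Suc n)) \<omega> * Z n \<omega>)"
    by (rule Bochner_Integration.integral_nonneg) (simp add: Z(3))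
  then have "l * prob (space M - U (Suc n)) \<le> expectation (Z 0) + real n * d"
    using split[of n] inv[of n] by simp
  moreover have "space M - U (Suc n) = {\<omega> \<in> space M. \<exists>k\<le>n. l < Z k \<omega>}"
    by (auto simp: U_def less_Suc_eq_le not_le)
  ultimately show ?thesis by simp
qed

text \<open>The interval [n, n + 1] is sampled at 2^N steps of length \<delta>. The delayed terms
  add up to O(n^\<beta>), while the local errors C \<delta>^(3/2) add up to C sqrt \<delta> and
  vanish as N grows. C may depend on n, because n stays fixed in this limit.\<close>

lemma pantograph_almost_sure_growth:
  fixes Y :: "real \<Rightarrow> 'a \<Rightarrow> real"
  assumes q: "0 < q" "q < 1" and ce: "c < 0" "0 \<le> e" "c + e * q powr \<beta> < 0" and \<gamma>: "\<beta> + 1 < \<gamma>"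
    and Y: "\<And>t. 0 \<le> t \<Longrightarrow> Y t \<in> borel_measurable (F t)" "\<And>t. 0 \<le> t \<Longrightarrow> integrable M (Y t)" "\<And>t \<omega>. 0 \<le> Y t \<omega>"
    and Y_cont: "AE \<omega> in M. continuous_on {0..} (\<lambda>t. Y t \<omega>)"
    and cont: "\<And>T. 0 \<le> T \<Longrightarrow> \<exists>C\<ge>0. \<forall>s t. 0 \<le> s \<and> s < t \<and> t \<le> T \<longrightarrow> \<bar>expectation (Y t) - expectation (Y s)\<bar> \<le> C * sqrt (t - s)"
    and step: "\<And>T. 0 \<le> T \<Longrightarrow> \<exists>C\<ge>0. \<exists>h0>0. \<forall>t h A. 0 \<le> t \<and> 0 < h \<and> h \<le> h0 \<and> t + h \<le> T \<and> A \<in> sets (F t) \<longrightarrow>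
      expectation (\<lambda>\<omega>. indicator A \<omega> * Y (t + h) \<omega>) \<le> (1 + c * h) * expectation (\<lambda>\<omega>. indicator A \<omega> * Y t \<omega>) +
        e * h * expectation (\<lambda>\<omega>. indicator A \<omega> * Y (q * t) \<omega>) + C * (h * sqrt h)"
  shows "AE \<omega> in M. \<exists>K. \<forall>\<^sub>F t in at_top. Y t \<omega> \<le> K * t powr \<gamma>"
proof -
  define m where "m t = expectation (Y t)" for t
  have iY: "integrable M (\<lambda>\<omega>. indicator A \<omega> * Y t \<omega>)" if "A \<in> events" "0 \<le> t" for A t
    using integrable_mult_indicator[OF that(1) Y(2)[OF that(2)]] by simp
  have m_space: "expectation (\<lambda>\<omega>. indicator (space M) \<omega> * Y t \<omega>) = m t" for t
    unfolding m_def by (rule Bochner_Integration.integral_cong) auto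
  have "\<exists>K>0. \<exists>T0>0. \<forall>t\<ge>T0. m t \<le> K * t powr \<beta>"
  proof (rule pantograph_comparison[OF q ce(2,3)])
    show "\<exists>C\<ge>0. \<forall>s t. 0 \<le> s \<and> s < t \<and> t \<le> T \<longrightarrow> \<bar>m t - m s\<bar> \<le> C * sqrt (t - s)" if "0 \<le> T" for T
      using cont[OF that] by (simp add: m_def)
    fix T :: real assume "0 \<le> T"
    from step[OF this] obtain C h0 where C: "C \<ge> 0" "h0 > 0" and st: "\<forall>t h A. 0 \<le> t \<and> 0 < h \<and> h \<le> h0 \<and> t + h \<le> T \<and> A \<in> sets (F t) \<longrightarrow>
      expectation (\<lambda>\<omega>. indicator A \<omega> * Y (t + h) \<omega>) \<le> (1 + c * h) * expectation (\<lambda>\<omega>. indicator A \<omega> * Y t \<omega>) +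
        e * h * expectation (\<lambda>\<omega>. indicator A \<omega> * Y (q * t) \<omega>) + C * (h * sqrt h)" by blast
    have "m (t + h) \<le> (1 + c * h) * m t + e * h * m (q * t) + C * (h * sqrt h)"
      if "0 \<le> t \<and> 0 < h \<and> h \<le> h0 \<and> t + h \<le> T" for t h
    proof -
      have "space M \<in> sets (F t)" using sets.top[of "F t"] space_F[of t] that by simp
      then show ?thesis using st[rule_format, of t h "space M"] that unfolding m_space by simp
    qed
    then show "\<exists>C\<ge>0. \<exists>h0>0. \<forall>t h. 0 \<le> t \<and> 0 < h \<and> h \<le> h0 \<and> t + h \<le> T \<longrightarrow>
      m (t + h) \<le> (1 + c * h) * m t + e * h * m (q * t) + C * (h * sqrt h)" using C by blast
  qed
  then obtain K T0 where K: "0 < K" "0 < T0" "\<And>t. T0 \<le> t \<Longrightarrow> m t \<le> K * t powr \<beta>" by blast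
  \<comment> \<open>Bounds x^\<beta> for x in [q, 2] whatever the sign of \<beta>. It compares (q
    t)^\<beta> with n^\<beta> through x = q t / n, for t in [n, n + 1].\<close>
  define L where "L = (2 / q) powr \<bar>\<beta>\<bar>"
  have L: "0 \<le> L" by (simp add: L_def)
  have xL: "x powr \<beta> \<le> L" if "q \<le> x" "x \<le> 2" for x
  proof -
    have x: "0 < x" using that q by simp
    have "ln q \<le> ln x" "ln x \<le> ln 2" using that x q by auto
    moreover have "ln (2 / q) = ln 2 - ln q" using q by (simp add: ln_div)
    moreover have "0 < ln (2::real)" "ln q < 0" using q by auto
    ultimately have "\<bar>ln x\<bar> \<le> ln (2 / q)" by linarith
    then have "\<bar>\<beta>\<bar> * \<bar>ln x\<bar> \<le> \<bar>\<beta>\<bar> * ln (2 / q)" by (rule mult_left_mono) simp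
    then have "\<beta> * ln x \<le> \<bar>\<beta>\<bar> * ln (2 / q)" using abs_ge_self[of "\<beta> * ln x"] by (simp add: abs_mult)
    then show ?thesis using x q by (simp add: L_def powr_def)
  qed
  \<comment> \<open>K for the mean at time n, and e K L for the delayed terms collected over unit
    time.\<close>
  define K' where "K' = K * (1 + e * L)"
  have K'0: "0 \<le> K'" using K ce L by (simp add: K'_def)
  \<comment> \<open>Dyadic times make the event a countable union; continuity of the paths supplies
    the remaining times of [n, n + 1].\<close>
  define E where "E n = {\<omega> \<in> space M. \<exists>N. \<exists>k\<le>2^N. real n powr \<gamma> < Y (real n + real k / 2^N) \<omega>}" for n :: nat
  have Ym: "Y t \<in> borel_measurable M" if "0 \<le> t" for t using Y(1)[OF that] F_measurable_M that by blast
  have Eev: "E n \<in> events" for n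
  proof -
    have "{\<omega> \<in> space M. real n powr \<gamma> < Y (real n + real k / 2^N) \<omega>} \<in> events" for k N :: nat
    proof -
      have [measurable]: "Y (real n + real k / 2^N) \<in> borel_measurable M" by (rule Ym) simp
      show ?thesis by measurable
    qed
    then have "(\<Union>N. \<Union>k\<in>{..2^N}. {\<omega> \<in> space M. real n powr \<gamma> < Y (real n + real k / 2^N) \<omega>}) \<in> events"
      by (intro sets.countable_UN'' countableI_type countable_finite finite_atMost)
    moreover have "E n = (\<Union>N. \<Union>k\<in>{..2^N}. {\<omega> \<in> space M. real n powr \<gamma> < Y (real n + real k / 2^N) \<omega>})"
      by (auto simp: E_def)
    ultimately show ?thesis by (simp only:)
  qed
  have PE: "prob (E n) \<le> K' * real n powr (\<beta> - \<gamma>)" if n: "1 \<le> n" "T0 \<le> q * real n" for n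
  proof -
    define l where "l = real n powr \<gamma>"
    have l: "0 < l" using n by (simp add: l_def)
    have "0 \<le> real n + 1" by simp
    from step[OF this] obtain C h0 where C: "C \<ge> 0" "h0 > 0" and st: "\<forall>t h A. 0 \<le> t \<and> 0 < h \<and> h \<le> h0 \<and> t + h \<le> real n + 1 \<and> A \<in> sets (F t) \<longrightarrow>
      expectation (\<lambda>\<omega>. indicator A \<omega> * Y (t + h) \<omega>) \<le> (1 + c * h) * expectation (\<lambda>\<omega>. indicator A \<omega> * Y t \<omega>) +
        e * h * expectation (\<lambda>\<omega>. indicator A \<omega> * Y (q * t) \<omega>) + C * (h * sqrt h)" by blast
    define EN where "EN N = {\<omega> \<in> space M. \<exists>k\<le>2^N. l < Y (real n + real k / 2^N) \<omega>}" for N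
    have mq: "m (q * t) \<le> K * L * real n powr \<beta>" if "real n \<le> t" "t \<le> real n + 1" for t
    proof -
      have n0: "0 < real n" using n by simp
      have "T0 \<le> q * t" using n(2) that(1) q by (meson less_imp_le mult_left_mono order_trans)
      then have "m (q * t) \<le> K * (q * t) powr \<beta>" by (rule K(3))
      also have "(q * t) powr \<beta> = (q * t / real n) powr \<beta> * real n powr \<beta>"
        using n0 q that by (subst powr_mult[symmetric]) auto
      also have "(q * t / real n) powr \<beta> \<le> L"
      proof (rule xL)
        show "q \<le> q * t / real n" using n0 q that by (simp add: pos_le_divide_eq)
        have "q * t \<le> 1 * (2 * real n)" using q that n by (intro mult_mono) auto
        then show "q * t / real n \<le> 2" using n0 by (simp add: pos_divide_le_eq)
      qed
      finally show ?thesis using K by (simp add: mult_left_mono mult_right_mono mult.assoc)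
    qed
    have bound: "l * prob (EN N) \<le> K' * real n powr \<beta> + C * sqrt (1 / 2 ^ N)" if N: "1 / 2 ^ N \<le> h0" for N
    proof -
      define \<delta> where "\<delta> = (1 :: real) / 2 ^ N"
      have \<delta>: "0 < \<delta>" "\<delta> \<le> h0" "2 ^ N * \<delta> = 1" using N by (auto simp: \<delta>_def)
      define dd where "dd = e * \<delta> * (K * L * real n powr \<beta>) + C * (\<delta> * sqrt \<delta>)"
      have dd: "0 \<le> dd" unfolding dd_def using ce K L C \<delta> by (intro add_nonneg_nonneg mult_nonneg_nonneg) auto
      let ?\<tau> = "\<lambda>k. real n + real k * \<delta>"
      have "l * prob {\<omega> \<in> space M. \<exists>k\<le>2^N. l < Y (?\<tau> k) \<omega>} \<le> expectation (Y (?\<tau> 0)) + real (2 ^ N) * dd"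
      proof (rule supermartingale_maximal_inequality[where \<tau> = ?\<tau> and Z = "\<lambda>k. Y (?\<tau> k)", OF _ _ _ _ _ _ dd l])
        show \<tau>0: "0 \<le> ?\<tau> k" for k using \<delta> by simp
        show "?\<tau> j \<le> ?\<tau> k" if "j \<le> k" for j k using \<delta> that by (simp add: mult_right_mono)
        show "Y (?\<tau> k) \<in> borel_measurable (F (?\<tau> k))" for k by (rule Y(1)[OF \<tau>0])
        show "integrable M (Y (?\<tau> k))" for k by (rule Y(2)[OF \<tau>0])
        show "0 \<le> Y (?\<tau> k) \<omega>" for k \<omega> by (rule Y(3))
        fix k A assume k: "k < 2 ^ N" and A: "A \<in> sets (F (?\<tau> k))"
        have Aev: "A \<in> events" by (rule F_sets_M[OF \<tau>0 A])
        have Suc: "?\<tau> (Suc k) = ?\<tau> k + \<delta>" by (simp add: algebra_simps)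
        have "real (Suc k) * \<delta> \<le> 2 ^ N * \<delta>"
        proof (rule mult_right_mono)
          have "real (Suc k) \<le> real (2 ^ N)" using k by (simp only: of_nat_le_iff Suc_le_eq)
          then show "real (Suc k) \<le> 2 ^ N" by simp
        qed (use \<delta> in simp)
        then have up: "?\<tau> k + \<delta> \<le> real n + 1" using \<delta>(3) unfolding Suc[symmetric] by simp
        have "expectation (\<lambda>\<omega>. indicator A \<omega> * Y (?\<tau> (Suc k)) \<omega>) \<le> (1 + c * \<delta>) * expectation (\<lambda>\<omega>. indicator A \<omega> * Y (?\<tau> k) \<omega>) +
          e * \<delta> * expectation (\<lambda>\<omega>. indicator A \<omega> * Y (q * ?\<tau> k) \<omega>) + C * (\<delta> * sqrt \<delta>)"
          unfolding Suc using st[rule_format, of "?\<tau> k" \<delta> A] \<delta> up A \<tau>0 by blast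
        moreover have "(1 + c * \<delta>) * expectation (\<lambda>\<omega>. indicator A \<omega> * Y (?\<tau> k) \<omega>) \<le> expectation (\<lambda>\<omega>. indicator A \<omega> * Y (?\<tau> k) \<omega>)"
        proof -
          have "0 \<le> expectation (\<lambda>\<omega>. indicator A \<omega> * Y (?\<tau> k) \<omega>)"
            by (rule Bochner_Integration.integral_nonneg) (simp add: Y(3))
          \<comment> \<open>The term with c < 0 is dropped: the sampled process is a supermartingale
            up to the error \<open>dd\<close> per step.\<close>
          moreover have "1 + c * \<delta> \<le> 1" using ce \<delta> by (simp add: mult_nonpos_nonneg)
          ultimately show ?thesis using mult_right_mono[of "1 + c * \<delta>" 1] by simp
        qed
        moreover have "e * \<delta> * expectation (\<lambda>\<omega>. indicator A \<omega> * Y (q * ?\<tau> k) \<omega>) \<le> e * \<delta> * (K * L * real n powr \<beta>)"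
        proof (rule mult_left_mono)
          have q\<tau>: "0 \<le> q * ?\<tau> k" using q \<tau>0 by (intro mult_nonneg_nonneg) auto
          have "expectation (\<lambda>\<omega>. indicator A \<omega> * Y (q * ?\<tau> k) \<omega>) \<le> m (q * ?\<tau> k)"
            unfolding m_def by (rule integral_indicator_mult_le[OF Y(2)[OF q\<tau>] Y(3) Aev])
          also have "\<dots> \<le> K * L * real n powr \<beta>" using up \<delta> by (intro mq) auto
          finally show "expectation (\<lambda>\<omega>. indicator A \<omega> * Y (q * ?\<tau> k) \<omega>) \<le> K * L * real n powr \<beta>" .
        qed (use ce \<delta> in auto)
        ultimately show "expectation (\<lambda>\<omega>. indicator A \<omega> * Y (?\<tau> (Suc k)) \<omega>) \<le> expectation (\<lambda>\<omega>. indicator A \<omega> * Y (?\<tau> k) \<omega>) + dd"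
          unfolding dd_def by linarith
      qed
      also have "{\<omega> \<in> space M. \<exists>k\<le>2^N. l < Y (?\<tau> k) \<omega>} = EN N" by (simp add: EN_def \<delta>_def)
      also have "real (2 ^ N) * dd = e * (K * L * real n powr \<beta>) + C * sqrt \<delta>"
      proof -
        have "real (2 ^ N) * dd = (2 ^ N * \<delta>) * (e * (K * L * real n powr \<beta>)) + (2 ^ N * \<delta>) * (C * sqrt \<delta>)"
          unfolding dd_def by (simp add: algebra_simps)
        then show ?thesis unfolding \<delta>(3) by simp
      qed
      also have "expectation (Y (?\<tau> 0)) \<le> K * real n powr \<beta>"
      proof -
        have "q * real n \<le> real n" using q by (simp add: mult_left_le_one_le)
        then show ?thesis using K(3)[of "real n"] n(2) by (simp add: m_def)
      qed
      finally show ?thesis by (simp add: K'_def \<delta>_def algebra_simps)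
    qed
    have "(\<lambda>N. (1::real) / 2 ^ N) \<longlonglongrightarrow> 0" by real_asymp
    then have "\<forall>\<^sub>F N in sequentially. 1 / 2 ^ N < h0" using C(2) by (rule order_tendstoD)
    then have ev: "\<forall>\<^sub>F N in sequentially. l * prob (EN N) \<le> K' * real n powr \<beta> + C * sqrt (1 / 2 ^ N)"
      by eventually_elim (rule bound, simp)
    have ENev: "EN N \<in> events" for N
    proof -
      have "{\<omega> \<in> space M. \<exists>k\<in>{..2^N}. l < Y (real n + real k / 2^N) \<omega>} \<in> events"
      proof (rule sets.sets_Collect_finite_Ex)
        fix k :: nat
        have [measurable]: "Y (real n + real k / 2^N) \<in> borel_measurable M" by (rule Ym) simp
        show "{\<omega> \<in> space M. l < Y (real n + real k / 2^N) \<omega>} \<in> events" by measurable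
      qed simp
      then show ?thesis by (simp only: EN_def Bex_def atMost_iff)
    qed
    have inc: "incseq EN"
    proof (rule incseq_SucI, rule subsetI)
      fix N \<omega> assume "\<omega> \<in> EN N"
      then obtain k where k: "\<omega> \<in> space M" "k \<le> 2 ^ N" "l < Y (real n + real k / 2^N) \<omega>" by (auto simp: EN_def)
      have "real (2 * k) / 2 ^ Suc N = real k / 2 ^ N" by simp
      then have "l < Y (real n + real (2 * k) / 2 ^ Suc N) \<omega>" using k(3) by simp
      moreover have "2 * k \<le> 2 ^ Suc N" using k(2) by simp
      ultimately show "\<omega> \<in> EN (Suc N)" using k(1) unfolding EN_def by blast
    qed
    have UN: "(\<Union>N. EN N) = E n" unfolding EN_def E_def l_def by blast
    have "(\<lambda>N. prob (EN N)) \<longlonglongrightarrow> prob (E n)"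
      unfolding UN[symmetric] by (rule finite_Lim_measure_incseq) (use ENev inc in auto)
    then have L1: "(\<lambda>N. l * prob (EN N)) \<longlonglongrightarrow> l * prob (E n)" by (intro tendsto_intros)
    have "(\<lambda>N. sqrt (1 / 2 ^ N)) \<longlonglongrightarrow> 0" by real_asymp
    then have "(\<lambda>N. K' * real n powr \<beta> + C * sqrt (1 / 2 ^ N)) \<longlonglongrightarrow> K' * real n powr \<beta> + C * 0"
      by (intro tendsto_intros)
    then have "l * prob (E n) \<le> K' * real n powr \<beta> + C * 0"
      by (rule tendsto_le[OF sequentially_bot _ L1 ev])
    then have "prob (E n) \<le> K' * real n powr \<beta> / l" using l by (simp add: pos_le_divide_eq mult.commute)
    then show ?thesis by (simp add: l_def powr_diff)
  qed
  \<comment> \<open>Here \<gamma> > \<beta> + 1 enters: the exponent is below -1.\<close>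
  have sm: "summable (\<lambda>n. K' * real n powr (\<beta> - \<gamma>))"
    using \<gamma> by (intro summable_mult) (simp add: summable_real_powr_iff)
  obtain n0 where n0: "T0 / q \<le> real n0" using real_arch_simple by blast
  have "\<forall>n\<ge>max 1 n0. norm (prob (E n)) \<le> K' * real n powr (\<beta> - \<gamma>)"
  proof (intro allI impI)
    fix n assume n: "max 1 n0 \<le> n"
    then have "T0 / q \<le> real n" using n0 by (meson max.boundedE of_nat_mono order_trans)
    then have "T0 \<le> q * real n" using q by (simp add: pos_divide_le_eq mult.commute)
    then show "norm (prob (E n)) \<le> K' * real n powr (\<beta> - \<gamma>)" using PE[of n] n by simp
  qed
  then have "summable (\<lambda>n. prob (E n))" by (intro summable_comparison_test[OF exI sm])
  then have "AE \<omega> in M. \<forall>\<^sub>F n in sequentially. \<omega> \<in> space M - E n"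
    by (rule borel_cantelli_AE1[OF Eev, rotated]) (simp add: emeasure_eq_measure)
  then show ?thesis
    using Y_cont
  proof eventually_elim
    case (elim \<omega>)
    then obtain n1 where n1: "\<And>n. n \<ge> n1 \<Longrightarrow> \<omega> \<in> space M - E n" by (auto simp: eventually_sequentially)
    have le: "Y t \<omega> \<le> real n powr \<gamma>" if n: "n1 \<le> n" and t: "real n \<le> t" "t \<le> real n + 1" for n t
    proof -
      define k where "k N = nat \<lfloor>(t - real n) * 2 ^ N\<rfloor>" for N
      have k1: "real (k N) \<le> (t - real n) * 2 ^ N" "(t - real n) * 2 ^ N < real (k N) + 1" for N
        using t by (auto simp: k_def)
      have k2: "k N \<le> 2 ^ N" for N
      proof -
        have "(t - real n) * 2 ^ N \<le> 1 * 2 ^ N" using t by (intro mult_right_mono) auto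
        then have "real (k N) \<le> 2 ^ N" using k1(1)[of N] by linarith
        then show ?thesis by simp
      qed
      define r where "r N = real n + real (k N) / 2 ^ N" for N
      have r1: "r N \<le> t" "t - 1 / 2 ^ N \<le> r N" for N
      proof -
        have "real (k N) / 2 ^ N \<le> t - real n" using k1(1)[of N] by (simp add: pos_divide_le_eq)
        then show "r N \<le> t" by (simp add: r_def)
        have "t - real n \<le> (real (k N) + 1) / 2 ^ N" using k1(2)[of N] by (simp add: pos_le_divide_eq)
        then show "t - 1 / 2 ^ N \<le> r N" by (simp add: r_def add_divide_distrib)
      qed
      have rt: "r \<longlonglongrightarrow> t"
      proof (rule tendsto_sandwich[of "\<lambda>N. t - 1 / 2 ^ N" r _ "\<lambda>_. t"])
        show "(\<lambda>N. t - 1 / 2 ^ N) \<longlonglongrightarrow> t" by real_asymp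
      qed (use r1 in auto)
      have lim: "(\<lambda>N. Y (r N) \<omega>) \<longlonglongrightarrow> Y t \<omega>"
        by (rule continuous_on_tendsto_compose[OF elim(2) rt]) (use t in \<open>auto simp: r_def\<close>)
      show ?thesis
      proof (rule tendsto_upperbound[OF lim])
        have "Y (r N) \<omega> \<le> real n powr \<gamma>" for N
          using n1[OF n] k2[of N] unfolding E_def r_def by (auto simp: not_less)
        then show "\<forall>\<^sub>F N in sequentially. Y (r N) \<omega> \<le> real n powr \<gamma>" by simp
      qed simp
    qed
    have "\<forall>\<^sub>F t in at_top. Y t \<omega> \<le> 2 powr \<bar>\<gamma>\<bar> * t powr \<gamma>"
      using eventually_ge_at_top[of "real (max 1 n1) + 1"]
    proof eventually_elim
      case (elim t)
      \<comment> \<open>As n \<le> t \<le> n + 1 \<le> 2 n, the power n^\<gamma> may be replaced by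
        t^\<gamma> up to the factor 2^|\<gamma>|, for either sign of \<gamma>.\<close>
      define n where "n = nat \<lfloor>t\<rfloor>"
      have t0: "0 \<le> t" using elim by simp
      have nt: "real n \<le> t" "t \<le> real n + 1" using t0 by (auto simp: n_def)
      then have "real (max 1 n1) \<le> real n" using elim by linarith
      then have nn: "max 1 n1 \<le> n" by (simp only: of_nat_le_iff)
      then have n0: "1 \<le> real n" by simp
      have "Y t \<omega> \<le> real n powr \<gamma>" using nn nt by (intro le) auto
      also have "\<dots> \<le> 2 powr \<bar>\<gamma>\<bar> * t powr \<gamma>"
      proof (cases "0 \<le> \<gamma>")
        case True
        have "real n powr \<gamma> \<le> t powr \<gamma>" using nt n0 True by (intro powr_mono2) auto
        also have "\<dots> \<le> 2 powr \<bar>\<gamma>\<bar> * t powr \<gamma>" using mult_right_mono[of 1 "2 powr \<bar>\<gamma>\<bar>" "t powr \<gamma>"] ge_one_powr_ge_zero[of 2 "\<bar>\<gamma>\<bar>"] by simp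
        finally show ?thesis .
      next
        case False
        have "(2 * real n) powr \<gamma> \<le> t powr \<gamma>"
          by (rule powr_mono2') (use False nt n0 in auto)
        then have "2 powr \<bar>\<gamma>\<bar> * (2 * real n) powr \<gamma> \<le> 2 powr \<bar>\<gamma>\<bar> * t powr \<gamma>" by (intro mult_left_mono) auto
        moreover have "2 powr \<bar>\<gamma>\<bar> * (2 * real n) powr \<gamma> = real n powr \<gamma>"
          using False n0 by (simp add: powr_mult powr_minus field_simps)
        ultimately show ?thesis by simp
      qed
      finally show ?case .
    qed
    then show ?case by blast
  qed
qed

end

section \<open>Growth exponents of the solution\<close>

lemma elog_ereal: "0 < x \<Longrightarrow> elog (ereal x) = ereal (ln x)"
  by (simp add: elog_def)

lemma growth_exponent_le:
  assumes "\<exists>K. \<forall>\<^sub>F t in at_top. \<bar>x t\<bar> \<le> K * t powr \<gamma>"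
  shows "growth_exponent x \<le> ereal \<gamma>"
proof -
  obtain K where K: "\<forall>\<^sub>F t in at_top. \<bar>x t\<bar> \<le> K * t powr \<gamma>" using assms by blast
  \<comment> \<open>At least 1, so that the logarithm of the bound splits into a sum; ln K' / ln t
    then tends to 0.\<close>
  define K' where "K' = max K 1"
  have "growth_exponent x \<le> Limsup at_top (\<lambda>t. ereal (ln K' / ln t + \<gamma>))"
    unfolding growth_exponent_def
  proof (rule Limsup_mono)
    show "\<forall>\<^sub>F t in at_top. elog (ereal \<bar>x t\<bar>) / ereal (ln t) \<le> ereal (ln K' / ln t + \<gamma>)"
      using K eventually_gt_at_top[of 1]
    proof eventually_elim
      case (elim t)
      then have l: "0 < ln t" by simp
      show ?case
      proof (cases "x t = 0")
        case True
        then have "elog (ereal \<bar>x t\<bar>) / ereal (ln t) = - \<infinity>"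
          using l by (simp add: elog_def divide_ereal_def)
        then show ?thesis by simp
      next
        case False
        have "\<bar>x t\<bar> \<le> K' * t powr \<gamma>"
          by (rule order_trans[OF elim(1)]) (simp add: K'_def mult_right_mono)
        then have "ln \<bar>x t\<bar> \<le> ln (K' * t powr \<gamma>)" using False elim by (subst ln_le_cancel_iff) (auto simp: K'_def)
        also have "\<dots> = ln K' + \<gamma> * ln t" using elim by (subst ln_mult) (auto simp: K'_def ln_powr)
        finally have "ln \<bar>x t\<bar> / ln t \<le> (ln K' + \<gamma> * ln t) / ln t" using l by (intro divide_right_mono) auto
        also have "\<dots> = ln K' / ln t + \<gamma>" using l by (simp add: add_divide_distrib)
        finally have le: "ln \<bar>x t\<bar> / ln t \<le> ln K' / ln t + \<gamma>" .
        have "elog (ereal \<bar>x t\<bar>) = ereal (ln \<bar>x t\<bar>)" using False by (simp add: elog_def)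
        then show ?thesis using le l by simp
      qed
    qed
  qed
  also have "\<dots> = ereal \<gamma>"
  proof (rule lim_imp_Limsup)
    have "((\<lambda>t. ln K' / ln t + \<gamma>) \<longlongrightarrow> \<gamma>) at_top" by real_asymp
    then show "((\<lambda>t. ereal (ln K' / ln t + \<gamma>)) \<longlongrightarrow> ereal \<gamma>) at_top" by simp
  qed simp
  finally show ?thesis .
qed

text \<open>Countably many rational bounds above g suffice, so that their exceptional null sets can
  be united. An extended real g is allowed because the exponent in case (i) is -\<infinity> for b =
  0.\<close>

lemma AE_growth_exponent_le:
  fixes g :: ereal
  assumes "\<And>\<gamma> :: real. g < ereal \<gamma> \<Longrightarrow> AE \<omega> in M. growth_exponent (\<lambda>t. X t \<omega>) \<le> ereal \<gamma>"
  shows "AE \<omega> in M. growth_exponent (\<lambda>t. X t \<omega>) \<le> g"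
proof -
  have "AE \<omega> in M. \<forall>r :: rat. g < ereal (of_rat r) \<longrightarrow> growth_exponent (\<lambda>t. X t \<omega>) \<le> ereal (of_rat r)"
    unfolding AE_all_countable
  proof
    fix r :: rat
    show "AE \<omega> in M. g < ereal (of_rat r) \<longrightarrow> growth_exponent (\<lambda>t. X t \<omega>) \<le> ereal (of_rat r)"
      using assms[of "of_rat r"] by (cases "g < ereal (of_rat r)") auto
  qed
  then show ?thesis
  proof eventually_elim
    case (elim \<omega>)
    show ?case
    proof (rule ccontr)
      assume "\<not> growth_exponent (\<lambda>t. X t \<omega>) \<le> g"
      then obtain r :: rat where "g < real_of_rat r" "real_of_rat r < growth_exponent (\<lambda>t. X t \<omega>)"
        using ereal_dense3[of g "growth_exponent (\<lambda>t. X t \<omega>)"] by (auto simp: not_le)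
      then show False using elim by (auto simp: not_le[symmetric])
    qed
  qed
qed

section \<open>The growth bounds in the two cases\<close>

context pantograph
begin

text \<open>Cauchy-Schwarz is replaced by |u| \<le> w + u^2 / w for the increment u, with w = sqrt
  (t - s) and mean square of u of order w^2.\<close>

lemma abs_mean_continuous:
  assumes "0 \<le> T"
  shows "\<exists>C\<ge>0. \<forall>s t. 0 \<le> s \<and> s < t \<and> t \<le> T \<longrightarrow>
    \<bar>expectation (\<lambda>\<omega>. \<bar>X t \<omega>\<bar>) - expectation (\<lambda>\<omega>. \<bar>X s \<omega>\<bar>)\<bar> \<le> C * sqrt (t - s)"
proof -
  obtain C where C: "C \<ge> 0" "\<forall>s t. 0 \<le> s \<and> s < t \<and> t \<le> T \<longrightarrow> expectation (\<lambda>\<omega>. (X t \<omega> - X s \<omega>)\<^sup>2) \<le> C * (t - s)"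
    using increment_bound[OF assms] by blast
  have "\<bar>expectation (\<lambda>\<omega>. \<bar>X t \<omega>\<bar>) - expectation (\<lambda>\<omega>. \<bar>X s \<omega>\<bar>)\<bar> \<le> (1 + C) * sqrt (t - s)"
    if st: "0 \<le> s" "s < t" "t \<le> T" for s t
  proof -
    define w where "w = sqrt (t - s)"
    have w: "0 < w" "w * w = t - s" using st by (auto simp: w_def)
    have Xs: "sq_integrable M (X s)" and Xt: "sq_integrable M (X t)" using st by (auto intro!: X_sq_integrable)
    have dif: "sq_integrable M (\<lambda>\<omega>. X t \<omega> - X s \<omega>)" by (rule sq_integrable_diff[OF Xt Xs])
    have i: "integrable M (\<lambda>\<omega>. \<bar>X t \<omega>\<bar>)" "integrable M (\<lambda>\<omega>. \<bar>X s \<omega>\<bar>)"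
      using sq_integrable_integrable[OF Xt] sq_integrable_integrable[OF Xs] by auto
    have "\<bar>expectation (\<lambda>\<omega>. \<bar>X t \<omega>\<bar>) - expectation (\<lambda>\<omega>. \<bar>X s \<omega>\<bar>)\<bar> = \<bar>expectation (\<lambda>\<omega>. \<bar>X t \<omega>\<bar> - \<bar>X s \<omega>\<bar>)\<bar>"
      using i by simp
    also have "\<dots> \<le> expectation (\<lambda>\<omega>. \<bar>\<bar>X t \<omega>\<bar> - \<bar>X s \<omega>\<bar>\<bar>)" by (rule integral_abs_bound)
    also have "\<dots> \<le> expectation (\<lambda>\<omega>. w + (X t \<omega> - X s \<omega>)\<^sup>2 / w)"
    proof (rule integral_mono)
      show "integrable M (\<lambda>\<omega>. \<bar>\<bar>X t \<omega>\<bar> - \<bar>X s \<omega>\<bar>\<bar>)" using i by auto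
      show "integrable M (\<lambda>\<omega>. w + (X t \<omega> - X s \<omega>)\<^sup>2 / w)" using sq_integrable_square[OF dif] by auto
      fix \<omega>
      have "2 * \<bar>X t \<omega> - X s \<omega>\<bar> \<le> w + (X t \<omega> - X s \<omega>)\<^sup>2 / w"
        using two_mult_abs_le_weighted[OF w(1), of 1 "X t \<omega> - X s \<omega>"] by simp
      then show "\<bar>\<bar>X t \<omega>\<bar> - \<bar>X s \<omega>\<bar>\<bar> \<le> w + (X t \<omega> - X s \<omega>)\<^sup>2 / w"
        by (intro order_trans[OF abs_triangle_ineq3] order_trans[OF _ \<open>2 * _ \<le> _\<close>]) simp
    qed
    also have "\<dots> = w + expectation (\<lambda>\<omega>. (X t \<omega> - X s \<omega>)\<^sup>2) / w"
      using sq_integrable_square[OF dif] by (simp add: prob_space)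
    also have "\<dots> \<le> w + C * (w * w) / w"
      using C(2) st w by (intro add_left_mono divide_right_mono) auto
    also have "\<dots> = (1 + C) * w" using w(1) by (simp add: distrib_right)
    finally show ?thesis by (simp add: w_def)
  qed
  moreover have "0 \<le> 1 + C" using C by simp
  ultimately show ?thesis by blast
qed

lemma square_mean_continuous:
  assumes "0 \<le> T"
  shows "\<exists>C\<ge>0. \<forall>s t. 0 \<le> s \<and> s < t \<and> t \<le> T \<longrightarrow>
    \<bar>expectation (\<lambda>\<omega>. (X t \<omega>)\<^sup>2) - expectation (\<lambda>\<omega>. (X s \<omega>)\<^sup>2)\<bar> \<le> C * sqrt (t - s)"
proof -
  obtain C where C: "C \<ge> 0" "\<forall>s t. 0 \<le> s \<and> s < t \<and> t \<le> T \<longrightarrow> expectation (\<lambda>\<omega>. (X t \<omega> - X s \<omega>)\<^sup>2) \<le> C * (t - s)"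
    using increment_bound[OF assms] by blast
  obtain C0 where C0: "C0 \<ge> 0" "\<forall>t. 0 \<le> t \<and> t \<le> T \<longrightarrow> sq_integrable M (X t) \<and> expectation (\<lambda>\<omega>. (X t \<omega>)\<^sup>2) \<le> C0"
    using second_moment_bound[OF assms] by blast
  have "\<bar>expectation (\<lambda>\<omega>. (X t \<omega>)\<^sup>2) - expectation (\<lambda>\<omega>. (X s \<omega>)\<^sup>2)\<bar> \<le> (4 * C0 + C) * sqrt (t - s)"
    if st: "0 \<le> s" "s < t" "t \<le> T" for s t
  proof -
    define w where "w = sqrt (t - s)"
    have w: "0 < w" "w * w = t - s" using st by (auto simp: w_def)
    have Xs: "sq_integrable M (X s)" and Xt: "sq_integrable M (X t)" using st by (auto intro!: X_sq_integrable)
    have dif: "sq_integrable M (\<lambda>\<omega>. X t \<omega> - X s \<omega>)" by (rule sq_integrable_diff[OF Xt Xs])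
    note i = sq_integrable_square[OF Xt] sq_integrable_square[OF Xs] sq_integrable_square[OF dif]
    have "\<bar>expectation (\<lambda>\<omega>. (X t \<omega>)\<^sup>2) - expectation (\<lambda>\<omega>. (X s \<omega>)\<^sup>2)\<bar> = \<bar>expectation (\<lambda>\<omega>. (X t \<omega>)\<^sup>2 - (X s \<omega>)\<^sup>2)\<bar>"
      using i by simp
    also have "\<dots> \<le> expectation (\<lambda>\<omega>. \<bar>(X t \<omega>)\<^sup>2 - (X s \<omega>)\<^sup>2\<bar>)" by (rule integral_abs_bound)
    also have "\<dots> \<le> expectation (\<lambda>\<omega>. w * (2 * (X t \<omega>)\<^sup>2 + 2 * (X s \<omega>)\<^sup>2) + (X t \<omega> - X s \<omega>)\<^sup>2 / w)"
    proof (rule integral_mono)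
      show "integrable M (\<lambda>\<omega>. \<bar>(X t \<omega>)\<^sup>2 - (X s \<omega>)\<^sup>2\<bar>)" using i by auto
      show "integrable M (\<lambda>\<omega>. w * (2 * (X t \<omega>)\<^sup>2 + 2 * (X s \<omega>)\<^sup>2) + (X t \<omega> - X s \<omega>)\<^sup>2 / w)" using i by auto
      fix \<omega>
      have "\<bar>(X t \<omega>)\<^sup>2 - (X s \<omega>)\<^sup>2\<bar> = \<bar>(X t \<omega> + X s \<omega>) * (X t \<omega> - X s \<omega>)\<bar>"
        by (simp add: power2_eq_square algebra_simps)
      also have "\<dots> \<le> 2 * \<bar>(X t \<omega> + X s \<omega>) * (X t \<omega> - X s \<omega>)\<bar>" by simp
      also have "\<dots> \<le> w * (X t \<omega> + X s \<omega>)\<^sup>2 + (X t \<omega> - X s \<omega>)\<^sup>2 / w" by (rule two_mult_abs_le_weighted[OF w(1)])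
      also have "\<dots> \<le> w * (2 * (X t \<omega>)\<^sup>2 + 2 * (X s \<omega>)\<^sup>2) + (X t \<omega> - X s \<omega>)\<^sup>2 / w"
        using w by (intro add_right_mono mult_left_mono sum_square_le2) auto
      finally show "\<bar>(X t \<omega>)\<^sup>2 - (X s \<omega>)\<^sup>2\<bar> \<le> w * (2 * (X t \<omega>)\<^sup>2 + 2 * (X s \<omega>)\<^sup>2) + (X t \<omega> - X s \<omega>)\<^sup>2 / w" .
    qed
    also have "\<dots> = w * (2 * expectation (\<lambda>\<omega>. (X t \<omega>)\<^sup>2) + 2 * expectation (\<lambda>\<omega>. (X s \<omega>)\<^sup>2)) + expectation (\<lambda>\<omega>. (X t \<omega> - X s \<omega>)\<^sup>2) / w"
      using i by simp
    also have "\<dots> \<le> w * (2 * C0 + 2 * C0) + C * (w * w) / w"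
      using C(2) C0(2) st w by (intro add_mono mult_left_mono divide_right_mono) auto
    also have "\<dots> = (4 * C0 + C) * w" using w by (simp add: field_simps)
    finally show ?thesis by (simp add: w_def)
  qed
  moreover have "0 \<le> 4 * C0 + C" using C C0 by simp
  ultimately show ?thesis by blast
qed

lemma abs_growth:
  assumes \<rho>: "\<rho> = 0" and a: "a < 0" "a + \<bar>b\<bar> * q powr \<beta> < 0" and \<gamma>: "\<beta> + 1 < \<gamma>"
  shows "AE \<omega> in M. growth_exponent (\<lambda>t. X t \<omega>) \<le> ereal \<gamma>"
proof -
  have "AE \<omega> in M. \<exists>K. \<forall>\<^sub>F t in at_top. \<bar>X t \<omega>\<bar> \<le> K * t powr \<gamma>"
  proof (rule pantograph_almost_sure_growth[OF q a(1) abs_ge_zero a(2) \<gamma>])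
    show "(\<lambda>\<omega>. \<bar>X t \<omega>\<bar>) \<in> borel_measurable (F t)" if "0 \<le> t" for t
      using X_measurable_F[OF that order_refl] by simp
    show "integrable M (\<lambda>\<omega>. \<bar>X t \<omega>\<bar>)" if "0 \<le> t" for t
      using sq_integrable_integrable[OF X_sq_integrable[OF that]] by simp
    show "AE \<omega> in M. continuous_on {0..} (\<lambda>t. \<bar>X t \<omega>\<bar>)"
      using X_cont by eventually_elim (rule continuous_on_rabs)
  qed (simp, fact abs_mean_continuous, fact abs_one_step[OF _ \<rho>])
  then show ?thesis by eventually_elim (rule growth_exponent_le)
qed

text \<open>The weight in 2 |x y| \<le> \<kappa> x^2 + y^2 / \<kappa> should minimize d \<kappa> +
  (d / \<kappa>) q^\<beta>. The minimum is at \<kappa>^2 = q^\<beta>, where both terms equal d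
  \<kappa>, and c' + e' q^\<beta> becomes the quadratic expression in \<kappa> of the
  hypothesis.\<close>

lemma square_growth:
  fixes \<kappa> :: real
  defines "d \<equiv> \<bar>b + \<sigma> * \<rho>\<bar>"
  assumes \<kappa>: "\<kappa> = q powr (\<beta> / 2)" and c: "2 * a + \<sigma>\<^sup>2 + 2 * d * \<kappa> + \<rho>\<^sup>2 * \<kappa>\<^sup>2 < 0" and \<gamma>: "\<beta> + 1 < 2 * \<gamma>"
  shows "AE \<omega> in M. growth_exponent (\<lambda>t. X t \<omega>) \<le> ereal \<gamma>"
proof -
  have k: "0 < \<kappa>" using \<kappa> q by simp
  have k2: "q powr \<beta> = \<kappa>\<^sup>2" unfolding \<kappa> power2_eq_square by (simp flip: powr_add)
  define c' where "c' = 2 * a + \<sigma>\<^sup>2 + d * \<kappa>"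
  define e' where "e' = \<rho>\<^sup>2 + d / \<kappa>"
  have d: "0 \<le> d" by (simp add: d_def)
  have e': "0 \<le> e'" using d k by (simp add: e'_def)
  have "0 \<le> d * \<kappa>" "0 \<le> \<rho>\<^sup>2 * \<kappa>\<^sup>2" using d k by auto
  then have c': "c' < 0" using c unfolding c'_def by linarith
  have ce: "c' + e' * q powr \<beta> < 0"
  proof -
    have "d / \<kappa> * \<kappa>\<^sup>2 = d * \<kappa>" using k by (simp add: power2_eq_square)
    then have "c' + e' * q powr \<beta> = 2 * a + \<sigma>\<^sup>2 + 2 * d * \<kappa> + \<rho>\<^sup>2 * \<kappa>\<^sup>2"
      unfolding k2 c'_def e'_def distrib_right by simp
    then show ?thesis using c by simp
  qed
  have "AE \<omega> in M. \<exists>K. \<forall>\<^sub>F t in at_top. (X t \<omega>)\<^sup>2 \<le> K * t powr (2 * \<gamma>)"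
  proof (rule pantograph_almost_sure_growth[OF q c' e' ce \<gamma>])
    show "(\<lambda>\<omega>. (X t \<omega>)\<^sup>2) \<in> borel_measurable (F t)" if "0 \<le> t" for t
      using X_measurable_F[OF that order_refl] by simp
    show "integrable M (\<lambda>\<omega>. (X t \<omega>)\<^sup>2)" if "0 \<le> t" for t
      by (rule sq_integrable_square[OF X_sq_integrable[OF that]])
    show "AE \<omega> in M. continuous_on {0..} (\<lambda>t. (X t \<omega>)\<^sup>2)"
      using X_cont by eventually_elim (intro continuous_intros)
    fix T :: real assume "0 \<le> T"
    from square_one_step[OF this] obtain C where C: "C \<ge> 0" and st: "\<forall>t h A. 0 \<le> t \<and> 0 < h \<and> h \<le> 1 \<and> t + h \<le> T \<and> A \<in> sets (F t) \<longrightarrow>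
      expectation (\<lambda>\<omega>. indicator A \<omega> * (X (t + h) \<omega>)\<^sup>2) \<le>
      expectation (\<lambda>\<omega>. indicator A \<omega> * (X t \<omega>)\<^sup>2) +
      h * expectation (\<lambda>\<omega>. indicator A \<omega> * (2 * X t \<omega> * drift t \<omega> + (noise t \<omega>)\<^sup>2)) + C * (h * sqrt h)" by blast
    have "expectation (\<lambda>\<omega>. indicator A \<omega> * (X (t + h) \<omega>)\<^sup>2) \<le>
      (1 + c' * h) * expectation (\<lambda>\<omega>. indicator A \<omega> * (X t \<omega>)\<^sup>2) +
      e' * h * expectation (\<lambda>\<omega>. indicator A \<omega> * (X (q * t) \<omega>)\<^sup>2) + C * (h * sqrt h)"
      if H: "0 \<le> t" "0 < h" "h \<le> 1" "t + h \<le> T" "A \<in> sets (F t)" for t h A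
    proof -
      let ?i = "indicator A :: 'a \<Rightarrow> real"
      have A: "A \<in> events" using F_sets_M H by blast
      have iX: "integrable M (\<lambda>\<omega>. ?i \<omega> * (X s \<omega>)\<^sup>2)" if "0 \<le> s" for s
        using integrable_mult_indicator[OF A sq_integrable_square[OF X_sq_integrable[OF that]]] by simp
      note i = iX[OF H(1)] iX[OF qs(1)[OF H(1)]]
      have "expectation (\<lambda>\<omega>. ?i \<omega> * (2 * X t \<omega> * drift t \<omega> + (noise t \<omega>)\<^sup>2)) \<le>
        expectation (\<lambda>\<omega>. c' * (?i \<omega> * (X t \<omega>)\<^sup>2) + e' * (?i \<omega> * (X (q * t) \<omega>)\<^sup>2))"
      proof (rule integral_mono)
        have "integrable M (\<lambda>\<omega>. 2 * (X t \<omega> * drift t \<omega>) + (noise t \<omega>)\<^sup>2)"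
          by (intro Bochner_Integration.integrable_add integrable_mult_right sq_integrable_mult sq_integrable_square
              X_sq_integrable linear_sq_integrable H)
        then have "integrable M (\<lambda>\<omega>. ?i \<omega> *\<^sub>R (2 * (X t \<omega> * drift t \<omega>) + (noise t \<omega>)\<^sup>2))"
          by (rule integrable_mult_indicator[OF A])
        then show "integrable M (\<lambda>\<omega>. ?i \<omega> * (2 * X t \<omega> * drift t \<omega> + (noise t \<omega>)\<^sup>2))" by (simp add: mult.assoc)
        show "integrable M (\<lambda>\<omega>. c' * (?i \<omega> * (X t \<omega>)\<^sup>2) + e' * (?i \<omega> * (X (q * t) \<omega>)\<^sup>2))"
          by (intro Bochner_Integration.integrable_add integrable_mult_right i)
        fix \<omega>
        let ?x = "X t \<omega>" and ?y = "X (q * t) \<omega>"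
        have "2 * ((b + \<sigma> * \<rho>) * (?x * ?y)) \<le> d * (2 * \<bar>?x * ?y\<bar>)"
          using abs_ge_self[of "(b + \<sigma> * \<rho>) * (?x * ?y)"] unfolding d_def abs_mult[of "b + \<sigma> * \<rho>"] by linarith
        also have "\<dots> \<le> d * (\<kappa> * ?x\<^sup>2 + ?y\<^sup>2 / \<kappa>)"
          by (rule mult_left_mono[OF two_mult_abs_le_weighted[OF k] d])
        finally have xy: "2 * ((b + \<sigma> * \<rho>) * (?x * ?y)) \<le> d * (\<kappa> * ?x\<^sup>2 + ?y\<^sup>2 / \<kappa>)" .
        \<comment> \<open>This is the drift of X^2 in Ito's formula; the mixed terms combine to the
          coefficient b + \<sigma> \<rho>.\<close>
        have "2 * ?x * drift t \<omega> + (noise t \<omega>)\<^sup>2 = (2 * a + \<sigma>\<^sup>2) * ?x\<^sup>2 + 2 * ((b + \<sigma> * \<rho>) * (?x * ?y)) + \<rho>\<^sup>2 * ?y\<^sup>2"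
          by (simp add: power2_eq_square algebra_simps)
        also have "\<dots> \<le> (2 * a + \<sigma>\<^sup>2) * ?x\<^sup>2 + d * (\<kappa> * ?x\<^sup>2 + ?y\<^sup>2 / \<kappa>) + \<rho>\<^sup>2 * ?y\<^sup>2" using xy by simp
        also have "\<dots> = c' * ?x\<^sup>2 + e' * ?y\<^sup>2" by (simp add: c'_def e'_def algebra_simps)
        finally show "?i \<omega> * (2 * ?x * drift t \<omega> + (noise t \<omega>)\<^sup>2) \<le> c' * (?i \<omega> * ?x\<^sup>2) + e' * (?i \<omega> * ?y\<^sup>2)"
          by (cases "\<omega> \<in> A") simp_all
      qed
      also have "\<dots> = c' * expectation (\<lambda>\<omega>. ?i \<omega> * (X t \<omega>)\<^sup>2) + e' * expectation (\<lambda>\<omega>. ?i \<omega> * (X (q * t) \<omega>)\<^sup>2)"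
        using i by (subst Bochner_Integration.integral_add) (auto intro!: integrable_mult_right)
      finally have "h * expectation (\<lambda>\<omega>. ?i \<omega> * (2 * X t \<omega> * drift t \<omega> + (noise t \<omega>)\<^sup>2)) \<le>
        h * (c' * expectation (\<lambda>\<omega>. ?i \<omega> * (X t \<omega>)\<^sup>2) + e' * expectation (\<lambda>\<omega>. ?i \<omega> * (X (q * t) \<omega>)\<^sup>2))"
        by (rule mult_left_mono) (use H in simp)
      moreover have "h * (c' * u + e' * v) = c' * h * u + e' * h * v" for u v by (simp add: algebra_simps)
      moreover have "(1 + c' * h) * u = u + c' * h * u" for u by (simp add: algebra_simps)
      moreover note st[rule_format, OF conjI[OF H(1) conjI[OF H(2) conjI[OF H(3) conjI[OF H(4,5)]]]]]
      ultimately show ?thesis by (simp only:)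
    qed
    then show "\<exists>C\<ge>0. \<exists>h0>0. \<forall>t h A. 0 \<le> t \<and> 0 < h \<and> h \<le> h0 \<and> t + h \<le> T \<and> A \<in> sets (F t) \<longrightarrow>
      expectation (\<lambda>\<omega>. indicator A \<omega> * (X (t + h) \<omega>)\<^sup>2) \<le>
      (1 + c' * h) * expectation (\<lambda>\<omega>. indicator A \<omega> * (X t \<omega>)\<^sup>2) +
      e' * h * expectation (\<lambda>\<omega>. indicator A \<omega> * (X (q * t) \<omega>)\<^sup>2) + C * (h * sqrt h)"
      using C by (intro exI[of _ C] conjI exI[of _ "1::real"]) auto
  qed (simp, fact square_mean_continuous)
  then show ?thesis
  proof eventually_elim
    case (elim \<omega>)
    then obtain K where K: "\<forall>\<^sub>F t in at_top. (X t \<omega>)\<^sup>2 \<le> K * t powr (2 * \<gamma>)" by blast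
    have "\<forall>\<^sub>F t in at_top. \<bar>X t \<omega>\<bar> \<le> sqrt \<bar>K\<bar> * t powr \<gamma>"
      using K eventually_gt_at_top[of 0]
    proof eventually_elim
      case (elim t)
      have "(X t \<omega>)\<^sup>2 \<le> \<bar>K\<bar> * t powr (2 * \<gamma>)"
        by (rule order_trans[OF elim(1)]) (simp add: mult_right_mono)
      also have "\<dots> = (sqrt \<bar>K\<bar> * t powr \<gamma>)\<^sup>2"
      proof -
        have "t powr (2 * \<gamma>) = (t powr \<gamma>)\<^sup>2" by (simp add: power2_eq_square flip: powr_add)
        then show ?thesis by (simp add: power_mult_distrib)
      qed
      finally have "\<bar>X t \<omega>\<bar> \<le> \<bar>sqrt \<bar>K\<bar> * t powr \<gamma>\<bar>" by (simp only: abs_le_square_iff)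
      then show ?case by (simp add: abs_mult)
    qed
    then show ?case by (intro growth_exponent_le) blast
  qed
qed

end

theorem theorem5:
  fixes M :: "'a measure" and B X :: "real \<Rightarrow> 'a \<Rightarrow> real" and X0 :: "'a \<Rightarrow> real"
    and a b \<sigma> \<rho> q :: real
  assumes "wiener_process M B"
    and "indep_of_process M X0 B"
    and "integrable M (\<lambda>\<omega>. \<bar>X0 \<omega>\<bar>\<^sup>2)"
    and "0 < q" "q < 1"
    and "pantograph_solution M B X0 a b \<sigma> \<rho> q X"
  shows "(\<rho> = 0 \<and> a < 0 \<longrightarrow>
            (AE \<omega> in M. growth_exponent (\<lambda>t. X t \<omega>) \<le> alpha_drift a b q + 1)) \<and>
         (\<rho> \<noteq> 0 \<and> integrable M (\<lambda>\<omega>. \<bar>X0 \<omega>\<bar> ^ 4) \<and> 2 * a + \<sigma>\<^sup>2 < 0 \<longrightarrow>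
            (AE \<omega> in M. growth_exponent (\<lambda>t. X t \<omega>)
               \<le> ereal (1 / 2 * (alpha_noise a b \<sigma> \<rho> q + 1))))"
proof -
  interpret BF: brownian_filtration M "aug_filtration M X0 B" B
    by (rule wiener_brownian_filtration[OF assms(1,2)])
  note sol = assms(6)[unfolded pantograph_solution_def]
  have X0: "AE \<omega> in M. X 0 \<omega> = X0 \<omega>" using sol by blast
  interpret pantograph M "aug_filtration M X0 B" B X a b \<sigma> \<rho> q
  proof
    show "0 < q" "q < 1" by fact+
    show ad: "adapted (aug_filtration M X0 B) X" using sol by blast
    show "AE \<omega> in M. continuous_on {0..} (\<lambda>t. X t \<omega>)" using sol by blast
    show "\<exists>I. has_ito_integral M (aug_filtration M X0 B) B (\<lambda>s \<omega>. \<sigma> * X s \<omega> + \<rho> * X (q * s) \<omega>) t I \<and>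
      (AE \<omega> in M. X t \<omega> = X 0 \<omega> + (LBINT s:{0..t}. a * X s \<omega> + b * X (q * s) \<omega>) + I \<omega>)" if "0 \<le> t" for t
    proof -
      from sol that obtain I where I: "has_ito_integral M (aug_filtration M X0 B) B (\<lambda>s \<omega>. \<sigma> * X s \<omega> + \<rho> * X (q * s) \<omega>) t I"
        "AE \<omega> in M. X t \<omega> = X0 \<omega> + (LBINT s:{0..t}. a * X s \<omega> + b * X (q * s) \<omega>) + I \<omega>" by blast
      have "AE \<omega> in M. X t \<omega> = X 0 \<omega> + (LBINT s:{0..t}. a * X s \<omega> + b * X (q * s) \<omega>) + I \<omega>"
        using I(2) X0 by eventually_elim simp
      then show ?thesis using I(1) by blast
    qed
    \<comment> \<open>Measurability of \<open>X 0\<close> comes from adaptedness; square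
      integrability is carried over from \<open>X0\<close> by almost sure equality.\<close>
    have "X 0 \<in> borel_measurable M"
      using ad BF.F_measurable_M[of 0 "X 0"] by (simp add: adapted_def)
    then have "(\<lambda>\<omega>. (X 0 \<omega>)\<^sup>2) \<in> borel_measurable M" by (rule borel_measurable_power)
    moreover have "AE \<omega> in M. \<bar>X0 \<omega>\<bar>\<^sup>2 = (X 0 \<omega>)\<^sup>2" using X0 by eventually_elim simp
    ultimately show "integrable M (\<lambda>\<omega>. (X 0 \<omega>)\<^sup>2)"
      by (rule integrable_cong_AE_imp[OF assms(3)])
  qed
  have lnq: "ln q < 0" using assms(4,5) by simp
  show ?thesis
  proof (intro conjI impI)
    assume H: "\<rho> = 0 \<and> a < 0"
    show "AE \<omega> in M. growth_exponent (\<lambda>t. X t \<omega>) \<le> alpha_drift a b q + 1"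
    proof (rule AE_growth_exponent_le)
      fix \<gamma> :: real assume \<gamma>: "alpha_drift a b q + 1 < ereal \<gamma>"
      show "AE \<omega> in M. growth_exponent (\<lambda>t. X t \<omega>) \<le> ereal \<gamma>"
      proof (cases "b = 0")
        \<comment> \<open>For b = 0 the exponent is -\<infinity> and every \<beta> satisfies the
          sign condition; \<gamma> - 2 is one with \<beta> + 1 < \<gamma>.\<close>
        case True
        then show ?thesis using H by (intro abs_growth[of "\<gamma> - 2"]) auto
      next
        case False
        define \<alpha> where "\<alpha> = 1 / ln q * ln (- a / \<bar>b\<bar>)"
        have ab: "0 < - a / \<bar>b\<bar>" using H False by (intro divide_pos_pos) auto
        have "ereal (- a) / ereal \<bar>b\<bar> = ereal (- a / \<bar>b\<bar>)" using False by simp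
        then have "alpha_drift a b q = ereal \<alpha>"
          unfolding alpha_drift_def \<alpha>_def by (simp only: elog_ereal[OF ab] times_ereal.simps)
        then have \<gamma>': "\<alpha> + 1 < \<gamma>" using \<gamma> by (simp add: one_ereal_def)
        \<comment> \<open>The midpoint of \<alpha> and \<gamma> - 1, strictly between them.\<close>
        define \<beta> where "\<beta> = (\<alpha> + \<gamma> - 1) / 2"
        have \<beta>: "\<alpha> < \<beta>" "\<beta> + 1 < \<gamma>" using \<gamma>' by (simp_all add: \<beta>_def field_simps)
        have "\<beta> * ln q < \<alpha> * ln q" using \<beta>(1) lnq by simp
        also have "\<alpha> * ln q = ln (- a / \<bar>b\<bar>)" using lnq by (simp add: \<alpha>_def)
        finally have "q powr \<beta> < - a / \<bar>b\<bar>"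
          using assms(4) ab by (metis exp_less_cancel_iff exp_ln powr_def less_irrefl)
        then have "\<bar>b\<bar> * q powr \<beta> < \<bar>b\<bar> * (- a / \<bar>b\<bar>)" using False by (intro mult_strict_left_mono) auto
        then have "a + \<bar>b\<bar> * q powr \<beta> < 0" using False by simp
        then show ?thesis using H \<beta> by (intro abs_growth) auto
      qed
    qed
  next
    assume H: "\<rho> \<noteq> 0 \<and> integrable M (\<lambda>\<omega>. \<bar>X0 \<omega>\<bar> ^ 4) \<and> 2 * a + \<sigma>\<^sup>2 < 0"
    show "AE \<omega> in M. growth_exponent (\<lambda>t. X t \<omega>) \<le> ereal (1 / 2 * (alpha_noise a b \<sigma> \<rho> q + 1))"
    proof (rule AE_growth_exponent_le)
      fix \<gamma> :: real assume "ereal (1 / 2 * (alpha_noise a b \<sigma> \<rho> q + 1)) < ereal \<gamma>"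
      then have \<gamma>: "alpha_noise a b \<sigma> \<rho> q + 1 < 2 * \<gamma>" by simp
      define d where "d = \<bar>b + \<sigma> * \<rho>\<bar>"
      define c where "c = 2 * a + \<sigma>\<^sup>2"
      define R where "R = sqrt (d\<^sup>2 - \<rho>\<^sup>2 * c)"
      \<comment> \<open>The positive root of \<rho>^2 x^2 + 2 d x + c = 0.\<close>
      define x where "x = 1 / \<rho>\<^sup>2 * (R - d)"
      have \<rho>2: "0 < \<rho>\<^sup>2" using H by simp
      have c: "c < 0" using H by (simp add: c_def)
      have d: "0 \<le> d" by (simp add: d_def)
      have rc: "\<rho>\<^sup>2 * c < 0" using \<rho>2 c by (simp add: mult_pos_neg)
      then have dR: "d < R" unfolding R_def by (intro real_less_rsqrt) simp
      have R2: "R\<^sup>2 = d\<^sup>2 - \<rho>\<^sup>2 * c"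
        unfolding R_def by (rule real_sqrt_pow2) (use rc zero_le_power2[of d] in linarith)
      have x: "0 < x" unfolding x_def using \<rho>2 dR by simp
      have \<alpha>: "alpha_noise a b \<sigma> \<rho> q = 2 / ln q * ln x"
        unfolding alpha_noise_def x_def R_def d_def c_def ..
      define \<beta> where "\<beta> = (alpha_noise a b \<sigma> \<rho> q + 2 * \<gamma> - 1) / 2"
      have \<beta>: "alpha_noise a b \<sigma> \<rho> q < \<beta>" "\<beta> + 1 < 2 * \<gamma>" using \<gamma> by (auto simp: \<beta>_def field_simps)
      define \<kappa> where "\<kappa> = q powr (\<beta> / 2)"
      have k: "0 < \<kappa>" using assms(4) by (simp add: \<kappa>_def)
      have "\<beta> / 2 * ln q < alpha_noise a b \<sigma> \<rho> q / 2 * ln q" using \<beta>(1) lnq by simp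
      also have "\<dots> = ln x" unfolding \<alpha> using lnq by simp
      \<comment> \<open>Between 0 and its positive root the quadratic is negative. Completing the
        square gives this in the form (\<rho>^2 \<kappa> + d)^2 < R^2.\<close>
      finally have "\<kappa> < x"
        unfolding \<kappa>_def using assms(4) x by (metis exp_less_cancel_iff exp_ln powr_def less_irrefl)
      then have "\<rho>\<^sup>2 * \<kappa> < \<rho>\<^sup>2 * x" using \<rho>2 by simp
      also have "\<rho>\<^sup>2 * x = R - d" using \<rho>2 by (simp add: x_def)
      finally have "\<rho>\<^sup>2 * \<kappa> + d < R" by simp
      then have "(\<rho>\<^sup>2 * \<kappa> + d)\<^sup>2 < R\<^sup>2" using \<rho>2 k d by (intro power_strict_mono) auto
      then have "\<rho>\<^sup>2 * (c + 2 * d * \<kappa> + \<rho>\<^sup>2 * \<kappa>\<^sup>2) < 0"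
        unfolding R2 by (simp add: power2_eq_square algebra_simps)
      then have "c + 2 * d * \<kappa> + \<rho>\<^sup>2 * \<kappa>\<^sup>2 < 0" using \<rho>2 by (simp only: mult_less_0_iff) auto
      then show "AE \<omega> in M. growth_exponent (\<lambda>t. X t \<omega>) \<le> ereal \<gamma>"
        unfolding c_def d_def by (rule square_growth[OF \<kappa>_def _ \<beta>(2)])
    qed
  qed
qed

end
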